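(* Let $\mathcal{F}$ be a saturated fusion system on a finite $p$-group $S$ and let $\pi$ be either Robinson's group $\pi_R$ or Leary–Stancu's group $\pi_{LS}$ associated to $\mathcal{F}$, so that $S$ is a Sylow $p$-subgroup of $\pi$ and $\mathcal{F}=\mathcal{F}_S(\pi)$. Then the following are equivalent (with $\mathcal{L}$ denoting the same category over $\mathcal{F}^c$ in both): (1) $\mathcal{F}$ has an associated centric linking system $\mathcal{L}$. (2) There exists a signaliser functor on $\pi$ which induces $\mathcal{L}$.
   Context: Let $p$ be a prime and $S$ a finite $p$-group; $c_g$ denotes conjugation $x\mapsto gxg^{-1}$. Fusion systems. A fusion system $\mathcal{F}$ on $S$ is a category whose objects are the subgroups of $S$, whose morphism sets $\mathcal{F}(P,Q)$ consist of group monomorphisms and contain all homomorphisms $P\to Q$ given by conjugation by elements of $S$, and in which every morphism is the composite of an isomorphism in $\mathcal{F}$ and an inclusion. $P,P'\le S$ are $\mathcal{F}$-conjugate if isomorphic in $\mathcal{F}$. $P$ is fully centralized (resp. fully normalized) if $|C_S(P)|$ (resp. $|N_S(P)|$) is maximal in its $\mathcal{F}$-conjugacy class. $\mathcal{F}$ is saturated if (i) every fully normalized $P$ is fully centralized and $\mathrm{Aut}_S(P)=N_S(P)/C_S(P)$ is a Sylow $p$-subgroup of $\mathrm{Aut}_{\mathcal{F}}(P)$; (ii) every $\varphi\in\mathcal{F}(P,S)$ with $\varphi(P)$ fully centralized extends to a morphism in $\mathcal{F}(N_\varphi,S)$, where $N_\varphi=\{g\in N_S(P):\varphi c_g\varphi^{-1}\in\mathrm{Aut}_S(\varphi(P))\}$.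 $P$ is $\mathcal{F}$-centric if $P$ and all its $\mathcal{F}$-conjugates contain their $S$-centralizers; $P$ is $\mathcal{F}$-radical if $\mathrm{Inn}(P)$ is the maximal normal $p$-subgroup of $\mathrm{Aut}_{\mathcal{F}}(P)$. $\mathcal{F}^c$ is the full subcategory of $\mathcal{F}$ on the $\mathcal{F}$-centric subgroups. Sylow subgroups and transporter systems. A finite $p$-subgroup $S$ of a possibly infinite group $\pi$ is a Sylow $p$-subgroup if every finite $p$-subgroup of $\pi$ is conjugate in $\pi$ to a subgroup of $S$. Then $\mathcal{F}_S(\pi)$ has as objects the subgroups of $S$ and as morphisms $P\to Q$ the maps $c_g$ with $g\in N_\pi(P,Q)=\{g\in\pi: gPg^{-1}\le Q\}$. $\mathcal{T}^c_S(\pi)$ is the category whose objects are the $\mathcal{F}$-centric subgroups of $S$, with morphism sets $N_\pi(P,Q)$. Linking systems. A centric linking system associated to $\mathcal{F}$ is a category $\mathcal{L}$ whose objects are the $\mathcal{F}$-centric subgroups, with a surjective functor $\mathrm{pr}\colon\mathcal{L}\to\mathcal{F}^c$ and an injective functor $\delta\colon\mathcal{T}^c_S(S)\to\mathcal{L}$, both the identity on objects, such that: $\delta(Z(P))\le\mathrm{Aut}_{\mathcal{L}}(P)$ acts freely on $\mathcal{L}(P,Q)$ with orbit set $\mathcal{F}(P,Q)$ via $\mathrm{pr}$; $\mathrm{pr}(\delta(g))=c_g$ for $g\in N_S(P,Q)$; and $\delta(\mathrm{pr}(f)(g))\circ f=f\circ\delta(g)$ for $f\in\mathcal{L}(P,Q)$,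 $g\in P$. Signaliser functors. If $\mathcal{F}=\mathcal{F}_S(\pi)$ with $S$ Sylow in $\pi$, a signaliser functor on $\pi$ is an assignment $P\mapsto\Theta(P)$ for each $\mathcal{F}$-centric $P\le S$ such that $\Theta(P)$ is a complement of $Z(P)$ in $C_\pi(P)$ and such that $gPg^{-1}\le Q$ implies $\Theta(Q)\le g\Theta(P)g^{-1}$. It gives rise to a centric linking system $\mathcal{L}_\Theta$ with $\mathcal{L}_\Theta(P,Q)=N_\pi(P,Q)/\Theta(P)$. $\Theta$ induces $\mathcal{L}$ if $\mathcal{L}\cong\mathcal{L}_\Theta$ over $\mathcal{F}^c$. The group $\pi_R$. Choose a collection $\mathcal{R}$ of $\mathcal{F}$-centric subgroups of $S$, closed under $\mathcal{F}$-conjugation and containing all $\mathcal{F}$-centric $\mathcal{F}$-radical subgroups, and fully normalized representatives $R_0=S,R_1,\dots,R_n$ of the $\mathcal{F}$-conjugacy classes in $\mathcal{R}$. The normalizer fusion system $N_{\mathcal{F}}(R_i)$ is the fusion system on $N_S(R_i)$ whose morphisms $P\to Q$ are those $\varphi\in\mathcal{F}(P,Q)$ which extend to a morphism $PR_i\to QR_i$ in $\mathcal{F}$ carrying $R_i$ onto $R_i$. It is saturated and constrained, so there is a finite group $L_i$ (its model; unique up to isomorphism) containing $N_S(R_i)$ as a Sylow $p$-subgroup, with $R_i\trianglelefteq L_i$, $C_{L_i}(R_i)\le R_i$ and $\mathcal{F}_{N_S(R_i)}(L_i)=N_{\mathcal{F}}(R_i)$. For $i\ge1$ put $L_{i,0}=N_{L_0}(R_i)\le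 L_0$; there is a monomorphism $L_{i,0}\to L_i$ which is the identity on $N_S(R_i)$. $\pi_R$ is the amalgamated product of the tree of groups with root group $L_0$, leaf groups $L_1,\dots,L_n$, and edge group $L_{i,0}$ joining $L_0$ to $L_i$; $S\le L_0\le\pi_R$. The group $\pi_{LS}$. Choose a set $\Phi=\{\varphi_1,\dots,\varphi_n\}$ of morphisms $\varphi_i\colon P_i\to S$ in $\mathcal{F}^c$ which together with $\mathrm{Inn}(S)$ generate $\mathcal{F}$. Then $\pi_{LS}$ is the quotient of the free product of $S$ with the free group on $t_1,\dots,t_n$ by the relations $t_i\,\varphi_i(u)\,t_i^{-1}=u$ for all $i$ and all $u\in P_i$ (an iterated HNN extension of $S$). *)

theory Defs
  imports "HOL-Computational_Algebra.Primes" "HOL-Algebra.Bij" "HOL-Algebra.Group_Action"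
begin

section \<open>Subgroups\<close>

definition centralizer :: "('g, 'h) monoid_scheme \<Rightarrow> 'g set \<Rightarrow> 'g set" where
  "centralizer G A = {g \<in> carrier G. \<forall>a\<in>A. g \<otimes>\<^bsub>G\<^esub> a = a \<otimes>\<^bsub>G\<^esub> g}"

definition centre :: "('g, 'h) monoid_scheme \<Rightarrow> 'g set \<Rightarrow> 'g set" where
  "centre G P = P \<inter> centralizer G P"

definition transporter :: "('g, 'h) monoid_scheme \<Rightarrow> 'g set \<Rightarrow> 'g set \<Rightarrow> 'g set" where
  "transporter G A B = {g \<in> carrier G. g <#\<^bsub>G\<^esub> A #>\<^bsub>G\<^esub> inv\<^bsub>G\<^esub> g \<subseteq> B}"

definition p_subgroup :: "nat \<Rightarrow> ('g, 'h) monoid_scheme \<Rightarrow> 'g set \<Rightarrow> bool" where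
  "p_subgroup p G Q \<longleftrightarrow> subgroup Q G \<and> finite Q \<and> (\<exists>k. card Q = p ^ k)"

text \<open>The ambient group may be infinite; for finite groups this is the usual notion.\<close>

definition sylow_subgroup :: "nat \<Rightarrow> ('g, 'h) monoid_scheme \<Rightarrow> 'g set \<Rightarrow> bool" where
  "sylow_subgroup p G T \<longleftrightarrow> p_subgroup p G T \<and>
     (\<forall>Q. p_subgroup p G Q \<longrightarrow> (\<exists>g\<in>carrier G. g <#\<^bsub>G\<^esub> Q #>\<^bsub>G\<^esub> inv\<^bsub>G\<^esub> g \<subseteq> T))"


section \<open>Fusion systems\<close>

text \<open>
  A fusion system is given by its morphism sets \<open>F P Q\<close>, for subgroups \<open>P\<close>, \<open>Q\<close> of \<open>S\<close>. A morphism
  out of \<open>P\<close> is a function that is \<open>undefined\<close> outside \<open>P\<close> (so that equal morphisms are equal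
  functions), and composition is \<^const>\<open>compose\<close>. Only the values of \<open>F\<close> at subgroups of \<open>S\<close> matter.
\<close>

type_synonym 'a fusion = "'a set \<Rightarrow> 'a set \<Rightarrow> ('a \<Rightarrow> 'a) set"

definition conj_map :: "('a, 'h) monoid_scheme \<Rightarrow> 'a set \<Rightarrow> 'a \<Rightarrow> 'a \<Rightarrow> 'a" where
  "conj_map S P g = (\<lambda>x\<in>P. g \<otimes>\<^bsub>S\<^esub> x \<otimes>\<^bsub>S\<^esub> inv\<^bsub>S\<^esub> g)"

definition fusion_iso :: "'a fusion \<Rightarrow> 'a set \<Rightarrow> 'a set \<Rightarrow> ('a \<Rightarrow> 'a) set" where
  "fusion_iso F P Q = {\<phi> \<in> F P Q. \<exists>\<psi>\<in>F Q P.
     compose P \<psi> \<phi> = (\<lambda>x\<in>P. x) \<and> compose Q \<phi> \<psi> = (\<lambda>y\<in>Q. y)}"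

definition fusion_system :: "('a, 'h) monoid_scheme \<Rightarrow> 'a fusion \<Rightarrow> bool" where
  "fusion_system S F \<longleftrightarrow>
     (\<forall>P Q \<phi>. subgroup P S \<and> subgroup Q S \<and> \<phi> \<in> F P Q \<longrightarrow>
        \<phi> \<in> mon (S\<lparr>carrier := P\<rparr>) (S\<lparr>carrier := Q\<rparr>) \<and> \<phi> \<in> extensional P) \<and>
     (\<forall>P Q g. subgroup P S \<and> subgroup Q S \<and> g \<in> transporter S P Q \<longrightarrow> conj_map S P g \<in> F P Q) \<and>
     (\<forall>P Q R \<phi> \<psi>. subgroup P S \<and> subgroup Q S \<and> subgroup R S \<and> \<phi> \<in> F P Q \<and> \<psi> \<in> F Q R \<longrightarrow>
        compose P \<psi> \<phi> \<in> F P R) \<and>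
     (\<forall>P Q \<phi>. subgroup P S \<and> subgroup Q S \<and> \<phi> \<in> F P Q \<longrightarrow>
        (\<exists>R \<alpha>. subgroup R S \<and> R \<subseteq> Q \<and> \<alpha> \<in> fusion_iso F P R \<and> \<phi> = compose P (\<lambda>x\<in>R. x) \<alpha>))"

definition fusion_conj :: "('a, 'h) monoid_scheme \<Rightarrow> 'a fusion \<Rightarrow> 'a set \<Rightarrow> 'a set \<Rightarrow> bool" where
  "fusion_conj S F P Q \<longleftrightarrow> subgroup P S \<and> subgroup Q S \<and> fusion_iso F P Q \<noteq> {}"

definition fully_centralized :: "('a, 'h) monoid_scheme \<Rightarrow> 'a fusion \<Rightarrow> 'a set \<Rightarrow> bool" where
  "fully_centralized S F P \<longleftrightarrow> subgroup P S \<and>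
     (\<forall>Q. fusion_conj S F P Q \<longrightarrow> card (centralizer S Q) \<le> card (centralizer S P))"

definition fully_normalized :: "('a, 'h) monoid_scheme \<Rightarrow> 'a fusion \<Rightarrow> 'a set \<Rightarrow> bool" where
  "fully_normalized S F P \<longleftrightarrow> subgroup P S \<and>
     (\<forall>Q. fusion_conj S F P Q \<longrightarrow> card (normalizer S Q) \<le> card (normalizer S P))"

text \<open>The members of \<open>F P P\<close> are bijections of the finite group \<open>P\<close>.\<close>

definition aut_fusion :: "'a fusion \<Rightarrow> 'a set \<Rightarrow> ('a \<Rightarrow> 'a) monoid" where
  "aut_fusion F P = (BijGroup P)\<lparr>carrier := F P P\<rparr>"

text \<open>\<open>Aut\<^sub>S(P)\<close>, realised inside \<open>Aut\<^sub>F(P)\<close> as the image of \<open>N\<^sub>S(P) / C\<^sub>S(P)\<close>.\<close>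

definition aut_S :: "('a, 'h) monoid_scheme \<Rightarrow> 'a set \<Rightarrow> ('a \<Rightarrow> 'a) set" where
  "aut_S S P = conj_map S P ` normalizer S P"

definition inner_auts :: "('a, 'h) monoid_scheme \<Rightarrow> 'a set \<Rightarrow> ('a \<Rightarrow> 'a) set" where
  "inner_auts S P = conj_map S P ` P"

definition extender :: "('a, 'h) monoid_scheme \<Rightarrow> 'a set \<Rightarrow> ('a \<Rightarrow> 'a) \<Rightarrow> 'a set" where
  "extender S P \<phi> = {g \<in> normalizer S P.
     (\<lambda>y\<in>\<phi> ` P. \<phi> (conj_map S P g (inv_into P \<phi> y))) \<in> aut_S S (\<phi> ` P)}"

definition saturated :: "nat \<Rightarrow> ('a, 'h) monoid_scheme \<Rightarrow> 'a fusion \<Rightarrow> bool" where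
  "saturated p S F \<longleftrightarrow>
     (\<forall>P. fully_normalized S F P \<longrightarrow>
        fully_centralized S F P \<and> sylow_subgroup p (aut_fusion F P) (aut_S S P)) \<and>
     (\<forall>P \<phi>. subgroup P S \<and> \<phi> \<in> F P (carrier S) \<and> fully_centralized S F (\<phi> ` P) \<longrightarrow>
        (\<exists>\<psi>\<in>F (extender S P \<phi>) (carrier S). \<forall>x\<in>P. \<psi> x = \<phi> x))"

definition centric :: "('a, 'h) monoid_scheme \<Rightarrow> 'a fusion \<Rightarrow> 'a set \<Rightarrow> bool" where
  "centric S F P \<longleftrightarrow> subgroup P S \<and> centralizer S P \<subseteq> P \<and>
     (\<forall>Q. fusion_conj S F P Q \<longrightarrow> centralizer S Q \<subseteq> Q)"

definition radical :: "nat \<Rightarrow> ('a, 'h) monoid_scheme \<Rightarrow> 'a fusion \<Rightarrow> 'a set \<Rightarrow> bool" where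
  "radical p S F P \<longleftrightarrow> subgroup P S \<and>
     inner_auts S P \<lhd> aut_fusion F P \<and> p_subgroup p (aut_fusion F P) (inner_auts S P) \<and>
     (\<forall>K. K \<lhd> aut_fusion F P \<and> p_subgroup p (aut_fusion F P) K \<longrightarrow> K \<subseteq> inner_auts S P)"

text \<open>
  The fusion system of a group \<open>G\<close> containing \<open>S\<close> by way of a monomorphism \<open>j\<close>: the maps
  \<open>j\<^sup>-\<^sup>1 \<circ> c\<^sub>g \<circ> j\<close> from \<open>P\<close> to \<open>Q\<close> with \<open>g \<in> N\<^sub>G(j(P), j(Q))\<close>.
\<close>

definition group_fusion :: "('g, 'h) monoid_scheme \<Rightarrow> ('a \<Rightarrow> 'g) \<Rightarrow> 'a fusion" where
  "group_fusion G j P Q = {\<phi> \<in> P \<rightarrow>\<^sub>E Q. \<exists>g\<in>transporter G (j ` P) (j ` Q).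
     \<forall>x\<in>P. j (\<phi> x) = g \<otimes>\<^bsub>G\<^esub> j x \<otimes>\<^bsub>G\<^esub> inv\<^bsub>G\<^esub> g}"

text \<open>The normalizer fusion system \<open>N\<^sub>F(R)\<close>, on the group \<open>N\<^sub>S(R)\<close>.\<close>

definition normalizer_fusion :: "('a, 'h) monoid_scheme \<Rightarrow> 'a fusion \<Rightarrow> 'a set \<Rightarrow> 'a fusion" where
  "normalizer_fusion S F R P Q = {\<phi> \<in> F P Q.
     \<exists>\<psi>\<in>F (P <#>\<^bsub>S\<^esub> R) (Q <#>\<^bsub>S\<^esub> R). \<psi> ` R = R \<and> (\<forall>x\<in>P. \<psi> x = \<phi> x)}"

text \<open>\<open>F\<close> is the smallest fusion system on \<open>S\<close> that contains the morphisms \<open>\<phi> : P \<rightarrow> Q\<close> in \<open>M\<close>.\<close>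

definition fusion_generated ::
  "('a, 'h) monoid_scheme \<Rightarrow> 'a fusion \<Rightarrow> ('a set \<times> 'a set \<times> ('a \<Rightarrow> 'a)) set \<Rightarrow> bool" where
  "fusion_generated S F M \<longleftrightarrow> (\<forall>(P, Q, \<phi>)\<in>M. \<phi> \<in> F P Q) \<and>
     (\<forall>E. fusion_system S E \<and> (\<forall>(P, Q, \<phi>)\<in>M. \<phi> \<in> E P Q) \<longrightarrow>
        (\<forall>P Q. subgroup P S \<and> subgroup Q S \<longrightarrow> F P Q \<subseteq> E P Q))"


section \<open>Categories\<close>

text \<open>
  Morphism sets need not be disjoint, so composition and functors take the objects as arguments:
  \<open>composite C P Q R g f\<close> is the composite of \<open>f : P \<rightarrow> Q\<close> and \<open>g : Q \<rightarrow> R\<close>.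
\<close>

record ('o, 'm) cat =
  objs :: "'o set"
  arrs :: "'o \<Rightarrow> 'o \<Rightarrow> 'm set"
  composite :: "'o \<Rightarrow> 'o \<Rightarrow> 'o \<Rightarrow> 'm \<Rightarrow> 'm \<Rightarrow> 'm"
  ident :: "'o \<Rightarrow> 'm"

definition is_category :: "('o, 'm) cat \<Rightarrow> bool" where
  "is_category C \<longleftrightarrow>
     (\<forall>P\<in>objs C. ident C P \<in> arrs C P P) \<and>
     (\<forall>P\<in>objs C. \<forall>Q\<in>objs C. \<forall>R\<in>objs C. \<forall>f\<in>arrs C P Q. \<forall>g\<in>arrs C Q R.
        composite C P Q R g f \<in> arrs C P R) \<and>
     (\<forall>P\<in>objs C. \<forall>Q\<in>objs C. \<forall>f\<in>arrs C P Q.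
        composite C P P Q f (ident C P) = f \<and> composite C P Q Q (ident C Q) f = f) \<and>
     (\<forall>P\<in>objs C. \<forall>Q\<in>objs C. \<forall>R\<in>objs C. \<forall>T\<in>objs C.
        \<forall>f\<in>arrs C P Q. \<forall>g\<in>arrs C Q R. \<forall>h\<in>arrs C R T.
          composite C P R T h (composite C P Q R g f) = composite C P Q T (composite C Q R T h g) f)"

text \<open>Functors that are the identity on objects.\<close>

definition id_functor :: "('o, 'm) cat \<Rightarrow> ('o, 'n) cat \<Rightarrow> ('o \<Rightarrow> 'o \<Rightarrow> 'm \<Rightarrow> 'n) \<Rightarrow> bool" where
  "id_functor C D f \<longleftrightarrow> is_category C \<and> is_category D \<and> objs C = objs D \<and>
     (\<forall>P\<in>objs C. \<forall>Q\<in>objs C. f P Q ` arrs C P Q \<subseteq> arrs D P Q) \<and>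
     (\<forall>P\<in>objs C. f P P (ident C P) = ident D P) \<and>
     (\<forall>P\<in>objs C. \<forall>Q\<in>objs C. \<forall>R\<in>objs C. \<forall>a\<in>arrs C P Q. \<forall>b\<in>arrs C Q R.
        f P R (composite C P Q R b a) = composite D P Q R (f Q R b) (f P Q a))"

definition cat_over_iso ::
  "('o, 'k) cat \<Rightarrow> ('o, 'm) cat \<Rightarrow> ('o \<Rightarrow> 'o \<Rightarrow> 'm \<Rightarrow> 'k) \<Rightarrow>
   ('o, 'n) cat \<Rightarrow> ('o \<Rightarrow> 'o \<Rightarrow> 'n \<Rightarrow> 'k) \<Rightarrow> bool" where
  "cat_over_iso B C pr C' pr' \<longleftrightarrow> id_functor C B pr \<and> id_functor C' B pr' \<and>
     (\<exists>\<alpha>. id_functor C C' \<alpha> \<and>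
        (\<forall>P\<in>objs C. \<forall>Q\<in>objs C. bij_betw (\<alpha> P Q) (arrs C P Q) (arrs C' P Q)) \<and>
        (\<forall>P\<in>objs C. \<forall>Q\<in>objs C. \<forall>f\<in>arrs C P Q. pr' P Q (\<alpha> P Q f) = pr P Q f))"

definition centric_fusion_cat :: "('a, 'h) monoid_scheme \<Rightarrow> 'a fusion \<Rightarrow> ('a set, 'a \<Rightarrow> 'a) cat" where
  "centric_fusion_cat S F = \<lparr>objs = {P. centric S F P}, arrs = F,
     composite = (\<lambda>P Q R \<psi> \<phi>. compose P \<psi> \<phi>), ident = (\<lambda>P. \<lambda>x\<in>P. x)\<rparr>"

definition centric_transporter_cat :: "('a, 'h) monoid_scheme \<Rightarrow> 'a fusion \<Rightarrow> ('a set, 'a) cat" where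
  "centric_transporter_cat S F = \<lparr>objs = {P. centric S F P}, arrs = transporter S,
     composite = (\<lambda>P Q R h g. h \<otimes>\<^bsub>S\<^esub> g), ident = (\<lambda>P. \<one>\<^bsub>S\<^esub>)\<rparr>"

text \<open>
  The second and third of the quantified conditions say that \<open>\<delta>(Z(P))\<close> acts freely on the morphisms
  \<open>P \<rightarrow> Q\<close>, by composition on the right, and that its orbits are the fibres of \<open>pr\<close>.
\<close>

definition centric_linking_system ::
  "('a, 'h) monoid_scheme \<Rightarrow> 'a fusion \<Rightarrow> ('a set, 'm) cat \<Rightarrow>
   ('a set \<Rightarrow> 'a set \<Rightarrow> 'm \<Rightarrow> 'a \<Rightarrow> 'a) \<Rightarrow> ('a set \<Rightarrow> 'a set \<Rightarrow> 'a \<Rightarrow> 'm) \<Rightarrow> bool" where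
  "centric_linking_system S F \<L> pr \<delta> \<longleftrightarrow>
     id_functor \<L> (centric_fusion_cat S F) pr \<and>
     id_functor (centric_transporter_cat S F) \<L> \<delta> \<and>
     (\<forall>P Q. centric S F P \<and> centric S F Q \<longrightarrow>
        pr P Q ` arrs \<L> P Q = F P Q \<and> inj_on (\<delta> P Q) (transporter S P Q)) \<and>
     (\<forall>P Q f z. centric S F P \<and> centric S F Q \<and> f \<in> arrs \<L> P Q \<and> z \<in> centre S P \<and>
        composite \<L> P P Q f (\<delta> P P z) = f \<longrightarrow> z = \<one>\<^bsub>S\<^esub>) \<and>
     (\<forall>P Q f f'. centric S F P \<and> centric S F Q \<and> f \<in> arrs \<L> P Q \<and> f' \<in> arrs \<L> P Q \<longrightarrow>
        (pr P Q f = pr P Q f' \<longleftrightarrow> (\<exists>z\<in>centre S P. f' = composite \<L> P P Q f (\<delta> P P z)))) \<and>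
     (\<forall>P Q g. centric S F P \<and> centric S F Q \<and> g \<in> transporter S P Q \<longrightarrow>
        pr P Q (\<delta> P Q g) = conj_map S P g) \<and>
     (\<forall>P Q f g. centric S F P \<and> centric S F Q \<and> f \<in> arrs \<L> P Q \<and> g \<in> P \<longrightarrow>
        composite \<L> P Q Q (\<delta> Q Q (pr P Q f g)) f = composite \<L> P P Q f (\<delta> P P g))"


section \<open>Signaliser functors\<close>

text \<open>
  \<open>S\<close> is a Sylow \<open>p\<close>-subgroup of \<open>G\<close>, by way of the monomorphism \<open>j\<close>, and \<open>F = F\<^sub>S(G)\<close>. The remaining
  definitions of this section are meant for such \<open>G\<close> and \<open>j\<close>.
\<close>

definition realises ::
  "nat \<Rightarrow> ('a, 'h) monoid_scheme \<Rightarrow> 'a fusion \<Rightarrow> ('g, 'k) monoid_scheme \<Rightarrow> ('a \<Rightarrow> 'g) \<Rightarrow> bool" where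
  "realises p S F G j \<longleftrightarrow> group G \<and> j \<in> mon S G \<and> sylow_subgroup p G (j ` carrier S) \<and>
     (\<forall>P Q. subgroup P S \<and> subgroup Q S \<longrightarrow> F P Q = group_fusion G j P Q)"

definition signaliser_functor ::
  "('a, 'h) monoid_scheme \<Rightarrow> 'a fusion \<Rightarrow> ('g, 'k) monoid_scheme \<Rightarrow> ('a \<Rightarrow> 'g) \<Rightarrow>
   ('a set \<Rightarrow> 'g set) \<Rightarrow> bool" where
  "signaliser_functor S F G j \<Theta> \<longleftrightarrow>
     (\<forall>P. centric S F P \<longrightarrow>
        subgroup (\<Theta> P) (G\<lparr>carrier := centralizer G (j ` P)\<rparr>) \<and>
        j ` centre S P \<inter> \<Theta> P = {\<one>\<^bsub>G\<^esub>} \<and>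
        j ` centre S P <#>\<^bsub>G\<^esub> \<Theta> P = centralizer G (j ` P)) \<and>
     (\<forall>P Q g. centric S F P \<and> centric S F Q \<and> g \<in> transporter G (j ` P) (j ` Q) \<longrightarrow>
        \<Theta> Q \<subseteq> g <#\<^bsub>G\<^esub> \<Theta> P #>\<^bsub>G\<^esub> inv\<^bsub>G\<^esub> g)"

text \<open>
  Morphisms are cosets \<open>g \<Theta>(P)\<close> with \<open>g \<in> N\<^sub>G(P, Q)\<close>. As \<open>\<Theta>(Q) \<le> g \<Theta>(P) g\<^sup>-\<^sup>1\<close>, the setwise product
  of \<open>h \<Theta>(Q)\<close> and \<open>g \<Theta>(P)\<close> is the coset \<open>h g \<Theta>(P)\<close>.
\<close>

definition signaliser_linking ::
  "('a, 'h) monoid_scheme \<Rightarrow> 'a fusion \<Rightarrow> ('g, 'k) monoid_scheme \<Rightarrow> ('a \<Rightarrow> 'g) \<Rightarrow>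
   ('a set \<Rightarrow> 'g set) \<Rightarrow> ('a set, 'g set) cat" where
  "signaliser_linking S F G j \<Theta> = \<lparr>objs = {P. centric S F P},
     arrs = (\<lambda>P Q. (\<lambda>g. g <#\<^bsub>G\<^esub> \<Theta> P) ` transporter G (j ` P) (j ` Q)),
     composite = (\<lambda>P Q R Y X. Y <#>\<^bsub>G\<^esub> X), ident = \<Theta>\<rparr>"

text \<open>The projection sends \<open>g \<Theta>(P)\<close> to \<open>c\<^sub>g\<close>, which does not depend on \<open>g\<close> as \<open>\<Theta>(P)\<close> centralizes \<open>P\<close>.\<close>

definition signaliser_proj ::
  "('g, 'k) monoid_scheme \<Rightarrow> ('a \<Rightarrow> 'g) \<Rightarrow> 'a set \<Rightarrow> 'a set \<Rightarrow> 'g set \<Rightarrow> 'a \<Rightarrow> 'a" where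
  "signaliser_proj G j P Q X = (THE \<phi>. \<phi> \<in> P \<rightarrow>\<^sub>E Q \<and>
     (\<forall>g\<in>X. \<forall>x\<in>P. j (\<phi> x) = g \<otimes>\<^bsub>G\<^esub> j x \<otimes>\<^bsub>G\<^esub> inv\<^bsub>G\<^esub> g))"

definition induces ::
  "('a, 'h) monoid_scheme \<Rightarrow> 'a fusion \<Rightarrow> ('g, 'k) monoid_scheme \<Rightarrow> ('a \<Rightarrow> 'g) \<Rightarrow>
   ('a set \<Rightarrow> 'g set) \<Rightarrow> ('a set, 'm) cat \<Rightarrow> ('a set \<Rightarrow> 'a set \<Rightarrow> 'm \<Rightarrow> 'a \<Rightarrow> 'a) \<Rightarrow> bool" where
  "induces S F G j \<Theta> \<L> pr \<longleftrightarrow>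
     cat_over_iso (centric_fusion_cat S F) \<L> pr
       (signaliser_linking S F G j \<Theta>) (signaliser_proj G j)"


section \<open>Groups given by generators and relations\<close>

text \<open>
  In a word, \<open>(x, True)\<close> is the generator \<open>x\<close> and \<open>(x, False)\<close> its formal inverse; a pair \<open>(r, s)\<close> of
  words is the relation \<open>r = s\<close>.
\<close>

type_synonym 'x word = "('x \<times> bool) list"

inductive_set pres_rel :: "'x set \<Rightarrow> ('x word \<times> 'x word) set \<Rightarrow> ('x word \<times> 'x word) set"
  for X :: "'x set" and Rel :: "('x word \<times> 'x word) set" where
  refl: "w \<in> lists (X \<times> UNIV) \<Longrightarrow> (w, w) \<in> pres_rel X Rel"
| sym: "(v, w) \<in> pres_rel X Rel \<Longrightarrow> (w, v) \<in> pres_rel X Rel"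
| trans: "(u, v) \<in> pres_rel X Rel \<Longrightarrow> (v, w) \<in> pres_rel X Rel \<Longrightarrow> (u, w) \<in> pres_rel X Rel"
| cancel: "u \<in> lists (X \<times> UNIV) \<Longrightarrow> v \<in> lists (X \<times> UNIV) \<Longrightarrow> x \<in> X \<Longrightarrow>
    (u @ [(x, b), (x, \<not> b)] @ v, u @ v) \<in> pres_rel X Rel"
| rel: "u \<in> lists (X \<times> UNIV) \<Longrightarrow> v \<in> lists (X \<times> UNIV) \<Longrightarrow> (r, s) \<in> Rel \<Longrightarrow>
    r \<in> lists (X \<times> UNIV) \<Longrightarrow> s \<in> lists (X \<times> UNIV) \<Longrightarrow> (u @ r @ v, u @ s @ v) \<in> pres_rel X Rel"

definition presented_group :: "'x set \<Rightarrow> ('x word \<times> 'x word) set \<Rightarrow> 'x word set monoid" where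
  "presented_group X Rel = \<lparr>carrier = lists (X \<times> UNIV) // pres_rel X Rel,
     mult = (\<lambda>A B. \<Union>a\<in>A. \<Union>b\<in>B. pres_rel X Rel `` {a @ b}),
     one = pres_rel X Rel `` {[]}\<rparr>"

definition pres_gen :: "'x set \<Rightarrow> ('x word \<times> 'x word) set \<Rightarrow> 'x \<Rightarrow> 'x word set" where
  "pres_gen X Rel x = pres_rel X Rel `` {[(x, True)]}"

lemma pres_rel_words:
  "(v, w) \<in> pres_rel X Rel \<Longrightarrow> v \<in> lists (X \<times> UNIV) \<and> w \<in> lists (X \<times> UNIV)"
  by (induction rule: pres_rel.induct) auto

lemma equiv_pres_rel: "equiv (lists (X \<times> UNIV)) (pres_rel X Rel)"
proof (intro equivI refl_onI symI transI)
  show "pres_rel X Rel \<subseteq> lists (X \<times> UNIV) \<times> lists (X \<times> UNIV)"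
    using pres_rel_words by fast
qed (fact pres_rel.refl pres_rel.sym pres_rel.trans)+

lemma pres_rel_context:
  assumes "(v, w) \<in> pres_rel X Rel" "a \<in> lists (X \<times> UNIV)" "b \<in> lists (X \<times> UNIV)"
  shows "(a @ v @ b, a @ w @ b) \<in> pres_rel X Rel"
  using assms
proof (induction rule: pres_rel.induct)
  case (refl w)
  then show ?case by (intro pres_rel.refl) auto
next
  case (sym v w)
  then show ?case by (simp add: pres_rel.sym)
next
  case (trans u v w)
  then show ?case using pres_rel.trans by fast
next
  case (cancel u v x c)
  then show ?case using pres_rel.cancel[of "a @ u" X "v @ b" x c Rel] by simp
next
  case (rel u v r s)
  then show ?case using pres_rel.rel[of "a @ u" X "v @ b" r s Rel] by simp
qed

lemma pres_mult:
  assumes "v \<in> lists (X \<times> UNIV)" "w \<in> lists (X \<times> UNIV)"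
  shows "pres_rel X Rel `` {v} \<otimes>\<^bsub>presented_group X Rel\<^esub> pres_rel X Rel `` {w} =
    pres_rel X Rel `` {v @ w}"
proof -
  have eq: "pres_rel X Rel `` {a @ b} = pres_rel X Rel `` {v @ w}"
    if "(v, a) \<in> pres_rel X Rel" "(w, b) \<in> pres_rel X Rel" for a b
  proof (rule equiv_class_eq[OF equiv_pres_rel])
    have ab: "a \<in> lists (X \<times> UNIV)" "b \<in> lists (X \<times> UNIV)"
      using that pres_rel_words by blast+
    have "(v @ w, a @ w) \<in> pres_rel X Rel"
      using pres_rel_context[OF that(1), of "[]" w] assms by simp
    moreover have "(a @ w, a @ b) \<in> pres_rel X Rel"
      using pres_rel_context[OF that(2), of a "[]"] ab by simp
    ultimately show "(a @ b, v @ w) \<in> pres_rel X Rel"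
      using pres_rel.sym[OF pres_rel.trans] by fast
  qed
  have "pres_rel X Rel `` {v} \<noteq> {}" "pres_rel X Rel `` {w} \<noteq> {}"
    using assms pres_rel.refl by blast+
  moreover have "pres_rel X Rel `` {v} \<otimes>\<^bsub>presented_group X Rel\<^esub> pres_rel X Rel `` {w} =
      (\<Union>a\<in>pres_rel X Rel `` {v}. \<Union>b\<in>pres_rel X Rel `` {w}. pres_rel X Rel `` {v @ w})"
    unfolding presented_group_def monoid.simps by (intro SUP_cong refl eq) simp_all
  ultimately show ?thesis by simp
qed

lemma inverse_word: "w \<in> lists (X \<times> UNIV) \<Longrightarrow> rev (map (apsnd Not) w) \<in> lists (X \<times> UNIV)"
  by (induction w) auto

lemma pres_rel_inverse:
  assumes "w \<in> lists (X \<times> UNIV)"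
  shows "(rev (map (apsnd Not) w) @ w, []) \<in> pres_rel X Rel"
  using assms
proof (induction w rule: list.induct)
  case Nil
  then show ?case by (simp add: pres_rel.refl)
next
  case (Cons l w)
  obtain x c where l: "l = (x, c)" by (cases l)
  have w: "w \<in> lists (X \<times> UNIV)" and x: "x \<in> X"
    using Cons.prems l by auto
  have "(rev (map (apsnd Not) w) @ [(x, \<not> c), (x, \<not> \<not> c)] @ w,
      rev (map (apsnd Not) w) @ w) \<in> pres_rel X Rel"
    using inverse_word[OF w] w x by (rule pres_rel.cancel)
  from pres_rel.trans[OF this Cons.IH[OF w]] show ?case
    by (simp add: l)
qed

lemma group_presented_group: "group (presented_group X Rel)"
proof (rule groupI)
  let ?G = "presented_group X Rel" and ?W = "lists (X \<times> UNIV)"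
  have carr: "carrier ?G = (\<lambda>w. pres_rel X Rel `` {w}) ` ?W"
    by (auto simp: presented_group_def quotient_def)
  have one: "\<one>\<^bsub>?G\<^esub> = pres_rel X Rel `` {[]}"
    by (simp add: presented_group_def)
  show "\<one>\<^bsub>?G\<^esub> \<in> carrier ?G"
    by (auto simp: carr one)
  fix A B C assume "A \<in> carrier ?G"
  then obtain a where a: "a \<in> ?W" "A = pres_rel X Rel `` {a}" by (auto simp: carr)
  then show "\<one>\<^bsub>?G\<^esub> \<otimes>\<^bsub>?G\<^esub> A = A" by (simp add: one pres_mult)
  have inv: "rev (map (apsnd Not) a) \<in> ?W"
    using a(1) by (rule inverse_word)
  then have "pres_rel X Rel `` {rev (map (apsnd Not) a)} \<otimes>\<^bsub>?G\<^esub> A = \<one>\<^bsub>?G\<^esub>"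
    using a pres_rel_inverse[OF a(1), of Rel] equiv_class_eq[OF equiv_pres_rel]
    by (simp add: one pres_mult)
  then show "\<exists>y\<in>carrier ?G. y \<otimes>\<^bsub>?G\<^esub> A = \<one>\<^bsub>?G\<^esub>"
    using inv by (auto simp: carr)
  assume "B \<in> carrier ?G"
  then obtain b where b: "b \<in> ?W" "B = pres_rel X Rel `` {b}" by (auto simp: carr)
  then show "A \<otimes>\<^bsub>?G\<^esub> B \<in> carrier ?G"
    using a by (auto simp: carr pres_mult)
  assume "C \<in> carrier ?G"
  then obtain c where c: "c \<in> ?W" "C = pres_rel X Rel `` {c}" by (auto simp: carr)
  have "a @ b \<in> ?W" "b @ c \<in> ?W" using a b c by auto
  then show "A \<otimes>\<^bsub>?G\<^esub> B \<otimes>\<^bsub>?G\<^esub> C = A \<otimes>\<^bsub>?G\<^esub> (B \<otimes>\<^bsub>?G\<^esub> C)"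
    using a b c by (simp add: pres_mult)
qed


section \<open>Robinson's group\<close>

text \<open>
  \<open>L i\<close> is the model of the normalizer fusion system of \<open>R i\<close>, and \<open>e i\<close> the embedding of
  \<open>N\<^sub>S(R i)\<close> in it. The map \<open>\<iota> i\<close> embeds the edge group, the normalizer of \<open>R i\<close> in \<open>L 0\<close>, in \<open>L i\<close>.
\<close>

definition is_model ::
  "nat \<Rightarrow> ('a, 'h) monoid_scheme \<Rightarrow> 'a fusion \<Rightarrow> 'a set \<Rightarrow> 'b monoid \<Rightarrow> ('a \<Rightarrow> 'b) \<Rightarrow> bool" where
  "is_model p S F R M e \<longleftrightarrow> group M \<and> finite (carrier M) \<and>
     e \<in> mon (S\<lparr>carrier := normalizer S R\<rparr>) M \<and>
     sylow_subgroup p M (e ` normalizer S R) \<and>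
     e ` R \<lhd> M \<and> centralizer M (e ` R) \<subseteq> e ` R \<and>
     (\<forall>P Q. subgroup P S \<and> subgroup Q S \<and> P \<subseteq> normalizer S R \<and> Q \<subseteq> normalizer S R \<longrightarrow>
        group_fusion M e P Q = normalizer_fusion S F R P Q)"

definition edge_group :: "(nat \<Rightarrow> 'a set) \<Rightarrow> (nat \<Rightarrow> 'b monoid) \<Rightarrow> (nat \<Rightarrow> 'a \<Rightarrow> 'b) \<Rightarrow> nat \<Rightarrow> 'b set" where
  "edge_group R L e i = normalizer (L 0) (e 0 ` R i)"

definition robinson_data ::
  "nat \<Rightarrow> ('a, 'h) monoid_scheme \<Rightarrow> 'a fusion \<Rightarrow> 'a set set \<Rightarrow> nat \<Rightarrow> (nat \<Rightarrow> 'a set) \<Rightarrow>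
   (nat \<Rightarrow> 'b monoid) \<Rightarrow> (nat \<Rightarrow> 'a \<Rightarrow> 'b) \<Rightarrow> (nat \<Rightarrow> 'b \<Rightarrow> 'b) \<Rightarrow> bool" where
  "robinson_data p S F \<R> n R L e \<iota> \<longleftrightarrow>
     (\<forall>P\<in>\<R>. centric S F P) \<and>
     (\<forall>P\<in>\<R>. \<forall>Q. fusion_conj S F P Q \<longrightarrow> Q \<in> \<R>) \<and>
     (\<forall>P. centric S F P \<and> radical p S F P \<longrightarrow> P \<in> \<R>) \<and>
     R 0 = carrier S \<and>
     (\<forall>i\<le>n. R i \<in> \<R> \<and> fully_normalized S F (R i)) \<and>
     (\<forall>P\<in>\<R>. \<exists>!i. i \<le> n \<and> fusion_conj S F P (R i)) \<and>
     (\<forall>i\<le>n. is_model p S F (R i) (L i) (e i)) \<and>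
     (\<forall>i. 1 \<le> i \<and> i \<le> n \<longrightarrow>
        \<iota> i \<in> mon ((L 0)\<lparr>carrier := edge_group R L e i\<rparr>) (L i) \<and>
        (\<forall>x\<in>normalizer S (R i). \<iota> i (e 0 x) = e i x))"

text \<open>
  The amalgamated product of the tree of groups: the elements of all the vertex groups are generators,
  subject to the multiplication tables and to the identification of each edge group with its image.
\<close>

definition robinson_gens :: "nat \<Rightarrow> (nat \<Rightarrow> 'b monoid) \<Rightarrow> (nat \<times> 'b) set" where
  "robinson_gens n L = (SIGMA i:{..n}. carrier (L i))"

definition robinson_rels ::
  "nat \<Rightarrow> (nat \<Rightarrow> 'a set) \<Rightarrow> (nat \<Rightarrow> 'b monoid) \<Rightarrow> (nat \<Rightarrow> 'a \<Rightarrow> 'b) \<Rightarrow> (nat \<Rightarrow> 'b \<Rightarrow> 'b) \<Rightarrow>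
   ((nat \<times> 'b) word \<times> (nat \<times> 'b) word) set" where
  "robinson_rels n R L e \<iota> =
     {([((i, x), True), ((i, y), True)], [((i, x \<otimes>\<^bsub>L i\<^esub> y), True)]) | i x y.
        i \<le> n \<and> x \<in> carrier (L i) \<and> y \<in> carrier (L i)} \<union>
     {([((0, x), True)], [((i, \<iota> i x), True)]) | i x. 1 \<le> i \<and> i \<le> n \<and> x \<in> edge_group R L e i}"

definition robinson_group ::
  "nat \<Rightarrow> (nat \<Rightarrow> 'a set) \<Rightarrow> (nat \<Rightarrow> 'b monoid) \<Rightarrow> (nat \<Rightarrow> 'a \<Rightarrow> 'b) \<Rightarrow> (nat \<Rightarrow> 'b \<Rightarrow> 'b) \<Rightarrow>
   (nat \<times> 'b) word set monoid" where
  "robinson_group n R L e \<iota> = presented_group (robinson_gens n L) (robinson_rels n R L e \<iota>)"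

definition robinson_incl ::
  "nat \<Rightarrow> (nat \<Rightarrow> 'a set) \<Rightarrow> (nat \<Rightarrow> 'b monoid) \<Rightarrow> (nat \<Rightarrow> 'a \<Rightarrow> 'b) \<Rightarrow> (nat \<Rightarrow> 'b \<Rightarrow> 'b) \<Rightarrow>
   'a \<Rightarrow> (nat \<times> 'b) word set" where
  "robinson_incl n R L e \<iota> s = pres_gen (robinson_gens n L) (robinson_rels n R L e \<iota>) (0, e 0 s)"


section \<open>The group of Leary and Stancu\<close>

text \<open>A pair \<open>(P, \<phi>)\<close> in \<open>\<Phi>\<close> is a morphism \<open>\<phi> : P \<rightarrow> S\<close>.\<close>

definition leary_stancu_data ::
  "('a, 'h) monoid_scheme \<Rightarrow> 'a fusion \<Rightarrow> ('a set \<times> ('a \<Rightarrow> 'a)) set \<Rightarrow> bool" where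
  "leary_stancu_data S F \<Phi> \<longleftrightarrow> finite \<Phi> \<and>
     (\<forall>(P, \<phi>)\<in>\<Phi>. centric S F P \<and> \<phi> \<in> F P (carrier S)) \<and>
     fusion_generated S F ((\<lambda>(P, \<phi>). (P, carrier S, \<phi>)) ` \<Phi> \<union>
       (\<lambda>\<phi>. (carrier S, carrier S, \<phi>)) ` inner_auts S (carrier S))"

text \<open>
  The generators are \<open>Inl s\<close> for \<open>s \<in> S\<close> and a stable letter \<open>Inr (P, \<phi>)\<close> for each \<open>(P, \<phi>) \<in> \<Phi>\<close>; the
  multiplication table of \<open>S\<close> alone would give the free product of \<open>S\<close> with the free group on \<open>\<Phi>\<close>.
\<close>

definition leary_stancu_gens ::
  "('a, 'h) monoid_scheme \<Rightarrow> ('a set \<times> ('a \<Rightarrow> 'a)) set \<Rightarrow> ('a + 'a set \<times> ('a \<Rightarrow> 'a)) set" where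
  "leary_stancu_gens S \<Phi> = carrier S <+> \<Phi>"

definition leary_stancu_rels ::
  "('a, 'h) monoid_scheme \<Rightarrow> ('a set \<times> ('a \<Rightarrow> 'a)) set \<Rightarrow>
   (('a + 'a set \<times> ('a \<Rightarrow> 'a)) word \<times> ('a + 'a set \<times> ('a \<Rightarrow> 'a)) word) set" where
  "leary_stancu_rels S \<Phi> =
     {([(Inl x, True), (Inl y, True)], [(Inl (x \<otimes>\<^bsub>S\<^esub> y), True)]) | x y.
        x \<in> carrier S \<and> y \<in> carrier S} \<union>
     {([(Inr (P, \<phi>), True), (Inl (\<phi> u), True), (Inr (P, \<phi>), False)], [(Inl u, True)]) | P \<phi> u.
        (P, \<phi>) \<in> \<Phi> \<and> u \<in> P}"

definition leary_stancu_group ::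
  "('a, 'h) monoid_scheme \<Rightarrow> ('a set \<times> ('a \<Rightarrow> 'a)) set \<Rightarrow>
   ('a + 'a set \<times> ('a \<Rightarrow> 'a)) word set monoid" where
  "leary_stancu_group S \<Phi> = presented_group (leary_stancu_gens S \<Phi>) (leary_stancu_rels S \<Phi>)"

definition leary_stancu_incl ::
  "('a, 'h) monoid_scheme \<Rightarrow> ('a set \<times> ('a \<Rightarrow> 'a)) set \<Rightarrow> 'a \<Rightarrow>
   ('a + 'a set \<times> ('a \<Rightarrow> 'a)) word set" where
  "leary_stancu_incl S \<Phi> s = pres_gen (leary_stancu_gens S \<Phi>) (leary_stancu_rels S \<Phi>) (Inl s)"

end

theory Submission
 imports Defs "HOL-Algebra.Sylow" "HOL-Algebra.Multiplicative_Group" "HOL-Library.Countable_Set"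
begin

text \<open>
  Both groups are given by a presentation, which acts as a universal property: to let \<open>\<pi>\<close> act on a set, it
  suffices to let the vertex groups act and to match these actions along the edges. Applied to suitably
  labelled cosets, this replaces the Bass--Serre tree: the part of the tree fixed by a subgroup \<open>P\<close> is
  connected, data given on the vertex groups compatibly along the edges glue to all of \<open>N\<^sub>\<pi>(P, S)\<close>, and a
  finite \<open>p\<close>-subgroup fixes a vertex. The last point gives the Sylow property; \<open>\<F> = \<F>\<^sub>S(\<pi>)\<close> holds by
  the choice of generators, respectively by Alperin's fusion theorem.

  Given a linking system, every edge or vertex group lifts to it: for \<open>\<pi>\<^sub>L\<^sub>S\<close> by choosing a preimage of
  each \<open>\<phi>\<^sub>i\<close>, for \<open>\<pi>\<^sub>R\<close> by averaging a set-theoretic lift of the model \<open>L\<^sub>i\<close> over the cosets of a Sylow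
  subgroup, which makes it multiplicative because \<open>Z(R\<^sub>i)\<close> is an abelian \<open>p\<close>-group. Gluing the lifts gives a
  functor from the transporter category of \<open>\<pi>\<close> to \<open>\<L>\<close> over the fusion category, and \<open>\<Theta>(P)\<close> is its kernel
  on \<open>C\<^sub>\<pi>(P)\<close>. Conversely, \<open>\<L>\<^sub>\<Theta>\<close> is a linking system and its structure is carried over to \<open>\<L>\<close> along the
  isomorphism.
\<close>

text \<open>A coset \<open>H g\<close> of a vertex group is fixed by right multiplication with
  \<open>P\<close> exactly when \<open>g\<close> carries \<open>P\<close> into \<open>H\<close>, so
  fixed vertices and edges appear as transporters. The obstacle is that a presentation yields an
  action only from bijections between entire label sets, also over edges that \<open>P\<close> moves
  and over edges with just one end in the region under study. Infinitely many spare labels, each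
  tagged by a coset that \<open>P\<close> moves, absorb the difference; a label fixed by
  \<open>P\<close> cannot be spare, which leads back to the fixed part. The label set decides what
  is obtained: a single label gives connectedness, integers exclude fixed-point-free elements of
  finite order, and \<open>Z(P)\<close> serves the linking system. There the lifts of one
  conjugation map form a torsor under \<open>Z(P)\<close>, so independent choices at the vertices
  differ along an edge by elements of \<open>Z(P)\<close>, and a tree imposes no condition on such
  differences. For Robinson's group the lifts of the models must also agree on the edge groups;
  hence averaging is needed twice, to make a lift multiplicative and to show that two lifts with
  equal values on a Sylow subgroup are conjugate.\<close>

notation iff (infixr "<-> " 25)
notation mult (infixl "\<cdot>\<index>" 70)
syntax "_index" :: "logic => index" ("\<^sub>_" [1000])

abbreviation conjugate :: "('g, 'm) monoid_scheme => 'g => 'g => 'g" (infixl "|>\<index>" 70) where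
 "g |>\<^sub>G x \<equiv> g \<cdot>\<^sub>G x \<cdot>\<^bsub>G\<^esub> inv\<^bsub>G\<^esub> g"

abbreviation "sgp == subgroup"
abbreviation "ctc == centric_transporter_cat"
lemmas trp_def = transporter_def and ctc_def = centric_transporter_cat_def
lemmas (in group) sub_self = subgroup_self
abbreviation "car \<equiv> carrier"
abbreviation "trp \<equiv> transporter"
lemmas sub_inv = subgroup.m_inv_closed and sub_one = subgroup.one_closed and sub_mult = subgroup.m_closed
 and sub_mem = subgroup.mem_carrier and sub_le = subgroup.subset

section \<open>Conjugation and transporters\<close>

context group
begin

lemma inv_cancel_left:
 assumes "x : car G" "y : car G"
 shows "inv x \<cdot> (x \<cdot> y) = y" "x \<cdot> (inv x \<cdot> y) = y" using assms by (simp_all add: m_assoc[symmetric])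

lemmas gnorm = m_assoc inv_mult_group inv_cancel_left

lemma conj_set:
 assumes "g : car G" "A <= car G"
 shows "g <# A #> inv g = (%a. g |> a) ` A" unfolding l_coset_def r_coset_def by auto

lemma trp_iff:
 assumes "A <= car G"
 shows "g : trp G A B <-> g : car G & (ALL a:A. g |> a : B)" unfolding trp_def using conj_set[OF _ assms] by auto

lemma transporter_mult:
 assumes "A <= car G" "B <= car G" "g : trp G A B" "h : trp G B C"
 shows "h \<cdot> g : trp G A C"
proof -
 have *: "g : car G" "h : car G" using assms by (auto simp: trp_def)
 have "h \<cdot> g |> a : C" if "a : A" for a
 proof -
  have "a : car G" using that assms by blast
  hence "h \<cdot> g |> a = h |> (g |> a)" using * by (simp add: gnorm)
  thus ?thesis using assms that by (simp add: trp_iff)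
 qed
 thus ?thesis using assms * by (simp add: trp_iff)
qed

text \<open>Conjugation by \<open>x\<close> maps \<open>H\<close> to itself, so membership depends
  only on the coset \<open>H g\<close>. The transporter into \<open>H\<close> is thus the set of
  vertices \<open>H g\<close> fixed by right multiplication with \<open>A\<close>, which is how the
  tree enters.\<close>

lemma transporter_left_mult:
 assumes "sgp H G" "A <= car G" "x : H" "g : car G"
 shows "x \<cdot> g : trp G A H <-> g : trp G A H"
proof -
 have H: "!!h. h : H ==> h : car G" using assms(1) by (meson sub_mem)
 have x: "x : car G" by (simp add: H assms)
 have "x \<cdot> g |> a : H <-> g |> a : H" if "a : A" for a
 proof -
  have a: "a : car G" using that assms by blast
  have 1: "x \<cdot> g |> a = x |> (g |> a)" using a x assms by (simp add: gnorm)
  have 2: "g |> a = inv x \<cdot> (x \<cdot> g |> a) \<cdot> x" using a x assms by (simp add: gnorm)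
  show ?thesis using 1 2 assms by (metis sub_mult sub_inv)
 qed
 thus ?thesis using assms x by (simp add: trp_iff)
qed

end

section \<open>Actions and presentations\<close>

definition acts_on :: "('g, 'k) monoid_scheme => 'g set => 'z set => ('g => 'z => 'z) => bool" where
 "acts_on G H Z a <-> (ALL x:H. ALL z:Z. a x z : Z) & (ALL z:Z. a \<one>\<^sub>G z = z) &
   (ALL x:H. ALL y:H. ALL z:Z. a (x \<cdot>\<^sub>G y) z = a x (a y z))"

lemma (in group) acts_on_bij:
 assumes "acts_on G H Z a" "sgp H G" "x : H"
 shows "bij_betw (a x) Z Z"
proof (rule bij_betw_byWitness[where f' = "a (inv x)"])
 have *: "inv x : H" "x : car G" using assms by (auto intro: sub_inv sub_mem)
 show "ALL z:Z. a (inv x) (a x z) = z" using assms * unfolding acts_on_def by (metis l_inv)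
 show "ALL z:Z. a x (a (inv x) z) = z" using assms * unfolding acts_on_def by (metis r_inv)
qed (use assms in \<open>auto simp: acts_on_def sub_inv\<close>)

text \<open>A formal inverse acts by \<open>inv_into Z\<close>, so a generator has to be given only
  as a bijection of \<open>Z\<close>.\<close>

fun word_action :: "'z set => ('x => 'z => 'z) => 'x word => 'z => 'z" where
 "word_action Z f [] z = z"
| "word_action Z f ((x, b) # w) z =
  (if b then f x else inv_into Z (f x)) (word_action Z f w z)"

lemma word_action_append: "word_action Z f (v @ w) z = word_action Z f v (word_action Z f w z)"
 by (induction v) (auto split: prod.splits)

lemma word_action_closed:
 assumes "!!x. x : X ==> bij_betw (f x) Z Z" "w : lists (X \<times> UNIV)" "z : Z"
 shows "word_action Z f w z : Z" using assms(2,3)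
proof (induction w)
 case (Cons l w)
 obtain x b where l: "l = (x, b)" by (cases l)
 have x: "bij_betw (f x) Z Z" using Cons.hyps l assms(1) by auto
 have "word_action Z f w z : Z" using Cons by auto
 thus ?case using x bij_betw_apply[OF x] bij_betw_apply[OF bij_betw_inv_into[OF x]] by (simp add: l)
qed simp

text \<open>The universal property of a presentation with the symmetric group of \<open>Z\<close> as
  target. Cancellation is respected because generators act bijectively, so equivalent words act
  alike and a class acts through any of its words.\<close>

lemma presented_group_action:
 assumes bij: "!!x. x : X ==> bij_betw (f x) Z Z"
  and rels: "!!r s z. (r, s) : Rel ==> r : lists (X \<times> UNIV) ==> s : lists (X \<times> UNIV) ==> z : Z ==>
   word_action Z f r z = word_action Z f s z"
 shows "EX act. acts_on (presented_group X Rel) (car (presented_group X Rel)) Z act &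
  (ALL x:X. ALL z:Z. act (pres_gen X Rel x) z = f x z)"
proof -
 have eq: "word_action Z f v z = word_action Z f w z" if "(v, w) : pres_rel X Rel" "z : Z" for v w z using that
 proof (induction arbitrary: z rule: pres_rel.induct)
  case (cancel u v x b)
  have x: "bij_betw (f x) Z Z" using cancel bij by auto
  have "word_action Z f v z : Z" using word_action_closed[of X f Z v] bij cancel by auto
  thus ?case using x by (simp add: word_action_append bij_betw_inv_into_left bij_betw_inv_into_right)
 next
  case (rel u v r s)
  have "word_action Z f v z : Z" using word_action_closed[of X f Z v] bij rel by auto
  thus ?case using rels rel by (simp add: word_action_append)
 qed auto
 define act where "act = (%A z. word_action Z f (SOME w. w : A) z)"
 have act: "act (pres_rel X Rel `` {w}) z = word_action Z f w z" if "w : lists (X \<times> UNIV)" "z : Z" for w z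
 proof -
  have "(w, SOME v. v : pres_rel X Rel `` {w}) : pres_rel X Rel"
   using pres_rel.refl[OF that(1), of Rel] by (metis Image_singleton_iff someI)
  thus ?thesis unfolding act_def using eq that by metis
 qed
 have carr: "car (presented_group X Rel) = (%w. pres_rel X Rel `` {w}) ` lists (X \<times> UNIV)"
  by (auto simp: presented_group_def quotient_def)
 have one: "\<one>\<^bsub>presented_group X Rel\<^esub> = pres_rel X Rel `` {[]}" by (simp add: presented_group_def)
 have "act (x \<cdot>\<^bsub>presented_group X Rel\<^esub> y) z = act x (act y z)"
  if xyz: "x : car (presented_group X Rel)" "y : car (presented_group X Rel)" "z : Z" for x y z
 proof -
  obtain v w where vw: "x = pres_rel X Rel `` {v}" "y = pres_rel X Rel `` {w}"
   "v : lists (X \<times> UNIV)" "w : lists (X \<times> UNIV)" using xyz unfolding carr by blast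
  hence "v @ w : lists (X \<times> UNIV)" by auto
  thus ?thesis using vw xyz word_action_closed[of X f Z, OF bij] by (simp add: pres_mult act word_action_append)
 qed
 moreover have "act x z : Z" if "x : car (presented_group X Rel)" "z : Z" for x z
 proof -
  obtain w where "w : lists (X \<times> UNIV)" "x = pres_rel X Rel `` {w}"
   using \<open>x : carrier _\<close> unfolding carr by blast
  thus ?thesis using act word_action_closed[of X f Z, OF bij] \<open>z : Z\<close> by simp
 qed
 ultimately have "acts_on (presented_group X Rel) (car (presented_group X Rel)) Z act"
  unfolding acts_on_def one by (auto simp: act)
 moreover have "act (pres_gen X Rel x) z = f x z" if "x : X" "z : Z" for x z using that by (simp add: pres_gen_def act)
 ultimately show ?thesis by blast
qed

lemma pres_gen_closed: "x : X ==> pres_gen X Rel x : car (presented_group X Rel)"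
 by (auto simp: presented_group_def quotient_def pres_gen_def)

lemma pres_gen_inv:
 assumes "x : X"
 shows "inv\<^bsub>presented_group X Rel\<^esub> (pres_gen X Rel x) = pres_rel X Rel `` {[(x, False)]}"
proof (rule group.inv_equality[OF group_presented_group])
 show "pres_rel X Rel `` {[(x, False)]} \<cdot>\<^bsub>presented_group X Rel\<^esub> pres_gen X Rel x =
   \<one>\<^bsub>presented_group X Rel\<^esub>"
  using assms pres_rel_inverse[of "[(x, True)]" X Rel] equiv_class_eq[OF equiv_pres_rel]
  by (simp add: pres_gen_def pres_mult presented_group_def[of X Rel, THEN arg_cong[of _ _ one]])
qed (use assms in \<open>auto simp: presented_group_def quotient_def pres_gen_def\<close>)

lemma presented_group_generated:
 assumes "sgp H (presented_group X Rel)" "!!x. x : X ==> pres_gen X Rel x : H"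
 shows "car (presented_group X Rel) <= H"
proof
 fix A assume "A : car (presented_group X Rel)"
 then obtain w where A: "A = pres_rel X Rel `` {w}" "w : lists (X \<times> UNIV)"
  by (auto simp: presented_group_def quotient_def)
 have "pres_rel X Rel `` {w} : H" using A(2)
 proof (induction w)
  case Nil
  thus ?case using sub_one[OF assms(1)] by (simp add: presented_group_def)
 next
  case (Cons l w)
  obtain x b where l: "l = (x, b)" by (cases l)
  hence x: "x : X" "w : lists (X \<times> UNIV)" using Cons.hyps by auto
  have "pres_rel X Rel `` {[l]} : H"
  proof (cases b)
   case True
   thus ?thesis using assms(2)[OF x(1)] by (simp add: l pres_gen_def)
  next
   case False
   thus ?thesis using sub_inv[OF assms(1) assms(2)[OF x(1)]] by (simp add: l pres_gen_inv x)
  qed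
  moreover have "pres_rel X Rel `` {l # w} =
    pres_rel X Rel `` {[l]} \<cdot>\<^bsub>presented_group X Rel\<^esub> pres_rel X Rel `` {w}"
   using x l by (subst pres_mult) auto
  ultimately show ?case using Cons x sub_mult[OF assms(1)] by auto
 qed
 thus "A : H" by (simp add: A)
qed

lemma presented_group_rel:
 assumes "(r, s) : Rel" "r : lists (X \<times> UNIV)" "s : lists (X \<times> UNIV)"
 shows "pres_rel X Rel `` {r} = pres_rel X Rel `` {s}" using pres_rel.rel[of "[]" X "[]" r s Rel] assms
 by (intro equiv_class_eq[OF equiv_pres_rel]) simp

section \<open>Fixed point trees\<close>

text \<open>One property that covers both presentations. The bijection \<open>T e\<close> identifies
  the set of the base vertex with that of the other end of \<open>e\<close>, compatibly with the
  edge group; through it the group \<open>B e\<close>, conjugated back by \<open>ta e\<close>, acts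
  on \<open>Z0\<close>. For a loop both ends carry the same set and \<open>T e\<close> becomes the
  action of \<open>ta e\<close> itself. The argument of type \<open>itself\<close> fixes the type of
  the sets acted on, over which the formula cannot quantify.\<close>

definition universal ::
 "('g, 'k) monoid_scheme => 'g set => 'e set => ('e => 'g set) => ('e => 'g set) => ('e => 'g) =>
  'e set => 'z itself => bool" where
 "universal G G0 E A B ta loops _ <-> (ALL (Z0 :: 'z set) Z a0 a T.
   acts_on G G0 Z0 a0 &
   (ALL e:E. acts_on G (B e) (Z e) (a e) & bij_betw (T e) Z0 (Z e) &
    (ALL x:A e. ALL z:Z0. T e (a0 x z) = a e (ta e |>\<^sub>G x) (T e z)) &
    (e : loops --> Z e = Z0 & (ALL x:G0. ALL z:Z0. a e x z = a0 x z))) -->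
   (EX act. acts_on G (car G) Z0 act & (ALL x:G0. ALL z:Z0. act x z = a0 x z) &
    (ALL e:E. (ALL x:B e. ALL z:Z0.
       T e (act (inv \<^sub>G ta e \<cdot>\<^sub>G x \<cdot>\<^sub>G ta e) z) = a e x (T e z)) &
      (e : loops --> (ALL z:Z0. act (ta e) z = T e z)))))"

text \<open>A star of groups: a centre \<open>G0\<close> and, for each edge, the edge group
  \<open>A e\<close> inside it and the group \<open>B e\<close> at the other end. In the amalgam
  \<open>ta e\<close> will be trivial; in the HNN extension it will be the inverse of a stable
  letter, every edge returning to the centre as a loop.\<close>

locale graph_group = group G for G :: "('g, 'k) monoid_scheme" (structure) +
 fixes G0 :: "'g set" and E :: "'e set" and A :: "'e => 'g set" and B :: "'e => 'g set"
  and ta :: "'e => 'g" and loops :: "'e set"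
 assumes base: "sgp G0 G"
  and edge: "!!e. e : E ==> sgp (A e) G" "!!e. e : E ==> A e <= G0"
  and vertex: "!!e. e : E ==> sgp (B e) G"
  and stable: "!!e. e : E ==> ta e : car G"
  and edge_target: "!!e x. e : E ==> x : A e ==> ta e |> x : B e"
  and loop: "!!e. e : E ==> e : loops ==> B e = G0"
  and generated: "!!X. sgp X G ==> G0 <= X ==>
   (!!e x. e : E ==> x : B e ==> inv ta e \<cdot> x \<cdot> ta e : X) ==>
   (!!e. e : E ==> e : loops ==> ta e : X) ==> car G <= X"

text \<open>\<open>Plain\<close> labels mark the vertices of the region under study.
  \<open>Shifted\<close> ones are spare: for each set \<open>C\<close> moved by \<open>P\<close> and
  each label there are countably many copies, so that the \<open>Plain\<close> labels can be stowed
  away or brought back by shifting the copies with tag \<open>C\<close>, as in Hilbert's hotel. The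
  tag keeps a spare label from being invariant under \<open>P\<close>.\<close>

datatype ('g, 'l) label = Plain 'l | Shifted nat "'g set" 'l

definition labels :: "('g, 'k) monoid_scheme => 'g set => 'l set => bool => ('g, 'l) label set" where
 "labels G P L b = (if b then Plain ` L else {}) \<union>
   {Shifted n C l | n C l. C <= car G & (EX u:P. C #>\<^sub>G u ~= C) & l : L}"

fun move_label :: "('g, 'k) monoid_scheme => 'g => ('g, 'l) label => ('g, 'l) label" where
 "move_label G u (Plain l) = Plain l"
| "move_label G u (Shifted n C l) = Shifted n (C #>\<^sub>G u) l"

fun shift :: "'g set => ('g, 'l) label => ('g, 'l) label" where
 "shift C (Plain l) = Shifted 0 C l"
| "shift C (Shifted n D l) = Shifted (if D = C then Suc n else n) D l"

fun unshift :: "'g set => ('g, 'l) label => ('g, 'l) label" where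
 "unshift C (Plain l) = Plain l"
| "unshift C (Shifted n D l) =
  (if D = C then case n of 0 => Plain l | Suc m => Shifted m D l else Shifted n D l)"

lemma labels_iff [simp]:
 "Plain l : labels G P L b <-> b & l : L"
 "Shifted n C l : labels G P L b <->
  C <= car G & (EX u:P. C #>\<^sub>G u ~= C) & l : L" by (cases b; simp add: labels_def image_iff)+

lemma shift_bij:
 fixes C :: "'g set" and L :: "'l set"
 assumes "C <= car G" "EX u:P. C #>\<^sub>G u ~= C"
 shows "bij_betw (shift C) (labels G P L True) (labels G P L False)"
  and "bij_betw (unshift C) (labels G P L False) (labels G P L True)"
proof -
 have 1: "unshift C (shift C k) = k" for k :: "('g, 'l) label" by (cases k) auto
 have 2: "shift C (unshift C k) = k" if "k : labels G P L False" for k using that by (cases k) (simp_all split: nat.splits)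
 have 3: "shift C k : labels G P L False" if "k : labels G P L True" for k using that assms by (cases k) simp_all
 have 4: "unshift C k : labels G P L True" if "k : labels G P L False" for k
  using that assms by (cases k) (simp_all split: nat.splits)
 show "bij_betw (shift C) (labels G P L True) (labels G P L False)"
  using 1 2 3 4 by (intro bij_betw_byWitness[where f' = "unshift C"]) blast+
 show "bij_betw (unshift C) (labels G P L False) (labels G P L True)"
  using 1 2 3 4 by (intro bij_betw_byWitness[where f' = "shift C"]) blast+
qed

context graph_group
begin

text \<open>
  Suppose that the vertices of the tree fixed by \<open>P\<close> are labelled, with label sets that are constant
  on \<open>N\<close> and empty outside, and that the labels are transported along the edges. Then the labels can
  be completed to a set on which the whole group acts, and the orbit of one label is a global section.
\<close>

theorem fixed_tree_section:
 fixes L :: "'l set" and ze :: "'e => 'g => 'l => 'l"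
 assumes univ: "universal G G0 E A B ta loops TYPE('g \<times> ('g, 'l) label)"
  and P: "sgp P G"
  and N: "N <= trp G P G0" "\<one> : N" "!!x g. x : G0 ==> g : N ==> x \<cdot> g : N"
  and M: "!!e. e : E ==> M e <= trp G P (B e)"
   "!!e x g. e : E ==> x : B e ==> g : M e ==> x \<cdot> g : M e"
   "!!e. e : E ==> e : loops ==> M e = N"
  and NM: "!!e g. e : E ==> g : trp G P (A e) ==> g : N <-> ta e \<cdot> g : M e"
  and ze: "!!e g. e : E ==> g : trp G P (A e) ==> bij_betw (ze e g) L L"
   "!!e g x. e : E ==> g : trp G P (A e) ==> x : A e ==> ze e (x \<cdot> g) = ze e g"
  and lz: "lz : L"
 shows "trp G P G0 <= N"
  and "EX c ce. c \<one> = lz & (ALL g:trp G P G0. c g : L & (ALL x:G0. c (x \<cdot> g) = c g)) &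
   (ALL e:E. (ALL g:trp G P (B e). ce e g : L & (ALL x:B e. ce e (x \<cdot> g) = ce e g)) &
    (ALL g:trp G P (A e). ce e (ta e \<cdot> g) = ze e g (c g)) &
    (e : loops --> (ALL g:trp G P G0. ce e g = c g)))"
proof -
 have Pc: "P <= car G" using P by (rule sub_le)
 have base_c: "G0 <= car G" using base by (rule sub_le)
 have edge_c: "!!e. e : E ==> A e <= car G" using edge(1) by (rule sub_le)
 have vertex_c: "!!e. e : E ==> B e <= car G" using vertex by (rule sub_le)
 have Nc: "g : car G" if "g : N" for g using that N(1) by (auto simp: trp_def)
 have Mc: "g : car G" if "g : M e" "e : E" for g e using that M(1) by (auto simp: trp_def)
 have N_left: "x \<cdot> g : N <-> g : N" if "x : G0" "g : car G" for x g
 proof -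
  have x: "x : car G" "inv x : G0" using that base base_c by (auto intro: sub_inv)
  have "inv x \<cdot> (x \<cdot> g) = g" using x that by (simp add: gnorm)
  thus ?thesis using N(3)[of "inv x" "x \<cdot> g"] N(3)[of x g] that x by auto
 qed
 have M_left: "x \<cdot> g : M e <-> g : M e" if "e : E" "x : B e" "g : car G" for e x g
 proof -
  have x: "x : car G" "inv x : B e" using that vertex[OF that(1)] vertex_c by (auto intro: sub_inv)
  have "inv x \<cdot> (x \<cdot> g) = g" using x that by (simp add: gnorm)
  thus ?thesis using M(2)[of e "inv x" "x \<cdot> g"] M(2)[of e x g] that x by auto
 qed
 have conj_right: "g \<cdot> u = (g |> u) \<cdot> g" if "g : car G" "u : P" for g u using that Pc by (auto simp: gnorm)
 have N_right: "g \<cdot> u : N <-> g : N" if "g : car G" "u : P" for g u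
 proof -
  have imp: "g \<cdot> u : N" if g: "g : N" and u: "u : P" for g u
  proof -
   have "g |> u : G0" using g u N(1) Pc by (auto simp: trp_iff)
   thus ?thesis using N(3)[OF _ g] conj_right[OF Nc[OF g] u] by metis
  qed
  have "g \<cdot> u \<cdot> inv u = g" using that Pc by (auto simp: gnorm)
  thus ?thesis using imp[of g u] imp[of "g \<cdot> u" "inv u"] that P by (auto intro: sub_inv)
 qed
 have M_right: "g \<cdot> u : M e <-> g : M e" if "e : E" "g : car G" "u : P" for e g u
 proof -
  have imp: "g \<cdot> u : M e" if g: "g : M e" and u: "u : P" for g u
  proof -
   have "g |> u : B e" using g u M(1)[OF \<open>e : E\<close>] Pc by (auto simp: trp_iff)
   thus ?thesis using M(2)[OF \<open>e : E\<close> _ g] conj_right[OF Mc[OF g \<open>e : E\<close>] u] by metis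
  qed
  have "g \<cdot> u \<cdot> inv u = g" using that Pc by (auto simp: gnorm)
  thus ?thesis using imp[of g u] imp[of "g \<cdot> u" "inv u"] that P by (auto intro: sub_inv)
 qed
 have A_right: "g \<cdot> u : trp G P (A e) <-> g : trp G P (A e)" if "e : E" "g : car G" "u : P" for e g u
 proof -
  have imp: "g \<cdot> u : trp G P (A e)" if g: "g : trp G P (A e)" and u: "u : P" for g u
  proof -
   have gc: "g : car G" using g by (simp add: trp_def)
   have "g |> u : A e" using g u Pc by (auto simp: trp_iff)
   thus ?thesis using transporter_left_mult[OF edge(1)[OF \<open>e : E\<close>] Pc _ gc] g conj_right[OF gc u] by metis
  qed
  have "g \<cdot> u \<cdot> inv u = g" using that Pc by (auto simp: gnorm)
  thus ?thesis using imp[of g u] imp[of "g \<cdot> u" "inv u"] that P by (auto intro: sub_inv)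
 qed
 \<comment> \<open>An edge that \<open>P\<close> does not fix has a coset moved by some element of
   \<open>P\<close>, so this coset is admissible as a tag.\<close>
 have moved: "A e #> g <= car G & (EX u:P. (A e #> g) #> u ~= A e #> g)"
  if e: "e : E" and g: "g : car G" "g ~: trp G P (A e)" for e g
 proof -
  obtain u where u: "u : P" "g |> u ~: A e" using g Pc by (auto simp: trp_iff)
  have uc: "u : car G" using u Pc by blast
  have "(A e #> g) #> u ~= A e #> g"
  proof
   assume "(A e #> g) #> u = A e #> g"
   moreover have "g : A e #> g" using rcos_self[OF g(1) edge(1)[OF e]] .
   ultimately have "g \<cdot> u : A e #> g" unfolding r_coset_def by blast
   then obtain h where h: "h : A e" "g \<cdot> u = h \<cdot> g" unfolding r_coset_def by blast
   hence "g |> u = h" using g edge_c[OF e] by (auto simp: gnorm)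
   thus False using u h by simp
  qed
  thus ?thesis using u(1) r_coset_subset_G[OF edge_c[OF e] g(1)] by blast
 qed

 \<comment> \<open>Points lie over group elements rather than cosets, so that vertex groups can act
   by left multiplication and \<open>P\<close> from the right. \<open>Plain\<close> labels occur
   only over \<open>N\<close> and \<open>M e\<close>.\<close>
 define Z0 where "Z0 = {(g, k). g : car G & k : labels G P L (g : N)}"
 define Z where "Z = (%e. {(g, k). g : car G & k : labels G P L (g : M e)})"
 define left where "left = (%x (g, k :: ('g, 'l) label). (x \<cdot> g, k))"
 define right where "right = (%u (g, k :: ('g, 'l) label). (g \<cdot> u, move_label G u k))"
 \<comment> \<open>On an edge fixed by \<open>P\<close> both ends lie in the region or neither does,
   and \<open>ze\<close> transports the \<open>Plain\<close> labels. On any other edge its own coset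
   is the tag of the shift that makes up for a difference between the ends.\<close>
 define b where "b = (%e g k. if g : trp G P (A e) then (case k of Plain l => Plain (ze e g l) | Shifted n C l => k)
  else if g : N & ta e \<cdot> g ~: M e then shift (A e #> g) k
  else if g ~: N & ta e \<cdot> g : M e then unshift (A e #> g) k else k)"
 define T where "T = (%e (g, k). (ta e \<cdot> g, b e g k))"

 have b_bij: "bij_betw (b e g) (labels G P L (g : N)) (labels G P L (ta e \<cdot> g : M e))"
  if e: "e : E" and g: "g : car G" for e g
 proof (cases "g : trp G P (A e)")
  case True
  have z: "bij_betw (ze e g) L L" using ze(1)[OF e True] .
  have *: "bij_betw (b e g) (labels G P L c) (labels G P L c)" for c
  proof (rule bij_betw_byWitness[where f' = "%k. case k of Plain l => Plain (inv_into L (ze e g) l) | _ => k"])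
   show "b e g ` labels G P L c <= labels G P L c"
   proof (rule image_subsetI)
    fix k assume "k : labels G P L c"
    thus "b e g k : labels G P L c" using True bij_betw_apply[OF z] by (cases k) (simp_all add: b_def)
   qed
   show "(%k. case k of Plain l => Plain (inv_into L (ze e g) l) | _ => k) ` labels G P L c <= labels G P L c"
   proof (rule image_subsetI)
    fix k assume "k : labels G P L c"
    thus "(case k of Plain l => Plain (inv_into L (ze e g) l) | _ => k) : labels G P L c"
     using bij_betw_apply[OF bij_betw_inv_into[OF z]] by (cases k) simp_all
   qed
  qed (use True z in \<open>auto simp: b_def bij_betw_inv_into_left bij_betw_inv_into_right split: label.splits\<close>)
  thus ?thesis using NM[OF e True] by simp
 next
  case False
  note mv = moved[OF e g False]
  have be: "b e g = (if g : N & ta e \<cdot> g ~: M e then shift (A e #> g)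
    else if g ~: N & ta e \<cdot> g : M e then unshift (A e #> g) else (%k. k))" using False by (auto simp: b_def)
  have id: "bij_betw (%k. k) X X" for X :: "('g, 'l) label set" by (simp add: bij_betw_def)
  show ?thesis using shift_bij[of "A e #> g" G P L] mv id unfolding be
   by (cases "g : N"; cases "ta e \<cdot> g : M e") simp_all
 qed
 have T_bij: "bij_betw (T e) Z0 (Z e)" if e: "e : E" for e
 proof (rule bij_betw_imageI)
  note ta = stable[OF e]
  show "inj_on (T e) Z0"
  proof (rule inj_onI)
   fix y z assume yz: "y : Z0" "z : Z0" "T e y = T e z"
   obtain g k h l where gh: "y = (g, k)" "z = (h, l)" by (metis surj_pair)
   hence "g = h" using yz ta by (auto simp: Z0_def T_def)
   thus "y = z" using yz gh inj_onD[OF bij_betw_imp_inj_on[OF b_bij[OF e]], of g k l] by (auto simp: Z0_def T_def)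
  qed
  show "T e ` Z0 = Z e"
  proof
   show "T e ` Z0 <= Z e" using ta bij_betw_apply[OF b_bij[OF e]] by (auto simp: Z0_def Z_def T_def)
   show "Z e <= T e ` Z0"
   proof
    fix z assume "z : Z e"
    then obtain g k where z: "z = (g, k)" "g : car G" "k : labels G P L (g : M e)" by (auto simp: Z_def)
    define h where "h = inv ta e \<cdot> g"
    have h: "h : car G" "ta e \<cdot> h = g" using ta z by (auto simp: h_def gnorm)
    then obtain k' where "k' : labels G P L (h : N)" "k = b e h k'"
     using bij_betw_imp_surj_on[OF b_bij[OF e h(1)]] z by auto
    hence "(h, k') : Z0" "T e (h, k') = z" using h z by (auto simp: Z0_def T_def)
    thus "z : T e ` Z0" by (metis imageI)
   qed
  qed
 qed
 have b_left: "b e (x \<cdot> g) = b e g" if e: "e : E" and x: "x : A e" and g: "g : car G" for e x g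
 proof -
  have xc: "x : car G" "x : G0" using x edge_c[OF e] edge(2)[OF e] by auto
  have 1: "A e #> (x \<cdot> g) = A e #> g"
   using coset_mult_assoc[of "A e" x g] xc g edge_c[OF e] coset_join2[OF xc(1) edge(1)[OF e] x] by simp
  have "ta e \<cdot> (x \<cdot> g) = (ta e |> x) \<cdot> (ta e \<cdot> g)" using stable[OF e] xc g by (simp add: gnorm)
  hence 2: "ta e \<cdot> (x \<cdot> g) : M e <-> ta e \<cdot> g : M e"
   using M_left[OF e edge_target[OF e x], of "ta e \<cdot> g"] stable[OF e] g by simp
  show ?thesis unfolding b_def
   using 1 2 N_left[OF xc(2) g] transporter_left_mult[OF edge(1)[OF e] Pc x g] ze(2)[OF e _ x, of g]
   by (auto intro!: ext split: label.splits)
 qed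
 \<comment> \<open>Right multiplication acts on the tags too; this is what makes the shift along an
   edge commute with \<open>P\<close>.\<close>
 have shift_right: "shift (C #> u) (move_label G u k) = move_label G u (shift C k)"
  "unshift (C #> u) (move_label G u k) = move_label G u (unshift C k)"
  if "u : P" "C <= car G" "k : labels G P L c" for C u k c
 proof -
  have uc: "u : car G" using that Pc by blast
  have canc: "D #> u #> inv u = D" if "D <= car G" for D using coset_mult_assoc[of D u "inv u"] uc that by simp
  have *: "D #> u = C #> u <-> D = C" if "D <= car G" for D using canc[OF that] canc[OF \<open>C <= car G\<close>] by metis
  show "shift (C #> u) (move_label G u k) = move_label G u (shift C k)"
  proof (cases k)
   case (Shifted n D l)
   thus ?thesis using *[of D] that(3) by simp
  qed simp
  show "unshift (C #> u) (move_label G u k) = move_label G u (unshift C k)"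
  proof (cases k)
   case (Shifted n D l)
   thus ?thesis using *[of D] that(3) by (simp split: nat.splits)
  qed simp
 qed
 have T_right: "T e (right u z) = right u (T e z)" if e: "e : E" and u: "u : P" and z: "z : Z0" for e u z
 proof -
  obtain g k where gk: "z = (g, k)" "g : car G" "k : labels G P L (g : N)" using z by (auto simp: Z0_def)
  have uc: "u : car G" using u Pc by blast
  have 1: "ta e \<cdot> (g \<cdot> u) = ta e \<cdot> g \<cdot> u" using uc gk stable[OF e] by (simp add: m_assoc)
  have 2: "ta e \<cdot> g \<cdot> u : M e <-> ta e \<cdot> g : M e" using M_right[OF e _ u] gk stable[OF e] by simp
  have 3: "A e #> (g \<cdot> u) = A e #> g #> u" using coset_mult_assoc[of "A e" g u] uc gk edge_c[OF e] by simp
  have "b e (g \<cdot> u) (move_label G u k) = move_label G u (b e g k)"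
  proof (cases "g : trp G P (A e)")
   case True
   hence "g |> u : A e" using u Pc by (auto simp: trp_iff)
   hence "ze e (g \<cdot> u) = ze e g" using ze(2)[OF e True] conj_right[OF gk(2) u] by metis
   thus ?thesis using True A_right[OF e gk(2) u] by (cases k) (auto simp: b_def)
  next
   case False
   thus ?thesis using A_right[OF e gk(2) u] N_right[OF gk(2) u] 1 2 3
     shift_right[OF u r_coset_subset_G[OF edge_c[OF e] gk(2)] gk(3)] by (simp add: b_def)
  qed
  thus ?thesis using 1 by (simp add: gk T_def right_def)
 qed
 have right_closed: "right u z : Z0" if "u : P" "z : Z0" for u z
 proof -
  have uc: "u : car G" using that Pc by blast
  obtain g k where gk: "z = (g, k)" "g : car G" "k : labels G P L (g : N)"
   using \<open>z : Z0\<close> by (auto simp: Z0_def)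
  have "move_label G u k : labels G P L (g : N)"
  proof (cases k)
   case (Plain l)
   thus ?thesis using gk by simp
  next
   case (Shifted n C l)
   hence C: "C <= car G" "EX v:P. C #> v ~= C" "l : L" using gk(3) by simp_all
   have "EX v:P. C #> u #> v ~= C #> u"
   proof (rule ccontr)
    assume "\<not> (EX v:P. C #> u #> v ~= C #> u)"
    hence *: "C #> u #> v = C #> u" if "v : P" for v using that by blast
    have "C #> u = C" using *[of "inv u"] sub_inv[OF P \<open>u : P\<close>] coset_mult_assoc[of C u "inv u"] C uc by simp
    thus False using * C by auto
   qed
   thus ?thesis using Shifted C r_coset_subset_G[OF C(1) uc] by simp
  qed
  thus ?thesis using N_right[OF gk(2) \<open>u : P\<close>] uc gk by (simp add: Z0_def right_def)
 qed
 have left_right: "left x (right u z) = right u (left x z)" if "x : car G" "u : P" "fst z : car G" for x u z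
  using that Pc by (cases z) (auto simp: left_def right_def m_assoc)
 have left_Z0: "acts_on G G0 Z0 left" using N_left base_c by (auto simp: acts_on_def left_def Z0_def m_assoc subset_iff)
 have left_Z: "acts_on G (B e) (Z e) left" if "e : E" for e
  using M_left[OF that] vertex_c[OF that] by (auto simp: acts_on_def left_def Z_def m_assoc subset_iff)
 have T_left: "T e (left x z) = left (ta e |> x) (T e z)" if "e : E" "x : A e" "z : Z0" for e x z
 proof -
  have "x : car G" using that edge_c by blast
  thus ?thesis using that b_left stable by (auto simp: Z0_def T_def left_def gnorm)
 qed
 obtain act where act: "acts_on G (car G) Z0 act"
  and act_G0: "!!x z. x : G0 ==> z : Z0 ==> act x z = left x z"
  and act_B: "!!e x z. e : E ==> x : B e ==> z : Z0 ==>
    T e (act (inv ta e \<cdot> x \<cdot> ta e) z) = left x (T e z)"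
  and act_loop: "!!e z. e : E ==> e : loops ==> z : Z0 ==> act (ta e) z = T e z"
 proof -
  have "acts_on G G0 Z0 left &
   (ALL e:E. acts_on G (B e) (Z e) left & bij_betw (T e) Z0 (Z e) &
    (ALL x:A e. ALL z:Z0. T e (left x z) = left (ta e |> x) (T e z)) &
    (e : loops --> Z e = Z0 & (ALL x:G0. ALL z:Z0. left x z = left x z)))"
   using left_Z0 left_Z T_bij T_left M(3) by (simp add: Z0_def Z_def)
  from univ[unfolded universal_def, rule_format, of Z0 left Z "%e. left" T, OF this]
  show thesis using that by blast
 qed
 have act_closed: "act g z : Z0" if "g : car G" "z : Z0" for g z using act that by (auto simp: acts_on_def)
 have act_mult: "act (g \<cdot> h) z = act g (act h z)" if "g : car G" "h : car G" "z : Z0" for g h z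
  using act that by (auto simp: acts_on_def)
 have act_one: "act \<one> z = z" if "z : Z0" for z using act that by (auto simp: acts_on_def)
 have Z0_fst: "fst z : car G" if "z : Z0" for z using that by (auto simp: Z0_def)
 \<comment> \<open>The action of an arbitrary element is not given explicitly. That it lies over
   left multiplication and commutes with \<open>P\<close> is shown by collecting the elements with
   these properties in a subgroup that contains the generators.\<close>
 define X where "X = {g : car G. ALL z:Z0. fst (act g z) = g \<cdot> fst z &
  (ALL u:P. act g (right u z) = right u (act g z))}"
 have "sgp X G"
 proof (rule subgroupI)
  have "\<one> : X" using act_one Z0_fst right_closed by (simp add: X_def)
  thus "X ~= {}" by blast
  fix g assume g: "g : X"
  hence gc: "g : car G" by (simp add: X_def)
  have "fst (act (inv g) z) = inv g \<cdot> fst z & (ALL u:P. act (inv g) (right u z) = right u (act (inv g) z))"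
   if z: "z : Z0" for z
  proof -
   define y where "y = act (inv g) z"
   have y: "y : Z0" "act g y = z" using act_closed z gc act_mult[of g "inv g" z] act_one by (auto simp: y_def)
   have "fst z = g \<cdot> fst y" using g y by (auto simp: X_def)
   hence "fst y = inv g \<cdot> fst z" using gc Z0_fst[OF y(1)] by (simp add: gnorm)
   moreover have "act (inv g) (right u z) = right u y" if "u : P" for u
   proof -
    have "right u z = act g (right u y)" using g y that by (auto simp: X_def)
    thus ?thesis using act_mult[of "inv g" g "right u y"] right_closed[OF that y(1)] gc act_one by simp
   qed
   ultimately show ?thesis by (simp add: y_def)
  qed
  thus "inv g : X" using gc by (simp add: X_def)
  fix h assume h: "h : X"
  hence hc: "h : car G" by (simp add: X_def)
  show "g \<cdot> h : X" using g h gc hc act_closed right_closed Z0_fst by (simp add: X_def act_mult m_assoc)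
 qed (auto simp: X_def)
 moreover have "G0 <= X"
  using base_c act_G0 left_right right_closed Z0_fst by (auto simp: X_def left_def subset_iff split: prod.splits)
 moreover have "inv ta e \<cdot> x \<cdot> ta e : X" if e: "e : E" and x: "x : B e" for e x
 proof -
  let ?y = "inv ta e \<cdot> x \<cdot> ta e"
  have c: "x : car G" "ta e : car G" using x vertex_c[OF e] stable[OF e] by auto
  hence yc: "?y : car G" by simp
  have "fst (act ?y z) = ?y \<cdot> fst z & (ALL u:P. act ?y (right u z) = right u (act ?y z))" if z: "z : Z0" for z
  proof (intro conjI ballI)
   have "fst (T e (act ?y z)) = x \<cdot> fst (T e z)" using act_B[OF e x z] by (cases "T e z") (simp add: left_def)
   hence "ta e \<cdot> fst (act ?y z) = x \<cdot> (ta e \<cdot> fst z)" by (cases "act ?y z"; cases z) (simp add: T_def)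
   hence "inv ta e \<cdot> (ta e \<cdot> fst (act ?y z)) = inv ta e \<cdot> (x \<cdot> (ta e \<cdot> fst z))" by simp
   thus "fst (act ?y z) = ?y \<cdot> fst z" using c Z0_fst[OF z] Z0_fst[OF act_closed[OF yc z]] by (simp add: gnorm)
   fix u assume u: "u : P"
   have Tz: "fst (T e z) : car G" using bij_betw_apply[OF T_bij[OF e] z] by (auto simp: Z_def)
   have "T e (act ?y (right u z)) = left x (T e (right u z))" using act_B[OF e x right_closed[OF u z]] .
   also have "... = right u (left x (T e z))" using T_right[OF e u z] left_right[OF c(1) u Tz] by simp
   also have "... = T e (right u (act ?y z))" using T_right[OF e u act_closed[OF yc z]] act_B[OF e x z] by simp
   finally show "act ?y (right u z) = right u (act ?y z)"
    using inj_onD[OF bij_betw_imp_inj_on[OF T_bij[OF e]]] act_closed[OF yc] right_closed[OF u] z by metis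
  qed
  thus ?thesis using yc by (simp add: X_def)
 qed
 moreover have "ta e : X" if e: "e : E" "e : loops" for e
 proof -
  have "fst (act (ta e) z) = ta e \<cdot> fst z" if "z : Z0" for z using act_loop[OF e that] by (cases z) (simp add: T_def)
  thus ?thesis using act_loop[OF e] T_right[OF e(1)] right_closed stable[OF e(1)] by (simp add: X_def)
 qed
 ultimately have X: "g : X" if "g : car G" for g using generated[of X] that by blast

 define s where "s = (%g. act g (\<one>, Plain lz))"
 have start: "(\<one>, Plain lz) : Z0" using N(2) lz by (simp add: Z0_def)
 have s_closed: "s g : Z0" "fst (s g) = g" if "g : car G" for g
  using X[OF that] act_closed[OF that start] start that by (auto simp: s_def X_def)
 have s_mult: "s (g \<cdot> h) = act g (s h)" if "g : car G" "h : car G" for g h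
  using act_mult that start by (simp add: s_def)
 have P_G0: "P <= G0" using N(1,2) Pc by (auto simp: trp_iff subset_iff)
 have s_P: "s (g \<cdot> u) = right u (s g)" if "g : car G" "u : P" for g u
 proof -
  have uc: "u : car G" using that Pc by blast
  have "s u = right u (\<one>, Plain lz)" using act_G0[of u] start P_G0 that uc by (auto simp: s_def left_def right_def)
  thus ?thesis using s_mult[OF that(1) uc] X[OF that(1)] start that by (auto simp: X_def s_def)
 qed
 \<comment> \<open>The tag of a spare label is moved by some element of \<open>P\<close>, so a label
   fixed by all of \<open>P\<close> is \<open>Plain\<close>; and \<open>Plain\<close> labels exist
   only inside the region.\<close>
 have fixed: "(EX l:L. snd z = Plain l) & c"
  if "snd z : labels G P L c" "!!u. u : P ==> move_label G u (snd z) = snd z" for z :: "'g \<times> ('g, 'l) label" and c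
 proof (cases "snd z")
  case (Plain l)
  thus ?thesis using that(1) by simp
 next
  case (Shifted n C l)
  thus ?thesis using that by auto
 qed
 have s_G0: "(EX l:L. snd (s g) = Plain l) & g : N" if g: "g : trp G P G0" for g
 proof -
  have gc: "g : car G" using g by (simp add: trp_def)
  have "move_label G u (snd (s g)) = snd (s g)" if u: "u : P" for u
  proof -
   have "g |> u : G0" using g u Pc by (auto simp: trp_iff)
   \<comment> \<open>As \<open>g\<close> carries \<open>P\<close> into \<open>G0\<close>,
     multiplying by \<open>u\<close> on the right is multiplying by an element of \<open>G0\<close>
     on the left, and this leaves the label alone. Comparison with the right action shows that
     \<open>P\<close> fixes the label.\<close>
   hence "s (g \<cdot> u) = left (g |> u) (s g)"
    using conj_right[OF gc u] s_mult[of "g |> u" g] act_G0 s_closed gc base_c by auto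
   hence "right u (s g) = left (g |> u) (s g)" using s_P[OF gc u] by simp
   thus ?thesis by (cases "s g") (simp add: left_def right_def)
  qed
  moreover have "snd (s g) : labels G P L (g : N)" using s_closed[OF gc] by (auto simp: Z0_def)
  ultimately show ?thesis using fixed by blast
 qed
 have s_B: "(EX l:L. snd (T e (s (inv ta e \<cdot> g))) = Plain l) & g : M e"
  if e: "e : E" and g: "g : trp G P (B e)" for e g
 proof -
  have gc: "g : car G" using g by (simp add: trp_def)
  let ?h = "inv ta e \<cdot> g"
  have hc: "?h : car G" "ta e \<cdot> ?h = g" using gc stable[OF e] by (auto simp: gnorm)
  have "move_label G u (snd (T e (s ?h))) = snd (T e (s ?h))" if u: "u : P" for u
  proof -
   let ?x = "g |> u"
   have x: "?x : B e" using g u Pc by (auto simp: trp_iff)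
   have uc: "u : car G" using u Pc by blast
   have "?h \<cdot> u = (inv ta e \<cdot> ?x \<cdot> ta e) \<cdot> ?h" using gc uc stable[OF e] by (simp add: gnorm)
   hence "right u (s ?h) = act (inv ta e \<cdot> ?x \<cdot> ta e) (s ?h)"
    using s_P[OF hc(1) u] s_mult[of "inv ta e \<cdot> ?x \<cdot> ta e" ?h] gc uc stable[OF e] by simp
   hence "right u (T e (s ?h)) = left ?x (T e (s ?h))"
    using T_right[OF e u s_closed(1)[OF hc(1)]] act_B[OF e x s_closed(1)[OF hc(1)]] by simp
   thus ?thesis by (cases "T e (s ?h)") (simp add: left_def right_def)
  qed
  moreover have "snd (T e (s ?h)) : labels G P L (g : M e)"
   using bij_betw_apply[OF T_bij[OF e] s_closed(1)[OF hc(1)]] s_closed(2)[OF hc(1)] hc(2)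
   by (cases "s ?h") (auto simp: Z_def T_def)
  ultimately show ?thesis using fixed by blast
 qed
 show "trp G P G0 <= N" using s_G0 by blast

 \<comment> \<open>The missing case is harmless: over elements that carry \<open>P\<close> into a
   vertex group only \<open>Plain\<close> labels occur.\<close>
 define val where "val = (%z :: 'g \<times> ('g, 'l) label. case snd z of Plain l => l)"
 define c where "c = (%g. val (s g))"
 define ce where "ce = (%e g. val (T e (s (inv ta e \<cdot> g))))"
 have val_left: "val (left x z) = val z" for x z by (cases z) (simp add: val_def left_def)
 have "c \<one> = lz" using act_one[OF start] by (simp add: c_def s_def val_def)
 moreover have "c g : L & (ALL x:G0. c (x \<cdot> g) = c g)" if g: "g : trp G P G0" for g
 proof -
  have gc: "g : car G" using g by (simp add: trp_def)
  have "c (x \<cdot> g) = c g" if "x : G0" for x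
   using s_mult[of x g] act_G0[OF that] s_closed[OF gc] gc base_c that by (auto simp: c_def val_left)
  thus ?thesis using s_G0[OF g] by (auto simp: c_def val_def)
 qed
 moreover have "ce e g : L & (ALL x:B e. ce e (x \<cdot> g) = ce e g)" if e: "e : E" and g: "g : trp G P (B e)" for e g
 proof -
  have gc: "g : car G" using g by (simp add: trp_def)
  have "ce e (x \<cdot> g) = ce e g" if x: "x : B e" for x
  proof -
   have xc: "x : car G" using x vertex_c[OF e] by blast
   let ?h = "inv ta e \<cdot> g"
   have hc: "?h : car G" using gc stable[OF e] by simp
   have "inv ta e \<cdot> (x \<cdot> g) = (inv ta e \<cdot> x \<cdot> ta e) \<cdot> ?h"
    using gc xc stable[OF e] by (simp add: gnorm)
   hence "T e (s (inv ta e \<cdot> (x \<cdot> g))) = left x (T e (s ?h))"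
    using s_mult[OF _ hc, of "inv ta e \<cdot> x \<cdot> ta e"] act_B[OF e x s_closed(1)[OF hc]] xc stable[OF e] by simp
   thus ?thesis by (simp add: ce_def val_left)
  qed
  thus ?thesis using s_B[OF e g] by (auto simp: ce_def val_def)
 qed
 moreover have "ce e (ta e \<cdot> g) = ze e g (c g)" if e: "e : E" and g: "g : trp G P (A e)" for e g
 proof -
  have gc: "g : car G" using g by (simp add: trp_def)
  have "g : trp G P G0" using g edge(2)[OF e] Pc by (auto simp: trp_iff)
  then obtain l where l: "snd (s g) = Plain l" using s_G0 by blast
  hence "s g = (g, Plain l)" using s_closed(2)[OF gc] by (cases "s g") auto
  moreover have "inv ta e \<cdot> (ta e \<cdot> g) = g" using gc stable[OF e] by (simp add: gnorm)
  ultimately show ?thesis using g by (simp add: ce_def c_def val_def T_def b_def)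
 qed
 moreover have "ce e g = c g" if e: "e : E" "e : loops" and g: "g : trp G P G0" for e g
 proof -
  have gc: "g : car G" using g by (simp add: trp_def)
  have hc: "inv ta e \<cdot> g : car G" "ta e \<cdot> (inv ta e \<cdot> g) = g" using gc stable[OF e(1)] by (auto simp: gnorm)
  have "T e (s (inv ta e \<cdot> g)) = s g"
   using act_loop[OF e s_closed(1)[OF hc(1)]] s_mult[OF stable[OF e(1)] hc(1)] hc(2) by simp
  thus ?thesis by (simp add: ce_def c_def)
 qed
 ultimately show "EX c ce. c \<one> = lz &
   (ALL g:trp G P G0. c g : L & (ALL x:G0. c (x \<cdot> g) = c g)) &
   (ALL e:E. (ALL g:trp G P (B e). ce e g : L & (ALL x:B e. ce e (x \<cdot> g) = ce e g)) &
    (ALL g:trp G P (A e). ce e (ta e \<cdot> g) = ze e g (c g)) &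
    (e : loops --> (ALL g:trp G P G0. ce e g = c g)))" by (intro exI[of _ c] exI[of _ ce]) blast
qed

end

section \<open>Finite \<open>p\<close>-groups\<close>

text \<open>An orbit containing a point not fixed by the group has size a power of \<open>p\<close>
  other than 1, so discarding these orbits preserves divisibility by \<open>p\<close>.\<close>

lemma (in group) p_group_orbit_count:
 assumes "Factorial_Ring.prime p" "finite (car G)" "order G = p ^ k" "group_action G X ph" "finite X"
  and "p dvd card X"
 shows "p dvd card {x : X. ALL g:car G. ph g x = x}"
proof -
 interpret group_action G X ph by fact
 define F where "F = {x : X. ALL g:car G. ph g x = x}"
 define R where "R = {D : orbits G X ph. \<not> D <= F}"
 interpret part: partition X "orbits G X ph" by (rule orbit_partition)
 have self: "x : orbit G ph x" if "x : X" for x using orbit_refl that by blast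
 have eq: "D = orbit G ph x" if "D : orbits G X ph" "x : D" for D x
 proof -
  have x: "x : X" using that part.incl by blast
  hence "orbit G ph x : orbits G X ph" by (auto simp: orbits_def)
  thus ?thesis using part.unique_class[OF x] that self[OF x] by blast
 qed
 have "X - F = \<Union>R"
 proof
  show "\<Union>R <= X - F"
  proof
   fix x assume "x \<in> \<Union>R"
   then obtain D y where D: "D \<in> orbits G X ph" "x : D" "y : D" "y ~: F" unfolding R_def by blast
   hence "x : X" using part.incl by blast
   moreover have "x ~: F"
   proof
    assume x: "x : F"
    have "y : orbit G ph x" using eq[OF D(1,2)] D(3) by simp
    hence "y = x" using x by (auto simp: orbit_def F_def)
    thus False using x D by simp
   qed
   ultimately show "x : X - F" by blast
  qed
  show "X - F <= \<Union>R"
  proof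
   fix x assume x: "x \<in> X - F"
   hence "orbit G ph x : R" using self[of x] by (auto simp: orbits_def R_def)
   thus "x : \<Union>R" using self[of x] x by blast
  qed
 qed
 moreover have "p dvd card (\<Union>R)"
 proof (rule dvd_partition)
  show "finite (\<Union>R)" using \<open>X - F = \<Union>R\<close> assms by (metis finite_Diff)
  show "ALL c:R. p dvd card c"
  proof
   fix D assume "D : R"
   then obtain x where x: "D : orbits G X ph" "x : D" "x ~: F" unfolding R_def by blast
   hence xX: "x : X" using part.incl by blast
   have D: "D = orbit G ph x" using eq x by blast
   have "card D dvd p ^ k" using orbit_stabilizer_theorem[OF xX] assms(3) D by (metis dvd_triv_left)
   then obtain i where i: "card D = p ^ i" using assms(1) by (metis divides_primepow_nat)
   have "card D ~= 1"
   proof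
    assume "card D = 1"
    hence "orbit G ph x = {x}" using D self[OF xX] by (metis card_1_singletonE singletonD)
    hence "ph g x = x" if "g : car G" for g using that by (auto simp: orbit_def)
    thus False using x xX by (simp add: F_def)
   qed
   thus "p dvd card D" using i by (cases i) auto
  qed
  show "ALL c1:R. ALL c2:R. c1 ~= c2 --> c1 \<inter> c2 = {}" unfolding R_def using eq by blast
 qed
 ultimately have "p dvd card (X - F)" by simp
 moreover have "F <= X" by (auto simp: F_def)
 hence "card (X - F) = card X - card F" "card F <= card X"
  using assms(5) by (simp_all add: card_Diff_subset finite_subset card_mono)
 ultimately have "p dvd card F" using assms(6) by (metis dvd_diffD1)
 thus ?thesis by (simp add: F_def)
qed

lemma (in group) subgroup_pow_card:
 assumes "sgp Q G" "finite Q" "x : Q"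
 shows "x [^] card Q = \<one>"
proof -
 interpret Q: group "G(|carrier := Q|)" using subgroup_imp_group[OF assms(1)] .
 have "x [^]\<^bsub>G(|carrier := Q|)\<^esub> order (G(|carrier := Q|)) = \<one>"
  using Q.pow_order_eq_1[of x] assms(3) by simp
 thus ?thesis using nat_pow_consistent[of x "card Q" Q] by (simp add: order_def)
qed

lemma (in group) conj_inj:
 assumes "g : car G"
 shows "inj_on (%a. g |> a) (car G)"
proof (rule inj_on_inverseI)
 fix a assume "a : car G"
 thus "inv g \<cdot> (g |> a) \<cdot> g = a" using assms by (simp add: gnorm)
qed

text \<open>\<open>H\<close> acts by right multiplication on its cosets in \<open>Q\<close>. Their
  number is divisible by \<open>p\<close> and the coset \<open>H\<close> is fixed, so another coset
  \<open>H g\<close> is fixed too, and then \<open>g\<close> normalises \<open>H\<close>. A suitable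
  power of \<open>g\<close> has its \<open>p\<close>-th power in \<open>H\<close> as well.\<close>

lemma (in group) p_group_normalizer_grows:
 assumes p: "Factorial_Ring.prime p" and Q: "p_subgroup p G Q" and H: "sgp H G" "H \<subset> Q"
 shows "EX x:Q - H. (ALL h:H. x |> h : H) & x [^] p : H"
proof -
 obtain k where sQ: "sgp Q G" "finite Q" "card Q = p ^ k" using Q by (auto simp: p_subgroup_def)
 have Qc: "Q <= car G" using sub_le[OF sQ(1)] .
 have fH: "finite H" "H <= car G" using H sQ Qc finite_subset by auto
 let ?Q = "G(|carrier := Q|)" and ?H = "G(|carrier := H|)"
 interpret Q: group ?Q using subgroup_imp_group[OF sQ(1)] .
 interpret H: group ?H using subgroup_imp_group[OF H(1)] .
 have HQ: "sgp H ?Q" using subgroup_incl[OF H(1) sQ(1)] H(2) by blast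
 let ?X = "rcosets\<^bsub>?Q\<^esub> H"
 have index: "card ?X * card H = card Q" using Q.lagrange[OF HQ] by (simp add: order_def)
 have X: "?X = (%g. H #> g) ` Q" unfolding RCOSETS_def r_coset_def by auto
 have finX: "finite ?X" using X sQ by simp
 have "card H < card Q" using H sQ psubset_card_mono by blast
 hence "card ?X ~= 1" using index by auto
 moreover have "card ?X dvd p ^ k" using index sQ by (metis dvd_triv_left)
 ultimately have pX: "p dvd card ?X" using p by (metis divides_primepow_nat dvd_power power_0 neq0_conv)
 have "card H dvd p ^ k" using index sQ by (metis dvd_triv_right)
 then obtain i where i: "card H = p ^ i" using p by (metis divides_primepow_nat)
 define ph where "ph = (%h. \<lambda>C\<in>?X. C #> inv h)"
 have ph_closed: "C #> inv h : ?X" if h: "h : H" and C: "C : ?X" for h C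
 proof -
  obtain g where g: "g : Q" "C = H #> g" using C X by auto
  have "C #> inv h = H #> (g \<cdot> inv h)" using g h fH Qc coset_mult_assoc[of H g "inv h"] by auto
  moreover have "g \<cdot> inv h : Q" using g h H sQ(1) by (meson psubsetD sub_mult sub_inv)
  ultimately show ?thesis using X by blast
 qed
 have Xc: "C <= car G" if C: "C : ?X" for C
 proof -
  obtain g where "g : Q" "C = H #> g" using C X by auto
  thus ?thesis using r_coset_subset_G[OF fH(2), of g] Qc by auto
 qed
 have ph_mult: "C #> inv (h \<cdot> h') = C #> inv h' #> inv h" if "h : H" "h' : H" "C : ?X" for h h' C
 proof -
  have "h : car G" "h' : car G" using that fH by auto
  thus ?thesis using coset_mult_assoc[of C "inv h'" "inv h"] Xc[OF that(3)] by (simp add: inv_mult_group)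
 qed
 have bij: "ph h : Bij ?X" if h: "h : H" for h
 proof -
  have hi: "inv h : H" "h : car G" using h H(1) fH by (auto simp: sub_inv)
  have "bij_betw (%C. C #> inv h) ?X ?X"
  proof (rule bij_betw_byWitness[where f' = "%C. C #> h"])
   show "ALL C:?X. C #> inv h #> h = C" using coset_mult_assoc[of _ "inv h" h] Xc hi(2) by simp
   show "ALL C:?X. C #> h #> inv h = C" using coset_mult_assoc[of _ h "inv h"] Xc hi(2) by simp
   show "(%C. C #> inv h) ` ?X <= ?X" using ph_closed[OF h] by blast
   have "inv (inv h) = h" using hi by simp
   thus "(%C. C #> h) ` ?X <= ?X" using ph_closed[OF hi(1)] by (metis image_subsetI)
  qed
  thus ?thesis by (simp add: ph_def Bij_def cong: bij_betw_cong)
 qed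
 have act: "group_action ?H ?X ph" unfolding group_action_def group_hom_def group_hom_axioms_def
 proof (intro conjI)
  show "ph : hom ?H (BijGroup ?X)"
  proof (rule homI)
   fix h h' assume h: "h : carrier ?H" "h' : carrier ?H"
   show "ph h : car (BijGroup ?X)" using bij h by (simp add: BijGroup_def)
   show "ph (h \<cdot>\<^bsub>?H\<^esub> h') = ph h \<cdot>\<^bsub>BijGroup ?X\<^esub> ph h'"
    using h bij ph_mult ph_closed by (auto simp: BijGroup_def ph_def compose_def restrict_def fun_eq_iff)
  qed
 qed (auto simp: group_BijGroup H.is_group)
 have "p dvd card {C : ?X. ALL h:carrier ?H. ph h C = C}"
  by (rule H.p_group_orbit_count[OF p _ _ act finX pX]) (use fH i in \<open>auto simp: order_def\<close>)
 moreover have "{C : ?X. ALL h:carrier ?H. ph h C = C} = {C : ?X. ALL h:H. C #> inv h = C}" by (auto simp: ph_def)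
 ultimately have pF: "p dvd card {C : ?X. ALL h:H. C #> inv h = C}" by simp
 have HX: "H : {C : ?X. ALL h:H. C #> inv h = C}"
 proof -
  have "H = H #> \<one>" using fH by simp
  moreover have "\<one> : Q" using sQ(1) by (rule sub_one)
  moreover have "H #> inv h = H" if "h : H" for h using coset_join2[of "inv h" H] H(1) that fH by (auto intro: sub_inv)
  ultimately show ?thesis using X by blast
 qed
 obtain C where C: "C : ?X" "!!h. h : H ==> C #> inv h = C" "C ~= H"
 proof (cases "{C : ?X. ALL h:H. C #> inv h = C} = {H}")
  case True
  thus thesis using pF p by (metis card.empty card.insert dvd_1_iff_1 empty_iff finite.emptyI One_nat_def not_prime_1)
 next
  case False
  thus thesis using HX that by blast
 qed
 obtain g where g: "g : Q" "C = H #> g" using C(1) X by blast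
 have gc: "g : car G" using g Qc by blast
 have gH: "g |> h : H" if "h : H" for h
 proof -
  have hc: "h : car G" "inv h : H" using that fH H(1) by (auto intro: sub_inv)
  have "C #> h = C" using C(2)[OF hc(2)] hc by simp
  hence "g \<cdot> h : H #> g" using g rcos_self[OF gc H(1)] unfolding r_coset_def by blast
  then obtain h' where "h' : H" "g \<cdot> h = h' \<cdot> g" unfolding r_coset_def by blast
  thus ?thesis using gc hc fH by (auto simp: gnorm)
 qed
 have gnH: "g ~: H" using C(3) g coset_join2[OF gc H(1)] by blast
 have pow_Q: "g [^] m : Q" for m :: nat using sQ(1) g(1) by (induction m) (auto intro: sub_one sub_mult)
 have pow_conj: "g [^] m \<cdot> h \<cdot> inv (g [^] m) : H" if "h : H" for m :: nat and h using that
 proof (induction m arbitrary: h)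
  case 0
  thus ?case using fH by auto
 next
  case (Suc m)
  have hc: "h : car G" using Suc fH by blast
  have "g [^] Suc m \<cdot> h \<cdot> inv (g [^] Suc m) = g [^] m \<cdot> (g |> h) \<cdot> inv (g [^] m)"
   using gc hc by (simp add: gnorm)
  thus ?case using Suc gH by simp
 qed
 have "g [^] (p ^ k) = \<one>" using subgroup_pow_card[OF sQ(1,2) g(1)] sQ(3) by simp
 hence ex: "EX m. g [^] (p ^ m) : H" using H(1) by (metis sub_one)
 \<comment> \<open>Among the iterated \<open>p\<close>-th powers of \<open>g\<close>, the last one
   outside \<open>H\<close> is the required element.\<close>
 define m where "m = (LEAST m. g [^] (p ^ m) : H)"
 have m: "g [^] (p ^ m) : H" unfolding m_def using ex by (rule LeastI_ex)
 have "m ~= 0" using m gnH gc by (cases m) auto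
 then obtain l where l: "m = Suc l" by (cases m) auto
 have "g [^] (p ^ l) ~: H" using not_less_Least[of l "%m. g [^] (p ^ m) : H"] l m_def by auto
 moreover have "(g [^] (p ^ l)) [^] p : H" using m l gc by (simp add: nat_pow_pow mult.commute)
 ultimately show ?thesis using pow_Q pow_conj by blast
qed

text \<open>A subgroup provided by Sylow's theorem is conjugate into \<open>T\<close>, so
  \<open>T\<close> is at least as large. This connects the definition by conjugacy, made for
  infinite groups, with the index that the averaging needs.\<close>

lemma (in group) sylow_subgroup_index:
 assumes p: "Factorial_Ring.prime p" and G: "finite (car G)" and T: "sylow_subgroup p G T"
 shows "EX m. order G = card T * m & \<not> p dvd m"
proof -
 have pos: "order G ~= 0" using G order_gt_0_iff_finite by simp
 obtain m where m: "order G = p ^ multiplicity p (order G) * m" "\<not> p dvd m"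
  using multiplicity_decompose'[of "order G" p] pos p not_prime_unit by metis
 obtain H where H: "sgp H G" "card H = p ^ multiplicity p (order G)" using sylow_thm[OF p is_group m(1) G] by blast
 have fH: "finite H" "H <= car G" using sub_le[OF H(1)] G finite_subset by auto
 have T': "sgp T G" "finite T" "EX k. card T = p ^ k" using T by (auto simp: sylow_subgroup_def p_subgroup_def)
 obtain g where g: "g : car G" "g <# H #> inv g <= T" using T H fH unfolding sylow_subgroup_def p_subgroup_def by blast
 have inj: "inj_on (%a. g |> a) H" using inj_on_subset[OF conj_inj[OF g(1)] fH(2)] .
 have "card H = card (g <# H #> inv g)" using conj_set[OF g(1) fH(2)] card_image[OF inj] by simp
 hence le: "card H <= card T" using card_mono[OF T'(2) g(2)] by simp
 obtain k where k: "card T = p ^ k" using T' by blast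
 have "card T dvd order G" using lagrange[OF T'(1)] by (metis dvd_triv_right)
 hence "k <= multiplicity p (order G)" using k p pos by (metis power_dvd_iff_le_multiplicity not_prime_unit)
 hence "card T = p ^ multiplicity p (order G)" using le k H(2) p by (metis le_antisym power_increasing prime_ge_1_nat)
 thus ?thesis using m by auto
qed

context group
begin

text \<open>The cyclic group generated by \<open>x\<close> acts on \<open>H \ N\<close>, freely modulo \<open>p\<close>-th powers.\<close>

lemma mod_p_coordinate:
 fixes p :: nat
 assumes p: "Factorial_Ring.prime p" and H: "sgp H G" and x: "x : car G"
  and N: "N <= car G" "!!h g. h : H ==> g : N ==> h \<cdot> g : N"
   "!!g i. g : N ==> g \<cdot> x [^] (i::int) : N"
  and power: "!!g. g : N ==> g \<cdot> x [^] p \<cdot> inv g : H"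
  and free: "!!g. g : N ==> g |> x ~: H"
 shows "EX ep :: 'a => int. ALL g:N. (ALL h:H. ep (h \<cdot> g) = ep g) & (ep (g \<cdot> x) - ep g) mod int p = 1 mod int p"
proof -
 have Hc: "h : car G" if "h : H" for h using H that by (rule sub_mem)
 \<comment> \<open>The orbit of the coset \<open>H g\<close> under the powers of \<open>x\<close>,
   as a set of elements. The coordinate of \<open>g\<close> will be its position in the orbit,
   counted from a chosen point and reduced modulo \<open>p\<close>.\<close>
 define cls where "cls = (%g. {r : N. EX h:H. EX i::int. g = h \<cdot> r \<cdot> x [^] i})"
 have cls_sub: "cls (h \<cdot> g \<cdot> x [^] i) <= cls g" if h: "h : H" and g: "g : N" for h g and i :: int
 proof
  fix r assume "r : cls (h \<cdot> g \<cdot> x [^] i)"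
  then obtain k :: int and l where r: "r : N" "k : UNIV" "l : H" "h \<cdot> g \<cdot> x [^] i = l \<cdot> r \<cdot> x [^] k"
   by (auto simp: cls_def)
  have c: "h : car G" "l : car G" "g : car G" "r : car G" using h g r N Hc by auto
  have "g = inv h \<cdot> (h \<cdot> g \<cdot> x [^] i) \<cdot> inv (x [^] i)" using c x by (simp add: gnorm)
  also have "... = (inv h \<cdot> l) \<cdot> r \<cdot> (x [^] k \<cdot> inv (x [^] i))"
   unfolding r(4) using c x by (simp add: gnorm)
  also have "x [^] k \<cdot> inv (x [^] i) = x [^] (k - i)" using x by (simp add: int_pow_diff)
  finally have "g = (inv h \<cdot> l) \<cdot> r \<cdot> x [^] (k - i)" .
  moreover have "inv h \<cdot> l : H" using H h r by (simp add: sub_mult sub_inv)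
  ultimately show "r : cls g" using r(1) by (auto simp: cls_def)
 qed
 have cls: "cls (h \<cdot> g \<cdot> x [^] i) = cls g" if h: "h : H" and g: "g : N" for h g and i :: int
 proof
  have c: "h : car G" "g : car G" using h g N Hc by auto
  have "inv h \<cdot> (h \<cdot> g \<cdot> x [^] i) \<cdot> x [^] (- i) = g" using c x by (simp add: gnorm int_pow_neg)
  moreover have "h \<cdot> g \<cdot> x [^] i : N" using N h g by simp
  ultimately show "cls g <= cls (h \<cdot> g \<cdot> x [^] i)"
   using cls_sub[of "inv h" "h \<cdot> g \<cdot> x [^] i" "- i"] H h by (simp add: sub_inv)
 qed (rule cls_sub[OF that])
 define rep where "rep = (%g. SOME r. r : cls g)"
 have rep: "rep g : cls g" if "g : N" for g
 proof -
  have "g = \<one> \<cdot> g \<cdot> x [^] (0::int)" using that N by auto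
  hence "g : cls g" using that sub_one[OF H] unfolding cls_def by blast
  thus ?thesis unfolding rep_def by (rule someI)
 qed
 define idx where "idx = (%g. SOME i::int. EX h:H. g = h \<cdot> rep g \<cdot> x [^] i)"
 have idx: "EX h:H. g = h \<cdot> rep g \<cdot> x [^] idx g" if "g : N" for g
 proof -
  have "EX i::int. EX h:H. g = h \<cdot> rep g \<cdot> x [^] i" using rep[OF that] by (auto simp: cls_def)
  thus ?thesis unfolding idx_def by (rule someI_ex)
 qed
 have uniq: "int p dvd i - k"
  if r: "r : N" and h: "h : H" "l : H" and eq: "h \<cdot> r \<cdot> x [^] i = l \<cdot> r \<cdot> x [^] k" for r h l and i k :: int
 proof (rule ccontr)
  have c: "h : car G" "l : car G" "r : car G" using h r N Hc by auto
  \<comment> \<open>These exponents form an ideal of the integers that contains \<open>p\<close>. A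
    member prime to \<open>p\<close> would put 1 into the ideal, against
    \<open>free\<close>.\<close>
  define I where "I = {m::int. r \<cdot> x [^] m \<cdot> inv r : H}"
  have I_add: "a + b : I" if "a : I" "b : I" for a b
  proof -
   have "r \<cdot> x [^] (a + b) \<cdot> inv r = (r \<cdot> x [^] a \<cdot> inv r) \<cdot> (r \<cdot> x [^] b \<cdot> inv r)"
    using c x by (simp add: gnorm int_pow_mult)
   thus ?thesis using that H by (simp add: I_def sub_mult)
  qed
  have I_neg: "- a : I" if "a : I" for a
  proof -
   have "r \<cdot> x [^] (- a) \<cdot> inv r = inv (r \<cdot> x [^] a \<cdot> inv r)"
    using c x by (simp add: gnorm int_pow_neg)
   thus ?thesis using that H by (simp add: I_def sub_inv)
  qed
  have I_mult_nat: "int n * a : I" if "a : I" for n a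
  proof (induction n)
   case 0
   thus ?case using c H by (simp add: I_def sub_one)
  next
   case (Suc n)
   thus ?case using I_add that by (simp add: algebra_simps)
  qed
  have I_mult: "b * a : I" if "a : I" for a b
   using I_mult_nat[OF that, of "nat \<bar>b\<bar>"] I_neg[OF I_mult_nat[OF that, of "nat \<bar>b\<bar>"]]
   by (cases "b \<ge> 0") auto
  have "r \<cdot> x [^] (i - k) \<cdot> inv r = inv h \<cdot> (h \<cdot> r \<cdot> x [^] i) \<cdot> inv (x [^] k) \<cdot> inv r"
   using c x by (simp add: gnorm int_pow_diff)
  also have "... = inv h \<cdot> l" unfolding eq using c x by (simp add: gnorm)
  finally have 1: "i - k : I" using H h by (simp add: I_def sub_mult sub_inv)
  have 2: "int p : I" using power[OF r] by (simp add: I_def int_pow_int)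
  assume "\<not> int p dvd i - k"
  hence "coprime (int p) (i - k)" using p by (simp add: prime_imp_coprime)
  then obtain u v where "u * int p + v * (i - k) = 1" by (metis bezout_int coprime_iff_gcd_eq_1)
  hence "1 : I" using I_add[OF I_mult[OF 2, of u] I_mult[OF 1, of v]] by simp
  thus False using free[OF r] x by (simp add: I_def)
 qed
 define ep where "ep = (%g. idx g mod int p)"
 have "ep (h \<cdot> g) = ep g & (ep (g \<cdot> x) - ep g) mod int p = 1 mod int p" if g: "g : N" and h: "h : H" for g h
 proof
  have gc: "g : car G" "h : car G" using g h N Hc by auto
  have r: "rep g : N" using rep[OF g] by (simp add: cls_def)
  hence rc: "rep g : car G" using N by blast
  obtain l where l: "l : H" "g = l \<cdot> rep g \<cdot> x [^] idx g" using idx[OF g] by blast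
  have lc: "l : car G" using l Hc by blast
  have "cls (h \<cdot> g) = cls g" using cls[OF h g, of 0] gc by simp
  hence r': "rep (h \<cdot> g) = rep g" by (simp add: rep_def)
  obtain l' where l': "l' : H" "h \<cdot> g = l' \<cdot> rep g \<cdot> x [^] idx (h \<cdot> g)"
   using idx[of "h \<cdot> g"] N(2)[OF h g] r' by auto
  have "h \<cdot> g = h \<cdot> (l \<cdot> rep g \<cdot> x [^] idx g)" using l(2) by simp
  hence "h \<cdot> g = (h \<cdot> l) \<cdot> rep g \<cdot> x [^] idx g" using gc rc lc x by (simp add: m_assoc)
  hence "l' \<cdot> rep g \<cdot> x [^] idx (h \<cdot> g) = (h \<cdot> l) \<cdot> rep g \<cdot> x [^] idx g" using l'(2) by simp
  hence "int p dvd idx (h \<cdot> g) - idx g" using uniq[OF r l'(1) sub_mult[OF H h l(1)]] by blast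
  thus "ep (h \<cdot> g) = ep g" by (simp add: ep_def mod_eq_dvd_iff)
  have gx: "g \<cdot> x = \<one> \<cdot> g \<cdot> x [^] (1::int)" using gc x by simp
  have "cls (g \<cdot> x) = cls g" unfolding gx by (rule cls[OF sub_one[OF H] g])
  hence r'': "rep (g \<cdot> x) = rep g" by (simp add: rep_def)
  have "g \<cdot> x : N" using N(3)[OF g, of 1] x by simp
  then obtain m where m: "m : H" "g \<cdot> x = m \<cdot> rep g \<cdot> x [^] idx (g \<cdot> x)"
   using idx[of "g \<cdot> x"] r'' by auto
  have "g \<cdot> x = (l \<cdot> rep g \<cdot> x [^] idx g) \<cdot> x [^] (1::int)" using l(2) x by simp
  also have "... = l \<cdot> rep g \<cdot> x [^] (idx g + 1)" using lc rc x by (simp add: m_assoc int_pow_mult)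
  finally have "m \<cdot> rep g \<cdot> x [^] idx (g \<cdot> x) = l \<cdot> rep g \<cdot> x [^] (idx g + 1)" using m(2) by simp
  from uniq[OF r m(1) l(1) this] have "int p dvd (idx (g \<cdot> x) - idx g) - 1" by (simp add: algebra_simps)
  thus "(ep (g \<cdot> x) - ep g) mod int p = 1 mod int p" unfolding ep_def mod_diff_eq mod_eq_dvd_iff .
 qed
 thus ?thesis using sub_one[OF H] by (intro exI[of _ ep]) blast
qed

end

section \<open>Connectedness, cocycles and torsion on the fixed tree\<close>

context graph_group
begin

text \<open>With a single label the section records nothing but membership in the region. It serves
  as an induction principle: a set of fixed vertices that contains the base vertex and is closed in
  both directions along the fixed edges contains every fixed vertex of the base type.\<close>

lemma fixed_tree_connected:
 assumes "universal G G0 E A B ta loops TYPE('g \<times> ('g, unit) label)"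
  and "sgp P G"
  and "N <= trp G P G0" "\<one> : N" "!!x g. x : G0 ==> g : N ==> x \<cdot> g : N"
  and "!!e. e : E ==> M e <= trp G P (B e)"
   "!!e x g. e : E ==> x : B e ==> g : M e ==> x \<cdot> g : M e"
   "!!e. e : E ==> e : loops ==> M e = N"
  and "!!e g. e : E ==> g : trp G P (A e) ==> g : N <-> ta e \<cdot> g : M e"
 shows "trp G P G0 <= N" by (rule fixed_tree_section(1)[OF assms(1-9), where L = UNIV and ze = "%e g l. l" and lz = "()"])
  (auto simp: bij_betw_def inj_on_def)

text \<open>Here the region consists of all fixed vertices. Changes prescribed along the fixed edges
  integrate to a function on the vertices, since a tree has no closed path that could obstruct
  this.\<close>

lemma fixed_tree_cocycle:
 fixes ze :: "'e => 'g => 'l => 'l"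
 assumes univ: "universal G G0 E A B ta loops TYPE('g \<times> ('g, 'l) label)"
  and P: "sgp P G" "P <= G0"
  and "!!e g. e : E ==> g : trp G P (A e) ==> bij_betw (ze e g) L L"
   "!!e g x. e : E ==> g : trp G P (A e) ==> x : A e ==> ze e (x \<cdot> g) = ze e g"
  and "l0 : L"
 shows "EX c ce. c \<one> = l0 & (ALL g:trp G P G0. c g : L & (ALL x:G0. c (x \<cdot> g) = c g)) &
   (ALL e:E. (ALL g:trp G P (B e). ce e g : L & (ALL x:B e. ce e (x \<cdot> g) = ce e g)) &
    (ALL g:trp G P (A e). ce e (ta e \<cdot> g) = ze e g (c g)) &
    (e : loops --> (ALL g:trp G P G0. ce e g = c g)))"
proof -
 have Pc: "P <= car G" using P(1) by (rule sub_le)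
 have left: "x \<cdot> g : trp G P H" if "sgp H G" "x : H" "g : trp G P H" for x g H
  using transporter_left_mult[OF that(1) Pc that(2)] that(3) by (auto simp: trp_def)
 have edge_mem: "g : trp G P G0 & ta e \<cdot> g : trp G P (B e)" if "e : E" "g : trp G P (A e)" for e g
 proof
  show "g : trp G P G0" using that edge(2)[OF that(1)] Pc by (auto simp: trp_iff)
  have "ta e : trp G (A e) (B e)" using stable edge_target that edge(1) by (simp add: trp_iff sub_le)
  thus "ta e \<cdot> g : trp G P (B e)" using transporter_mult[OF Pc _ that(2)] edge(1) that by (meson sub_le)
 qed
 have one: "\<one> : trp G P G0" using P Pc by (simp add: trp_iff subset_iff)
 show ?thesis
  by (rule fixed_tree_section(2)[OF univ P(1) order_refl one left[OF base] order_refl left[OF vertex] _ _ assms(4-6)])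
   (use loop edge_mem in auto)
qed

text \<open>If \<open>x\<close> fixed no vertex of the tree of \<open>Q\<close>, the vertices would
  carry a coordinate modulo \<open>p\<close> that \<open>x\<close> raises by 1. Lifting its changes
  along the edges to integers produces an integer function which \<open>x\<close> shifts by a
  constant, the same everywhere by connectedness. The constant is 0 because \<open>x\<close> has
  finite order, yet it is 1 modulo \<open>p\<close>.\<close>

theorem torsion_fixes_vertex:
 fixes p :: nat
 assumes p: "Factorial_Ring.prime p"
  and univ: "universal G G0 E A B ta loops TYPE('g \<times> ('g, unit) label)"
   "universal G G0 E A B ta loops TYPE('g \<times> ('g, int) label)"
  and Q: "sgp Q G" "Q <= G0"
  and x: "x : car G" "!!u. u : Q ==> x |> u : Q" "!!u. u : Q ==> inv x \<cdot> u \<cdot> x : Q"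
   "x [^] p : Q" "x [^] (n::nat) = \<one>" "n > 0"
 shows "(EX g:trp G Q G0. g |> x : G0) \<or>
  (EX e:E. EX g:trp G Q (B e). g |> x : B e)"
proof (rule ccontr)
 assume contra: "\<not> ?thesis"
 have Qc: "Q <= car G" using Q(1) by (rule sub_le)
 have normalizes: "u : trp G Q Q" if "u = x \<or> u = inv x" for u using that x Qc by (auto simp: trp_iff)
 have powers: "x [^] (i::int) : trp G Q Q" for i
 proof -
  have nat: "u [^] (m::nat) : trp G Q Q" if "u = x \<or> u = inv x" for u m
  proof (induction m)
   case 0
   thus ?case using Qc by (auto simp: trp_iff)
  next
   case (Suc m)
   thus ?case using transporter_mult[OF Qc Qc normalizes[OF that] Suc] by simp
  qed
  show ?thesis
  proof (cases i rule: int_cases2)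
   case (nonneg m)
   thus ?thesis using nat[of x m] by (simp add: int_pow_int)
  next
   case (nonpos m)
   thus ?thesis using nat[of "inv x" m] x(1) by (simp add: int_pow_neg_int nat_pow_inv)
  qed
 qed
 have right: "g \<cdot> x [^] (i::int) : trp G Q H" if "g : trp G Q H" for g i H
  using transporter_mult[OF Qc Qc powers that] .
 have right1: "g \<cdot> x : trp G Q H" if "g : trp G Q H" for g H using right[OF that, of 1] x by simp
 have left: "h \<cdot> g : trp G Q H" if "sgp H G" "h : H" "g : trp G Q H" for h g H
  using transporter_left_mult[OF that(1) Qc that(2)] that(3) by (auto simp: trp_def)
 have coord: "EX ep :: 'g => int. ALL g:trp G Q H. (ALL h:H. ep (h \<cdot> g) = ep g) &
   (ep (g \<cdot> x) - ep g) mod int p = 1 mod int p" if "sgp H G" "!!g. g : trp G Q H ==> g |> x ~: H" for H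
 proof (rule mod_p_coordinate[OF p that(1) x(1)])
  show "g \<cdot> x [^] p \<cdot> inv g : H" if "g : trp G Q H" for g using that x(4) Qc by (auto simp: trp_iff)
 qed (use left[OF that(1)] right that(2) in \<open>auto simp: trp_def\<close>)
 obtain ep :: "'g => int" where ep:
  "!!g h. g : trp G Q G0 ==> h : G0 ==> ep (h \<cdot> g) = ep g"
  "!!g. g : trp G Q G0 ==> (ep (g \<cdot> x) - ep g) mod int p = 1 mod int p" using coord[OF base] contra by blast
 have "EX ep' :: 'g => int. (ALL g:trp G Q (B e). (ALL h:B e. ep' (h \<cdot> g) = ep' g) &
   (ep' (g \<cdot> x) - ep' g) mod int p = 1 mod int p) & (e : loops --> ep' = ep)" if e: "e : E" for e
 proof (cases "e : loops")
  case True
  thus ?thesis using ep loop[OF e] by auto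
 next
  case False
  thus ?thesis using coord[OF vertex[OF e]] contra e by blast
 qed
 then obtain epe :: "'e => 'g => int" where epe:
  "!!e g h. e : E ==> g : trp G Q (B e) ==> h : B e ==> epe e (h \<cdot> g) = epe e g"
  "!!e g. e : E ==> g : trp G Q (B e) ==> (epe e (g \<cdot> x) - epe e g) mod int p = 1 mod int p"
  "!!e. e : E ==> e : loops ==> epe e = ep" by metis
 \<comment> \<open>The residue from 0 to \<open>p - 1\<close> is used as an integer lift of the
   change along an edge. It depends only on the change modulo \<open>p\<close>, and \<open>x\<close>
   raises both coordinates by 1, so it is invariant under \<open>x\<close>.\<close>
 define z where "z = (%e g. (epe e (ta e \<cdot> g) - ep g) mod int p)"
 have edge_mem: "g : trp G Q G0" "ta e \<cdot> g : trp G Q (B e)" "g : car G" if "e : E" "g : trp G Q (A e)" for e g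
 proof -
  show "g : trp G Q G0" using that edge(2)[OF that(1)] Qc by (auto simp: trp_iff)
  have "ta e : trp G (A e) (B e)" using stable edge_target that edge(1) by (simp add: trp_iff sub_le)
  thus "ta e \<cdot> g : trp G Q (B e)" using transporter_mult[OF Qc _ that(2)] edge(1) that by (meson sub_le)
  show "g : car G" using that(2) by (simp add: trp_def)
 qed
 have z_left: "z e (a \<cdot> g) = z e g" if e: "e : E" and g: "g : trp G Q (A e)" and a: "a : A e" for e g a
 proof -
  have c: "a : car G" "a : G0" using a edge[OF e] by (auto simp: sub_mem)
  have "ta e \<cdot> (a \<cdot> g) = (ta e |> a) \<cdot> (ta e \<cdot> g)"
   using c edge_mem[OF e g] stable[OF e] by (simp add: gnorm)
  thus ?thesis using ep(1)[OF edge_mem(1)[OF e g] c(2)] epe(1)[OF e edge_mem(2)[OF e g] edge_target[OF e a]]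
   by (simp add: z_def)
 qed
 have z_right: "z e (g \<cdot> x) = z e g" if e: "e : E" and g: "g : trp G Q (A e)" for e g
 proof -
  have "ta e \<cdot> (g \<cdot> x) = ta e \<cdot> g \<cdot> x" using edge_mem[OF e g] stable[OF e] x by (simp add: m_assoc)
  moreover have "int p dvd (epe e (ta e \<cdot> g \<cdot> x) - epe e (ta e \<cdot> g)) - (ep (g \<cdot> x) - ep g)"
   using epe(2)[OF e edge_mem(2)[OF e g]] ep(2)[OF edge_mem(1)[OF e g]] unfolding mod_eq_dvd_iff[symmetric] by simp
  ultimately show ?thesis by (simp add: z_def mod_eq_dvd_iff algebra_simps)
 qed
 have "bij_betw (%l. l + z e g) UNIV UNIV" for e g by (rule bij_betw_byWitness[where f' = "%l. l - z e g"]) auto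
 hence "EX c ce. c \<one> = 0 & (ALL g:trp G Q G0. c g : UNIV & (ALL x:G0. c (x \<cdot> g) = c g)) &
   (ALL e:E. (ALL g:trp G Q (B e). ce e g : UNIV & (ALL x:B e. ce e (x \<cdot> g) = ce e g)) &
    (ALL g:trp G Q (A e). ce e (ta e \<cdot> g) = c g + z e g) &
    (e : loops --> (ALL g:trp G Q G0. ce e g = c g)))"
  using z_left by (intro fixed_tree_cocycle[OF univ(2) Q, of "%e g l. l + z e g"]) auto
 then obtain c ce where c: "c \<one> = 0"
  "!!g h. g : trp G Q G0 ==> h : G0 ==> c (h \<cdot> g) = c g"
  "!!e g h. e : E ==> g : trp G Q (B e) ==> h : B e ==> ce e (h \<cdot> g) = ce e g"
  "!!e g. e : E ==> g : trp G Q (A e) ==> ce e (ta e \<cdot> g) = c g + z e g"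
  "!!e g. e : E ==> e : loops ==> g : trp G Q G0 ==> ce e g = c g" by (elim exE conjE) blast
 have one: "\<one> : trp G Q G0" using Q Qc by (simp add: trp_iff subset_iff)
 have in_c: "g : car G" if "g : trp G Q H" for g H using that by (simp add: trp_def)
 have c_right: "c (g \<cdot> x) = c g + c x" if "g : trp G Q G0" for g
 proof -
  have "trp G Q G0 <= {g : trp G Q G0. c (g \<cdot> x) = c g + c x}"
  proof (rule fixed_tree_connected[OF univ(1) Q(1),
     where M = "%e. {g : trp G Q (B e). ce e (g \<cdot> x) = ce e g + c x}"])
   show "\<one> : {g : trp G Q G0. c (g \<cdot> x) = c g + c x}" using one x c(1) by simp
   fix h g assume hg: "h : G0" "g : {g : trp G Q G0. c (g \<cdot> x) = c g + c x}"
   hence "h \<cdot> g \<cdot> x = h \<cdot> (g \<cdot> x)" using in_c x base by (auto simp: m_assoc sub_mem)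
   thus "h \<cdot> g : {g : trp G Q G0. c (g \<cdot> x) = c g + c x}" using hg left[OF base] c(2) right1 by simp
  next
   fix e h g assume e: "e : E" and hg: "h : B e" "g : {g : trp G Q (B e). ce e (g \<cdot> x) = ce e g + c x}"
   hence "h \<cdot> g \<cdot> x = h \<cdot> (g \<cdot> x)" using in_c x vertex[OF e] by (auto simp: m_assoc sub_mem)
   thus "h \<cdot> g : {g : trp G Q (B e). ce e (g \<cdot> x) = ce e g + c x}"
    using e hg left[OF vertex[OF e]] c(3)[OF e] right1 by simp
  next
   fix e g assume e: "e : E" and g: "g : trp G Q (A e)"
   have "ta e \<cdot> g \<cdot> x = ta e \<cdot> (g \<cdot> x)" using edge_mem[OF e g] stable[OF e] x by (simp add: m_assoc)
   thus "g : {g : trp G Q G0. c (g \<cdot> x) = c g + c x} <->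
     ta e \<cdot> g : {g : trp G Q (B e). ce e (g \<cdot> x) = ce e g + c x}"
    using edge_mem[OF e g] c(4)[OF e g] c(4)[OF e right1[OF g]] z_right[OF e g] by simp
  qed (use loop c(5) right1 in auto)
  thus ?thesis using that by blast
 qed
 have power_mem: "x [^] (m::nat) : trp G Q G0" for m using powers[of "int m"] Q(2) Qc by (auto simp: trp_iff int_pow_int)
 have "c (x [^] m) = int m * c x" for m :: nat
 proof (induction m)
  case 0
  thus ?case using c(1) by simp
 next
  case (Suc m)
  thus ?case using c_right[OF power_mem[of m]] by (simp add: algebra_simps)
 qed
 from this[of n] have cx: "c x = 0" using x(5,6) c(1) by simp
 \<comment> \<open>By construction \<open>c\<close> and the coordinate change alike along edges
   modulo \<open>p\<close>, so by connectedness they differ by a constant.\<close>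
 have "trp G Q G0 <= {g : trp G Q G0. (c g - ep g) mod p = (c \<one> - ep \<one>) mod p}"
 proof (rule fixed_tree_connected[OF univ(1) Q(1),
    where M = "%e. {g : trp G Q (B e). (ce e g - epe e g) mod p = (c \<one> - ep \<one>) mod p}"])
  fix e g assume e: "e : E" and g: "g : trp G Q (A e)"
  have "(ce e (ta e \<cdot> g) - epe e (ta e \<cdot> g)) mod p = (c g - ep g) mod p"
  proof -
   have "ce e (ta e \<cdot> g) - epe e (ta e \<cdot> g) =
     (c g - ep g) - int p * ((epe e (ta e \<cdot> g) - ep g) div int p)"
    unfolding c(4)[OF e g] z_def by (simp add: minus_mult_div_eq_mod[symmetric])
   thus ?thesis by (simp add: mod_eq_dvd_iff)
  qed
  thus "g : {g : trp G Q G0. (c g - ep g) mod p = (c \<one> - ep \<one>) mod p} <->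
    ta e \<cdot> g : {g : trp G Q (B e). (ce e g - epe e g) mod p = (c \<one> - ep \<one>) mod p}"
   using edge_mem[OF e g] by simp
 qed (use one loop left[OF base] left[OF vertex] c(2,3,5) ep(1) epe(1,3) in auto)
 hence "(c x - ep x) mod p = (c \<one> - ep \<one>) mod p" using power_mem[of 1] x(1) by auto
 hence "int p dvd (- ep x) - (- ep \<one>)" using cx c(1) unfolding mod_eq_dvd_iff by simp
 moreover have "int p dvd (ep x - ep \<one>) - 1" using ep(2)[OF one] x(1) unfolding mod_eq_dvd_iff by simp
 ultimately have "int p dvd ((- ep x) - (- ep \<one>)) + ((ep x - ep \<one>) - 1)" by (rule dvd_add)
 thus False using p by (simp add: not_prime_unit)
qed

end

lemma (in group) conj_subgroup:
 assumes "sgp H G" "g : car G"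
 shows "sgp ((%a. g |> a) ` H) G"
proof -
 have "group_hom G G (%a. g |> a)" using assms(2) by unfold_locales (auto intro!: homI simp: gnorm)
 thus ?thesis using assms(1) by (rule group_hom.subgroup_img_is_subgroup)
qed

lemma (in group) p_subgroup_conj:
 assumes "p_subgroup p G H" "g : car G"
 shows "p_subgroup p G ((%a. g |> a) ` H)"
proof -
 have "H <= car G" using assms by (simp add: p_subgroup_def sub_le)
 thus ?thesis using assms conj_subgroup card_image[OF inj_on_subset[OF conj_inj[OF assms(2)]]] by (simp add: p_subgroup_def)
qed

lemma (in group) p_subgroup_mono:
 assumes "Factorial_Ring.prime p" "p_subgroup p G H" "sgp K G" "K <= H"
 shows "p_subgroup p G K"
proof -
 have H: "sgp H G" "finite H" "EX k. card H = p ^ k" using assms by (auto simp: p_subgroup_def)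
 interpret H: group "G(|carrier := H|)" using subgroup_imp_group[OF H(1)] .
 have "card K dvd card H"
  using H.lagrange[OF subgroup_incl[OF assms(3) H(1) assms(4)]] by (simp add: order_def) (metis dvd_triv_right)
 thus ?thesis using H assms finite_subset by (auto simp: p_subgroup_def) (metis divides_primepow_nat)
qed

text \<open>Take a largest subgroup \<open>K\<close> of \<open>Q\<close> that is conjugate into
  \<open>T\<close>. Were it proper, some \<open>x\<close> in \<open>Q\<close> outside
  \<open>K\<close> would normalise it and have its \<open>p\<close>-th power in it; then
  \<open>K\<close> and \<open>x\<close> fix a common vertex. The enlarged group is conjugate into
  that vertex group, hence into \<open>T\<close>, against the choice of \<open>K\<close>.\<close>

theorem (in graph_group) sylow_of_vertices:
 assumes p: "Factorial_Ring.prime p"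
  and univ: "universal G G0 E A B ta loops TYPE('g \<times> ('g, unit) label)"
   "universal G G0 E A B ta loops TYPE('g \<times> ('g, int) label)"
  and T: "p_subgroup p G T" "T <= G0"
  and vertices: "!!Q. p_subgroup p G Q ==> Q <= G0 \<or> (EX e:E. Q <= B e) ==>
   EX g:car G. (%a. g |> a) ` Q <= T"
 shows "sylow_subgroup p G T"
proof -
 have "EX g:car G. (%a. g |> a) ` Q <= T" if Q: "p_subgroup p G Q" for Q
 proof -
  have sQ: "sgp Q G" "finite Q" using Q by (auto simp: p_subgroup_def)
  have Qc: "Q <= car G" using sub_le[OF sQ(1)] .
  define W where "W = {K. sgp K G & K <= Q & (EX g:car G. (%a. g |> a) ` K <= T)}"
  have finW: "finite W" using finite_subset[of W "Pow Q"] sQ by (auto simp: W_def)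
  have "{\<one>} : W" using triv_subgroup sQ T by (auto simp: W_def p_subgroup_def sub_one intro!: bexI[of _ \<one>])
  hence "Max (card ` W) : card ` W" using finW by (intro Max_in) auto
  then obtain K where "K : W" "card K = Max (card ` W)" by auto
  hence K: "K : W" "!!K'. K' : W ==> card K' <= card K" using finW by simp_all
  then obtain g where g: "sgp K G" "K <= Q" "g : car G" "(%a. g |> a) ` K <= T" by (auto simp: W_def)
  have "K = Q"
  proof (rule ccontr)
   assume "K ~= Q"
   then obtain x where x: "x : Q" "x ~: K" "!!h. h : K ==> x |> h : K" "x [^] p : K"
    using p_group_normalizer_grows[OF p Q g(1)] g(2) by blast
   have Kc: "K <= car G" using g(2) Qc by blast
   have xc: "x : car G" using x Qc by blast
   have "(%h. x |> h) ` K = K"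
   proof (rule card_subset_eq)
    show "finite K" using g(2) sQ(2) finite_subset by blast
    show "(%h. x |> h) ` K <= K" using x by blast
    show "card ((%h. x |> h) ` K) = card K" using inj_on_subset[OF conj_inj[OF xc] Kc] by (rule card_image)
   qed
   hence xinv: "inv x \<cdot> h \<cdot> x : K" if h: "h : K" for h
   proof -
    have "h : (%h. x |> h) ` K" using \<open>_ ` K = K\<close> h by simp
    then obtain k where "k : K" "h = x |> k" by (rule imageE)
    thus ?thesis using xc Kc by (auto simp: gnorm subset_iff)
   qed
   let ?c = "%a. g |> a"
   have c_mult: "?c (a \<cdot> b) = ?c a \<cdot> ?c b" if "a : car G" "b : car G" for a b
    using that g(3) by (simp add: gnorm)
   have c_pow: "?c (x [^] m) = (?c x) [^] m" for m :: nat
   proof (induction m)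
    case (Suc m)
    thus ?case using c_mult[of "x [^] m" x] xc by simp
   qed (use g(3) in simp)
   have sub: "sgp (?c ` K) G" by (rule conj_subgroup[OF g(1,3)])
   have n1: "?c x \<cdot> u \<cdot> inv (?c x) : ?c ` K" if u: "u : ?c ` K" for u
   proof -
    obtain k where k: "k : K" "u = ?c k" using u by blast
    hence "?c x \<cdot> u \<cdot> inv (?c x) = ?c (x |> k)" using xc g(3) Kc by (auto simp: gnorm subset_iff)
    thus ?thesis using x(3)[OF k(1)] by blast
   qed
   have n2: "inv (?c x) \<cdot> u \<cdot> ?c x : ?c ` K" if u: "u : ?c ` K" for u
   proof -
    obtain k where k: "k : K" "u = ?c k" using u by blast
    hence "inv (?c x) \<cdot> u \<cdot> ?c x = ?c (inv x \<cdot> k \<cdot> x)"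
     using xc g(3) Kc by (auto simp: gnorm subset_iff)
    thus ?thesis using xinv[OF k(1)] by blast
   qed
   have n3: "(?c x) [^] p : ?c ` K" using c_pow[of p] x(4) by (metis imageI)
   have n4: "(?c x) [^] card Q = \<one>" using c_pow[of "card Q"] subgroup_pow_card[OF sQ x(1)] g(3) by simp
   have "card Q > 0" using sQ sub_one[OF sQ(1)] by (auto simp: card_gt_0_iff)
   hence "(EX h:trp G (?c ` K) G0. h \<cdot> ?c x \<cdot> inv h : G0) \<or>
     (EX e:E. EX h:trp G (?c ` K) (B e). h \<cdot> ?c x \<cdot> inv h : B e)"
    using torsion_fixes_vertex[OF p univ sub _ _ n1 n2 n3 n4] g(3,4) T(2) xc by blast
   then obtain H h where H: "sgp H G" "H = G0 \<or> (EX e:E. H = B e)"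
    "h : trp G (?c ` K) H" "h \<cdot> ?c x \<cdot> inv h : H" using base vertex by blast
   have hc: "h : car G" using H(3) by (simp add: trp_def)
   have hgc: "h \<cdot> g : car G" using hc g(3) by simp
   have conj: "(h \<cdot> g) |> a = h \<cdot> ?c a \<cdot> inv h" if "a : car G" for a
    using that hc g(3) by (simp add: gnorm)
   \<comment> \<open>Taking all elements of \<open>Q\<close> carried into the vertex group avoids
     describing the subgroup generated by \<open>K\<close> and \<open>x\<close>.\<close>
   define K' where "K' = {w : Q. (h \<cdot> g) |> w : H}"
   have K'Q: "K' <= Q" by (auto simp: K'_def)
   have K': "sgp K' G"
   proof (rule subgroupI)
    show "K' <= car G" using K'Q Qc by blast
    have "\<one> : K'" using sQ(1) H(1) hgc by (simp add: K'_def sub_one)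
    thus "K' ~= {}" by blast
    fix a assume a: "a : K'"
    hence ac: "a : car G" using K'Q Qc by blast
    have "(h \<cdot> g) |> inv a = inv ((h \<cdot> g) |> a)" using ac hc g(3) by (simp add: gnorm)
    thus "inv a : K'" using a sQ(1) H(1) by (simp add: K'_def sub_inv)
    fix b assume b: "b : K'"
    hence bc: "b : car G" using K'Q Qc by blast
    have "(h \<cdot> g) |> (a \<cdot> b) =
      ((h \<cdot> g) |> a) \<cdot> ((h \<cdot> g) |> b)" using ac bc hc g(3) by (simp add: gnorm)
    thus "a \<cdot> b : K'" using a b sQ(1) H(1) by (simp add: K'_def sub_mult)
   qed
   have "(h \<cdot> g) |> a : H" if "a : K" for a
   proof -
    have "h \<cdot> ?c a \<cdot> inv h : H" using H(3) that sub_le[OF sub] by (simp add: trp_iff)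
    thus ?thesis using conj that Kc by auto
   qed
   hence "insert x K <= K'" using g(2) x(1) H(4) conj[OF xc] by (auto simp: K'_def)
   hence bigger: "card K < card K'" using x(2) finite_subset[OF K'Q sQ(2)] by (intro psubset_card_mono) auto
   have "(%a. (h \<cdot> g) |> a) ` K' <= H" by (auto simp: K'_def)
   moreover have pK': "p_subgroup p G ((%a. (h \<cdot> g) |> a) ` K')"
    by (rule p_subgroup_conj[OF p_subgroup_mono[OF p Q K' K'Q] hgc])
   ultimately obtain k where k: "k : car G"
    "(%a. k |> a) ` (%a. (h \<cdot> g) |> a) ` K' <= T" using vertices[OF pK'] H(2) by blast
   have "(%a. (k \<cdot> (h \<cdot> g)) |> a) ` K' <= T"
   proof (rule image_subsetI)
    fix a assume a: "a : K'"
    hence "a : car G" using K'Q Qc by blast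
    hence "(k \<cdot> (h \<cdot> g)) |> a =
      k \<cdot> ((h \<cdot> g) |> a) \<cdot> inv k" using k(1) hc g(3) by (simp add: gnorm)
    thus "(k \<cdot> (h \<cdot> g)) |> a : T" using k(2) a by auto
   qed
   moreover have "k \<cdot> (h \<cdot> g) : car G" using k(1) hgc by simp
   ultimately have "K' : W" using K' K'Q unfolding W_def by blast
   thus False using K(2) bigger by fastforce
  qed
  thus ?thesis using g by blast
 qed
 thus ?thesis using T(1) conj_set by (auto simp: sylow_subgroup_def p_subgroup_def sub_le)
qed

section \<open>Free actions and the vertex groups\<close>

text \<open>Translation makes the group a free \<open>K\<close>-set, a union of copies of
  \<open>K\<close> indexed by cosets. The factor \<open>nat\<close> makes the number of copies
  countably infinite whatever the index, so the resulting \<open>K\<close>-set depends on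
  \<open>K\<close> alone.\<close>

lemma (in group) free_action_coordinates:
 assumes K: "sgp K G" and fin: "finite (car G)"
 shows "EX D. bij_betw D (car G \<times> (UNIV :: nat set)) (K \<times> (UNIV :: nat set)) &
  (ALL h:K. ALL x:car G. ALL n. D (h \<cdot> x, n) = (h \<cdot> fst (D (x, n)), snd (D (x, n))))"
proof -
 have Kc: "K <= car G" using K by (rule sub_le)
 define rep where "rep = (%x. SOME r. r : K #> x)"
 have rep: "EX h:K. rep x = h \<cdot> x" if "x : car G" for x
  using someI[of "%r. r : K #> x", OF rcos_self[OF that K]] by (auto simp: rep_def r_coset_def)
 have rep_c: "rep x : car G" if "x : car G" for x using rep[OF that] that Kc by auto
 have rep_left: "rep (h \<cdot> x) = rep x" if "h : K" "x : car G" for h x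
 proof -
  have "K #> (h \<cdot> x) = K #> x" using coset_mult_assoc[of K h x] coset_join2[of h K] that K Kc by auto
  thus ?thesis by (simp add: rep_def)
 qed
 have eta: "x \<cdot> inv (rep x) : K" if x: "x : car G" for x
 proof -
  obtain h where h: "h : K" "rep x = h \<cdot> x" using rep[OF x] by blast
  hence "x \<cdot> inv (rep x) = inv h" using x Kc by (auto simp: gnorm)
  thus ?thesis using h K by (simp add: sub_inv)
 qed
 define R where "R = (rep ` car G) \<times> (UNIV :: nat set)"
 have "finite (rep ` car G)" "rep ` car G ~= {}" using fin by auto
 hence "countable R" "infinite R" by (auto simp: R_def countable_finite finite_cartesian_product_iff)
 hence enc: "bij_betw (to_nat_on R) R UNIV" by (rule to_nat_on_infinite)
 define D where "D = (%(x, n). (x \<cdot> inv (rep x), to_nat_on R (rep x, n)))"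
 have "bij_betw D (car G \<times> UNIV) (K \<times> UNIV)"
 proof (rule bij_betw_imageI)
  show "inj_on D (car G \<times> UNIV)"
  proof (rule inj_onI)
   fix y z assume yz: "y : car G \<times> (UNIV :: nat set)" "z : car G \<times> (UNIV :: nat set)" "D y = D z"
   obtain a m b n where ab: "y = (a, m)" "z = (b, n)" by (metis surj_pair)
   have c: "a : car G" "b : car G" using yz ab by auto
   have eq: "a \<cdot> inv (rep a) = b \<cdot> inv (rep b)" "to_nat_on R (rep a, m) = to_nat_on R (rep b, n)"
    using yz(3) by (auto simp: D_def ab)
   have "(rep a, m) = (rep b, n)" using inj_onD[OF bij_betw_imp_inj_on[OF enc] eq(2)] c by (auto simp: R_def)
   thus "y = z" using eq(1) c rep_c ab by simp
  qed
  show "D ` (car G \<times> UNIV) = K \<times> UNIV"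
  proof
   show "D ` (car G \<times> UNIV) <= K \<times> UNIV" using eta by (auto simp: D_def)
   show "K \<times> UNIV <= D ` (car G \<times> UNIV)"
   proof
    fix z assume "z : K \<times> (UNIV :: nat set)"
    then obtain h m where z: "z = (h, m)" "h : K" by auto
    obtain q where "q : R" "to_nat_on R q = m" using bij_betw_imp_surj_on[OF enc] by (metis UNIV_I imageE)
    then obtain x n where q: "x : car G" "to_nat_on R (rep x, n) = m" by (auto simp: R_def)
    have hc: "h : car G" using z Kc by blast
    obtain k where k: "k : K" "rep x = k \<cdot> x" using rep[OF q(1)] by blast
    have kc: "k : car G" using k Kc by blast
    have "rep (h \<cdot> (k \<cdot> x)) = rep x" using rep_left z(2) k(1) q(1) kc by simp
    moreover have "h \<cdot> (k \<cdot> x) \<cdot> inv (rep x) = h" using hc k(2) kc q(1) by (simp add: gnorm)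
    ultimately have "D (h \<cdot> (k \<cdot> x), n) = z" using q z by (simp add: D_def)
    thus "z : D ` (car G \<times> UNIV)" using hc kc q(1) by (metis UNIV_I SigmaI imageI m_closed)
   qed
  qed
 qed
 moreover have "D (h \<cdot> x, n) = (h \<cdot> fst (D (x, n)), snd (D (x, n)))" if "h : K" "x : car G" for h x n
  using that rep_left rep_c Kc by (auto simp: D_def m_assoc subset_iff)
 ultimately show ?thesis by blast
qed

text \<open>Once the factor \<open>nat\<close> has absorbed the indices, both sides are the same
  free \<open>K\<close>-set. Such bijections let all vertex groups act by translations at the same
  time, which shows that they embed in the presented group.\<close>

lemma free_actions_isomorphic:
 assumes G: "group G" "finite (car G)" and H: "group H" "finite (car H)"
  and K: "sgp K G" and th: "th : mon (G(|carrier := K|)) H"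
 shows "EX T. bij_betw T (car G \<times> (UNIV :: nat set)) (car H \<times> (UNIV :: nat set)) &
  (ALL h:K. ALL x:car G. ALL n. T (h \<cdot>\<^sub>G x, n) = (th h \<cdot>\<^sub>H fst (T (x, n)), snd (T (x, n))))"
proof -
 interpret G: group G by fact
 interpret H: group H by fact
 interpret K: group "G(|carrier := K|)" using G.subgroup_imp_group[OF K] .
 have th': "group_hom (G(|carrier := K|)) H th" "inj_on th K"
  using th by (auto simp: mon_def group_hom_def group_hom_axioms_def K.is_group H.is_group)
 have K': "sgp (th ` K) H" using group_hom.img_is_subgroup[OF th'(1)] by simp
 obtain D1 where D1: "bij_betw D1 (car G \<times> (UNIV :: nat set)) (K \<times> (UNIV :: nat set))"
  "!!h x n. h : K ==> x : car G ==> D1 (h \<cdot>\<^sub>G x, n) = (h \<cdot>\<^sub>G fst (D1 (x, n)), snd (D1 (x, n)))"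
  using G.free_action_coordinates[OF K G(2)] by blast
 obtain D2 where D2: "bij_betw D2 (car H \<times> (UNIV :: nat set)) (th ` K \<times> (UNIV :: nat set))"
  "!!h x n. h : th ` K ==> x : car H ==> D2 (h \<cdot>\<^sub>H x, n) = (h \<cdot>\<^sub>H fst (D2 (x, n)), snd (D2 (x, n)))"
  using H.free_action_coordinates[OF K' H(2)] by blast
 define I where "I = inv_into (car H \<times> (UNIV :: nat set)) D2"
 have I: "bij_betw I (th ` K \<times> UNIV) (car H \<times> UNIV)" unfolding I_def by (rule bij_betw_inv_into[OF D2(1)])
 have D2I: "D2 (I y) = y" if "y : th ` K \<times> UNIV" for y using that D2(1) by (simp add: I_def bij_betw_inv_into_right)
 define M where "M = (%(h, n :: nat). (th h, n))"
 have M: "bij_betw M (K \<times> UNIV) (th ` K \<times> UNIV)" using th'(2) by (auto simp: M_def bij_betw_def inj_on_def)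
 define T where "T = (%y. I (M (D1 y)))"
 have "bij_betw T (car G \<times> UNIV) (car H \<times> UNIV)"
  using bij_betw_trans[OF bij_betw_trans[OF D1(1) M] I] by (simp add: T_def comp_def)
 moreover have "T (h \<cdot>\<^sub>G x, n) = (th h \<cdot>\<^sub>H fst (T (x, n)), snd (T (x, n)))"
  if h: "h : K" and x: "x : car G" for h x n
 proof -
  obtain k m where km: "D1 (x, n) = (k, m)" "k : K"
   using bij_betw_apply[OF D1(1), of "(x, n)"] x by (metis SigmaD1 SigmaI UNIV_I surj_pair)
  obtain y l where yl: "T (x, n) = (y, l)" by (metis surj_pair)
  have y: "y : car H" "D2 (y, l) = (th k, m)"
   using yl bij_betw_apply[OF I, of "(th k, m)"] D2I[of "(th k, m)"] km by (auto simp: T_def M_def)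
  have thh: "th h : car H" using sub_mem[OF K'] h by blast
  have "D2 (th h \<cdot>\<^sub>H y, l) = (th h \<cdot>\<^sub>H th k, m)" using D2(2)[of "th h" y l] h y by simp
  also have "th h \<cdot>\<^sub>H th k = th (h \<cdot>\<^sub>G k)" using group_hom.hom_mult[OF th'(1), of h k] h km by simp
  finally have "I (th (h \<cdot>\<^sub>G k), m) = (th h \<cdot>\<^sub>H y, l)"
   using bij_betw_inv_into_left[OF D2(1), of "(th h \<cdot>\<^sub>H y, l)"] y thh by (simp add: I_def)
  thus ?thesis using D1(2)[OF h x, of n] km yl by (simp add: T_def M_def)
 qed
 ultimately show ?thesis by blast
qed

section \<open>The group of Leary and Stancu\<close>

locale hnn_data = S: group S for S :: "'a monoid" +
 fixes Ph :: "('a set \<times> ('a => 'a)) set"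
 assumes finite_S: "finite (car S)"
  and domain: "!!P ph. (P, ph) : Ph ==> sgp P S"
  and morphism: "!!P ph. (P, ph) : Ph ==> ph : mon (S(|carrier := P|)) S"
begin

abbreviation "X == leary_stancu_gens S Ph"
abbreviation "Rel == leary_stancu_rels S Ph"
abbreviation "pG == leary_stancu_group S Ph"
abbreviation "j == leary_stancu_incl S Ph"

text \<open>The stable letter \<open>t\<close>. Its relation reads
  \<open>t \<phi>(u) t^-1 = u\<close>, so it is the inverse of \<open>t\<close> that conjugates
  \<open>P\<close> onto its image; hence the inverse is the element attached to the edge
  below.\<close>

definition stl :: "'a set \<times> ('a => 'a) => ('a + 'a set \<times> ('a => 'a)) word set" where
 "stl e = pres_gen X Rel (Inr e)"

sublocale pG: group pG unfolding leary_stancu_group_def by (rule group_presented_group)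

lemma image_in_S:
 assumes "(P, ph) : Ph" "u : P"
 shows "ph u : car S" using morphism[OF assms(1)] assms(2) by (auto simp: mon_def hom_def)

lemma domain_in_S: "(P, ph) : Ph ==> u : P ==> u : car S" using domain by (meson sub_mem)

lemma j_closed: "s : car S ==> j s : car pG" unfolding leary_stancu_incl_def leary_stancu_group_def
 by (rule pres_gen_closed) (auto simp: leary_stancu_gens_def)

lemma stl_closed: "e : Ph ==> stl e : car pG" unfolding stl_def leary_stancu_group_def
 by (rule pres_gen_closed) (auto simp: leary_stancu_gens_def)

lemma j_mult:
 assumes "x : car S" "y : car S"
 shows "j (x \<cdot>\<^sub>S y) = j x \<cdot>\<^sub>pG j y"
proof -
 have X: "Inl x : X" "Inl y : X" "Inl (x \<cdot>\<^sub>S y) : X" using assms by (auto simp: leary_stancu_gens_def)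
 have "([(Inl x, True), (Inl y, True)], [(Inl (x \<cdot>\<^sub>S y), True)]) : Rel"
  using assms by (auto simp: leary_stancu_rels_def)
 from presented_group_rel[OF this] X show ?thesis
  by (simp add: leary_stancu_incl_def leary_stancu_group_def pres_gen_def pres_mult)
qed

lemma j_hom: "j : hom S pG" by (rule homI) (auto simp: j_closed j_mult)

lemma stl_conj:
 assumes "(P, ph) : Ph" "u : P"
 shows "stl (P, ph) |>\<^sub>pG j (ph u) = j u"
proof -
 have X: "Inr (P, ph) : X" "Inl u : X" "Inl (ph u) : X"
  using assms image_in_S domain_in_S by (auto simp: leary_stancu_gens_def)
 have "([(Inr (P, ph), True), (Inl (ph u), True), (Inr (P, ph), False)], [(Inl u, True)]) : Rel"
  using assms by (auto simp: leary_stancu_rels_def)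
 from presented_group_rel[OF this] X show ?thesis
  by (simp add: leary_stancu_incl_def leary_stancu_group_def stl_def pres_gen_inv)
   (simp add: pres_gen_def pres_mult)
qed

lemma stl_conj_inv:
 assumes "(P, ph) : Ph" "u : P"
 shows "inv \<^sub>pG stl (P, ph) \<cdot>\<^sub>pG j u \<cdot>\<^sub>pG stl (P, ph) = j (ph u)"
 using stl_closed[OF assms(1)] j_closed[OF image_in_S[OF assms]] by (simp add: stl_conj[OF assms, symmetric] pG.gnorm)

text \<open>\<open>T e\<close> is the intended action of the inverse stable letter, and its
  equivariance is precisely the relation for that letter.\<close>

lemma action:
 assumes a0: "!!s z. s : car S ==> z : Z ==> a s z : Z" "!!z. z : Z ==> a \<one>\<^sub>S z = z"
   "!!s t z. s : car S ==> t : car S ==> z : Z ==> a (s \<cdot>\<^sub>S t) z = a s (a t z)"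
  and T: "!!e. e : Ph ==> bij_betw (T e) Z Z"
   "!!P ph u z. (P, ph) : Ph ==> u : P ==> z : Z ==> T (P, ph) (a u z) = a (ph u) (T (P, ph) z)"
 shows "EX act. acts_on pG (car pG) Z act & (ALL s:car S. ALL z:Z. act (j s) z = a s z) &
  (ALL e:Ph. ALL z:Z. act (inv \<^sub>pG stl e) z = T e z)"
proof -
 define f where "f = (%x. case x of Inl s => a s | Inr e => inv_into Z (T e))"
 have acts: "acts_on S (car S) Z a" using a0 by (auto simp: acts_on_def)
 have bij: "bij_betw (f x) Z Z" if "x : X" for x using that S.acts_on_bij[OF acts S.sub_self] bij_betw_inv_into[OF T(1)]
  by (auto simp: f_def leary_stancu_gens_def)
 have inv_f: "inv_into Z (f (Inr e)) z = T e z" if "e : Ph" "z : Z" for e z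
  using bij_betw_inv_into_left[OF T(1)[OF that(1)] that(2)] bij[of "Inr e"] that
   bij_betw_inv_into_left[of "f (Inr e)" Z Z "T e z"] bij_betw_apply[OF T(1)[OF that(1)] that(2)]
  by (auto simp: f_def leary_stancu_gens_def)
 have "EX act. acts_on (presented_group X Rel) (car (presented_group X Rel)) Z act &
  (ALL x:X. ALL z:Z. act (pres_gen X Rel x) z = f x z)"
 proof (rule presented_group_action[OF bij])
  fix r s z assume rs: "(r, s) : Rel" and z: "z : Z"
  from rs consider (mult) x y where "r = [(Inl x, True), (Inl y, True)]" "s = [(Inl (x \<cdot>\<^sub>S y), True)]"
    "x : car S" "y : car S"
   | (conj) P ph u where "r = [(Inr (P, ph), True), (Inl (ph u), True), (Inr (P, ph), False)]"
    "s = [(Inl u, True)]" "(P, ph) : Ph" "u : P" unfolding leary_stancu_rels_def by blast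
  thus "word_action Z f r z = word_action Z f s z"
  proof cases
   case mult
   thus ?thesis using a0 z by (simp add: f_def)
  next
   case conj
   have "a u z : Z" using a0(1) domain_in_S conj z by blast
   hence "inv_into Z (T (P, ph)) (a (ph u) (T (P, ph) z)) = a u z"
    using T(2)[OF conj(3,4) z] bij_betw_inv_into_left[OF T(1)[OF conj(3)]] by metis
   thus ?thesis using conj inv_f[OF conj(3) z] by (simp add: f_def)
  qed
 qed
 then obtain act where act: "acts_on pG (car pG) Z act"
  "!!x z. x : X ==> z : Z ==> act (pres_gen X Rel x) z = f x z" unfolding leary_stancu_group_def by blast
 have "act (j s) z = a s z" if "s : car S" "z : Z" for s z
  using act(2)[of "Inl s" z] that by (auto simp: f_def leary_stancu_gens_def leary_stancu_incl_def)
 moreover have "act (inv \<^sub>pG stl e) z = T e z" if e: "e : Ph" and z: "z : Z" for e z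
 proof -
  have Tz: "T e z : Z" using bij_betw_apply[OF T(1)[OF e] z] .
  have "act (stl e) (T e z) = z" using act(2)[of "Inr e" "T e z"] e z Tz bij_betw_inv_into_left[OF T(1)[OF e] z]
   by (auto simp: f_def leary_stancu_gens_def stl_def)
  moreover have "act (inv \<^sub>pG stl e) (act (stl e) (T e z)) = T e z"
   using act(1) Tz stl_closed[OF e] unfolding acts_on_def by (metis pG.inv_closed pG.l_inv)
  ultimately show ?thesis by simp
 qed
 ultimately show ?thesis using act(1) by blast
qed

text \<open>\<open>S\<close> acts on \<open>car S \<times> UNIV\<close> by translation. Twisting
  this action of \<open>P\<close> by \<open>\<phi>\<close> gives an isomorphic free
  \<open>P\<close>-set, so stable letters can act as well, and an element of \<open>S\<close> is
  recovered from its effect on the point with coordinates 1 and 0.\<close>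

lemma j_inj: "inj_on j (car S)"
proof -
 let ?Z = "car S \<times> (UNIV :: nat set)"
 let ?a = "%s z. (s \<cdot>\<^sub>S fst z, snd z)"
 have "ALL e:Ph. EX T. bij_betw T ?Z ?Z &
  (ALL u:fst e. ALL x:car S. ALL n. T (u \<cdot>\<^sub>S x, n) = ?a (snd e u) (T (x, n)))"
 proof
  fix e assume "e : Ph"
  hence e: "(fst e, snd e) : Ph" by simp
  show "EX T. bij_betw T ?Z ?Z &
    (ALL u:fst e. ALL x:car S. ALL n. T (u \<cdot>\<^sub>S x, n) = ?a (snd e u) (T (x, n)))"
   by (rule free_actions_isomorphic[OF S.is_group finite_S S.is_group finite_S domain[OF e] morphism[OF e]])
 qed
 from bchoice[OF this] obtain T where T: "ALL e:Ph. bij_betw (T e) ?Z ?Z &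
  (ALL u:fst e. ALL x:car S. ALL n. T e (u \<cdot>\<^sub>S x, n) = ?a (snd e u) (T e (x, n)))" ..
 have "EX act. acts_on pG (car pG) ?Z act & (ALL s:car S. ALL z:?Z. act (j s) z = ?a s z) &
   (ALL e:Ph. ALL z:?Z. act (inv \<^sub>pG stl e) z = T e z)"
 proof (rule action)
  fix P ph u z assume "(P, ph) : Ph" "u : P" "z : ?Z"
  thus "T (P, ph) (?a u z) = ?a (ph u) (T (P, ph) z)" using T by (cases z) fastforce
 qed (use T in \<open>auto simp: S.m_assoc\<close>)
 then obtain act where act: "!!s z. s : car S ==> z : ?Z ==> act (j s) z = ?a s z" by blast
 show ?thesis
 proof (rule inj_onI)
  fix x y assume xy: "x : car S" "y : car S" "j x = j y"
  have "act (j x) (\<one>\<^sub>S, 0) = (x, 0)" "act (j y) (\<one>\<^sub>S, 0) = (y, 0)"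
   using act[OF xy(1), of "(\<one>\<^sub>S, 0)"] act[OF xy(2), of "(\<one>\<^sub>S, 0)"] xy(1,2) by auto
  thus "x = y" using xy(3) by (metis Pair_inject)
 qed
qed

lemma j_mon: "j : mon S pG" using j_hom j_inj by (simp add: mon_def)

sublocale jh: group_hom S pG j by unfold_locales (rule j_hom)

sublocale tree: graph_group pG "j ` car S" Ph "%e. j ` fst e" "%e. j ` car S"
 "%e. inv \<^sub>pG stl e" Ph
proof (intro graph_group.intro graph_group_axioms.intro, goal_cases)
 case 1
 show ?case by (rule pG.is_group)
next
 case 2
 show ?case by (rule jh.img_is_subgroup)
next
 case (3 e)
 thus ?case using jh.subgroup_img_is_subgroup[OF domain[of "fst e" "snd e"]] by simp
next
 case (4 e)
 thus ?case using domain_in_S[of "fst e" "snd e"] by auto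
next
 case (5 e)
 show ?case by (rule jh.img_is_subgroup)
next
 case (6 e)
 thus ?case using stl_closed by simp
next
 case (7 e x)
 hence P: "(fst e, snd e) : Ph" by simp
 show ?case using 7(2) stl_conj_inv[OF P] image_in_S[OF P] stl_closed[OF 7(1)] by auto
next
 case (8 e)
 show ?case ..
next
 case (9 X')
 note X' = 9(1,2,4)
 show "car pG <= X'" unfolding leary_stancu_group_def
 proof (rule presented_group_generated)
  show "sgp X' (presented_group X Rel)" using X'(1) by (simp add: leary_stancu_group_def)
  fix x assume x: "x : X"
  show "pres_gen X Rel x : X'"
  proof (cases x)
   case (Inl s)
   thus ?thesis using x X'(2) by (auto simp: leary_stancu_gens_def leary_stancu_incl_def)
  next
   case (Inr e)
   hence e: "e : Ph" using x by (auto simp: leary_stancu_gens_def)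
   have "inv \<^sub>pG (inv \<^sub>pG stl e) : X'" using X'(1) X'(3)[OF e e] by (rule sub_inv)
   thus ?thesis using Inr stl_closed[OF e] by (simp add: stl_def)
  qed
 qed
qed

lemma universal_actions:
 "universal pG (j ` car S) Ph (%e. j ` fst e) (%e. j ` car S) (%e. inv \<^sub>pG stl e) Ph TYPE('z)" unfolding universal_def
proof (intro allI impI)
 fix Z0 :: "'z set" and Z a0 a T
 assume asm: "acts_on pG (j ` car S) Z0 a0 & (ALL e:Ph. acts_on pG (j ` car S) (Z e) (a e) &
  bij_betw (T e) Z0 (Z e) &
  (ALL x:j ` fst e. ALL z:Z0. T e (a0 x z) =
   a e (inv \<^sub>pG stl e \<cdot>\<^sub>pG x \<cdot>\<^sub>pG inv \<^sub>pG (inv \<^sub>pG stl e)) (T e z)) &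
  (e : Ph --> Z e = Z0 & (ALL x:j ` car S. ALL z:Z0. a e x z = a0 x z)))"
 have a0: "acts_on pG (j ` car S) Z0 a0" using asm by blast
 have T: "bij_betw (T e) Z0 Z0" if "e : Ph" for e using asm that by metis
 have Ta: "T (P, ph) (a0 (j u) z) = a0 (j (ph u)) (T (P, ph) z)" if e: "(P, ph) : Ph" and u: "u : P" and z: "z : Z0" for P ph u z
 proof -
  have "T (P, ph) (a0 (j u) z) = a (P, ph) (j (ph u)) (T (P, ph) z)"
   using asm e u z stl_conj_inv[OF e u] stl_closed[OF e] by fastforce
  also have "... = a0 (j (ph u)) (T (P, ph) z)" using asm e image_in_S[OF e u] bij_betw_apply[OF T[OF e] z] by blast
  finally show ?thesis .
 qed
 have "EX act. acts_on pG (car pG) Z0 act & (ALL s:car S. ALL z:Z0. act (j s) z = a0 (j s) z) &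
  (ALL e:Ph. ALL z:Z0. act (inv \<^sub>pG stl e) z = T e z)"
  by (rule action[where a = "%s. a0 (j s)"]) (use a0 T Ta jh.hom_one in \<open>auto simp: acts_on_def j_mult\<close>)
 then obtain act where act: "acts_on pG (car pG) Z0 act"
  "!!s z. s : car S ==> z : Z0 ==> act (j s) z = a0 (j s) z"
  "!!e z. e : Ph ==> z : Z0 ==> act (inv \<^sub>pG stl e) z = T e z" by blast
 have "T e (act (inv \<^sub>pG (inv \<^sub>pG stl e) \<cdot>\<^sub>pG x \<cdot>\<^sub>pG inv \<^sub>pG stl e) z) = a e x (T e z)"
  if e: "e : Ph" and x: "x : j ` car S" and z: "z : Z0" for e x z
 proof -
  let ?t = "stl e"
  let ?y = "inv \<^sub>pG (inv \<^sub>pG ?t) \<cdot>\<^sub>pG x \<cdot>\<^sub>pG inv \<^sub>pG ?t"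
  have c: "?t : car pG" "x : car pG" using stl_closed[OF e] x j_closed by auto
  have mult: "act (g \<cdot>\<^sub>pG h) y = act g (act h y)" "act g y : Z0" if "g : car pG" "h : car pG" "y : Z0" for g h y
   using act(1) that by (auto simp: acts_on_def)
  have yz: "act ?y z : Z0" using mult(2)[of ?y ?y z] c z by simp
  have "T e (act ?y z) = act (inv \<^sub>pG ?t \<cdot>\<^sub>pG ?y) z"
   using act(3)[OF e yz] mult(1)[of "inv \<^sub>pG ?t" ?y z] c z by simp
  also have "inv \<^sub>pG ?t \<cdot>\<^sub>pG ?y = x \<cdot>\<^sub>pG inv \<^sub>pG ?t" using c by (simp add: pG.gnorm)
  also have "act (x \<cdot>\<^sub>pG inv \<^sub>pG ?t) z = act x (T e z)"
   using act(3)[OF e z] mult(1)[of x "inv \<^sub>pG ?t" z] c z by simp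
  also have "... = a e x (T e z)" using act(2) x asm e bij_betw_apply[OF T[OF e] z] by auto
  finally show ?thesis .
 qed
 thus "EX act. acts_on pG (car pG) Z0 act & (ALL x:j ` car S. ALL z:Z0. act x z = a0 x z) &
   (ALL e:Ph. (ALL x:j ` car S. ALL z:Z0. T e (act (inv \<^sub>pG (inv \<^sub>pG stl e) \<cdot>\<^sub>pG x \<cdot>\<^sub>pG
     inv \<^sub>pG stl e) z) = a e x (T e z)) &
    (e : Ph --> (ALL z:Z0. act (inv \<^sub>pG stl e) z = T e z)))" using act by (intro exI[of _ act]) auto
qed

end

section \<open>Robinson's group\<close>

locale amalgam_data =
 fixes n :: nat and R :: "nat => 'a set" and L :: "nat => 'b monoid" and e :: "nat => 'a => 'b"
  and io :: "nat => 'b => 'b"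
 assumes L_group: "!!i. i <= n ==> group (L i)" and L_finite: "!!i. i <= n ==> finite (car (L i))"
  and edge_subgroup: "!!i. 1 <= i ==> i <= n ==> sgp (edge_group R L e i) (L 0)"
  and io_mon: "!!i. 1 <= i ==> i <= n ==> io i : mon ((L 0)(|carrier := edge_group R L e i|)) (L i)"
begin

abbreviation "X == robinson_gens n L"
abbreviation "Rel == robinson_rels n R L e io"
abbreviation "pG == robinson_group n R L e io"
abbreviation "edge i == edge_group R L e i"

definition vert :: "nat => 'b => (nat \<times> 'b) word set" where
 "vert i x = pres_gen X Rel (i, x)"

sublocale pG: group pG unfolding robinson_group_def by (rule group_presented_group)

lemma vert_closed: "i <= n ==> x : car (L i) ==> vert i x : car pG"
 unfolding vert_def robinson_group_def by (rule pres_gen_closed) (auto simp: robinson_gens_def)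

lemma vert_mult:
 assumes "i <= n" "x : car (L i)" "y : car (L i)"
 shows "vert i (x \<cdot>\<^sub>(L i) y) = vert i x \<cdot>\<^sub>pG vert i y"
proof -
 have "x \<cdot>\<^sub>(L i) y : car (L i)" using group.is_monoid[OF L_group[OF assms(1)]] assms by (simp add: monoid.m_closed)
 hence X: "(i, x) : X" "(i, y) : X" "(i, x \<cdot>\<^sub>(L i) y) : X" using assms by (auto simp: robinson_gens_def)
 have "([((i, x), True), ((i, y), True)], [((i, x \<cdot>\<^sub>(L i) y), True)]) : Rel"
  using assms by (auto simp: robinson_rels_def)
 from presented_group_rel[OF this] X show ?thesis by (simp add: vert_def robinson_group_def pres_gen_def pres_mult)
qed

lemma edge_in: "1 <= i ==> i <= n ==> x : edge i ==> x : car (L 0) & io i x : car (L i)"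
 using edge_subgroup io_mon by (fastforce simp: mon_def hom_def dest: sub_mem)

lemma vert_edge:
 assumes "1 <= i" "i <= n" "x : edge i"
 shows "vert i (io i x) = vert 0 x"
proof -
 have X: "(0, x) : X" "(i, io i x) : X" using edge_in[OF assms] assms by (auto simp: robinson_gens_def)
 have "([((0, x), True)], [((i, io i x), True)]) : Rel" using assms by (auto simp: robinson_rels_def)
 from presented_group_rel[OF this] X show ?thesis by (simp add: vert_def pres_gen_def)
qed

lemma vert_hom: "i <= n ==> vert i : hom (L i) pG" by (rule homI) (auto simp: vert_closed vert_mult)

lemma vert_group_hom: "i <= n ==> group_hom (L i) pG (vert i)"
 using L_group vert_hom by (simp add: group_hom_def group_hom_axioms_def)

text \<open>The action of \<open>L i\<close> on \<open>Z i\<close> is pulled back to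
  \<open>Z 0\<close> along \<open>T i\<close>. Equivariance of \<open>T i\<close> says that the
  actions of \<open>L 0\<close> and \<open>L i\<close> then agree on the edge group, which is the
  amalgamation relation.\<close>

lemma action:
 assumes a: "!!i. i <= n ==> acts_on (L i) (car (L i)) (Z i) (a i)"
  and T: "!!i. 1 <= i ==> i <= n ==> bij_betw (T i) (Z 0) (Z i)"
   "!!i x z. 1 <= i ==> i <= n ==> x : edge i ==> z : Z 0 ==> T i (a 0 x z) = a i (io i x) (T i z)"
 shows "EX act. acts_on pG (car pG) (Z 0) act & (ALL x:car (L 0). ALL z:Z 0. act (vert 0 x) z = a 0 x z) &
  (ALL i x z. 1 <= i & i <= n & x : car (L i) & z : Z 0 --> T i (act (vert i x) z) = a i x (T i z))"
proof -
 define T' where "T' = (%i. if i = 0 then (%z. z) else T i)"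
 have T': "bij_betw (T' i) (Z 0) (Z i)" if "i <= n" for i
  using T(1)[of i] that by (cases i) (auto simp: T'_def bij_betw_def)
 define f where "f = (%(i, x) z. inv_into (Z 0) (T' i) (a i x (T' i z)))"
 have T'_inv: "inv_into (Z 0) (T' i) (T' i z) = z" if "i <= n" "z : Z 0" for i z
  using bij_betw_inv_into_left[OF T'[OF that(1)] that(2)] .
 have T'_f: "T' i (f (i, x) z) = a i x (T' i z)" "f (i, x) z : Z 0" if "i <= n" "x : car (L i)" "z : Z 0" for i x z
 proof -
  have "a i x (T' i z) : Z i" using a[OF that(1)] that bij_betw_apply[OF T'[OF that(1)]] by (auto simp: acts_on_def)
  thus "T' i (f (i, x) z) = a i x (T' i z)" "f (i, x) z : Z 0"
   using bij_betw_inv_into_right[OF T'[OF that(1)]] bij_betw_apply[OF bij_betw_inv_into[OF T'[OF that(1)]]]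
   by (auto simp: f_def)
 qed
 have bij: "bij_betw (f q) (Z 0) (Z 0)" if "q : X" for q
 proof -
  obtain i x where q: "q = (i, x)" "i <= n" "x : car (L i)" using \<open>q : X\<close> by (auto simp: robinson_gens_def)
  have "bij_betw (a i x) (Z i) (Z i)"
   using group.acts_on_bij[OF L_group[OF q(2)] a[OF q(2)] group.sub_self[OF L_group[OF q(2)]] q(3)] .
  from bij_betw_trans[OF bij_betw_trans[OF T'[OF q(2)] this] bij_betw_inv_into[OF T'[OF q(2)]]]
  show ?thesis by (simp add: q f_def comp_def)
 qed
 have "EX act. acts_on (presented_group X Rel) (car (presented_group X Rel)) (Z 0) act &
  (ALL x:X. ALL z:Z 0. act (pres_gen X Rel x) z = f x z)"
 proof (rule presented_group_action[OF bij])
  fix r s z assume rs: "(r, s) : Rel" and z: "z : Z 0"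
  from rs consider (mult) i x y where "r = [((i, x), True), ((i, y), True)]" "s = [((i, x \<cdot>\<^sub>(L i) y), True)]"
    "i <= n" "x : car (L i)" "y : car (L i)"
   | (amalg) i x where "r = [((0, x), True)]" "s = [((i, io i x), True)]" "1 <= i" "i <= n" "x : edge i"
   unfolding robinson_rels_def by blast
  thus "word_action (Z 0) f r z = word_action (Z 0) f s z"
  proof cases
   case mult
   have "a i (x \<cdot>\<^sub>(L i) y) (T' i z) = a i x (a i y (T' i z))"
    using a[OF mult(3)] mult bij_betw_apply[OF T'[OF mult(3)] z] by (auto simp: acts_on_def)
   thus ?thesis using mult T'_f(1)[OF mult(3,5) z] by (simp add: f_def)
  next
   case amalg
   have "a 0 x z : Z 0" using a[of 0] edge_in[OF amalg(3-5)] z by (auto simp: acts_on_def)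
   moreover have "T' i (a 0 x z) = a i (io i x) (T' i z)" using T(2)[OF amalg(3-5) z] amalg by (simp add: T'_def)
   ultimately have "inv_into (Z 0) (T' i) (a i (io i x) (T' i z)) = a 0 x z" using T'_inv[OF amalg(4)] by metis
   moreover have "f (0, x) z = a 0 x z"
    using T'_inv[of 0 "a 0 x z"] \<open>a 0 x z : Z 0\<close> by (simp add: f_def T'_def)
   ultimately show ?thesis using amalg by (simp add: f_def)
  qed
 qed
 then obtain act where act: "acts_on pG (car pG) (Z 0) act"
  "!!x z. x : X ==> z : Z 0 ==> act (pres_gen X Rel x) z = f x z" unfolding robinson_group_def by blast
 have act_vert: "act (vert i x) z = f (i, x) z" if "i <= n" "x : car (L i)" "z : Z 0" for i x z
  using act(2)[of "(i, x)" z] that by (simp add: robinson_gens_def vert_def)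
 have "act (vert 0 x) z = a 0 x z" if "x : car (L 0)" "z : Z 0" for x z
  using act_vert[of 0 x z] T'_f(1)[of 0 x z] that by (simp add: T'_def)
 moreover have "T i (act (vert i x) z) = a i x (T i z)" if "1 <= i" "i <= n" "x : car (L i)" "z : Z 0" for i x z
  using act_vert[of i x z] T'_f(1)[of i x z] that by (simp add: T'_def)
 ultimately show ?thesis using act(1) by blast
qed

text \<open>The amalgam acts on \<open>car (L 0) \<times> UNIV\<close> in such a way that, viewed
  through \<open>T i\<close>, the elements of \<open>L i\<close> act as translations of
  \<open>L i\<close>, hence faithfully.\<close>

lemma vert_inj:
 assumes i: "i <= n"
 shows "inj_on (vert i) (car (L i))"
proof -
 have "ALL k:{1..n}. EX T. bij_betw T (car (L 0) \<times> (UNIV :: nat set)) (car (L k) \<times> (UNIV :: nat set)) &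
  (ALL u:edge k. ALL x:car (L 0). ALL m. T (u \<cdot>\<^sub>(L 0) x, m) = (io k u \<cdot>\<^bsub>L k\<^esub> fst (T (x, m)), snd (T (x, m))))"
  by (intro ballI free_actions_isomorphic L_group L_finite edge_subgroup io_mon) auto
 from bchoice[OF this] obtain T where "ALL k:{1..n}.
  bij_betw (T k) (car (L 0) \<times> (UNIV :: nat set)) (car (L k) \<times> (UNIV :: nat set)) &
  (ALL u:edge k. ALL x:car (L 0). ALL m.
   T k (u \<cdot>\<^sub>(L 0) x, m) = (io k u \<cdot>\<^bsub>L k\<^esub> fst (T k (x, m)), snd (T k (x, m))))" ..
 hence T: "!!k. 1 <= k ==> k <= n ==>
   bij_betw (T k) (car (L 0) \<times> (UNIV :: nat set)) (car (L k) \<times> UNIV)"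
  "!!k u x m. 1 <= k ==> k <= n ==> u : edge k ==> x : car (L 0) ==>
   T k (u \<cdot>\<^sub>(L 0) x, m) = (io k u \<cdot>\<^bsub>L k\<^esub> fst (T k (x, m)), snd (T k (x, m)))" by auto
 define Z where "Z = (%k. car (L k) \<times> (UNIV :: nat set))"
 define a where "a = (%k x (z :: 'b \<times> nat). (x \<cdot>\<^bsub>L k\<^esub> fst z, snd z))"
 have "acts_on (L k) (car (L k)) (Z k) (a k)" if "k <= n" for k
 proof -
  interpret group "L k" using L_group[OF that] .
  show ?thesis by (auto simp: acts_on_def Z_def a_def m_assoc)
 qed
 moreover have "bij_betw (T k) (Z 0) (Z k)" if "1 <= k" "k <= n" for k using T(1)[OF that] by (simp add: Z_def)
 moreover have "T k (a 0 x z) = a k (io k x) (T k z)" if "1 <= k" "k <= n" "x : edge k" "z : Z 0" for k x z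
  using T(2)[OF that(1-3), of "fst z" "snd z"] that(4) by (auto simp: a_def Z_def)
 ultimately obtain act where act: "!!x z. x : car (L 0) ==> z : Z 0 ==> act (vert 0 x) z = a 0 x z"
  "!!k x z. 1 <= k ==> k <= n ==> x : car (L k) ==> z : Z 0 ==> T k (act (vert k x) z) = a k x (T k z)"
  using action[of Z a T] by blast
 interpret Li: group "L i" using L_group[OF i] .
 show ?thesis
 proof (rule inj_onI)
  fix x y assume xy: "x : car (L i)" "y : car (L i)" "vert i x = vert i y"
  show "x = y"
  proof (cases "i = 0")
   case True
   have "act (vert i z) (\<one>\<^sub>(L i), 0) = (z, 0)" if "z : car (L i)" for z
   proof -
    have "act (vert 0 z) (\<one>\<^sub>(L i), 0) = a 0 z (\<one>\<^sub>(L i), 0)"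
     by (rule act(1)) (use that Li.one_closed True in \<open>auto simp: Z_def\<close>)
    thus ?thesis using Li.r_one[OF that] by (simp add: a_def True)
   qed
   from this[OF xy(1)] this[OF xy(2)] show ?thesis using xy(3) by (metis Pair_inject)
  next
   case False
   hence i': "1 <= i" by simp
   have "(\<one>\<^sub>(L i), 0) : T i ` Z 0" using bij_betw_imp_surj_on[OF T(1)[OF i' i]] by (simp add: Z_def)
   then obtain z where z: "z : Z 0" "T i z = (\<one>\<^sub>(L i), 0)" by (metis imageE)
   have "T i (act (vert i x) z) = (x, 0)" "T i (act (vert i y) z) = (y, 0)"
    using act(2)[OF i' i xy(1) z(1)] act(2)[OF i' i xy(2) z(1)] z(2) xy(1,2) by (simp_all add: a_def)
   thus ?thesis using xy(3) by (metis Pair_inject)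
  qed
 qed
qed

sublocale tree: graph_group pG "vert 0 ` car (L 0)" "{1..n}" "%i. vert 0 ` edge i" "%i. vert i ` car (L i)"
 "%i. \<one>\<^sub>pG" "{}"
proof (intro graph_group.intro graph_group_axioms.intro, goal_cases)
 case 1
 show ?case by (rule pG.is_group)
next
 case 2
 show ?case by (rule group_hom.img_is_subgroup[OF vert_group_hom]) simp
next
 case (3 i)
 thus ?case by (intro group_hom.subgroup_img_is_subgroup[OF vert_group_hom edge_subgroup]) auto
next
 case (4 i)
 thus ?case using edge_in by auto
next
 case (5 i)
 thus ?case by (intro group_hom.img_is_subgroup[OF vert_group_hom]) simp
next
 case (6 i)
 show ?case by simp
next
 case (7 i x)
 then obtain y where i: "1 <= i" "i <= n" and y: "y : edge i" "x = vert 0 y" by auto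
 hence "x : car pG" "x = vert i (io i y)" using vert_edge[OF i y(1)] edge_in[OF i y(1)] vert_closed[of 0 y] by auto
 thus ?case using edge_in[OF i y(1)] by simp
next
 case (8 i)
 thus ?case by simp
next
 case (9 X')
 note X' = 9(1-3)
 show "car pG <= X'" unfolding robinson_group_def
 proof (rule presented_group_generated)
  show "sgp X' (presented_group X Rel)" using X'(1) by (simp add: robinson_group_def)
  fix q assume "q : X"
  then obtain i x where q: "q = (i, x)" "i <= n" "x : car (L i)" by (auto simp: robinson_gens_def)
  have "vert i x : X'"
  proof (cases "i = 0")
   case False
   thus ?thesis using X'(3)[of i "vert i x"] q vert_closed[OF q(2,3)] by simp
  qed (use X'(2) q in auto)
  thus "pres_gen X Rel q : X'" by (simp add: q vert_def)
 qed
qed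

lemma universal_actions:
 "universal pG (vert 0 ` car (L 0)) {1..n} (%i. vert 0 ` edge i) (%i. vert i ` car (L i))
  (%i. \<one>\<^sub>pG) {} TYPE('z)" unfolding universal_def
proof (intro allI impI)
 fix Z0 :: "'z set" and Z a0 a T
 assume asm: "acts_on pG (vert 0 ` car (L 0)) Z0 a0 &
  (ALL i:{1..n}. acts_on pG (vert i ` car (L i)) (Z i) (a i) & bij_betw (T i) Z0 (Z i) &
   (ALL x:vert 0 ` edge i. ALL z:Z0. T i (a0 x z) = a i (\<one>\<^sub>pG \<cdot>\<^sub>pG x \<cdot>\<^sub>pG inv \<^sub>pG \<one>\<^sub>pG) (T i z)) &
   (i : {} --> Z i = Z0 & (ALL x:vert 0 ` car (L 0). ALL z:Z0. a i x z = a0 x z)))"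
 define Z' where "Z' = (%i. if i = 0 then Z0 else Z i)"
 define a' where "a' = (%i x. (if i = 0 then a0 else a i) (vert i x))"
 have "acts_on (L i) (car (L i)) (Z' i) (a' i)" if i: "i <= n" for i
 proof -
  have *: "acts_on pG (vert i ` car (L i)) (Z' i) (if i = 0 then a0 else a i)"
   using asm i by (cases "i = 0") (auto simp: Z'_def)
  show ?thesis using * group_hom.hom_one[OF vert_group_hom[OF i]] vert_mult[OF i] by (auto simp: acts_on_def a'_def)
 qed
 moreover have "bij_betw (T i) (Z' 0) (Z' i)" if "1 <= i" "i <= n" for i using asm that by (auto simp: Z'_def)
 moreover have "T i (a' 0 x z) = a' i (io i x) (T i z)" if "1 <= i" "i <= n" "x : edge i" "z : Z' 0" for i x z
 proof -
  have "vert 0 x : car pG" using edge_in[OF that(1-3)] vert_closed by simp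
  thus ?thesis using asm that vert_edge[OF that(1-3)] by (auto simp: Z'_def a'_def)
 qed
 ultimately obtain act where act: "acts_on pG (car pG) (Z' 0) act"
  "!!x z. x : car (L 0) ==> z : Z' 0 ==> act (vert 0 x) z = a' 0 x z"
  "!!i x z. 1 <= i ==> i <= n ==> x : car (L i) ==> z : Z' 0 ==> T i (act (vert i x) z) = a' i x (T i z)"
  using action[of Z' a' T] by blast
 have "T i (act (inv \<^sub>pG \<one>\<^sub>pG \<cdot>\<^sub>pG x \<cdot>\<^sub>pG \<one>\<^sub>pG) z) = a i x (T i z)"
  if "i : {1..n}" "x : vert i ` car (L i)" "z : Z0" for i x z
 proof -
  have "x : car pG" using that vert_closed by auto
  thus ?thesis using act(3)[of i _ z] that by (auto simp: Z'_def a'_def)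
 qed
 thus "EX act. acts_on pG (car pG) Z0 act & (ALL x:vert 0 ` car (L 0). ALL z:Z0. act x z = a0 x z) &
   (ALL i:{1..n}. (ALL x:vert i ` car (L i). ALL z:Z0.
     T i (act (inv \<^sub>pG \<one>\<^sub>pG \<cdot>\<^sub>pG x \<cdot>\<^sub>pG \<one>\<^sub>pG) z) = a i x (T i z)) &
    (i : {} --> (ALL z:Z0. act \<one>\<^sub>pG z = T i z)))"
  using act(1,2) by (intro exI[of _ act]) (auto simp: Z'_def a'_def)
qed

end

section \<open>Fusion systems\<close>

locale fusion = group S for S :: "'a monoid" (structure) +
 fixes F :: "'a fusion"
 assumes fusion_system: "fusion_system S F"
begin

lemma sub_car: "sgp P S ==> x : P ==> x : car S" by (rule sub_mem)

lemma trp_iff': "sgp P S ==> g : trp S P Q <-> g : car S & (ALL x:P. g |> x : Q)" by (intro trp_iff sub_le)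

lemma one_trp: "sgp P S ==> P <= Q ==> \<one> : trp S P Q" by (auto simp: trp_iff' sub_car)

lemma self_transporter: "sgp P S ==> g : P ==> g : trp S P P" by (simp add: trp_iff' sub_car sub_mult sub_inv)

lemma F_mon:
 assumes "sgp P S" "sgp Q S" "ph : F P Q"
 shows "ph : mon (S(|carrier := P|)) (S(|carrier := Q|))" "ph : extensional P"
 using fusion_system assms unfolding fusion_system_def by blast+

lemma F_conj: "sgp P S ==> sgp Q S ==> g : trp S P Q ==> conj_map S P g : F P Q"
 using fusion_system unfolding fusion_system_def by blast

lemma F_comp: "sgp P S ==> sgp Q S ==> sgp R S ==> ph : F P Q ==> ps : F Q R ==>
  compose P ps ph : F P R" using fusion_system unfolding fusion_system_def by blast

lemma F_factor:
 assumes "sgp P S" "sgp Q S" "ph : F P Q"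
 obtains R al where "sgp R S" "R <= Q" "al : fusion_iso F P R" "ph = compose P (\<lambda>x\<in>R. x) al"
 using fusion_system assms unfolding fusion_system_def by blast

lemma F_in:
 assumes "sgp P S" "sgp Q S" "ph : F P Q" "x : P"
 shows "ph x : Q" using F_mon(1)[OF assms(1-3)] assms(4) by (auto simp: mon_def hom_def)

lemma F_mult:
 assumes "sgp P S" "sgp Q S" "ph : F P Q" "x : P" "y : P"
 shows "ph (x \<cdot> y) = ph x \<cdot> ph y" using F_mon(1)[OF assms(1-3)] assms(4,5) by (auto simp: mon_def hom_def)

lemma F_inj:
 assumes "sgp P S" "sgp Q S" "ph : F P Q"
 shows "inj_on ph P" using F_mon(1)[OF assms(1-3)] by (simp add: mon_def)

lemma F_group_hom:
 assumes "sgp P S" "sgp Q S" "ph : F P Q"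
 shows "group_hom (S(|carrier := P|)) S ph"
 using F_in[OF assms] F_mult[OF assms] subgroup_imp_group[OF assms(1)] sub_car[OF assms(2)]
 by (auto simp: group_hom_def group_hom_axioms_def hom_def)

lemma F_inv:
 assumes "sgp P S" "sgp Q S" "ph : F P Q" "x : P"
 shows "ph (inv x) = inv (ph x)" using group_hom.hom_inv[OF F_group_hom[OF assms(1-3)], of x] assms by simp

lemma F_one:
 assumes "sgp P S" "sgp Q S" "ph : F P Q"
 shows "ph \<one> = \<one>" using group_hom.hom_one[OF F_group_hom[OF assms]] by simp

lemma F_image:
 assumes "sgp P S" "sgp Q S" "ph : F P Q" "sgp K S" "K <= P"
 shows "sgp (ph ` K) S"
 by (rule group_hom.subgroup_img_is_subgroup[OF F_group_hom[OF assms(1-3)] subgroup_incl[OF assms(4,1,5)]])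

lemma F_incl:
 assumes "sgp P S" "sgp Q S" "P <= Q"
 shows "(\<lambda>x\<in>P. x) : F P Q"
proof -
 have "conj_map S P \<one> = (\<lambda>x\<in>P. x)" using sub_car[OF assms(1)] by (auto simp: conj_map_def)
 thus ?thesis using F_conj[OF assms(1,2) one_trp[OF assms(1,3)]] by simp
qed

lemma F_restrict:
 assumes "sgp P S" "sgp Q S" "ph : F P Q" "sgp K S" "K <= P"
 shows "restrict ph K : F K Q"
proof -
 have "compose K ph (\<lambda>x\<in>K. x) = restrict ph K" by (auto simp: compose_def)
 thus ?thesis using F_comp[OF assms(4,1,2) F_incl[OF assms(4,1,5)] assms(3)] by simp
qed

lemma fusion_iso_inverse:
 assumes "al : fusion_iso F P Q"
 shows "EX bt:fusion_iso F Q P. (ALL x:P. bt (al x) = x) & (ALL y:Q. al (bt y) = y)"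
proof -
 obtain bt where bt: "al : F P Q" "bt : F Q P" "compose P bt al = (\<lambda>x\<in>P. x)" "compose Q al bt = (\<lambda>y\<in>Q. y)"
  using assms by (auto simp: fusion_iso_def)
 have "bt (al x) = x" if "x : P" for x using fun_cong[OF bt(3), of x] that by (simp add: compose_def)
 moreover have "al (bt y) = y" if "y : Q" for y using fun_cong[OF bt(4), of y] that by (simp add: compose_def)
 moreover have "bt : fusion_iso F Q P" unfolding fusion_iso_def using bt by blast
 ultimately show ?thesis by blast
qed

lemma fusion_iso_image:
 assumes "sgp P S" "sgp Q S" "al : fusion_iso F P Q"
 shows "al ` P = Q"
proof -
 obtain bt where bt: "bt : fusion_iso F Q P" "ALL y:Q. al (bt y) = y" using fusion_iso_inverse[OF assms(3)] by blast
 have "al : F P Q" "bt : F Q P" using assms(3) bt(1) by (auto simp: fusion_iso_def)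
 note F = F_in[OF assms(1,2) this(1)] F_in[OF assms(2,1) this(2)]
 show ?thesis
 proof
  show "al ` P <= Q" using F(1) by blast
  show "Q <= al ` P" using F(2) bt(2) by (metis imageI subsetI)
 qed
qed

text \<open>The subgroup in the factorisation axiom has to be the image, because an isomorphism of
  the fusion system is onto.\<close>

lemma F_image_iso:
 assumes "sgp P S" "sgp Q S" "ph : F P Q"
 shows "ph : fusion_iso F P (ph ` P)"
proof -
 obtain R al where R: "sgp R S" "R <= Q" "al : fusion_iso F P R" "ph = compose P (\<lambda>x\<in>R. x) al"
  using F_factor[OF assms] by blast
 have al: "al : F P R" using R(3) by (simp add: fusion_iso_def)
 have eq: "ph x = al x" if "x : P" for x using R(4) F_in[OF assms(1) R(1) al that] that by (simp add: compose_def)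
 have "ph = al" by (rule extensionalityI[OF F_mon(2)[OF assms] F_mon(2)[OF assms(1) R(1) al] eq])
 thus ?thesis using R(3) fusion_iso_image[OF assms(1) R(1,3)] by simp
qed

lemma F_corestrict:
 assumes "sgp P S" "sgp Q S" "ph : F P Q" "sgp K S" "ph ` P <= K"
 shows "ph : F P K"
proof -
 have im: "sgp (ph ` P) S" using F_image[OF assms(1-3,1)] by simp
 have ph: "ph : F P (ph ` P)" using F_image_iso[OF assms(1-3)] by (simp add: fusion_iso_def)
 have "compose P (\<lambda>x\<in>ph ` P. x) ph = ph"
  using F_mon(2)[OF assms(1-3)] by (intro extensionalityI[of _ P]) (auto simp: compose_def)
 thus ?thesis using F_comp[OF assms(1) im assms(4) ph F_incl[OF im assms(4,5)]] by simp
qed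

lemma F_isoI:
 assumes "sgp P S" "sgp Q S" "ph : F P Q" "ph ` P = Q"
 shows "ph : fusion_iso F P Q" using F_image_iso[OF assms(1-3)] assms(4) by simp

lemma fusion_conjI:
 assumes "sgp P S" "sgp Q S" "ph : F P Q" "sgp K S" "K <= P"
 shows "fusion_conj S F K (ph ` K)"
proof -
 have "restrict ph K : fusion_iso F K (restrict ph K ` K)" by (rule F_image_iso[OF assms(4,2) F_restrict[OF assms]])
 thus ?thesis using F_image[OF assms] assms(4) unfolding fusion_conj_def image_restrict_eq by blast
qed

lemma fusion_conj_sym:
 assumes "fusion_conj S F P Q"
 shows "fusion_conj S F Q P"
proof -
 obtain al where "al : fusion_iso F P Q" using assms unfolding fusion_conj_def by blast
 from fusion_iso_inverse[OF this] have "fusion_iso F Q P ~= {}" by blast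
 thus ?thesis using assms by (simp add: fusion_conj_def)
qed

lemma fusion_conj_trans:
 assumes "fusion_conj S F P Q" "fusion_conj S F Q R"
 shows "fusion_conj S F P R"
proof -
 have sub: "sgp P S" "sgp Q S" "sgp R S" using assms by (auto simp: fusion_conj_def)
 obtain al bt where ab: "al : fusion_iso F P Q" "bt : fusion_iso F Q R" using assms by (auto simp: fusion_conj_def)
 hence F: "compose P bt al : F P R" using F_comp[OF sub] by (simp add: fusion_iso_def)
 have "compose P bt al ` P = R" using fusion_iso_image[OF sub(1,2) ab(1)] fusion_iso_image[OF sub(2,3) ab(2)]
  by (auto simp: compose_def image_iff)
 thus ?thesis using F_isoI[OF sub(1,3) F] sub by (auto simp: fusion_conj_def)
qed

lemma fusion_conj_refl:
 assumes "sgp P S"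
 shows "fusion_conj S F P P"
proof -
 have "(\<lambda>x\<in>P. x) : fusion_iso F P P" by (rule F_isoI[OF assms assms F_incl[OF assms assms subset_refl]]) simp
 thus ?thesis using assms unfolding fusion_conj_def by blast
qed

lemma centric_subgroup: "centric S F P ==> sgp P S" by (simp add: centric_def)

text \<open>The centralizer of a conjugate of \<open>D\<close> lies in that of the corresponding
  conjugate of \<open>P\<close>, which is contained in the latter conjugate.\<close>

lemma centric_overgroup:
 assumes "centric S F P" "sgp D S" "P <= D"
 shows "centric S F D"
proof -
 have P: "sgp P S" using assms centric_subgroup by blast
 have *: "centralizer S Q <= Q" if "fusion_conj S F D Q" for Q
 proof -
  have Q: "sgp Q S" using that by (simp add: fusion_conj_def)
  obtain al where "al : fusion_iso F D Q" using \<open>fusion_conj S F D Q\<close> by (auto simp: fusion_conj_def)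
  hence al: "al : F D Q" by (simp add: fusion_iso_def)
  have im: "al ` P <= Q" using F_in[OF assms(2) Q al] assms(3) by auto
  hence "centralizer S Q <= centralizer S (al ` P)" by (auto simp: centralizer_def)
  also have "... <= al ` P" using fusion_conjI[OF assms(2) Q al P assms(3)] assms(1) by (auto simp: centric_def)
  finally show ?thesis using im by blast
 qed
 thus ?thesis using assms(2) fusion_conj_refl[OF assms(2)] by (auto simp: centric_def)
qed

lemma centreI: "sgp P S ==> z : P ==> (!!x. x : P ==> z \<cdot> x = x \<cdot> z) ==> z : centre S P"
 by (simp add: centre_def centralizer_def sub_mem)

lemma centreD:
 assumes "z : centre S P"
 shows "z : P" "x : P ==> z \<cdot> x = x \<cdot> z" using assms unfolding centre_def centralizer_def by blast+

lemma centre_subgroup: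
 assumes "sgp P S"
 shows "sgp (centre S P) S"
proof (rule subgroupI)
 note c = sub_car[OF assms]
 show "centre S P <= car S" using c centreD(1) by blast
 have "\<one> : centre S P" using assms c by (intro centreI) (simp_all add: sub_one)
 thus "centre S P ~= {}" by blast
 fix a assume a: "a : centre S P"
 note a' = centreD[OF a]
 show "inv a : centre S P"
 proof (rule centreI[OF assms])
  show "inv a : P" using a'(1) assms by (simp add: sub_inv)
  fix x assume x: "x : P"
  have "inv a \<cdot> (a \<cdot> x) \<cdot> inv a = inv a \<cdot> (x \<cdot> a) \<cdot> inv a" using a'(2)[OF x] by simp
  thus "inv a \<cdot> x = x \<cdot> inv a" using c[OF a'(1)] c[OF x] by (simp add: gnorm)
 qed
 fix b assume b: "b : centre S P"
 note b' = centreD[OF b]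
 show "a \<cdot> b : centre S P"
 proof (rule centreI[OF assms])
  show "a \<cdot> b : P" using a'(1) b'(1) assms by (simp add: sub_mult)
  fix x assume x: "x : P"
  have cs: "a : car S" "b : car S" "x : car S" using c a'(1) b'(1) x by auto
  have "a \<cdot> b \<cdot> x = a \<cdot> (b \<cdot> x)" using cs by (simp add: m_assoc)
  also have "... = (a \<cdot> x) \<cdot> b" unfolding b'(2)[OF x] using cs by (simp add: m_assoc)
  also have "... = x \<cdot> (a \<cdot> b)" unfolding a'(2)[OF x] using cs by (simp add: m_assoc)
  finally show "a \<cdot> b \<cdot> x = x \<cdot> (a \<cdot> b)" .
 qed
qed

end

section \<open>Linking systems\<close>

locale linking = fusion S F for S :: "'a monoid" (structure) and F +
 fixes LL :: "('a set, 'm) cat" and pr and dl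
 assumes link: "centric_linking_system S F LL pr dl"
begin

abbreviation "cen == centric S F"
abbreviation "mor == arrs LL"
abbreviation "cmp == composite LL"

lemma cen_sub: "cen P ==> sgp P S" by (rule centric_subgroup)

lemma functors: "id_functor LL (centric_fusion_cat S F) pr" "id_functor (ctc S F) LL dl"
 using link by (simp_all add: centric_linking_system_def)

lemma category: "is_category LL" using functors(1) by (simp add: id_functor_def)

lemma objs_cen: "objs LL = {P. cen P}" using functors(1) by (simp add: id_functor_def centric_fusion_cat_def)

lemma cmp_closed: "cen P ==> cen Q ==> cen R ==> f : mor P Q ==> g : mor Q R ==> cmp P Q R g f : mor P R"
 using category[unfolded is_category_def, THEN conjunct2, THEN conjunct1] by (simp add: objs_cen)

lemma cmp_assoc: "cen P ==> cen Q ==> cen R ==> cen T ==> f : mor P Q ==> g : mor Q R ==> h : mor R T ==>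
  cmp P R T h (cmp P Q R g f) = cmp P Q T (cmp Q R T h g) f"
 using category[unfolded is_category_def, THEN conjunct2, THEN conjunct2, THEN conjunct2] by (simp add: objs_cen)

lemma ident_closed: "cen P ==> ident LL P : mor P P"
 using category[unfolded is_category_def, THEN conjunct1] by (simp add: objs_cen)

lemma cmp_ident:
 assumes "cen P" "cen Q" "f : mor P Q"
 shows "cmp P P Q f (ident LL P) = f" "cmp P Q Q (ident LL Q) f = f"
 using category[unfolded is_category_def, THEN conjunct2, THEN conjunct2, THEN conjunct1] assms by (simp_all add: objs_cen)

lemma pr_closed: "cen P ==> cen Q ==> f : mor P Q ==> pr P Q f : F P Q"
 using functors(1)[unfolded id_functor_def, THEN conjunct2, THEN conjunct2, THEN conjunct2, THEN conjunct1]
 by (simp add: objs_cen centric_fusion_cat_def image_subset_iff)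

lemma pr_ident: "cen P ==> pr P P (ident LL P) = (\<lambda>x\<in>P. x)"
 using functors(1)[unfolded id_functor_def, THEN conjunct2, THEN conjunct2, THEN conjunct2, THEN conjunct2, THEN conjunct1]
 by (simp add: objs_cen centric_fusion_cat_def)

lemma pr_cmp:
 "cen P ==> cen Q ==> cen R ==> f : mor P Q ==> g : mor Q R ==>
  pr P R (cmp P Q R g f) = compose P (pr Q R g) (pr P Q f)"
 using functors(1)[unfolded id_functor_def, THEN conjunct2, THEN conjunct2, THEN conjunct2, THEN conjunct2, THEN conjunct2]
 by (simp add: objs_cen centric_fusion_cat_def)

lemma pr_cmp_apply:
 "cen P ==> cen Q ==> cen R ==> f : mor P Q ==> g : mor Q R ==> x : P ==>
  pr P R (cmp P Q R g f) x = pr Q R g (pr P Q f x)" by (simp add: pr_cmp compose_def)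

lemma dl_closed: "cen P ==> cen Q ==> g : trp S P Q ==> dl P Q g : mor P Q"
 using functors(2)[unfolded id_functor_def, THEN conjunct2, THEN conjunct2, THEN conjunct2, THEN conjunct1]
 by (simp add: ctc_def image_subset_iff)

lemma dl_one: "cen P ==> dl P P \<one> = ident LL P"
 using functors(2)[unfolded id_functor_def, THEN conjunct2, THEN conjunct2, THEN conjunct2, THEN conjunct2, THEN conjunct1]
 by (simp add: ctc_def)

lemma dl_cmp:
 "cen P ==> cen Q ==> cen R ==> g : trp S P Q ==> h : trp S Q R ==>
  cmp P Q R (dl Q R h) (dl P Q g) = dl P R (h \<cdot> g)"
 using functors(2)[unfolded id_functor_def, THEN conjunct2, THEN conjunct2, THEN conjunct2, THEN conjunct2, THEN conjunct2]
 by (simp add: ctc_def)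

lemma pr_surj: "cen P ==> cen Q ==> ph : F P Q ==> EX f:mor P Q. pr P Q f = ph"
proof -
 assume *: "cen P" "cen Q" "ph : F P Q"
 hence "pr P Q ` mor P Q = F P Q" using link[unfolded centric_linking_system_def, THEN conjunct2, THEN conjunct2, THEN conjunct1] by simp
 thus ?thesis using * by (metis imageE)
qed

lemma dl_inj: "cen P ==> cen Q ==> inj_on (dl P Q) (trp S P Q)"
 using link[unfolded centric_linking_system_def, THEN conjunct2, THEN conjunct2, THEN conjunct1] by simp

lemma free:
 assumes "cen P" "cen Q" "f : mor P Q" "z : centre S P" "cmp P P Q f (dl P P z) = f"
 shows "z = \<one>"
 using link[unfolded centric_linking_system_def, THEN conjunct2, THEN conjunct2, THEN conjunct2, THEN conjunct1, rule_format, of P Q f z] assms by simp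

lemma fibre:
 assumes "cen P" "cen Q" "f : mor P Q" "f' : mor P Q" "pr P Q f = pr P Q f'"
 shows "EX z:centre S P. f' = cmp P P Q f (dl P P z)"
 using link[unfolded centric_linking_system_def, THEN conjunct2, THEN conjunct2, THEN conjunct2, THEN conjunct2, THEN conjunct1, rule_format, of P Q f f'] assms by simp

lemma pr_dl:
 assumes "cen P" "cen Q" "g : trp S P Q"
 shows "pr P Q (dl P Q g) = conj_map S P g"
 using link[unfolded centric_linking_system_def, THEN conjunct2, THEN conjunct2, THEN conjunct2, THEN conjunct2, THEN conjunct2, THEN conjunct1, rule_format, of P Q g] assms by simp

lemma pr_dl_apply: "cen P ==> cen Q ==> g : trp S P Q ==> x : P ==> pr P Q (dl P Q g) x = g |> x"
 by (simp add: pr_dl conj_map_def)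

lemma dl_commute:
 assumes "cen P" "cen Q" "f : mor P Q" "g : P"
 shows "cmp P Q Q (dl Q Q (pr P Q f g)) f = cmp P P Q f (dl P P g)"
 using link[unfolded centric_linking_system_def, THEN conjunct2, THEN conjunct2, THEN conjunct2, THEN conjunct2, THEN conjunct2, THEN conjunct2, rule_format, of P Q f g] assms by simp

section \<open>Cancellation, restriction and unique extension in a linking system\<close>

lemma centre_in: "cen P ==> z : centre S P ==> z : P" by (simp add: centre_def)

lemma self_transp: "cen P ==> z : P ==> z : trp S P P" by (rule self_transporter[OF cen_sub])

lemma dl_self_closed: "cen P ==> z : P ==> dl P P z : mor P P" by (rule dl_closed[OF _ _ self_transp])

text \<open>The projections agree because maps of \<open>F\<close> are injective, so
  \<open>f'\<close> is \<open>f\<close> composed with some central \<open>z\<close>. This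
  \<open>z\<close> fixes the composite with \<open>k\<close>, and the action of the centre is
  free.\<close>

lemma mono:
 assumes c: "cen P" "cen Q" "cen R" and f: "f : mor P Q" "f' : mor P Q" and k: "k : mor Q R"
  and eq: "cmp P Q R k f = cmp P Q R k f'"
 shows "f = f'"
proof -
 note s = cen_sub[OF c(1)] cen_sub[OF c(2)] cen_sub[OF c(3)]
 have "pr P Q f = pr P Q f'"
 proof (rule extensionalityI[of _ P])
  show "pr P Q f : extensional P" "pr P Q f' : extensional P" using F_mon(2)[OF s(1,2)] pr_closed[OF c(1,2)] f by blast+
  fix x assume x: "x : P"
  have "pr Q R k (pr P Q f x) = pr Q R k (pr P Q f' x)"
   using eq pr_cmp_apply[OF c f(1) k x] pr_cmp_apply[OF c f(2) k x] by simp
  thus "pr P Q f x = pr P Q f' x"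
   using inj_onD[OF F_inj[OF s(2,3) pr_closed[OF c(2,3) k]]] F_in[OF s(1,2) pr_closed[OF c(1,2)] x] f by blast
 qed
 then obtain z where z: "z : centre S P" "f' = cmp P P Q f (dl P P z)" using fibre c f by blast
 have dz: "dl P P z : mor P P" using dl_self_closed c z centre_in by blast
 have "cmp P P R (cmp P Q R k f) (dl P P z) = cmp P Q R k f" using cmp_assoc[OF c(1,1,2,3) dz f(1) k] z(2) eq by simp
 hence "z = \<one>" using free[OF c(1,3) cmp_closed[OF c f(1) k] z(1)] by blast
 thus ?thesis using z(2) dl_one[OF c(1)] cmp_ident(1)[OF c(1,2) f(1)] by simp
qed

abbreviation "inc P Q == dl P Q \<one>"

lemma inc_closed: "cen P ==> cen Q ==> P <= Q ==> inc P Q : mor P Q" using dl_closed one_trp cen_sub by blast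

lemma pr_inc:
 assumes "cen P" "cen Q" "P <= Q" "x : P"
 shows "pr P Q (inc P Q) x = x" using pr_dl_apply[OF assms(1,2) one_trp[OF cen_sub[OF assms(1)] assms(3)] assms(4)]
  sub_car[OF cen_sub[OF assms(1)] assms(4)] by simp

text \<open>A lift of the corestricted map, followed by the inclusion, is \<open>f\<close> up to an
  element of the centre of \<open>P\<close>, which the lift can absorb. Uniqueness is the
  monomorphism property.\<close>

lemma restriction:
 assumes c: "cen P" "cen Q" "cen R" and f: "f : mor P R" and sub: "pr P R f ` P <= Q" "Q <= R"
 shows "EX! f0. f0 : mor P Q & cmp P Q R (inc Q R) f0 = f"
proof (rule ex_ex1I)
 note s = cen_sub[OF c(1)] cen_sub[OF c(2)] cen_sub[OF c(3)]
 have i: "inc Q R : mor Q R" using inc_closed c sub by blast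
 have "pr P R f : F P Q" using F_corestrict[OF s(1,3) pr_closed[OF c(1,3) f] s(2) sub(1)] .
 then obtain h where h: "h : mor P Q" "pr P Q h = pr P R f" using pr_surj c by blast
 have ih: "cmp P Q R (inc Q R) h : mor P R" using cmp_closed[OF c h(1) i] .
 have "pr P R (cmp P Q R (inc Q R) h) = pr P R f"
 proof (rule extensionalityI[of _ P])
  show "pr P R (cmp P Q R (inc Q R) h) : extensional P" "pr P R f : extensional P"
   using F_mon(2)[OF s(1,3)] pr_closed[OF c(1,3)] ih f by blast+
  fix x assume x: "x : P"
  have "pr P Q h x : Q" using h sub x by auto
  thus "pr P R (cmp P Q R (inc Q R) h) x = pr P R f x"
   using pr_cmp_apply[OF c h(1) i x] pr_inc[OF c(2,3) sub(2)] h(2) by simp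
 qed
 then obtain z where z: "z : centre S P" "f = cmp P P R (cmp P Q R (inc Q R) h) (dl P P z)"
  using fibre[OF c(1,3) ih f] by blast
 have dz: "dl P P z : mor P P" using dl_self_closed c z centre_in by blast
 show "EX f0. f0 : mor P Q & cmp P Q R (inc Q R) f0 = f"
  using cmp_assoc[OF c(1,1,2,3) dz h(1) i] z(2) cmp_closed[OF c(1,1,2) dz h(1)] by metis
 show "f0 = f1" if "f0 : mor P Q & cmp P Q R (inc Q R) f0 = f" "f1 : mor P Q & cmp P Q R (inc Q R) f1 = f" for f0 f1
  using mono[OF c _ _ i, of f0 f1] that by simp
qed

definition res :: "'a set => 'a set => 'a set => 'm => 'm" where
 "res P Q R f = (THE f0. f0 : mor P Q & cmp P Q R (inc Q R) f0 = f)"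

lemma res:
 assumes "cen P" "cen Q" "cen R" "f : mor P R" "pr P R f ` P <= Q" "Q <= R"
 shows "res P Q R f : mor P Q" "cmp P Q R (inc Q R) (res P Q R f) = f"
 using theI'[OF restriction[OF assms]] by (auto simp: res_def)

lemma res_unique:
 assumes "cen P" "cen Q" "cen R" "f0 : mor P Q" "Q <= R"
 shows "res P Q R (cmp P Q R (inc Q R) f0) = f0"
proof -
 have i: "inc Q R : mor Q R" using inc_closed assms by blast
 have cl: "cmp P Q R (inc Q R) f0 : mor P R" using cmp_closed assms i by blast
 have "pr P R (cmp P Q R (inc Q R) f0) x = pr P Q f0 x & pr P Q f0 x : Q" if "x : P" for x
 proof -
  have "pr P Q f0 x : Q" using F_in[OF cen_sub cen_sub pr_closed that] assms by blast
  thus ?thesis using pr_cmp_apply[OF assms(1-4) i that] pr_inc[OF assms(2,3,5)] by simp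
 qed
 hence "pr P R (cmp P Q R (inc Q R) f0) ` P <= Q" by auto
 from res[OF assms(1-3) cl this assms(5)] show ?thesis using mono[OF assms(1-3) _ assms(4) i] by blast
qed

lemma pr_res:
 assumes "cen P" "cen Q" "cen R" "f : mor P R" "pr P R f ` P <= Q" "Q <= R"
 shows "pr P Q (res P Q R f) = pr P R f"
proof (rule extensionalityI[of _ P])
 note r = res[OF assms]
 show "pr P Q (res P Q R f) : extensional P" "pr P R f : extensional P"
  using F_mon(2)[OF cen_sub cen_sub] pr_closed r(1) assms by blast+
 fix x assume x: "x : P"
 have i: "inc Q R : mor Q R" using inc_closed assms by blast
 have "pr P Q (res P Q R f) x : Q" using F_in[OF cen_sub cen_sub pr_closed x] r(1) assms by blast
 thus "pr P Q (res P Q R f) x = pr P R f x" using pr_cmp_apply[OF assms(1-3) r(1) i x] r(2) pr_inc[OF assms(2,3,6)] by simp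
qed

lemma res_cmp:
 assumes "cen P" "cen P'" "cen Q" "cen R" "f : mor P R" "pr P R f ` P <= Q" "Q <= R" "k : mor P' P"
 shows "res P' Q R (cmp P' P R f k) = cmp P' P Q (res P Q R f) k"
proof -
 note r = res[OF assms(1,3-7)]
 have i: "inc Q R : mor Q R" using inc_closed assms by blast
 have "cmp P' P R f k = cmp P' Q R (inc Q R) (cmp P' P Q (res P Q R f) k)"
  using cmp_assoc[OF assms(2,1,3,4,8) r(1) i] r(2) by simp
 thus ?thesis using res_unique[OF assms(2-4) cmp_closed[OF assms(2,1,3,8) r(1)] assms(7)] by simp
qed

text \<open>Cancellation on the other side, for morphisms that come from \<open>S\<close>. The
  quotient of \<open>a\<close> and \<open>b\<close> centralizes the image of \<open>P\<close>, which
  contains its centralizer, so it is the image of some \<open>z\<close> in \<open>P\<close>. Moved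
  across \<open>h\<close> by \<open>dl_commute\<close>, this central \<open>z\<close> acts trivially
  on \<open>h\<close> and is 1 by freeness.\<close>

lemma dl_left_cancel:
 assumes c: "cen P" "cen Q" "cen R" and h: "h : mor P Q" and a: "a : trp S Q R" "b : trp S Q R"
  and eq: "cmp P Q R (dl Q R a) h = cmp P Q R (dl Q R b) h"
 shows "a = b"
proof -
 note s = cen_sub[OF c(1)] cen_sub[OF c(2)] cen_sub[OF c(3)]
 have ac: "a : car S" "b : car S" using a by (auto simp: trp_def)
 let ?ph = "pr P Q h"
 have ph: "?ph : F P Q" using pr_closed c h by blast
 have in_Q: "?ph x : Q" "?ph x : car S" if "x : P" for x using F_in[OF s(1,2) ph that] sub_car[OF s(2)] by auto
 define x where "x = inv b \<cdot> a"
 have xc: "x : car S" using ac by (simp add: x_def)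
 have "x : centralizer S (?ph ` P)"
 proof -
  have "x \<cdot> ?ph u = ?ph u \<cdot> x" if u: "u : P" for u
  proof -
   have "a \<cdot> ?ph u \<cdot> inv a = b \<cdot> ?ph u \<cdot> inv b"
    using pr_cmp_apply[OF c h dl_closed[OF c(2,3) a(1)] u] pr_cmp_apply[OF c h dl_closed[OF c(2,3) a(2)] u]
     pr_dl_apply[OF c(2,3) a(1) in_Q(1)[OF u]] pr_dl_apply[OF c(2,3) a(2) in_Q(1)[OF u]] eq by simp
   hence "inv b \<cdot> (a \<cdot> ?ph u \<cdot> inv a) \<cdot> a = inv b \<cdot> (b \<cdot> ?ph u \<cdot> inv b) \<cdot> a" by simp
   thus ?thesis using ac in_Q[OF u] by (simp add: x_def gnorm)
  qed
  thus ?thesis using xc by (auto simp: centralizer_def)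
 qed
 moreover have "fusion_conj S F P (?ph ` P)" using fusion_conjI[OF s(1,2) ph s(1)] by simp
 hence "centralizer S (?ph ` P) <= ?ph ` P" using c(1) unfolding centric_def by blast
 ultimately obtain z where z: "z : P" "x = ?ph z" by blast
 have xQ: "x : trp S Q Q" using in_Q[OF z(1)] z(2) self_transp c by simp
 have bx: "b \<cdot> x = a" using ac by (simp add: x_def gnorm)
 have dx: "dl Q Q x : mor Q Q" using dl_closed[OF c(2,2) xQ] .
 have dz: "dl P P z : mor P P" using dl_self_closed[OF c(1) z(1)] .
 have db: "dl Q R b : mor Q R" using dl_closed[OF c(2,3) a(2)] .
 have "cmp P Q R (dl Q R b) (cmp P Q Q (dl Q Q x) h) = cmp P Q R (dl Q R b) h"
  using cmp_assoc[OF c(1,2,2,3) h dx db] dl_cmp[OF c(2,2,3) xQ a(2)] bx eq by simp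
 hence "cmp P Q Q (dl Q Q x) h = h" using mono[OF c(1,2,3) cmp_closed[OF c(1,2,2) h dx] h db] by blast
 hence "cmp P P Q h (dl P P z) = h" using dl_commute[OF c(1,2) h z(1)] z(2) by simp
 moreover have "z : centre S P"
 proof -
  have "z \<cdot> u = u \<cdot> z" if u: "u : P" for u
  proof -
   have "?ph (z \<cdot> u) = ?ph (u \<cdot> z)" using F_mult[OF s(1,2) ph z(1) u] F_mult[OF s(1,2) ph u z(1)] z(2) u
     \<open>x : centralizer S (?ph ` P)\<close> by (simp add: centralizer_def)
   thus ?thesis using inj_onD[OF F_inj[OF s(1,2) ph]] u z(1) s(1) by (simp add: sub_mult)
  qed
  thus ?thesis using centreI[OF s(1) z(1)] by blast
 qed
 ultimately have "z = \<one>" using free[OF c(1,2) h] by blast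
 hence "x = \<one>" using z(2) F_one[OF s(1,2) ph] by simp
 thus ?thesis using bx ac by simp
qed

text \<open>Each \<open>d\<close> in \<open>D\<close> normalises \<open>R\<close>, so over the
  common restriction to \<open>R\<close> both extensions intertwine \<open>d\<close> with its image;
  cancelling the restriction shows that the projections agree. The extensions then differ by an
  element of the centre of \<open>D\<close>. It centralizes \<open>R\<close>, so it lies in
  \<open>R\<close>, and freeness on \<open>R\<close> makes it trivial.\<close>

lemma extension_unique:
 assumes c: "cen R" "cen D" "cen Q" and sub: "R <= D" "!!d. d : D ==> d : trp S R R"
  and f: "f : mor D Q" "f' : mor D Q" and eq: "cmp R D Q f (inc R D) = cmp R D Q f' (inc R D)"
 shows "f = f'"
proof -
 note s = cen_sub[OF c(1)] cen_sub[OF c(2)] cen_sub[OF c(3)]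
 have i: "inc R D : mor R D" using inc_closed[OF c(1,2) sub(1)] .
 let ?h = "cmp R D Q f (inc R D)"
 have h: "?h : mor R Q" using cmp_closed[OF c(1,2,3) i f(1)] .
 have key: "cmp R Q Q (dl Q Q (pr D Q g d)) ?h = cmp R R Q ?h (dl R R d) & pr D Q g d : trp S Q Q"
  if g: "g : mor D Q" "cmp R D Q g (inc R D) = ?h" and d: "d : D" for g d
 proof
  have gd: "pr D Q g d : Q" using F_in[OF s(2,3) pr_closed[OF c(2,3) g(1)] d] .
  thus t: "pr D Q g d : trp S Q Q" using self_transp c by blast
  have dd: "dl D D d : mor D D" using dl_self_closed c(2) d by blast
  have dR: "dl R R d : mor R R" using dl_closed[OF c(1,1) sub(2)[OF d]] .
  have "cmp R Q Q (dl Q Q (pr D Q g d)) ?h = cmp R D Q (cmp D Q Q (dl Q Q (pr D Q g d)) g) (inc R D)"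
   using cmp_assoc[OF c(1,2,3,3) i g(1) dl_closed[OF c(3,3) t]] g(2) by simp
  also have "cmp D Q Q (dl Q Q (pr D Q g d)) g = cmp D D Q g (dl D D d)" using dl_commute[OF c(2,3) g(1) d] .
  also have "cmp R D Q (cmp D D Q g (dl D D d)) (inc R D) = cmp R D Q g (cmp R D D (dl D D d) (inc R D))"
   using cmp_assoc[OF c(1,2,2,3) i dd g(1)] by simp
  also have "cmp R D D (dl D D d) (inc R D) = cmp R R D (inc R D) (dl R R d)"
   using dl_cmp[OF c(1,2,2) one_trp[OF s(1) sub(1)] self_transp[OF c(2) d]]
    dl_cmp[OF c(1,1,2) sub(2)[OF d] one_trp[OF s(1) sub(1)]] sub_car[OF s(2) d] by simp
  also have "cmp R D Q g (cmp R R D (inc R D) (dl R R d)) = cmp R R Q ?h (dl R R d)"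
   using cmp_assoc[OF c(1,1,2,3) dR i g(1)] g(2) by simp
  finally show "cmp R Q Q (dl Q Q (pr D Q g d)) ?h = cmp R R Q ?h (dl R R d)" .
 qed
 have "pr D Q f = pr D Q f'"
 proof (rule extensionalityI[of _ D])
  show "pr D Q f : extensional D" "pr D Q f' : extensional D" using F_mon(2)[OF s(2,3)] pr_closed[OF c(2,3)] f by blast+
  fix d assume d: "d : D"
  show "pr D Q f d = pr D Q f' d"
   using dl_left_cancel[OF c(1,3,3) h] key[OF f(1) HOL.refl d] key[OF f(2) eq[symmetric] d] by metis
 qed
 then obtain z where z: "z : centre S D" "f' = cmp D D Q f (dl D D z)" using fibre c f by blast
 have zD: "z : D" using z centre_in c by blast
 have zc: "z : car S" using sub_car[OF s(2) zD] .
 have "z : centralizer S R" using centreD(2)[OF z(1)] sub(1) zc unfolding centralizer_def by blast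
 hence "z : R" using c(1) by (auto simp: centric_def)
 hence zR: "z : centre S R" using centreD(2)[OF z(1)] sub(1) by (intro centreI[OF s(1)]) blast+
 have dz: "dl D D z : mor D D" "dl R R z : mor R R" using dl_self_closed c zD \<open>z : R\<close> by auto
 have "cmp R D D (dl D D z) (inc R D) = cmp R R D (inc R D) (dl R R z)"
  using dl_cmp[OF c(1,2,2) one_trp[OF s(1) sub(1)] self_transp[OF c(2) zD]]
   dl_cmp[OF c(1,1,2) self_transp[OF c(1) \<open>z : R\<close>] one_trp[OF s(1) sub(1)]] zc by simp
 hence "cmp R R Q ?h (dl R R z) = ?h"
  using cmp_assoc[OF c(1,1,2,3) dz(2) i f(1)] cmp_assoc[OF c(1,2,2,3) i dz(1) f(1)] z(2) eq by simp
 hence "z = \<one>" using free[OF c(1,3) h zR] by blast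
 thus ?thesis using z(2) dl_one[OF c(2)] cmp_ident(1)[OF c(2,3) f(1)] by simp
qed

end

section \<open>Signaliser functors and linking systems\<close>

text \<open>Besides the given \<open>F\<close>, this is instantiated with the fusion system of the
  group itself, before the two are known to coincide.\<close>

locale realised = fusion S F for S :: "'a monoid" (structure) and F +
 fixes G :: "'g monoid" and j :: "'a => 'g"
 assumes G_group: "group G" and j_mon: "j : mon S G"
  and F_eq: "!!P Q. sgp P S ==> sgp Q S ==> F P Q = group_fusion G j P Q"
begin

sublocale G: group G by (rule G_group)

sublocale jh: group_hom S G j using j_mon by unfold_locales (simp add: mon_def)

lemma j_inj: "inj_on j (car S)" using j_mon by (simp add: mon_def)

abbreviation "N P Q == trp G (j ` P) (j ` Q)"

lemma j_sub: "sgp P S ==> j ` P <= car G" using sub_car by auto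

lemma N_iff: "sgp P S ==> g : N P Q <-> g : car G & (ALL x:P. g |>\<^sub>G j x : j ` Q)" using G.trp_iff[OF j_sub] by auto

lemma N_carrier: "g : N P Q ==> g : car G" by (simp add: trp_def)

lemma N_mult: "sgp P S ==> sgp Q S ==> g : N P Q ==> h : N Q R ==> h \<cdot>\<^sub>G g : N P R"
 by (rule G.transporter_mult[OF j_sub j_sub])

text \<open>The map \<open>j^-1 c_g j\<close> on \<open>P\<close>. The target is not an argument, so
  one function serves for all targets that contain the image.\<close>

definition ind :: "'a set => 'g => 'a => 'a" where
 "ind P g = (\<lambda>x\<in>P. inv_into (car S) j (g |>\<^sub>G j x))"

lemma ind_apply:
 assumes "sgp P S" "sgp Q S" "g : N P Q" "x : P"
 shows "ind P g x : Q" "j (ind P g x) = g |>\<^sub>G j x"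
proof -
 obtain y where y: "y : Q" "g |>\<^sub>G j x = j y" using assms(3,4) N_iff[OF assms(1)] by blast
 hence "ind P g x = y" using assms(4) j_inj sub_car[OF assms(2)] by (simp add: ind_def)
 thus "ind P g x : Q" "j (ind P g x) = g |>\<^sub>G j x" using y by auto
qed

lemma ind_unique:
 assumes "sgp P S" "sgp Q S" "ph : P \<rightarrow>\<^sub>E Q"
  "!!x. x : P ==> j (ph x) = g |>\<^sub>G j x"
 shows "ph = ind P g"
proof (rule extensionalityI[of _ P])
 show "ph : extensional P" using assms(3) by (simp add: PiE_def)
 show "ind P g : extensional P" by (simp add: ind_def)
 fix x assume x: "x : P"
 hence "ph x : car S" using assms(3) sub_car[OF assms(2)] by auto
 thus "ph x = ind P g x" using x j_inj by (simp add: ind_def assms(4)[OF x, symmetric])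
qed

lemma ind_F:
 assumes "sgp P S" "sgp Q S" "g : N P Q"
 shows "ind P g : F P Q"
proof -
 have "ind P g : P \<rightarrow>\<^sub>E Q" using ind_apply(1)[OF assms] by (auto simp: PiE_def ind_def)
 thus ?thesis unfolding F_eq[OF assms(1,2)] group_fusion_def using assms(3) ind_apply(2)[OF assms] by blast
qed

lemma F_ind:
 assumes "sgp P S" "sgp Q S" "ph : F P Q"
 shows "EX g:N P Q. ph = ind P g"
proof -
 obtain g where "ph : P \<rightarrow>\<^sub>E Q" "g : N P Q" "ALL x:P. j (ph x) = g |>\<^sub>G j x"
  using assms(3) unfolding F_eq[OF assms(1,2)] group_fusion_def by blast
 thus ?thesis using ind_unique[OF assms(1,2)] by blast
qed

lemma j_transporter:
 assumes "sgp P S" "s : trp S P Q"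
 shows "j s : N P Q"
proof -
 have s: "s : car S" "!!x. x : P ==> s |> x : Q" using assms trp_iff' by auto
 have "j s |>\<^sub>G j x = j (s |> x)" if "x : P" for x using s(1) sub_car[OF assms(1) that] by simp
 thus ?thesis using s by (auto simp: N_iff[OF assms(1)])
qed

lemma ind_j:
 assumes "sgp P S" "sgp Q S" "s : trp S P Q"
 shows "ind P (j s) = conj_map S P s"
proof -
 have s: "s : car S" "!!x. x : P ==> s |> x : Q" using assms trp_iff' by auto
 have "conj_map S P s = ind P (j s)"
  by (rule ind_unique[OF assms(1,2)]) (use s sub_car[OF assms(1)] in \<open>auto simp: conj_map_def\<close>)
 thus ?thesis by simp
qed

lemma centralizer_N:
 assumes "sgp P S" "g : centralizer G (j ` P)"
 shows "g : N P P" "ind P g = (\<lambda>x\<in>P. x)"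
proof -
 have g: "g : car G" "!!x. x : P ==> g \<cdot>\<^sub>G j x = j x \<cdot>\<^sub>G g"
  using assms(2) by (auto simp: centralizer_def)
 have *: "g |>\<^sub>G j x = j x" if "x : P" for x using g sub_car[OF assms(1) that] that by (simp add: G.m_assoc)
 thus "g : N P P" using g by (simp add: N_iff[OF assms(1)])
 have "(\<lambda>x\<in>P. x) = ind P g" by (rule ind_unique[OF assms(1,1)]) (use * in auto)
 thus "ind P g = (\<lambda>x\<in>P. x)" by simp
qed

lemma ind_eq_centralizer:
 assumes "sgp P S" "sgp Q S" "g : N P Q" "h : N P Q" "ind P g = ind P h"
 shows "inv \<^sub>G g \<cdot>\<^sub>G h : centralizer G (j ` P)"
proof -
 have c: "g : car G" "h : car G" using assms N_carrier by auto
 have "(inv \<^sub>G g \<cdot>\<^sub>G h) \<cdot>\<^sub>G j x = j x \<cdot>\<^sub>G (inv \<^sub>G g \<cdot>\<^sub>G h)" if x: "x : P" for x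
 proof -
  have jx: "j x : car G" using sub_car[OF assms(1) x] by simp
  have "g |>\<^sub>G j x = h |>\<^sub>G j x"
   using ind_apply(2)[OF assms(1,2,3) x] ind_apply(2)[OF assms(1,2,4) x] assms(5) by simp
  hence "inv \<^sub>G g \<cdot>\<^sub>G (g |>\<^sub>G j x) \<cdot>\<^sub>G h =
    inv \<^sub>G g \<cdot>\<^sub>G (h |>\<^sub>G j x) \<cdot>\<^sub>G h" by simp
  thus ?thesis using c jx by (simp add: G.gnorm)
 qed
 thus ?thesis using c by (auto simp: centralizer_def)
qed

lemma centralizer_subgroup:
 assumes "sgp P S"
 shows "sgp (centralizer G (j ` P)) G"
proof (rule G.subgroupI)
 have jc: "j x : car G" if "x : P" for x using sub_car[OF assms that] by simp
 show "centralizer G (j ` P) <= car G" by (auto simp: centralizer_def)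
 have "\<one>\<^sub>G : centralizer G (j ` P)" using jc by (auto simp: centralizer_def)
 thus "centralizer G (j ` P) ~= {}" by blast
 fix a assume a: "a : centralizer G (j ` P)"
 hence ac: "a : car G" "!!x. x : P ==> a \<cdot>\<^sub>G j x = j x \<cdot>\<^sub>G a" by (auto simp: centralizer_def)
 have "inv \<^sub>G a \<cdot>\<^sub>G j x = j x \<cdot>\<^sub>G inv \<^sub>G a" if x: "x : P" for x
 proof -
  have "inv \<^sub>G a \<cdot>\<^sub>G (a \<cdot>\<^sub>G j x) \<cdot>\<^sub>G inv \<^sub>G a = inv \<^sub>G a \<cdot>\<^sub>G (j x \<cdot>\<^sub>G a) \<cdot>\<^sub>G inv \<^sub>G a"
   using ac(2)[OF x] by simp
  thus ?thesis using ac(1) jc[OF x] by (simp add: G.gnorm)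
 qed
 thus "inv \<^sub>G a : centralizer G (j ` P)" using ac(1) by (auto simp: centralizer_def)
 fix b assume b: "b : centralizer G (j ` P)"
 hence bc: "b : car G" "!!x. x : P ==> b \<cdot>\<^sub>G j x = j x \<cdot>\<^sub>G b" by (auto simp: centralizer_def)
 have "(a \<cdot>\<^sub>G b) \<cdot>\<^sub>G j x = j x \<cdot>\<^sub>G (a \<cdot>\<^sub>G b)" if x: "x : P" for x
 proof -
  have "(a \<cdot>\<^sub>G b) \<cdot>\<^sub>G j x = a \<cdot>\<^sub>G (b \<cdot>\<^sub>G j x)" using ac(1) bc(1) jc[OF x] by (simp add: G.m_assoc)
  also have "... = (a \<cdot>\<^sub>G j x) \<cdot>\<^sub>G b" unfolding bc(2)[OF x] using ac(1) bc(1) jc[OF x] by (simp add: G.m_assoc)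
  also have "... = j x \<cdot>\<^sub>G (a \<cdot>\<^sub>G b)" unfolding ac(2)[OF x] using ac(1) bc(1) jc[OF x] by (simp add: G.m_assoc)
  finally show ?thesis .
 qed
 thus "a \<cdot>\<^sub>G b : centralizer G (j ` P)" using ac(1) bc(1) by (auto simp: centralizer_def)
qed

lemma coset_mem: "x : g <#\<^sub>G T <-> (EX t:T. x = g \<cdot>\<^sub>G t)" by (auto simp: l_coset_def)

lemma coset_eq:
 assumes "sgp T G" "g : car G" "h : car G"
 shows "g <#\<^sub>G T = h <#\<^sub>G T <-> inv \<^sub>G g \<cdot>\<^sub>G h : T"
proof
 note T = sub_mem[OF assms(1)]
 assume "g <#\<^sub>G T = h <#\<^sub>G T"
 moreover have "h : h <#\<^sub>G T" using assms(3) sub_one[OF assms(1)] unfolding coset_mem by (metis G.r_one)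
 ultimately obtain t where t: "t : T" "h = g \<cdot>\<^sub>G t" unfolding coset_mem[symmetric] by (metis coset_mem)
 thus "inv \<^sub>G g \<cdot>\<^sub>G h : T" using assms(2) T[OF t(1)] by (simp add: G.gnorm)
next
 note T = sub_mem[OF assms(1)]
 assume x: "inv \<^sub>G g \<cdot>\<^sub>G h : T"
 show "g <#\<^sub>G T = h <#\<^sub>G T"
 proof (rule Set.set_eqI)
  fix y
  have 1: "g \<cdot>\<^sub>G t = h \<cdot>\<^sub>G (inv \<^sub>G (inv \<^sub>G g \<cdot>\<^sub>G h) \<cdot>\<^sub>G t)"
   "h \<cdot>\<^sub>G t = g \<cdot>\<^sub>G ((inv \<^sub>G g \<cdot>\<^sub>G h) \<cdot>\<^sub>G t)" if "t : T" for t
   using assms(2,3) T[OF that] by (simp_all add: G.gnorm)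
  have 2: "inv \<^sub>G (inv \<^sub>G g \<cdot>\<^sub>G h) \<cdot>\<^sub>G t : T" "(inv \<^sub>G g \<cdot>\<^sub>G h) \<cdot>\<^sub>G t : T" if "t : T" for t
   using assms(1) x that by (auto intro: sub_mult sub_inv)
  show "y : g <#\<^sub>G T <-> y : h <#\<^sub>G T" unfolding coset_mem using 1 2 by metis
 qed
qed

end

locale signaliser = realised S F G j for S :: "'a monoid" (structure) and F and G :: "'g monoid" and j +
 fixes Th :: "'a set => 'g set"
 assumes Th: "signaliser_functor S F G j Th"
begin

abbreviation "cen == centric S F"

lemma cen_sub: "cen P ==> sgp P S" by (rule centric_subgroup)

lemma Th_subgroup: "cen P ==> sgp (Th P) G"
proof -
 assume P: "cen P"
 hence "sgp (Th P) (G(|carrier := centralizer G (j ` P)|))" using Th by (simp add: signaliser_functor_def)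
 thus ?thesis using G.incl_subgroup[OF centralizer_subgroup[OF cen_sub[OF P]]] by blast
qed

lemma Th_centralizes:
 assumes "cen P" "t : Th P"
 shows "t : centralizer G (j ` P)"
proof -
 have "sgp (Th P) (G(|carrier := centralizer G (j ` P)|))" using Th assms(1) by (simp add: signaliser_functor_def)
 from sub_mem[OF this assms(2)] show ?thesis by simp
qed

lemma Th_trivial: "cen P ==> z : centre S P ==> j z : Th P ==> z = \<one>"
proof -
 assume *: "cen P" "z : centre S P" "j z : Th P"
 hence "j ` centre S P \<inter> Th P = {\<one>\<^sub>G}" using Th by (simp add: signaliser_functor_def)
 hence "j z = j \<one>" using * by auto
 thus "z = \<one>" using inj_onD[OF j_inj] * cen_sub sub_car centreD(1) by (metis one_closed)
qed

lemma Th_complement: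
 assumes "cen P" "g : centralizer G (j ` P)"
 obtains z t where "z : centre S P" "t : Th P" "g = j z \<cdot>\<^sub>G t"
proof -
 have "j ` centre S P <#>\<^sub>G Th P = centralizer G (j ` P)" using Th assms(1) by (simp add: signaliser_functor_def)
 hence "g : j ` centre S P <#>\<^sub>G Th P" using assms(2) by simp
 thus thesis using that unfolding set_mult_def by blast
qed

lemma Th_conj:
 assumes "cen P" "cen Q" "g : N P Q" "t : Th Q"
 shows "EX u:Th P. t \<cdot>\<^sub>G g = g \<cdot>\<^sub>G u"
proof -
 have c: "g : car G" "Th P <= car G" using N_carrier assms(3) sub_le[OF Th_subgroup[OF assms(1)]] by auto
 have "Th Q <= g <#\<^sub>G Th P #>\<^sub>G inv \<^sub>G g" using Th assms(1-3) unfolding signaliser_functor_def by blast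
 then obtain u where u: "u : Th P" "t = g |>\<^sub>G u" using assms(4) G.conj_set[OF c] by auto
 hence "t \<cdot>\<^sub>G g = g \<cdot>\<^sub>G u" using c by (auto simp: G.gnorm)
 thus ?thesis using u(1) by blast
qed

text \<open>Elements of \<open>Th Q\<close> move to the right past \<open>g\<close> and turn into
  elements of \<open>Th P\<close>; this is the second condition on a signaliser functor, read
  elementwise.\<close>

lemma coset_mult:
 assumes "cen P" "cen Q" "g : N P Q" "h : N Q R"
 shows "(h <#\<^sub>G Th Q) <#>\<^sub>G (g <#\<^sub>G Th P) = (h \<cdot>\<^sub>G g) <#\<^sub>G Th P"
proof
 note T = sub_mem[OF Th_subgroup[OF assms(1)]] sub_mem[OF Th_subgroup[OF assms(2)]]
 have c: "g : car G" "h : car G" using assms N_carrier by auto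
 show "(h <#\<^sub>G Th Q) <#>\<^sub>G (g <#\<^sub>G Th P) <= (h \<cdot>\<^sub>G g) <#\<^sub>G Th P"
 proof
  fix x assume "x : (h <#\<^sub>G Th Q) <#>\<^sub>G (g <#\<^sub>G Th P)"
  then obtain t u where tu: "t : Th Q" "u : Th P" "x = (h \<cdot>\<^sub>G t) \<cdot>\<^sub>G (g \<cdot>\<^sub>G u)"
   unfolding set_mult_def by (auto simp: coset_mem)
  obtain v where v: "v : Th P" "t \<cdot>\<^sub>G g = g \<cdot>\<^sub>G v" using Th_conj[OF assms(1-3) tu(1)] by blast
  have "x = h \<cdot>\<^sub>G (t \<cdot>\<^sub>G g) \<cdot>\<^sub>G u" using tu T c by (simp add: G.m_assoc)
  also have "... = (h \<cdot>\<^sub>G g) \<cdot>\<^sub>G (v \<cdot>\<^sub>G u)" unfolding v(2) using tu v T c by (simp add: G.m_assoc)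
  finally show "x : (h \<cdot>\<^sub>G g) <#\<^sub>G Th P"
   using sub_mult[OF Th_subgroup[OF assms(1)] v(1) tu(2)] unfolding coset_mem by blast
 qed
 show "(h \<cdot>\<^sub>G g) <#\<^sub>G Th P <= (h <#\<^sub>G Th Q) <#>\<^sub>G (g <#\<^sub>G Th P)"
 proof
  fix x assume "x : (h \<cdot>\<^sub>G g) <#\<^sub>G Th P"
  then obtain u where u: "u : Th P" "x = (h \<cdot>\<^sub>G g) \<cdot>\<^sub>G u" by (auto simp: coset_mem)
  have "x = (h \<cdot>\<^sub>G \<one>\<^sub>G) \<cdot>\<^sub>G (g \<cdot>\<^sub>G u)" using u T c by (simp add: G.m_assoc)
  moreover have "h \<cdot>\<^sub>G \<one>\<^sub>G : h <#\<^sub>G Th Q" "g \<cdot>\<^sub>G u : g <#\<^sub>G Th P"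
   using sub_one[OF Th_subgroup[OF assms(2)]] u(1) unfolding coset_mem by blast+
  ultimately show "x : (h <#\<^sub>G Th Q) <#>\<^sub>G (g <#\<^sub>G Th P)" unfolding set_mult_def by blast
 qed
qed

lemma proj_coset:
 assumes "cen P" "cen Q" "g : N P Q"
 shows "signaliser_proj G j P Q (g <#\<^sub>G Th P) = ind P g" unfolding signaliser_proj_def
proof (rule the_equality)
 note s = cen_sub[OF assms(1)] cen_sub[OF assms(2)]
 have c: "g : car G" using assms(3) N_carrier by blast
 have "j (ind P g x) = g' |>\<^sub>G j x" if g': "g' : g <#\<^sub>G Th P" and x: "x : P" for g' x
 proof -
  obtain t where t: "t : Th P" "g' = g \<cdot>\<^sub>G t" using g' by (auto simp: coset_mem)
  have tc: "t : car G" "t \<cdot>\<^sub>G j x = j x \<cdot>\<^sub>G t"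
   using Th_centralizes[OF assms(1) t(1)] x by (auto simp: centralizer_def)
  have jx: "j x : car G" using sub_car[OF s(1) x] by simp
  have "g' |>\<^sub>G j x = g \<cdot>\<^sub>G (t \<cdot>\<^sub>G j x) \<cdot>\<^sub>G inv \<^sub>G t \<cdot>\<^sub>G inv \<^sub>G g"
   using t(2) c tc(1) jx by (simp add: G.gnorm)
  also have "... = g |>\<^sub>G j x" unfolding tc(2) using c tc(1) jx by (simp add: G.gnorm)
  finally show ?thesis using ind_apply(2)[OF s assms(3) x] by simp
 qed
 moreover have "ind P g : P \<rightarrow>\<^sub>E Q" using ind_apply(1)[OF s assms(3)] by (auto simp: PiE_def ind_def)
 ultimately show "ind P g : P \<rightarrow>\<^sub>E Q &
   (ALL g':g <#\<^sub>G Th P. ALL x:P. j (ind P g x) = g' |>\<^sub>G j x)" by blast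
 fix ph assume ph: "ph : P \<rightarrow>\<^sub>E Q & (ALL g':g <#\<^sub>G Th P. ALL x:P. j (ph x) = g' |>\<^sub>G j x)"
 have "g : g <#\<^sub>G Th P" using c sub_one[OF Th_subgroup[OF assms(1)]] unfolding coset_mem by (metis G.r_one)
 thus "ph = ind P g" using ind_unique[OF s] ph by blast
qed

lemma transporter_category: "is_category (ctc S F)"
proof -
 have c: "g : car S" if "g : trp S P Q" for g P Q using that by (simp add: trp_def)
 have m: "h \<cdot> g : trp S P R" if "cen P" "cen Q" "g : trp S P Q" "h : trp S Q R" for g h P Q R
  by (rule transporter_mult[OF sub_le[OF cen_sub[OF that(1)]] sub_le[OF cen_sub[OF that(2)]] that(3,4)])
 show ?thesis unfolding is_category_def
 proof (intro conjI ballI)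
  fix P assume "P : objs (ctc S F)"
  hence P: "cen P" by (simp add: ctc_def)
  show "ident (ctc S F) P : arrs (ctc S F) P P" using one_trp[OF cen_sub[OF P] subset_refl] by (simp add: ctc_def)
  fix Q assume "Q : objs (ctc S F)"
  hence Q: "cen Q" by (simp add: ctc_def)
  {
   fix f assume "f : arrs (ctc S F) P Q"
   hence "f : car S" using c by (simp add: ctc_def)
   thus "composite (ctc S F) P P Q f (ident (ctc S F) P) = f"
    "composite (ctc S F) P Q Q (ident (ctc S F) Q) f = f" by (simp_all add: ctc_def)
  }
  fix R f g assume fg: "f : arrs (ctc S F) P Q" "g : arrs (ctc S F) Q R"
  show "composite (ctc S F) P Q R g f : arrs (ctc S F) P R" using m[OF P Q] fg by (simp add: ctc_def)
  fix T h assume h: "h : arrs (ctc S F) R T"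
  have "f : car S" "g : car S" "h : car S" using fg h c[of f P Q] c[of g Q R] c[of h R T] by (simp_all add: ctc_def)
  thus "composite (ctc S F) P R T h (composite (ctc S F) P Q R g f) =
    composite (ctc S F) P Q T (composite (ctc S F) Q R T h g) f" by (simp add: ctc_def m_assoc)
 qed
qed

text \<open>Under the given isomorphism each coset \<open>g Th(P)\<close> has a preimage
  \<open>lift P Q g\<close>. These preimages are all the morphisms and they compose like group
  elements, so every axiom becomes a statement on cosets. The functor \<open>\<delta>\<close> sends
  \<open>s\<close> to the preimage of the coset of \<open>j s\<close>.\<close>

theorem linking_of_signaliser:
 fixes LL :: "('a set, 'm) cat"
 assumes "induces S F G j Th LL pr"
 shows "EX dl. centric_linking_system S F LL pr dl"
proof -
 let ?D = "signaliser_linking S F G j Th"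
 obtain al where pr: "id_functor LL (centric_fusion_cat S F) pr" and al: "id_functor LL ?D al"
  "!!P Q. P : objs LL ==> Q : objs LL ==> bij_betw (al P Q) (arrs LL P Q) (arrs ?D P Q)"
  "!!P Q f. P : objs LL ==> Q : objs LL ==> f : arrs LL P Q ==>
   signaliser_proj G j P Q (al P Q f) = pr P Q f" using assms unfolding induces_def cat_over_iso_def by blast
 have cat: "is_category LL" and objs: "objs LL = {P. cen P}"
  using pr by (simp_all add: id_functor_def centric_fusion_cat_def)
 have bij: "bij_betw (al P Q) (arrs LL P Q) ((%g. g <#\<^sub>G Th P) ` N P Q)" if "cen P" "cen Q" for P Q
  using al(2)[of P Q] that objs by (simp add: signaliser_linking_def)
 have al_ident: "al P P (ident LL P) = Th P" if "cen P" for P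
  using al(1)[unfolded id_functor_def, THEN conjunct2, THEN conjunct2, THEN conjunct2, THEN conjunct2, THEN conjunct1]
   that objs by (simp add: signaliser_linking_def)
 have al_cmp: "al P R (composite LL P Q R b a) = al Q R b <#>\<^sub>G al P Q a"
  if "cen P" "cen Q" "cen R" "a : arrs LL P Q" "b : arrs LL Q R" for P Q R a b
  using al(1)[unfolded id_functor_def, THEN conjunct2, THEN conjunct2, THEN conjunct2, THEN conjunct2, THEN conjunct2]
   that objs by (simp add: signaliser_linking_def)
 have cmp_closed: "composite LL P Q R b a : arrs LL P R"
  if "cen P" "cen Q" "cen R" "a : arrs LL P Q" "b : arrs LL Q R" for P Q R a b
  using cat[unfolded is_category_def, THEN conjunct2, THEN conjunct1] that objs by simp
 have ident_closed: "ident LL P : arrs LL P P" if "cen P" for P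
  using cat[unfolded is_category_def, THEN conjunct1] that objs by simp
 define lift where "lift = (%P Q g. inv_into (arrs LL P Q) (al P Q) (g <#\<^sub>G Th P))"
 have lift: "lift P Q g : arrs LL P Q" "al P Q (lift P Q g) = g <#\<^sub>G Th P" if "cen P" "cen Q" "g : N P Q" for P Q g
  using bij_betw_apply[OF bij_betw_inv_into[OF bij[OF that(1,2)]]] bij_betw_inv_into_right[OF bij[OF that(1,2)]] that(3)
  by (auto simp: lift_def)
 have lift_ex: "EX g:N P Q. f = lift P Q g" if c: "cen P" "cen Q" "f : arrs LL P Q" for P Q f
 proof -
  obtain g where "g : N P Q" "al P Q f = g <#\<^sub>G Th P" using bij_betw_apply[OF bij[OF c(1,2)] c(3)] by blast
  thus ?thesis using bij_betw_inv_into_left[OF bij[OF c(1,2)] c(3)] by (auto simp: lift_def)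
 qed
 have lift_eq: "lift P Q g = lift P Q h <-> inv \<^sub>G g \<cdot>\<^sub>G h : Th P"
  if "cen P" "cen Q" "g : N P Q" "h : N P Q" for P Q g h
  using lift(2)[OF that(1,2,3)] lift(2)[OF that(1,2,4)] coset_eq[OF Th_subgroup[OF that(1)]] N_carrier that(3,4)
  by (metis lift_def)
 have inj: "f = f'" if "cen P" "cen Q" "f : arrs LL P Q" "f' : arrs LL P Q" "al P Q f = al P Q f'" for P Q f f'
  using bij[OF that(1,2)] that(3-5) by (meson bij_betw_def inj_onD)
 have lift_cmp: "composite LL P Q R (lift Q R h) (lift P Q g) = lift P R (h \<cdot>\<^sub>G g)"
  if c: "cen P" "cen Q" "cen R" and gh: "g : N P Q" "h : N Q R" for P Q R g h
 proof -
  have m: "h \<cdot>\<^sub>G g : N P R" using N_mult[OF cen_sub[OF c(1)] cen_sub[OF c(2)] gh] .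
  note l = lift[OF c(1,2) gh(1)] lift[OF c(2,3) gh(2)] lift[OF c(1,3) m]
  show ?thesis by (rule inj[OF c(1,3) cmp_closed[OF c l(1,3)] l(5)])
    (simp add: al_cmp[OF c l(1,3)] l coset_mult[OF c(1,2) gh])
 qed
 have lift_pr: "pr P Q (lift P Q g) = ind P g" if "cen P" "cen Q" "g : N P Q" for P Q g
  using al(3)[of P Q "lift P Q g"] lift[OF that] proj_coset[OF that] that objs by simp
 have lift_one: "lift P P \<one>\<^sub>G = ident LL P" if P: "cen P" for P
 proof -
  have "\<one>\<^sub>G : N P P" using j_sub[OF cen_sub[OF P]] by (auto simp: N_iff[OF cen_sub[OF P]])
  note l = lift[OF P P this]
  have "\<one>\<^sub>G <#\<^sub>G Th P = Th P" using G.lcos_mult_one sub_le[OF Th_subgroup[OF P]] by blast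
  thus ?thesis using inj[OF P P l(1) ident_closed[OF P]] l(2) al_ident[OF P] by simp
 qed
 define dl where "dl = (%P Q s. lift P Q (j s))"
 have jN: "j s : N P Q" if "cen P" "s : trp S P Q" for P Q s using j_transporter[OF cen_sub[OF that(1)] that(2)] .
 have sc: "s : car S" if "s : trp S P Q" for P Q s using that by (simp add: trp_def)
 have self: "x : trp S P P" if "cen P" "x : P" for P x using self_transporter[OF cen_sub[OF that(1)] that(2)] .
 have zP: "z : P" if "z : centre S P" for z P using centreD(1)[OF that] .
 have h1: "id_functor (ctc S F) LL dl" unfolding id_functor_def
 proof (intro conjI ballI transporter_category cat)
  show "objs (ctc S F) = objs LL" by (simp add: objs ctc_def)
  fix P assume "P : objs (ctc S F)"
  hence P: "cen P" by (simp add: ctc_def)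
  show "dl P P (ident (ctc S F) P) = ident LL P" using lift_one[OF P] by (simp add: dl_def ctc_def)
  fix Q assume "Q : objs (ctc S F)"
  hence Q: "cen Q" by (simp add: ctc_def)
  show "dl P Q ` arrs (ctc S F) P Q <= arrs LL P Q" using lift(1)[OF P Q jN[OF P]] by (auto simp: dl_def ctc_def)
  fix R assume "R : objs (ctc S F)"
  hence R: "cen R" by (simp add: ctc_def)
  fix a b assume "a : arrs (ctc S F) P Q" "b : arrs (ctc S F) Q R"
  hence ab: "a : trp S P Q" "b : trp S Q R" by (simp_all add: ctc_def)
  show "dl P R (composite (ctc S F) P Q R b a) = composite LL P Q R (dl Q R b) (dl P Q a)"
   using lift_cmp[OF P Q R jN[OF P ab(1)] jN[OF Q ab(2)]] sc[OF ab(1)] sc[OF ab(2)] by (simp add: dl_def ctc_def)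
 qed
 have h2: "pr P Q ` arrs LL P Q = F P Q" if c: "cen P" "cen Q" for P Q
 proof
  show "pr P Q ` arrs LL P Q <= F P Q"
   using lift_ex[OF c] lift_pr[OF c] ind_F[OF cen_sub[OF c(1)] cen_sub[OF c(2)]] by (metis image_subsetI)
  show "F P Q <= pr P Q ` arrs LL P Q"
  proof
   fix ph assume "ph : F P Q"
   then obtain g where "g : N P Q" "ph = ind P g" using F_ind[OF cen_sub[OF c(1)] cen_sub[OF c(2)]] by blast
   thus "ph : pr P Q ` arrs LL P Q" using lift(1)[OF c] lift_pr[OF c] by (metis imageI)
  qed
 qed
 \<comment> \<open>If \<open>s\<close> and \<open>t\<close> have the same image, their quotient lies
   in \<open>Th P\<close> and so centralizes \<open>P\<close>. As \<open>P\<close> is centric, the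
   quotient is in the centre of \<open>P\<close>, which meets \<open>Th P\<close> trivially.\<close>
 have h3: "inj_on (dl P Q) (trp S P Q)" if c: "cen P" "cen Q" for P Q
 proof (rule inj_onI)
  fix s t assume st: "s : trp S P Q" "t : trp S P Q" "dl P Q s = dl P Q t"
  note s = cen_sub[OF c(1)]
  have carr: "s : car S" "t : car S" using st sc by auto
  have "inv \<^sub>G (j s) \<cdot>\<^sub>G j t : Th P"
   using st lift_eq[OF c jN[OF c(1) st(1)] jN[OF c(1) st(2)]] by (simp add: dl_def)
  hence z: "j (inv s \<cdot> t) : Th P" using carr by simp
  have comm: "(inv s \<cdot> t) \<cdot> x = x \<cdot> (inv s \<cdot> t)" if x: "x : P" for x
  proof -
   have "j (inv s \<cdot> t) \<cdot>\<^sub>G j x = j x \<cdot>\<^sub>G j (inv s \<cdot> t)"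
    using Th_centralizes[OF c(1) z] x by (auto simp: centralizer_def)
   hence "j ((inv s \<cdot> t) \<cdot> x) = j (x \<cdot> (inv s \<cdot> t))"
    using carr sub_car[OF s x] by (simp del: jh.hom_inv)
   thus ?thesis using inj_onD[OF j_inj] carr sub_car[OF s x] by (metis inv_closed m_closed)
  qed
  hence "inv s \<cdot> t : centralizer S P" using carr by (auto simp: centralizer_def)
  hence "inv s \<cdot> t : P" using c(1) unfolding centric_def by blast
  hence "inv s \<cdot> t = \<one>" using Th_trivial[OF c(1) _ z] centreI[OF s _ comm] by blast
  thus "s = t" using carr by (metis inv_equality inv_inv inv_closed)
 qed
 have h4: "z = \<one>" if c: "cen P" "cen Q" and f: "f : arrs LL P Q" and z: "z : centre S P"
  and eq: "composite LL P P Q f (dl P P z) = f" for P Q f z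
 proof -
  obtain g where g: "g : N P Q" "f = lift P Q g" using lift_ex[OF c f] by blast
  have jz: "j z : N P P" using jN[OF c(1) self[OF c(1) zP[OF z]]] .
  have "lift P Q (g \<cdot>\<^sub>G j z) = lift P Q g" using eq lift_cmp[OF c(1,1,2) jz g(1)] g(2) by (simp add: dl_def)
  hence "inv \<^sub>G (g \<cdot>\<^sub>G j z) \<cdot>\<^sub>G g : Th P"
   using lift_eq[OF c N_mult[OF cen_sub[OF c(1)] cen_sub[OF c(1)] jz g(1)] g(1)] by simp
  moreover have "inv \<^sub>G (g \<cdot>\<^sub>G j z) \<cdot>\<^sub>G g = inv \<^sub>G (j z)"
   using N_carrier[OF g(1)] N_carrier[OF jz] by (simp add: G.gnorm)
  ultimately have "inv \<^sub>G (inv \<^sub>G (j z)) : Th P" using sub_inv[OF Th_subgroup[OF c(1)]] by metis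
  thus ?thesis using Th_trivial[OF c(1) z] N_carrier[OF jz] by simp
 qed
 have h5: "pr P Q f = pr P Q f' <-> (EX z:centre S P. f' = composite LL P P Q f (dl P P z))"
  if c: "cen P" "cen Q" and f: "f : arrs LL P Q" "f' : arrs LL P Q" for P Q f f'
 proof
  note s = cen_sub[OF c(1)] cen_sub[OF c(2)]
  obtain g g' where g: "g : N P Q" "f = lift P Q g" "g' : N P Q" "f' = lift P Q g'"
   using lift_ex[OF c f(1)] lift_ex[OF c f(2)] by blast
  have gc: "g : car G" "g' : car G" using g N_carrier by auto
  {
   assume "pr P Q f = pr P Q f'"
   hence "ind P g = ind P g'" using lift_pr[OF c] g by simp
   \<comment> \<open>Elements that induce the same map differ by an element of the centralizer. Its
     factor in \<open>Th P\<close> disappears in the coset, and its factor in the centre is the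
     required \<open>z\<close>.\<close>
   then obtain z t where zt: "z : centre S P" "t : Th P" "inv \<^sub>G g \<cdot>\<^sub>G g' = j z \<cdot>\<^sub>G t"
    using Th_complement[OF c(1) ind_eq_centralizer[OF s g(1,3)]] by blast
   have jz: "j z : N P P" using jN[OF c(1) self[OF c(1) zP[OF zt(1)]]] .
   have tc: "t : car G" using sub_mem[OF Th_subgroup[OF c(1)] zt(2)] .
   have "inv \<^sub>G (g \<cdot>\<^sub>G j z) \<cdot>\<^sub>G g' = inv \<^sub>G (j z) \<cdot>\<^sub>G (inv \<^sub>G g \<cdot>\<^sub>G g')"
    using gc N_carrier[OF jz] by (simp add: G.gnorm)
   also have "... = t" unfolding zt(3) using N_carrier[OF jz] tc by (simp add: G.gnorm)
   finally have "f' = lift P Q (g \<cdot>\<^sub>G j z)"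
    using lift_eq[OF c N_mult[OF s(1,1) jz g(1)] g(3)] g(4) zt(2) by simp
   thus "EX z:centre S P. f' = composite LL P P Q f (dl P P z)"
    using lift_cmp[OF c(1,1,2) jz g(1)] g(2) zt(1) by (intro bexI[of _ z]) (simp_all add: dl_def)
  }
  {
   assume "EX z:centre S P. f' = composite LL P P Q f (dl P P z)"
   then obtain z where z: "z : centre S P" "f' = composite LL P P Q f (dl P P z)" by blast
   have jz: "j z : N P P" using jN[OF c(1) self[OF c(1) zP[OF z(1)]]] .
   have f': "f' = lift P Q (g \<cdot>\<^sub>G j z)" using z(2) lift_cmp[OF c(1,1,2) jz g(1)] g(2) by (simp add: dl_def)
   note m = N_mult[OF s(1,1) jz g(1)]
   have "ind P g = ind P (g \<cdot>\<^sub>G j z)"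
   proof (rule ind_unique[OF s])
    show "ind P g : P \<rightarrow>\<^sub>E Q" using ind_apply(1)[OF s g(1)] by (auto simp: PiE_def ind_def)
    fix x assume x: "x : P"
    have c': "z : car S" "x : car S" using sub_car[OF s(1)] zP[OF z(1)] x by auto
    have "z |> x = x" using centreD(2)[OF z(1) x] c' by (simp add: m_assoc)
    hence "j z |>\<^sub>G j x = j x" using c' by (metis inv_closed jh.hom_inv jh.hom_mult m_closed)
    moreover have "(g \<cdot>\<^sub>G j z) |>\<^sub>G j x =
      g \<cdot>\<^sub>G (j z |>\<^sub>G j x) \<cdot>\<^sub>G inv \<^sub>G g" using gc c' by (simp add: G.gnorm)
    ultimately show "j (ind P g x) = (g \<cdot>\<^sub>G j z) |>\<^sub>G j x" using ind_apply(2)[OF s g(1) x] by simp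
   qed
   thus "pr P Q f = pr P Q f'" using lift_pr[OF c g(1)] lift_pr[OF c m] g(2) f' by metis
  }
 qed
 have h6: "pr P Q (dl P Q s) = conj_map S P s" if c: "cen P" "cen Q" and s: "s : trp S P Q" for P Q s
  using lift_pr[OF c jN[OF c(1) s]] ind_j[OF cen_sub[OF c(1)] cen_sub[OF c(2)] s] by (simp add: dl_def)
 have h7: "composite LL P Q Q (dl Q Q (pr P Q f x)) f = composite LL P P Q f (dl P P x)"
  if c: "cen P" "cen Q" and f: "f : arrs LL P Q" and x: "x : P" for P Q f x
 proof -
  note s = cen_sub[OF c(1)] cen_sub[OF c(2)]
  obtain g where g: "g : N P Q" "f = lift P Q g" using lift_ex[OF c f] by blast
  have pr_f: "pr P Q f = ind P g" using g lift_pr[OF c] by simp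
  note i = ind_apply[OF s g(1) x]
  have jx: "j x : N P P" using jN[OF c(1) self[OF c(1) x]] .
  have jy: "j (ind P g x) : N Q Q" using jN[OF c(2) self[OF c(2) i(1)]] .
  have "j (ind P g x) \<cdot>\<^sub>G g = g \<cdot>\<^sub>G j x"
   unfolding i(2) using N_carrier[OF g(1)] N_carrier[OF jx] by (simp add: G.gnorm)
  thus ?thesis unfolding dl_def pr_f unfolding g(2) lift_cmp[OF c(1,2,2) g(1) jy] lift_cmp[OF c(1,1,2) jx g(1)] by simp
 qed
 have "centric_linking_system S F LL pr dl" unfolding centric_linking_system_def
 proof (intro conjI allI impI; (elim conjE)?)
  show "id_functor LL (centric_fusion_cat S F) pr" by (rule pr)
  show "id_functor (ctc S F) LL dl" by (rule h1)
 qed (fact h2 h3 h4 h5 h6 h7)+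
 thus ?thesis by blast
qed

end

section \<open>The kernel of a functor from transporters to a linking system\<close>

text \<open>
  \<open>r P g\<close> is the image in \<open>LL\<close> of \<open>g \<in> N\<^sub>G(P, S)\<close> under a functor from the transporter category of \<open>G\<close>.
\<close>

locale transporter_functor = realised S F G j + linking S F LL pr dl
 for S :: "'a monoid" (structure) and F and G :: "'g monoid" and j
  and LL :: "('a set, 'm) cat" and pr and dl +
 fixes r :: "'a set => 'g => 'm"
 assumes r_closed: "!!P g. cen P ==> g : N P (car S) ==> r P g : mor P (car S)"
  and r_pr: "!!P g. cen P ==> g : N P (car S) ==> pr P (car S) (r P g) = ind P g"
  and r_j: "!!P s. cen P ==> s : car S ==> r P (j s) = dl P (car S) s"
  and r_mult: "!!P Q g h f. cen P ==> cen Q ==> g : N P Q ==> h : N Q (car S) ==> f : mor P Q ==>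
   cmp P Q (car S) (inc Q (car S)) f = r P g ==> r P (h \<cdot>\<^sub>G g) = cmp P Q (car S) (r Q h) f"
begin

abbreviation "U == car S"

lemma U_cen: "cen P ==> cen U" using centric_overgroup sub_self sub_le cen_sub by blast

lemma cen_U: "cen P ==> P <= U" using sub_le cen_sub by blast

lemma N_U: "cen P ==> cen Q ==> g : N P Q ==> g : N P U" using cen_U unfolding trp_def by blast

text \<open>The functor is prescribed for the target \<open>S\<close> only. Restrictions in a
  linking system are unique, so its values for smaller targets, and their compatibility with
  composition, follow.\<close>

definition rho :: "'a set => 'a set => 'g => 'm" where
 "rho P Q g = res P Q U (r P g)"

lemma r_res:
 assumes "cen P" "cen Q" "g : N P Q"
 shows "pr P U (r P g) ` P <= Q"
 using r_pr[OF assms(1) N_U[OF assms]] ind_apply(1)[OF cen_sub[OF assms(1)] cen_sub[OF assms(2)] assms(3)] by auto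

lemma rho:
 assumes "cen P" "cen Q" "g : N P Q"
 shows "rho P Q g : mor P Q" "cmp P Q U (inc Q U) (rho P Q g) = r P g" "pr P Q (rho P Q g) = ind P g" unfolding rho_def
 using res[OF assms(1,2) U_cen[OF assms(1)] r_closed[OF assms(1) N_U[OF assms]] r_res[OF assms] cen_U[OF assms(2)]]
  pr_res[OF assms(1,2) U_cen[OF assms(1)] r_closed[OF assms(1) N_U[OF assms]] r_res[OF assms] cen_U[OF assms(2)]]
  r_pr[OF assms(1) N_U[OF assms]] by simp_all

lemma rho_mult:
 assumes c: "cen P" "cen Q" "cen R" and g: "g : N P Q" and h: "h : N Q R"
 shows "rho P R (h \<cdot>\<^sub>G g) = cmp P Q R (rho Q R h) (rho P Q g)"
proof -
 note U = U_cen[OF c(1)]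
 have "r P (h \<cdot>\<^sub>G g) = cmp P Q U (r Q h) (rho P Q g)"
  by (rule r_mult[OF c(1,2) g N_U[OF c(2,3) h] rho(1,2)[OF c(1,2) g]])
 thus ?thesis
  using res_cmp[OF c(2,1,3) U r_closed[OF c(2) N_U[OF c(2,3) h]] r_res[OF c(2,3) h] cen_U[OF c(3)] rho(1)[OF c(1,2) g]]
  by (simp add: rho_def)
qed

lemma rho_j:
 assumes c: "cen P" "cen Q" and s: "s : trp S P Q"
 shows "rho P Q (j s) = dl P Q s"
proof -
 note U = U_cen[OF c(1)]
 have sc: "s : car S" using s by (simp add: trp_def)
 have "r P (j s) = cmp P Q U (inc Q U) (dl P Q s)"
  using r_j[OF c(1) sc] dl_cmp[OF c U s one_trp[OF cen_sub[OF c(2)] cen_U[OF c(2)]]] sc by simp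
 thus ?thesis using res_unique[OF c U dl_closed[OF c s] cen_U[OF c(2)]] by (simp add: rho_def)
qed

lemma rho_one: "cen P ==> rho P P \<one>\<^sub>G = ident LL P"
 using rho_j[of P P \<one>] one_trp[OF cen_sub subset_refl] dl_one by simp

definition signal :: "'a set => 'g set" where
 "signal P = {g : centralizer G (j ` P). rho P P g = ident LL P}"

lemma centralizer_mem:
 assumes "cen P" "g : centralizer G (j ` P)"
 shows "g : car G" "g : N P P" "ind P g = (\<lambda>x\<in>P. x)"
 using centralizer_N[OF cen_sub[OF assms(1)] assms(2)] N_carrier by auto

lemma signal_subgroup:
 assumes P: "cen P"
 shows "sgp (signal P) G" "sgp (signal P) (G(|carrier := centralizer G (j ` P)|))"
proof -
 note C = centralizer_subgroup[OF cen_sub[OF P]]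
 show *: "sgp (signal P) G"
 proof (rule G.subgroupI)
  show "signal P <= car G" using centralizer_mem(1)[OF P] by (auto simp: signal_def)
  have "\<one>\<^sub>G : signal P" using sub_one[OF C] rho_one[OF P] by (simp add: signal_def)
  thus "signal P ~= {}" by blast
  fix a assume "a : signal P"
  hence a: "a : centralizer G (j ` P)" "rho P P a = ident LL P" by (auto simp: signal_def)
  note aN = centralizer_mem[OF P a(1)]
  have ia: "inv \<^sub>G a : centralizer G (j ` P)" using sub_inv[OF C a(1)] .
  note iaN = centralizer_mem[OF P ia]
  have "rho P P (inv \<^sub>G a \<cdot>\<^sub>G a) = cmp P P P (rho P P (inv \<^sub>G a)) (ident LL P)"
   using rho_mult[OF P P P aN(2) iaN(2)] a(2) by simp
  thus "inv \<^sub>G a : signal P"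
   using cmp_ident(1)[OF P P rho(1)[OF P P iaN(2)]] rho_one[OF P] aN(1) ia by (simp add: signal_def)
  fix b assume "b : signal P"
  hence b: "b : centralizer G (j ` P)" "rho P P b = ident LL P" by (auto simp: signal_def)
  have "rho P P (a \<cdot>\<^sub>G b) = ident LL P"
   using rho_mult[OF P P P centralizer_mem(2)[OF P b(1)] aN(2)] a(2) b(2) cmp_ident(1)[OF P P ident_closed[OF P]] by simp
  thus "a \<cdot>\<^sub>G b : signal P" using sub_mult[OF C a(1) b(1)] by (simp add: signal_def)
 qed
 show "sgp (signal P) (G(|carrier := centralizer G (j ` P)|))" using G.subgroup_incl[OF * C] by (auto simp: signal_def)
qed

text \<open>Equal images force equal conjugation maps, so the quotient of \<open>g\<close> and
  \<open>h\<close> lies in the centralizer; the monomorphism property then cancels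
  \<open>rho P Q g\<close> and places the quotient in the kernel.\<close>

lemma signal_iff:
 assumes c: "cen P" "cen Q" and g: "g : N P Q" "h : N P Q"
 shows "rho P Q g = rho P Q h <-> inv \<^sub>G g \<cdot>\<^sub>G h : signal P"
proof -
 note s = cen_sub[OF c(1)] cen_sub[OF c(2)]
 have gc: "g : car G" "h : car G" using g N_carrier by auto
 let ?x = "inv \<^sub>G g \<cdot>\<^sub>G h"
 have gx: "g \<cdot>\<^sub>G ?x = h" using gc by (simp add: G.gnorm)
 have key: "rho P Q h = cmp P P Q (rho P Q g) (rho P P ?x)" if "?x : centralizer G (j ` P)"
  using rho_mult[OF c(1,1,2) centralizer_mem(2)[OF c(1) that] g(1)] gx by simp
 show ?thesis
 proof
  assume eq: "rho P Q g = rho P Q h"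
  hence "ind P g = ind P h" using rho(3)[OF c g(1)] rho(3)[OF c g(2)] by simp
  hence x: "?x : centralizer G (j ` P)" using ind_eq_centralizer[OF s g] by blast
  note xm = rho(1)[OF c(1,1) centralizer_mem(2)[OF c(1) x]]
  have "cmp P P Q (rho P Q g) (rho P P ?x) = cmp P P Q (rho P Q g) (ident LL P)"
   using key[OF x] eq cmp_ident(1)[OF c rho(1)[OF c g(1)]] by simp
  hence "rho P P ?x = ident LL P" using mono[OF c(1,1,2) xm ident_closed[OF c(1)] rho(1)[OF c g(1)]] by blast
  thus "?x : signal P" using x by (simp add: signal_def)
 next
  assume "?x : signal P"
  thus "rho P Q g = rho P Q h" using key cmp_ident(1)[OF c rho(1)[OF c g(1)]] by (simp add: signal_def)
 qed
qed

lemma signaliser_signal: "signaliser_functor S F G j signal" unfolding signaliser_functor_def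
proof (intro conjI allI impI)
 fix P assume P: "cen P"
 note s = cen_sub[OF P]
 have zN: "z : trp S P P" "z : car S" "j z : centralizer G (j ` P)" if z: "z : centre S P" for z
 proof -
  have zP: "z : P" using centreD(1)[OF z] .
  show zc: "z : trp S P P" "z : car S" using self_transp[OF P zP] sub_car[OF s zP] by auto
  have "j z \<cdot>\<^sub>G j x = j x \<cdot>\<^sub>G j z" if "x : P" for x
   using centreD(2)[OF z that] zc(2) sub_car[OF s that] by (metis jh.hom_mult)
  thus "j z : centralizer G (j ` P)" using zc(2) by (auto simp: centralizer_def)
 qed
 show "sgp (signal P) (G(|carrier := centralizer G (j ` P)|))" by (rule signal_subgroup(2)[OF P])
 show "j ` centre S P \<inter> signal P = {\<one>\<^sub>G}"
 proof
  show "j ` centre S P \<inter> signal P <= {\<one>\<^sub>G}"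
  proof
   fix y assume "y : j ` centre S P \<inter> signal P"
   then obtain z where z: "z : centre S P" "y = j z" "j z : signal P" by blast
   have "dl P P z = ident LL P" using rho_j[OF P P zN(1)[OF z(1)]] z(3) by (simp add: signal_def)
   hence "z = \<one>" using free[OF P P ident_closed[OF P] z(1)] cmp_ident(1)[OF P P ident_closed[OF P]] by simp
   thus "y : {\<one>\<^sub>G}" using z(2) by simp
  qed
  have "\<one>\<^sub>G = j \<one>" by simp
  thus "{\<one>\<^sub>G} <= j ` centre S P \<inter> signal P"
   using sub_one[OF centre_subgroup[OF s]] sub_one[OF signal_subgroup(1)[OF P]] by blast
 qed
 show "j ` centre S P <#>\<^sub>G signal P = centralizer G (j ` P)"
 proof
  show "j ` centre S P <#>\<^sub>G signal P <= centralizer G (j ` P)" using zN(3) sub_mult[OF centralizer_subgroup[OF s]]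
   by (auto simp: set_mult_def signal_def)
  show "centralizer G (j ` P) <= j ` centre S P <#>\<^sub>G signal P"
  proof
   fix g assume g: "g : centralizer G (j ` P)"
   note gm = centralizer_mem[OF P g]
   \<comment> \<open>An element of the centralizer is sent to an automorphism over the identity,
     that is to \<open>\<delta>(z)\<close> with \<open>z\<close> central. Dividing by
     \<open>z\<close> leaves an element of the kernel.\<close>
   have "pr P P (ident LL P) = pr P P (rho P P g)" using rho(3)[OF P P gm(2)] gm(3) pr_ident[OF P] by simp
   then obtain z where z: "z : centre S P" "rho P P g = cmp P P P (ident LL P) (dl P P z)"
    using fibre[OF P P ident_closed[OF P] rho(1)[OF P P gm(2)]] by blast
   note zm = zN[OF z(1)]
   have "rho P P (j z) = rho P P g" using z(2) rho_j[OF P P zm(1)] cmp_ident(2)[OF P P dl_closed[OF P P zm(1)]] by simp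
   hence "inv \<^sub>G (j z) \<cdot>\<^sub>G g : signal P"
    using signal_iff[OF P P centralizer_mem(2)[OF P zm(3)] gm(2)] by simp
   moreover have "g = j z \<cdot>\<^sub>G (inv \<^sub>G (j z) \<cdot>\<^sub>G g)" using gm(1) zm(2) by (simp add: G.gnorm)
   ultimately show "g : j ` centre S P <#>\<^sub>G signal P" using z(1) unfolding set_mult_def by blast
  qed
 qed
next
 fix P Q g assume "cen P & cen Q & g : N P Q"
 hence c: "cen P" "cen Q" and g: "g : N P Q" by auto
 note s = cen_sub[OF c(1)] cen_sub[OF c(2)]
 have gc: "g : car G" using N_carrier[OF g] .
 show "signal Q <= g <#\<^sub>G signal P #>\<^sub>G inv \<^sub>G g"
 proof
  fix h assume "h : signal Q"
  hence h: "h : centralizer G (j ` Q)" "rho Q Q h = ident LL Q" by (auto simp: signal_def)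
  note hm = centralizer_mem[OF c(2) h(1)]
  \<comment> \<open>A kernel element over \<open>Q\<close> does not alter the image of
    \<open>g\<close>, so its conjugate by the inverse of \<open>g\<close> is a kernel element over
    \<open>P\<close>.\<close>
  have "rho P Q (h \<cdot>\<^sub>G g) = rho P Q g"
   using rho_mult[OF c(1,2,2) g hm(2)] h(2) cmp_ident(2)[OF c rho(1)[OF c g]] by simp
  hence "inv \<^sub>G g \<cdot>\<^sub>G (h \<cdot>\<^sub>G g) : signal P"
   using signal_iff[OF c g N_mult[OF s g hm(2)]] by simp
  moreover have "h = g |>\<^sub>G (inv \<^sub>G g \<cdot>\<^sub>G (h \<cdot>\<^sub>G g))"
   using gc hm(1) by (simp add: G.gnorm)
  ultimately show "h : g <#\<^sub>G signal P #>\<^sub>G inv \<^sub>G g"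
   using G.conj_set[OF gc sub_le[OF signal_subgroup(1)[OF c(1)]]] by blast
 qed
qed

sublocale sig: signaliser S F G j signal by unfold_locales (rule signaliser_signal)

text \<open>Some group element has the right projection, and the central factor that remains is the
  image of an element of \<open>S\<close>.\<close>

lemma rho_surj:
 assumes c: "cen P" "cen Q" and f: "f : mor P Q"
 shows "EX g:N P Q. f = rho P Q g"
proof -
 note s = cen_sub[OF c(1)] cen_sub[OF c(2)]
 obtain g where g: "g : N P Q" "pr P Q f = ind P g" using F_ind[OF s pr_closed[OF c f]] by blast
 then obtain z where z: "z : centre S P" "f = cmp P P Q (rho P Q g) (dl P P z)"
  using fibre[OF c rho(1)[OF c g(1)] f] rho(3)[OF c g(1)] by auto
 have zP: "z : trp S P P" using self_transp[OF c(1) centreD(1)[OF z(1)]] .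
 have "f = rho P Q (g \<cdot>\<^sub>G j z)"
  using z(2) rho_mult[OF c(1,1,2) j_transporter[OF s(1) zP] g(1)] rho_j[OF c(1,1) zP] by simp
 thus ?thesis using N_mult[OF s(1,1) j_transporter[OF s(1) zP] g(1)] by blast
qed

theorem signal_induces: "induces S F G j signal LL pr"
proof -
 let ?D = "signaliser_linking S F G j signal"
 have arrs: "arrs ?D P Q = (%g. g <#\<^sub>G signal P) ` N P Q" for P Q by (simp add: signaliser_linking_def)
 have objs: "objs ?D = {P. cen P}" by (simp add: signaliser_linking_def)
 have cmpD: "composite ?D P Q R Y X = Y <#>\<^sub>G X" for P Q R X Y by (simp add: signaliser_linking_def)
 have identD: "ident ?D P = signal P" for P by (simp add: signaliser_linking_def)
 have one: "\<one>\<^sub>G : N P P" "\<one>\<^sub>G <#\<^sub>G signal P = signal P" if P: "cen P" for P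
  using j_transporter[OF cen_sub[OF P] one_trp[OF cen_sub[OF P] subset_refl]]
   G.lcos_mult_one[OF sub_le[OF signal_subgroup(1)[OF P]]] by auto
 have catD: "is_category ?D" unfolding is_category_def objs cmpD identD arrs
 proof (intro conjI ballI; (elim imageE)?; (simp only: mem_Collect_eq)?)
  fix P assume P: "cen P"
  show "signal P : (%g. g <#\<^sub>G signal P) ` N P P" using one[OF P] by (metis imageI)
 next
  fix P Q R f g x y assume c: "cen P" "cen Q" "cen R" and xy: "x : N P Q" "y : N Q R"
  show "(y <#\<^sub>G signal Q) <#>\<^sub>G (x <#\<^sub>G signal P) : (%g. g <#\<^sub>G signal P) ` N P R"
   using sig.coset_mult[OF c(1,2) xy] N_mult[OF cen_sub[OF c(1)] cen_sub[OF c(2)] xy] by simp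
 next
  fix P Q x assume c: "cen P" "cen Q" and x: "x : N P Q"
  show "(x <#\<^sub>G signal P) <#>\<^sub>G signal P = x <#\<^sub>G signal P"
   using sig.coset_mult[OF c(1,1) one(1)[OF c(1)] x] one(2)[OF c(1)] N_carrier[OF x] by simp
  show "signal Q <#>\<^sub>G (x <#\<^sub>G signal P) = x <#\<^sub>G signal P"
   using sig.coset_mult[OF c x one(1)[OF c(2)]] one(2)[OF c(2)] N_carrier[OF x] by simp
 next
  fix P Q R T x y w assume c: "cen P" "cen Q" "cen R" "cen T" and xy: "x : N P Q" "y : N Q R" "w : N R T"
  note s = cen_sub[OF c(1)] cen_sub[OF c(2)] cen_sub[OF c(3)]
  show "(w <#\<^sub>G signal R) <#>\<^sub>G ((y <#\<^sub>G signal Q) <#>\<^sub>G (x <#\<^sub>G signal P)) =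
    ((w <#\<^sub>G signal R) <#>\<^sub>G (y <#\<^sub>G signal Q)) <#>\<^sub>G (x <#\<^sub>G signal P)"
   using sig.coset_mult[OF c(1,2) xy(1,2)] sig.coset_mult[OF c(1,3) N_mult[OF s(1,2) xy(1,2)] xy(3)]
    sig.coset_mult[OF c(2,3) xy(2,3)] sig.coset_mult[OF c(1,2) xy(1) N_mult[OF s(2,3) xy(2,3)]] N_carrier xy
   by (simp add: G.m_assoc)
 qed
 have proj: "signaliser_proj G j P Q (g <#\<^sub>G signal P) = ind P g" if "cen P" "cen Q" "g : N P Q" for P Q g
  using sig.proj_coset[OF that] .
 have catF: "is_category (centric_fusion_cat S F)" and objsF: "objs (centric_fusion_cat S F) = {P. cen P}"
  using functors(1) by (simp_all add: id_functor_def centric_fusion_cat_def)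
 have projF: "id_functor ?D (centric_fusion_cat S F) (signaliser_proj G j)" unfolding id_functor_def
 proof (intro conjI ballI catD catF)
  show "objs ?D = objs (centric_fusion_cat S F)" by (simp add: objs objsF)
  fix P assume "P : objs ?D"
  hence P: "cen P" by (simp add: objs)
  have "ind P \<one>\<^sub>G = (\<lambda>x\<in>P. x)"
   using centralizer_mem(3)[OF P sub_one[OF centralizer_subgroup[OF cen_sub[OF P]]]] .
  thus "signaliser_proj G j P P (ident ?D P) = ident (centric_fusion_cat S F) P"
   using proj[OF P P one(1)[OF P]] one(2)[OF P] by (simp add: identD centric_fusion_cat_def)
  fix Q assume "Q : objs ?D"
  hence Q: "cen Q" by (simp add: objs)
  show "signaliser_proj G j P Q ` arrs ?D P Q <= arrs (centric_fusion_cat S F) P Q"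
   using proj[OF P Q] ind_F[OF cen_sub[OF P] cen_sub[OF Q]] by (auto simp: arrs centric_fusion_cat_def)
  fix R assume "R : objs ?D"
  hence R: "cen R" by (simp add: objs)
  fix a b assume "a : arrs ?D P Q" "b : arrs ?D Q R"
  then obtain x y where xy: "x : N P Q" "y : N Q R" "a = x <#\<^sub>G signal P" "b = y <#\<^sub>G signal Q"
   by (auto simp: arrs)
  have m: "y \<cdot>\<^sub>G x : N P R" using N_mult[OF cen_sub[OF P] cen_sub[OF Q] xy(1,2)] .
  have "ind P (y \<cdot>\<^sub>G x) = compose P (ind Q y) (ind P x)"
   using rho(3)[OF P R m] rho_mult[OF P Q R xy(1,2)] pr_cmp[OF P Q R rho(1)[OF P Q xy(1)] rho(1)[OF Q R xy(2)]]
    rho(3)[OF P Q xy(1)] rho(3)[OF Q R xy(2)] by simp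
  thus "signaliser_proj G j P R (composite ?D P Q R b a) =
    composite (centric_fusion_cat S F) P Q R (signaliser_proj G j Q R b) (signaliser_proj G j P Q a)"
   using sig.coset_mult[OF P Q xy(1,2)] proj[OF P R m] proj[OF P Q xy(1)] proj[OF Q R xy(2)] xy(3,4)
   by (simp add: cmpD centric_fusion_cat_def)
 qed
 \<comment> \<open>Any preimage of \<open>f\<close> will do, since all of them lie in one coset of
   \<open>signal P\<close>.\<close>
 define al where "al = (%P Q f. (SOME g. g : N P Q & f = rho P Q g) <#\<^sub>G signal P)"
 have al: "al P Q (rho P Q g) = g <#\<^sub>G signal P" if c: "cen P" "cen Q" and g: "g : N P Q" for P Q g
 proof -
  let ?h = "SOME h. h : N P Q & rho P Q g = rho P Q h"
  have h: "?h : N P Q & rho P Q g = rho P Q ?h" by (rule someI[of _ g]) (use g in simp)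
  hence "inv \<^sub>G g \<cdot>\<^sub>G ?h : signal P" using signal_iff[OF c g] by blast
  thus ?thesis using coset_eq[OF signal_subgroup(1)[OF c(1)] N_carrier[OF g] N_carrier[OF conjunct1[OF h]]]
   by (simp add: al_def)
 qed
 have alF: "id_functor LL ?D al" unfolding id_functor_def
 proof (intro conjI ballI category catD)
  show "objs LL = objs ?D" by (simp add: objs objs_cen)
  fix P assume "P : objs LL"
  hence P: "cen P" by (simp add: objs_cen)
  show "al P P (ident LL P) = ident ?D P" using al[OF P P one(1)[OF P]] rho_one[OF P] one(2)[OF P] by (simp add: identD)
  fix Q assume "Q : objs LL"
  hence Q: "cen Q" by (simp add: objs_cen)
  show "al P Q ` mor P Q <= arrs ?D P Q"
   using al[OF P Q] rho_surj[OF P Q] unfolding arrs by (metis (no_types, lifting) imageI image_subsetI)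
  fix R assume "R : objs LL"
  hence R: "cen R" by (simp add: objs_cen)
  fix a b assume "a : mor P Q" "b : mor Q R"
  then obtain x y where xy: "x : N P Q" "y : N Q R" "a = rho P Q x" "b = rho Q R y"
   using rho_surj[OF P Q] rho_surj[OF Q R] by metis
  have m: "y \<cdot>\<^sub>G x : N P R" using N_mult[OF cen_sub[OF P] cen_sub[OF Q] xy(1,2)] .
  show "al P R (cmp P Q R b a) = composite ?D P Q R (al Q R b) (al P Q a)"
   using rho_mult[OF P Q R xy(1,2)] al[OF P R m] al[OF P Q xy(1)] al[OF Q R xy(2)]
    sig.coset_mult[OF P Q xy(1,2)] xy(3,4) by (simp add: cmpD)
 qed
 have bij: "bij_betw (al P Q) (mor P Q) (arrs ?D P Q)" if c: "cen P" "cen Q" for P Q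
 proof (rule bij_betw_imageI)
  show "inj_on (al P Q) (mor P Q)"
  proof (rule inj_onI)
   fix f f' assume f: "f : mor P Q" "f' : mor P Q" "al P Q f = al P Q f'"
   obtain g g' where g: "g : N P Q" "f = rho P Q g" "g' : N P Q" "f' = rho P Q g'"
    using rho_surj[OF c f(1)] rho_surj[OF c f(2)] by blast
   thus "f = f'"
    using al[OF c g(1)] al[OF c g(3)] f(3) coset_eq[OF signal_subgroup(1)[OF c(1)] N_carrier[OF g(1)] N_carrier[OF g(3)]]
     signal_iff[OF c g(1,3)] by simp
  qed
  show "al P Q ` mor P Q = arrs ?D P Q"
  proof
   show "al P Q ` mor P Q <= arrs ?D P Q"
    using al[OF c] rho_surj[OF c] unfolding arrs by (metis (no_types, lifting) imageI image_subsetI)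
   show "arrs ?D P Q <= al P Q ` mor P Q"
    unfolding arrs using al[OF c] rho(1)[OF c] by (metis (no_types, lifting) imageI image_subsetI)
  qed
 qed
 have "signaliser_proj G j P Q (al P Q f) = pr P Q f" if c: "cen P" "cen Q" and f: "f : mor P Q" for P Q f
 proof -
  obtain g where g: "g : N P Q" "f = rho P Q g" using rho_surj[OF c f] by blast
  thus ?thesis using al[OF c g(1)] proj[OF c g(1)] rho(3)[OF c g(1)] by simp
 qed
 hence "ALL P:objs LL. ALL Q:objs LL. ALL f:mor P Q. signaliser_proj G j P Q (al P Q f) = pr P Q f" by (simp add: objs_cen)
 moreover have "ALL P:objs LL. ALL Q:objs LL. bij_betw (al P Q) (mor P Q) (arrs ?D P Q)" using bij by (simp add: objs_cen)
 ultimately show ?thesis unfolding induces_def cat_over_iso_def using functors(1) projF alF by blast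
qed

end

section \<open>Functors defined by moves\<close>

lemma (in group) group_fusion_system:
 fixes S :: "'s monoid"
 assumes S: "group S" and j: "j : mon S G"
 shows "fusion_system S (group_fusion G j)"
proof -
 interpret S: group S by fact
 interpret jh: group_hom S G j using j by unfold_locales (simp add: mon_def)
 have j_inj: "inj_on j (car S)" using j by (simp add: mon_def)
 have jc: "j ` P <= car G" "P <= car S" if "sgp P S" for P using sub_le[OF that] by auto
 have gf: "ph : group_fusion G j P Q <-> ph : P \<rightarrow>\<^sub>E Q & (EX g:car G. ALL x:P. j (ph x) = g |> j x)"
  if "sgp P S" for P Q ph
 proof -
  have "g : trp G (j ` P) (j ` Q)" if "ph : P \<rightarrow>\<^sub>E Q" "g : car G" "ALL x:P. j (ph x) = g |> j x" for g
   using that(1,2) that(3)[rule_format, symmetric] by (auto simp: trp_iff[OF jc(1)[OF \<open>sgp P S\<close>]])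
  moreover have "g : car G" if "g : trp G (j ` P) (j ` Q)" for g using that by (simp add: trp_def)
  ultimately show ?thesis unfolding group_fusion_def by blast
 qed
 have hom: "ph : mon (S(|carrier := P|)) (S(|carrier := Q|))"
  if P: "sgp P S" and Q: "sgp Q S" and ph: "ph : P \<rightarrow>\<^sub>E Q" and g: "g : car G"
   "!!x. x : P ==> j (ph x) = g |> j x" for P Q ph g
 proof -
  have c: "x : car S" "ph x : car S" "ph x : Q" if "x : P" for x using that jc(2)[OF P] jc(2)[OF Q] ph by auto
  have "ph (x \<cdot>\<^sub>S y) = ph x \<cdot>\<^sub>S ph y" if x: "x : P" and y: "y : P" for x y
  proof -
   have xy: "x \<cdot>\<^sub>S y : P" using sub_mult[OF P x y] .
   have "j (ph (x \<cdot>\<^sub>S y)) = (g |> j x) \<cdot> (g |> j y)"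
    unfolding g(2)[OF xy] using c[OF x] c[OF y] g(1) by (simp add: gnorm)
   hence "j (ph (x \<cdot>\<^sub>S y)) = j (ph x \<cdot>\<^sub>S ph y)" using c[OF x] c[OF y] g(2)[OF x] g(2)[OF y] by simp
   thus ?thesis using inj_onD[OF j_inj] c[OF xy] c[OF x] c[OF y] by simp
  qed
  moreover have "inj_on ph P"
  proof (rule inj_onI)
   fix x y assume xy: "x : P" "y : P" "ph x = ph y"
   hence "g |> j x = g |> j y" using g(2) by metis
   hence "j x = j y" using inj_onD[OF conj_inj[OF g(1)]] c xy by simp
   thus "x = y" using inj_onD[OF j_inj] c xy by simp
  qed
  ultimately show ?thesis using c by (auto simp: mon_def hom_def)
 qed
 have comp: "compose P ps ph : group_fusion G j P R"
  if P: "sgp P S" and Q: "sgp Q S" and ph: "ph : group_fusion G j P Q" and ps: "ps : group_fusion G j Q R" for P Q R ph ps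
 proof -
  obtain g where g: "ph : P \<rightarrow>\<^sub>E Q" "g : car G" "!!x. x : P ==> j (ph x) = g |> j x"
   using ph[unfolded gf[OF P]] by blast
  obtain h where h: "ps : Q \<rightarrow>\<^sub>E R" "h : car G" "!!x. x : Q ==> j (ps x) = h |> j x"
   using ps[unfolded gf[OF Q]] by blast
  have "j (compose P ps ph x) = (h \<cdot> g) |> j x" if x: "x : P" for x
  proof -
   have xc: "x : car S" "ph x : Q" using x jc(2)[OF P] g(1) by auto
   thus ?thesis using x h(3)[OF xc(2)] g(3)[OF x] g(2) h(2) by (simp add: compose_def gnorm)
  qed
  moreover have "compose P ps ph : P \<rightarrow>\<^sub>E R" using g(1) h(1) by (auto simp: compose_def)
  ultimately show ?thesis unfolding gf[OF P] using m_closed[OF h(2) g(2)] by blast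
 qed
 have img: "sgp (ph ` P) S" if P: "sgp P S" and Q: "sgp Q S" and ph: "ph : group_fusion G j P Q" for P Q ph
 proof -
  obtain g where "ph : P \<rightarrow>\<^sub>E Q" "g : car G" "!!x. x : P ==> j (ph x) = g |> j x"
   using ph[unfolded gf[OF P]] by blast
  hence "ph : mon (S(|carrier := P|)) (S(|carrier := Q|))" using hom[OF P Q] by blast
  hence "group_hom (S(|carrier := P|)) S ph"
   using S.subgroup_imp_group[OF P] jc(2)[OF Q] by (auto simp: group_hom_def group_hom_axioms_def mon_def hom_def)
  from group_hom.img_is_subgroup[OF this] show ?thesis by simp
 qed
 have iso: "EX R al. sgp R S & R <= Q & al : fusion_iso (group_fusion G j) P R & ph = compose P (\<lambda>x\<in>R. x) al"
  if P: "sgp P S" and Q: "sgp Q S" and ph: "ph : group_fusion G j P Q" for P Q ph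
 proof (intro exI conjI)
  obtain g where g: "ph : P \<rightarrow>\<^sub>E Q" "g : car G" "!!x. x : P ==> j (ph x) = g |> j x"
   using ph[unfolded gf[OF P]] by blast
  have inj: "inj_on ph P" using hom[OF P Q g] by (simp add: mon_def)
  show R: "sgp (ph ` P) S" by (rule img[OF P Q ph])
  show "ph ` P <= Q" using g(1) by auto
  show "ph = compose P (\<lambda>x\<in>ph ` P. x) ph"
   using g(1) by (intro extensionalityI[of _ P]) (auto simp: compose_def PiE_def)
  define bt where "bt = (\<lambda>y\<in>ph ` P. inv_into P ph y)"
  have bt: "bt (ph x) = x" if "x : P" for x using that inj by (simp add: bt_def)
  have "j (bt y) = inv g |> j y" if "y : ph ` P" for y
  proof -
   obtain x where x: "x : P" "y = ph x" using \<open>y : ph ` P\<close> by blast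
   have "x : car S" using x jc(2)[OF P] by blast
   thus ?thesis using x bt g(3)[OF x(1)] g(2) by (simp add: gnorm)
  qed
  moreover have "bt : ph ` P \<rightarrow>\<^sub>E P" using bt by (auto simp: bt_def inv_into_into)
  ultimately have "bt : group_fusion G j (ph ` P) P" unfolding gf[OF R] using inv_closed[OF g(2)] by blast
  moreover have "ph : group_fusion G j P (ph ` P)" unfolding gf[OF P] using g by auto
  moreover have "compose P bt ph = (\<lambda>x\<in>P. x)" using bt by (auto simp: compose_def)
  moreover have "compose (ph ` P) ph bt = (\<lambda>y\<in>ph ` P. y)"
   using bt by (intro extensionalityI[of _ "ph ` P"]) (auto simp: compose_def)
  ultimately show "ph : fusion_iso (group_fusion G j) P (ph ` P)" unfolding fusion_iso_def by blast
 qed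
 have conj: "conj_map S P s : group_fusion G j P Q" if P: "sgp P S" and s: "s : trp S P Q" for P Q s
 proof -
  have s': "s : car S" "!!x. x : P ==> s |>\<^sub>S x : Q" using s S.trp_iff[OF jc(2)[OF P]] by auto
  have "j (conj_map S P s x) = j s |> j x" if "x : P" for x using that s'(1) jc(2)[OF P] by (auto simp: conj_map_def)
  moreover have "conj_map S P s : P \<rightarrow>\<^sub>E Q" using s'(2) by (auto simp: conj_map_def)
  ultimately show ?thesis unfolding gf[OF P] using jh.hom_closed[OF s'(1)] by blast
 qed
 show ?thesis unfolding fusion_system_def
 proof (intro conjI allI impI; elim conjE)
  fix P Q ph assume *: "sgp P S" "sgp Q S" "ph : group_fusion G j P Q"
  then obtain g where g: "ph : P \<rightarrow>\<^sub>E Q" "g : car G" "!!x. x : P ==> j (ph x) = g |> j x"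
   using *(3)[unfolded gf[OF *(1)]] by blast
  show "ph : mon (S(|carrier := P|)) (S(|carrier := Q|))" by (rule hom[OF *(1,2) g])
  show "ph : extensional P" using g(1) by (simp add: PiE_def)
 qed (assumption | rule conj comp iso | elim conjE, assumption)+
qed

text \<open>A value is chosen at one point of \<open>N\<close> in each coset of \<open>H\<close> and
  transported to the others. As \<open>N\<close> need not be stable under \<open>H\<close>, the maps
  \<open>m\<close> form a partial action only; its multiplicativity makes the transported values
  consistent.\<close>

lemma (in group) equivariant_choice:
 assumes H: "sgp H G" and N: "N <= car G"
  and Y: "!!g. g : N ==> Y g ~= {}"
   "!!x g y. x : H ==> g : N ==> x \<cdot> g : N ==> y : Y g ==> m x g y : Y (x \<cdot> g)"
   "!!x x' g y. x : H ==> x' : H ==> g : N ==> x \<cdot> g : N ==> x' \<cdot> (x \<cdot> g) : N ==> y : Y g ==>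
    m x' (x \<cdot> g) (m x g y) = m (x' \<cdot> x) g y"
 shows "EX f. ALL g:N. f g : Y g & (ALL x:H. x \<cdot> g : N --> f (x \<cdot> g) = m x g (f g))"
proof -
 have Hc: "h : car G" if "h : H" for h using H that by (rule sub_mem)
 define rep where "rep = (%g. SOME r. r : (H #> g) \<inter> N)"
 have rep: "rep g : N & g \<cdot> inv (rep g) : H" if g: "g : N" for g
 proof -
  have gc: "g : car G" using g N by blast
  have "rep g : (H #> g) \<inter> N" unfolding rep_def by (rule someI[of _ g]) (use rcos_self[OF gc H] g in blast)
  then obtain h where h: "h : H" "rep g = h \<cdot> g" "rep g : N" by (auto simp: r_coset_def)
  hence "g \<cdot> inv (rep g) = inv h" using gc Hc by (simp add: gnorm)
  thus ?thesis using h H by (simp add: sub_inv)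
 qed
 have rep_left: "rep (x \<cdot> g) = rep g" if "x : H" "g : N" for x g
 proof -
  have "x : car G" "g : car G" "H <= car G" using that Hc N by auto
  hence "H #> (x \<cdot> g) = H #> g" using coset_mult_assoc[of H x g] coset_join2[of x H] that H by simp
  thus ?thesis by (simp add: rep_def)
 qed
 define y0 where "y0 = (%g. SOME y. y : Y g)"
 have y0: "y0 g : Y g" if "g : N" for g using Y(1)[OF that] by (simp add: y0_def some_in_eq)
 define f where "f = (%g. m (g \<cdot> inv (rep g)) (rep g) (y0 (rep g)))"
 have split: "g \<cdot> inv (rep g) \<cdot> rep g = g" if "g : N" for g
 proof -
  have "g : car G" "rep g : car G" using that rep[OF that] N by auto
  thus ?thesis by (simp add: gnorm)
 qed
 have "f g : Y g" if g: "g : N" for g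
  using Y(2)[of "g \<cdot> inv (rep g)" "rep g" "y0 (rep g)"] rep[OF g] y0 g split[OF g] by (simp add: f_def)
 moreover have "f (x \<cdot> g) = m x g (f g)" if g: "g : N" and x: "x : H" "x \<cdot> g : N" for g x
 proof -
  have c: "x : car G" "g : car G" "rep g : car G" using Hc x g N rep[OF g] by auto
  have "m x (g \<cdot> inv (rep g) \<cdot> rep g) (m (g \<cdot> inv (rep g)) (rep g) (y0 (rep g))) =
    m (x \<cdot> (g \<cdot> inv (rep g))) (rep g) (y0 (rep g))" using rep[OF g] y0 g x split[OF g] by (intro Y(3)) auto
  thus ?thesis using split[OF g] rep_left[OF x(1) g] c by (simp add: f_def m_assoc)
 qed
 ultimately show ?thesis by (intro exI[of _ f]) blast
qed

context fusion
begin

text \<open>Compose with the inverse of \<open>ph\<close> on its image, which again belongs to the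
  fusion system.\<close>

lemma F_left_cancel:
 assumes s: "sgp P S" "sgp D S" "sgp Q S" and ph: "ph : F D Q" and al: "al : P \<rightarrow>\<^sub>E D"
  and comp: "compose P ph al : F P Q"
 shows "al : F P D"
proof -
 have im: "sgp (ph ` D) S" using F_image[OF s(2,3) ph s(2)] by simp
 obtain bt where bt: "bt : fusion_iso F (ph ` D) D" "ALL x:D. bt (ph x) = x"
  using fusion_iso_inverse[OF F_image_iso[OF s(2,3) ph]] by blast
 have "compose P ph al ` P <= ph ` D" using al by (auto simp: compose_def)
 hence 1: "compose P ph al : F P (ph ` D)" using F_corestrict[OF s(1,3) comp im] by blast
 have "bt : F (ph ` D) D" using bt(1) by (simp add: fusion_iso_def)
 from F_comp[OF s(1) im s(2) 1 this] have "compose P bt (compose P ph al) : F P D" .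
 moreover have "compose P bt (compose P ph al) = al"
  using al bt(2) by (intro extensionalityI[of _ P]) (auto simp: compose_def PiE_def Pi_def)
 ultimately show ?thesis by simp
qed

end

text \<open>
  A move \<open>(ta, D)\<close> multiplies \<open>g\<close> by \<open>ta\<close> if \<open>g P g\<^sup>-\<^sup>1 \<le> D\<close>. The condition says that, for each \<open>P\<close>, all of
  \<open>N\<^sub>G(P, S)\<close> can be reached from \<open>1\<close>.
\<close>

definition connected_moves ::
 "('a, 'h) monoid_scheme => ('g, 'k) monoid_scheme => ('a => 'g) => 'i set => ('i => 'g) => ('i => 'a set) => bool" where
 "connected_moves S G j I ta D <-> (ALL P X. sgp P S --> \<one>\<^sub>G : X -->
   (ALL i:I. ALL g:trp G (j ` P) (j ` D i). g : X <-> ta i \<cdot>\<^sub>G g : X) -->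
   trp G (j ` P) (j ` car S) <= X)"

context realised
begin

lemma ind_mult:
 assumes "sgp P S" "sgp Q S" "sgp R S" "g : N P Q" "h : N Q R"
 shows "ind P (h \<cdot>\<^sub>G g) = compose P (ind Q h) (ind P g)"
proof -
 have "compose P (ind Q h) (ind P g) = ind P (h \<cdot>\<^sub>G g)"
 proof (rule ind_unique[OF assms(1,3)])
  show "compose P (ind Q h) (ind P g) : P \<rightarrow>\<^sub>E R"
   using ind_apply(1)[OF assms(1,2,4)] ind_apply(1)[OF assms(2,3,5)] by (auto simp: compose_def)
  fix x assume x: "x : P"
  note i = ind_apply[OF assms(1,2,4) x]
  have "j (compose P (ind Q h) (ind P g) x) = h |>\<^sub>G (g |>\<^sub>G j x)"
   using x ind_apply(2)[OF assms(2,3,5) i(1)] i(2) by (simp add: compose_def)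
  thus "j (compose P (ind Q h) (ind P g) x) = h \<cdot>\<^sub>G g |>\<^sub>G j x"
   using N_carrier[OF assms(4)] N_carrier[OF assms(5)] sub_car[OF assms(1) x] by (simp add: G.gnorm)
 qed
 thus ?thesis by simp
qed

lemma ind_mem: "sgp P S ==> sgp Q S ==> g : N P Q ==> ind P g : P \<rightarrow>\<^sub>E Q"
 using ind_apply(1) by (auto simp: PiE_def ind_def)

text \<open>Applied with \<open>F\<close> the fusion system of \<open>G\<close> and \<open>F'\<close> a possibly smaller one.\<close>

lemma fusion_of_moves:
 assumes F': "fusion_system S F'" and moves: "connected_moves S G j I ta D"
  and D: "!!i. i : I ==> sgp (D i) S" "!!i. i : I ==> ta i : N (D i) (car S)"
   "!!i. i : I ==> ind (D i) (ta i) : F' (D i) (car S)"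
  and P: "sgp P S" "sgp Q S"
 shows "F P Q <= F' P Q"
proof
 interpret F': fusion S F' using F' is_group by (simp add: fusion_def fusion_axioms_def)
 let ?U = "car S"
 have U: "sgp ?U S" by (rule sub_self)
 \<comment> \<open>This set is closed under moves in both directions: forwards by composition,
   backwards because the map of a move can be cancelled inside \<open>F'\<close>.\<close>
 define X where "X = {g : N P ?U. ind P g : F' P ?U}"
 have one: "\<one>\<^sub>G : N P ?U" using j_transporter[OF P(1) one_trp[OF P(1) sub_le[OF P(1)]]] by simp
 have "ind P \<one>\<^sub>G = (\<lambda>x\<in>P. x)"
  using centralizer_N(2)[OF P(1) sub_one[OF centralizer_subgroup[OF P(1)]]] .
 hence "\<one>\<^sub>G : X" using one F'.F_incl[OF P(1) U sub_le[OF P(1)]] by (simp add: X_def)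
 moreover have "g : X <-> ta i \<cdot>\<^sub>G g : X" if i: "i : I" and g: "g : N P (D i)" for i g
 proof -
  have gU: "g : N P ?U" using g sub_car[OF D(1)[OF i]] unfolding trp_def by blast
  have tg: "ta i \<cdot>\<^sub>G g : N P ?U" by (rule N_mult[OF P(1) D(1)[OF i] g D(2)[OF i]])
  have eq: "ind P (ta i \<cdot>\<^sub>G g) = compose P (ind (D i) (ta i)) (ind P g)"
   by (rule ind_mult[OF P(1) D(1)[OF i] U g D(2)[OF i]])
  have im: "ind P g : P \<rightarrow>\<^sub>E D i" by (rule ind_mem[OF P(1) D(1)[OF i] g])
  show ?thesis
  proof
   assume "g : X"
   hence "ind P g : F' P (D i)" using F'.F_corestrict[OF P(1) U _ D(1)[OF i]] im by (auto simp: X_def)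
   thus "ta i \<cdot>\<^sub>G g : X" using F'.F_comp[OF P(1) D(1)[OF i] U _ D(3)[OF i]] tg eq by (simp add: X_def)
  next
   assume "ta i \<cdot>\<^sub>G g : X"
   hence "compose P (ind (D i) (ta i)) (ind P g) : F' P ?U" using eq by (simp add: X_def)
   hence 1: "ind P g : F' P (D i)" by (rule F'.F_left_cancel[OF P(1) D(1)[OF i] U D(3)[OF i] im])
   have "ind P g : F' P ?U"
   proof -
    have "compose P (\<lambda>x\<in>D i. x) (ind P g) = ind P g"
     using im by (intro extensionalityI[of _ P]) (auto simp: compose_def PiE_def Pi_def)
    thus ?thesis using F'.F_comp[OF P(1) D(1)[OF i] U 1 F'.F_incl[OF D(1)[OF i] U sub_le[OF D(1)[OF i]]]] by simp
   qed
   thus "g : X" using gU by (simp add: X_def)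
  qed
 qed
 ultimately have X: "N P ?U <= X" using moves P(1) unfolding connected_moves_def by blast
 fix ph assume "ph : F P Q"
 then obtain g where g: "g : N P Q" "ph = ind P g" using F_ind[OF P] by blast
 have "g : N P ?U" using g(1) sub_car[OF P(2)] unfolding trp_def by blast
 hence "ind P g : F' P ?U" using X by (auto simp: X_def)
 thus "ph : F' P Q" using F'.F_corestrict[OF P(1) U _ P(2)] ind_mem[OF P g(1)] g(2) by auto
qed

end

section \<open>Lifts of conjugation maps as torsors under the centre\<close>

locale realised_linking = realised S F G j + linking S F LL pr dl
 for S :: "'a monoid" (structure) and F and G :: "'g monoid" and j
  and LL :: "('a set, 'm) cat" and pr and dl
begin

abbreviation "U == car S"

lemma U_cen: "cen P ==> cen U" using centric_overgroup sub_self sub_le cen_sub by blast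

lemma cen_U: "cen P ==> P <= U" using sub_le cen_sub by blast

lemma N_into_U: "cen D ==> g : N P D ==> g : N P U" using cen_U unfolding trp_def by blast

text \<open>For centric \<open>P\<close> and \<open>g\<close> carrying \<open>P\<close> into
  \<open>S\<close>, this is a torsor under the centre of \<open>P\<close>: \<open>scale\<close> is
  the action and \<open>ratio\<close> the difference of two members.\<close>

definition over :: "'a set => 'g => 'm set" where
 "over P g = {f : mor P U. pr P U f = ind P g}"

definition scale :: "'a set => 'm => 'a => 'm" where
 "scale P f z = cmp P P U f (dl P P z)"

text \<open>The effect on lifts of multiplying \<open>g\<close> by an element \<open>t\<close> on
  the left. The lift \<open>l\<close> of \<open>t\<close> is defined on \<open>D\<close> only, so
  \<open>f\<close> is first restricted to take its values there.\<close>

definition move :: "'a set => 'a set => 'm => 'm => 'm" where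
 "move P D l f = cmp P D U l (res P D U f)"

lemma over_nonempty: "cen P ==> g : N P U ==> over P g ~= {}"
 using pr_surj[OF _ U_cen] ind_F[OF cen_sub sub_self] unfolding over_def by blast

lemma over_res:
 assumes "cen P" "cen D" "g : N P D" "f : over P g"
 shows "f : mor P U" "pr P U f ` P <= D" "res P D U f : mor P D" "cmp P D U (inc D U) (res P D U f) = f"
proof -
 show f: "f : mor P U" using assms(4) by (simp add: over_def)
 show i: "pr P U f ` P <= D"
  using assms(4) ind_apply(1)[OF cen_sub[OF assms(1)] cen_sub[OF assms(2)] assms(3)] by (auto simp: over_def)
 show "res P D U f : mor P D" "cmp P D U (inc D U) (res P D U f) = f"
  using res[OF assms(1,2) U_cen[OF assms(1)] f i cen_U[OF assms(2)]] by auto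
qed

lemma move_over:
 assumes "cen P" "cen D" "g : N P D" "f : over P g" "l : over D t" "t : N D U"
 shows "move P D l f : over P (t \<cdot>\<^sub>G g)"
proof -
 note U = U_cen[OF assms(1)]
 note r = over_res[OF assms(1-4)]
 have l: "l : mor D U" "pr D U l = ind D t" using assms(5) by (auto simp: over_def)
 have "pr P U (move P D l f) = compose P (ind D t) (ind P g)"
  using pr_cmp[OF assms(1,2) U r(3) l(1)] l(2) pr_res[OF assms(1,2) U r(1,2) cen_U[OF assms(2)]] assms(4)
  by (simp add: move_def over_def)
 thus ?thesis using cmp_closed[OF assms(1,2) U r(3) l(1)]
   ind_mult[OF cen_sub[OF assms(1)] cen_sub[OF assms(2)] sub_self assms(3,6)] by (simp add: over_def move_def)
qed

lemma move_cancel: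
 assumes "cen P" "cen D" "g : N P D" "f : over P g" "f' : over P g" "l : mor D U"
  and "move P D l f = move P D l f'"
 shows "f = f'"
proof -
 note r = over_res[OF assms(1-4)] over_res[OF assms(1-3,5)]
 have "res P D U f = res P D U f'"
  using mono[OF assms(1,2) U_cen[OF assms(1)] r(3,7) assms(6)] assms(7) by (simp add: move_def)
 thus ?thesis using r(4,8) by metis
qed

lemma move_cmp:
 assumes "cen P" "cen Q" "cen D" "h : N Q D" "k : over Q h" "f : mor P Q" "l : mor D U"
 shows "move P D l (cmp P Q U k f) = cmp P Q U (move Q D l k) f"
proof -
 note U = U_cen[OF assms(1)]
 note r = over_res[OF assms(2-5)]
 show ?thesis
  using res_cmp[OF assms(2,1,3) U r(1,2) cen_U[OF assms(3)] assms(6)] cmp_assoc[OF assms(1-3) U assms(6) r(3) assms(7)]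
  by (simp add: move_def)
qed

lemma centre_transporter: "cen P ==> z : centre S P ==> z : trp S P P" using self_transp centreD(1) by blast

lemma scale_over:
 assumes "cen P" "f : over P g" "z : centre S P"
 shows "scale P f z : over P g"
proof -
 note U = U_cen[OF assms(1)]
 have f: "f : mor P U" using assms(2) by (simp add: over_def)
 have z: "dl P P z : mor P P" "z : P" using dl_closed centre_transporter centreD(1) assms by blast+
 have s: "scale P f z : mor P U" unfolding scale_def by (rule cmp_closed[OF assms(1,1) U z(1) f])
 have "pr P U (scale P f z) = pr P U f"
 proof (rule extensionalityI[of _ P])
  show "pr P U (scale P f z) : extensional P" "pr P U f : extensional P"
   using F_mon(2)[OF cen_sub sub_self pr_closed[OF _ U]] s f assms(1) by blast+
  fix x assume x: "x : P"
  have "z : car S" "x : car S" using sub_car[OF cen_sub[OF assms(1)]] z x by auto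
  hence "z |> x = x" using centreD(2)[OF assms(3) x] by (simp add: m_assoc)
  thus "pr P U (scale P f z) x = pr P U f x"
   using pr_cmp_apply[OF assms(1,1) U z(1) f x] pr_dl_apply[OF assms(1,1) centre_transporter[OF assms(1,3)] x]
   by (simp add: scale_def)
 qed
 thus ?thesis using s assms(2) by (simp add: over_def)
qed

lemma scale_inj:
 assumes "cen P" "f : mor P U" "z : centre S P" "z' : centre S P" "scale P f z = scale P f z'"
 shows "z = z'"
proof -
 note t = centre_transporter[OF assms(1,3)] centre_transporter[OF assms(1,4)]
 have "dl P P z = dl P P z'"
  using mono[OF assms(1,1) U_cen[OF assms(1)] dl_closed[OF assms(1,1) t(1)] dl_closed[OF assms(1,1) t(2)] assms(2)]
   assms(5) by (simp add: scale_def)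
 thus ?thesis using inj_onD[OF dl_inj[OF assms(1,1)]] t by blast
qed

definition ratio :: "'a set => 'm => 'm => 'a" where
 "ratio P f f' = (THE z. z : centre S P & scale P f z = f')"

lemma ratio:
 assumes "cen P" "f : over P g" "f' : over P g"
 shows "ratio P f f' : centre S P" "scale P f (ratio P f f') = f'"
proof -
 have f: "f : mor P U" "f' : mor P U" "pr P U f = pr P U f'" using assms by (auto simp: over_def)
 have "EX! z. z : centre S P & scale P f z = f'"
  using fibre[OF assms(1) U_cen[OF assms(1)] f] scale_inj[OF assms(1) f(1)] unfolding scale_def by metis
 from theI'[OF this] show "ratio P f f' : centre S P" "scale P f (ratio P f f') = f'" by (auto simp: ratio_def)
qed

lemma move_scale:
 assumes "cen P" "cen D" "g : N P D" "f : over P g" "l : mor D U" "z : centre S P"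
 shows "move P D l (scale P f z) = scale P (move P D l f) z" unfolding scale_def
 by (rule move_cmp[OF assms(1,1,2,3,4) dl_closed[OF assms(1,1) centre_transporter[OF assms(1,6)]] assms(5)])

lemma move_dl:
 assumes "cen P" "cen D" "g : N P D" "f : over P g" "s : U"
 shows "move P D (dl D U s) f = cmp P U U (dl U U s) f"
proof -
 note U = U_cen[OF assms(1)]
 note r = over_res[OF assms(1-4)]
 have t: "\<one> : trp S D U" "s : trp S U U"
  using one_trp[OF cen_sub[OF assms(2)] cen_U[OF assms(2)]] self_transp[OF U assms(5)] by auto
 have "dl D U s = cmp D U U (dl U U s) (inc D U)" using dl_cmp[OF assms(2) U U t] assms(5) by simp
 thus ?thesis using cmp_assoc[OF assms(1,2) U U r(3) dl_closed[OF assms(2) U t(1)] dl_closed[OF U U t(2)]] r(4)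
  by (simp add: move_def)
qed

lemma ratio_unique:
 assumes "cen P" "f : over P g" "z : centre S P" "scale P f z = f'"
 shows "ratio P f f' = z"
proof -
 have f: "f : mor P U" "f' : over P g" using assms scale_over by (auto simp: over_def)
 show ?thesis
  using scale_inj[OF assms(1) f(1) ratio(1)[OF assms(1,2) f(2)] assms(3)] ratio(2)[OF assms(1,2) f(2)] assms(4) by simp
qed

lemma left_scale:
 assumes "cen P" "k : mor U U" "f : mor P U" "z : centre S P"
 shows "scale P (cmp P U U k f) z = cmp P U U k (scale P f z)"
 using cmp_assoc[OF assms(1,1) U_cen[OF assms(1)] U_cen[OF assms(1)]
   dl_closed[OF assms(1,1) centre_transporter[OF assms(1,4)]] assms(3,2)] by (simp add: scale_def)

lemma left_dl_over:
 assumes "cen P" "g : N P U" "f : over P g" "s : U"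
 shows "cmp P U U (dl U U s) f : over P (j s \<cdot>\<^sub>G g)"
proof -
 note U = U_cen[OF assms(1)]
 have "dl U U s : over U (j s)" "j s : N U U"
  using pr_dl[OF U U self_transp[OF U assms(4)]] ind_j[OF sub_self sub_self self_transp[OF U assms(4)]]
   dl_closed[OF U U self_transp[OF U assms(4)]] j_transporter[OF sub_self self_transp[OF U assms(4)]]
  by (auto simp: over_def)
 thus ?thesis using move_over[OF assms(1) U assms(2,3)] move_dl[OF assms(1) U assms(2-4)] by metis
qed

lemma left_dl_mult:
 assumes "cen P" "f : mor P U" "s : U" "t : U"
 shows "cmp P U U (dl U U t) (cmp P U U (dl U U s) f) = cmp P U U (dl U U (t \<cdot> s)) f"
proof -
 note U = U_cen[OF assms(1)]
 note t = self_transp[OF U assms(3)] self_transp[OF U assms(4)]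
 show ?thesis
  using cmp_assoc[OF assms(1) U U U assms(2) dl_closed[OF U U t(1)] dl_closed[OF U U t(2)]] dl_cmp[OF U U U t] by simp
qed

text \<open>The last axiom of a linking system carries \<open>u\<close> across \<open>l\<close>. For
  the HNN extension this shows that the correction along an edge is unchanged by the edge
  group.\<close>

lemma move_left:
 assumes "cen P" "cen D" "g : N P D" "f : over P g" "l : mor D U" "u : D"
 shows "move P D l (cmp P U U (dl U U u) f) = cmp P U U (dl U U (pr D U l u)) (move P D l f)"
proof -
 note U = U_cen[OF assms(1)]
 note r = over_res[OF assms(1-4)]
 have u: "u : U" "u : trp S D D" "u : trp S U U" "\<one> : trp S D U"
  using assms(6) cen_U[OF assms(2)] self_transp[OF assms(2)] self_transp[OF U]
   one_trp[OF cen_sub[OF assms(2)] cen_U[OF assms(2)]] by auto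
 have lu: "pr D U l u : U" using F_in[OF cen_sub[OF assms(2)] sub_self pr_closed[OF assms(2) U assms(5)] assms(6)] .
 note d = dl_closed[OF assms(2,2) u(2)] dl_closed[OF U U u(3)] dl_closed[OF assms(2) U u(4)]
 have "cmp P U U (dl U U u) f = cmp P D U (cmp D U U (dl U U u) (inc D U)) (res P D U f)"
  using cmp_assoc[OF assms(1,2) U U r(3) d(3,2)] r(4) by simp
 also have "cmp D U U (dl U U u) (inc D U) = cmp D D U (inc D U) (dl D D u)"
  using dl_cmp[OF assms(2) U U u(4,3)] dl_cmp[OF assms(2,2) U u(2,4)] u(1) by simp
 also have "cmp P D U (cmp D D U (inc D U) (dl D D u)) (res P D U f) = cmp P D U (inc D U) (cmp P D D (dl D D u) (res P D U f))"
  using cmp_assoc[OF assms(1,2,2) U r(3) d(1,3)] by simp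
 finally have "res P D U (cmp P U U (dl U U u) f) = cmp P D D (dl D D u) (res P D U f)"
  using res_unique[OF assms(1,2) U cmp_closed[OF assms(1,2,2) r(3) d(1)] cen_U[OF assms(2)]] by simp
 hence "move P D l (cmp P U U (dl U U u) f) = cmp P D U (cmp D D U l (dl D D u)) (res P D U f)"
  using cmp_assoc[OF assms(1,2,2) U r(3) d(1) assms(5)] by (simp add: move_def)
 also have "cmp D D U l (dl D D u) = cmp D U U (dl U U (pr D U l u)) l" using dl_commute[OF assms(2) U assms(5,6)] by simp
 also have "cmp P D U (cmp D U U (dl U U (pr D U l u)) l) (res P D U f) =
   cmp P U U (dl U U (pr D U l u)) (move P D l f)"
  using cmp_assoc[OF assms(1,2) U U r(3) assms(5) dl_closed[OF U U self_transp[OF U lu]]] by (simp add: move_def)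
 finally show ?thesis .
qed

lemma inc_over:
 assumes "cen P"
 shows "inc P U : over P \<one>\<^sub>G"
proof -
 note s = cen_sub[OF assms]
 have t: "\<one> : trp S P U" using one_trp[OF s cen_U[OF assms]] .
 have "pr P U (inc P U) = ind P (j \<one>)" using pr_dl[OF assms U_cen[OF assms] t] ind_j[OF s sub_self t] by simp
 thus ?thesis using dl_closed[OF assms U_cen[OF assms] t] by (simp add: over_def)
qed

lemma dl_over:
 assumes "cen P" "s : U"
 shows "dl P U s : over P (j s)" "j s : N P U"
proof -
 note sub = cen_sub[OF assms(1)]
 have t: "s : trp S P U" using assms sub_car[OF sub] by (simp add: trp_iff'[OF sub])
 show "dl P U s : over P (j s)"
  using pr_dl[OF assms(1) U_cen[OF assms(1)] t] ind_j[OF sub sub_self t] dl_closed[OF assms(1) U_cen[OF assms(1)] t]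
  by (simp add: over_def)
 show "j s : N P U" by (rule j_transporter[OF sub t])
qed

text \<open>For fixed \<open>g\<close>, the set of \<open>h\<close> at which multiplicativity holds
  contains 1 and is closed under moves in both directions, backwards by \<open>move_cancel\<close>.
  Since moves connect the whole transporter, nothing beyond equivariance under single moves has to
  be checked.\<close>

theorem functor_of_moves:
 assumes moves: "connected_moves S G j I ta D"
  and D: "!!i. i : I ==> cen (D i)" "!!i. i : I ==> ta i : N (D i) U" "!!i. i : I ==> l i : over (D i) (ta i)"
  and r: "!!P. cen P ==> r P \<one>\<^sub>G = inc P U" "!!P g. cen P ==> g : N P U ==> r P g : over P g"
   "!!P g s. cen P ==> g : N P U ==> s : U ==> r P (j s \<cdot>\<^sub>G g) = cmp P U U (dl U U s) (r P g)"
   "!!P g i. cen P ==> i : I ==> g : N P (D i) ==> r P (ta i \<cdot>\<^sub>G g) = move P (D i) (l i) (r P g)"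
 shows "transporter_functor S F G j LL pr dl r"
proof unfold_locales
 show "r P g : mor P U" "pr P U (r P g) = ind P g" if "cen P" "g : N P U" for P g
  using r(2)[OF that] by (auto simp: over_def)
 show "r P (j s) = dl P U s" if P: "cen P" and s: "s : U" for P s
 proof -
  note t = one_trp[OF cen_sub[OF P] cen_U[OF P]] self_transp[OF U_cen[OF P] s]
  have "\<one>\<^sub>G : N P U" using j_transporter[OF cen_sub[OF P] t(1)] by simp
  from r(3)[OF P this s] show ?thesis using r(1)[OF P] dl_cmp[OF P U_cen[OF P] U_cen[OF P] t] s by simp
 qed
 fix P Q g h f
 assume c: "cen P" "cen Q" and g: "g : N P Q" and h: "h : N Q U" and f: "f : mor P Q"
  and eq: "cmp P Q U (inc Q U) f = r P g"
 note s = cen_sub[OF c(1)] cen_sub[OF c(2)]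
 note U = U_cen[OF c(1)]
 define X where "X = {h : car G. r P (h \<cdot>\<^sub>G g) = cmp P Q U (r Q h) f}"
 have gc: "g : car G" using N_carrier[OF g] .
 have "\<one>\<^sub>G : X" using r(1)[OF c(2)] eq gc by (simp add: X_def)
 moreover have "h : X <-> ta i \<cdot>\<^sub>G h : X" if i: "i : I" and h: "h : N Q (D i)" for i h
 proof -
  note Dc = D(1)[OF i]
  have hU: "h : N Q U" using N_into_U[OF Dc h] .
  have hg: "h \<cdot>\<^sub>G g : N P (D i)" by (rule N_mult[OF s g h])
  have hgU: "h \<cdot>\<^sub>G g : N P U" using N_into_U[OF Dc hg] .
  have l: "l i : mor (D i) U" using D(3)[OF i] by (simp add: over_def)
  have kc: "h : car G" "ta i : car G" using N_carrier h D(2)[OF i] by auto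
  have 1: "r P (ta i \<cdot>\<^sub>G h \<cdot>\<^sub>G g) = move P (D i) (l i) (r P (h \<cdot>\<^sub>G g))"
   using r(4)[OF c(1) i hg] kc gc by (simp add: G.m_assoc)
  have 2: "cmp P Q U (r Q (ta i \<cdot>\<^sub>G h)) f = move P (D i) (l i) (cmp P Q U (r Q h) f)"
   using r(4)[OF c(2) i h] move_cmp[OF c Dc h r(2)[OF c(2) hU] f l] by simp
  have k: "cmp P Q U (r Q h) f : over P (h \<cdot>\<^sub>G g)"
  proof -
   have rh: "r Q h : mor Q U" "pr Q U (r Q h) = ind Q h" using r(2)[OF c(2) hU] by (auto simp: over_def)
   have rg: "r P g : over P g" using r(2)[OF c(1) N_into_U[OF c(2) g]] .
   have "f = res P Q U (r P g)" using res_unique[OF c U f cen_U[OF c(2)]] eq by simp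
   hence "pr P Q f = ind P g" using pr_res[OF c U over_res(1,2)[OF c g rg] cen_U[OF c(2)]] rg by (simp add: over_def)
   hence "pr P U (cmp P Q U (r Q h) f) = ind P (h \<cdot>\<^sub>G g)"
    using pr_cmp[OF c U f rh(1)] rh(2) ind_mult[OF s sub_self g hU] by simp
   thus ?thesis using cmp_closed[OF c U f rh(1)] by (simp add: over_def)
  qed
  show ?thesis using 1 2 move_cancel[OF c(1) Dc hg r(2)[OF c(1) hgU] k l] kc by (auto simp: X_def)
 qed
 ultimately have "N Q U <= X" using moves s(2) unfolding connected_moves_def by blast
 thus "r P (h \<cdot>\<^sub>G g) = cmp P Q U (r Q h) f" using h by (auto simp: X_def)
qed

end

section \<open>The corollary for the group of Leary and Stancu\<close>

context hnn_data
begin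

definition move_elt :: "'a + 'a set \<times> ('a => 'a) => ('a + 'a set \<times> ('a => 'a)) word set" where
 "move_elt = case_sum j (%e. inv \<^sub>pG stl e)"

definition move_dom :: "'a + 'a set \<times> ('a => 'a) => 'a set" where
 "move_dom = case_sum (%_. car S) fst"

sublocale gfs: realised S "group_fusion pG j" pG j
proof (intro realised.intro fusion.intro fusion_axioms.intro realised_axioms.intro)
 show "group S" by (rule S.is_group)
 show "fusion_system S (group_fusion pG j)" by (rule pG.group_fusion_system[OF S.is_group j_mon])
 show "group pG" by (rule pG.is_group)
 show "j : mon S pG" by (rule j_mon)
qed simp

lemma stl_transporter:
 assumes "e : Ph"
 shows "inv \<^sub>pG stl e : trp pG (j ` fst e) (j ` car S)"
proof -
 have e: "(fst e, snd e) : Ph" using assms by simp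
 have "inv \<^sub>pG stl e \<cdot>\<^sub>pG j u \<cdot>\<^sub>pG inv \<^sub>pG (inv \<^sub>pG stl e) = j (snd e u)" if "u : fst e" for u
  using stl_conj_inv[OF e that] stl_closed[OF assms] by simp
 thus ?thesis using stl_closed[OF assms] image_in_S[OF e] by (auto simp: gfs.N_iff[OF domain[OF e]])
qed

lemma ind_stable_letter:
 assumes "(P, ph) : Ph" "ph : extensional P"
 shows "gfs.ind P (inv \<^sub>pG stl (P, ph)) = ph"
proof -
 have "ph = gfs.ind P (inv \<^sub>pG stl (P, ph))"
 proof (rule gfs.ind_unique[OF domain[OF assms(1)] S.sub_self])
  show "ph : P \<rightarrow>\<^sub>E car S" using assms image_in_S[OF assms(1)] by (auto simp: PiE_def)
  fix u assume "u : P"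
  thus "j (ph u) = inv \<^sub>pG stl (P, ph) \<cdot>\<^sub>pG j u \<cdot>\<^sub>pG inv \<^sub>pG (inv \<^sub>pG stl (P, ph))"
   using stl_conj_inv[OF assms(1)] stl_closed[OF assms(1)] by simp
 qed
 thus ?thesis by simp
qed

text \<open>Closure under moves by \<open>S\<close> makes the set a union of vertices, and closure
  under the stable letters is closure along edges.\<close>

lemma connected: "connected_moves S pG j (car S <+> Ph) move_elt move_dom" unfolding connected_moves_def
proof (intro allI impI)
 fix P X
 assume P: "sgp P S" and one: "\<one>\<^sub>pG : X"
  and step: "ALL i:car S <+> Ph. ALL g:trp pG (j ` P) (j ` move_dom i). g : X <-> move_elt i \<cdot>\<^sub>pG g : X"
 let ?N = "trp pG (j ` P) (j ` car S)"
 have jP: "j ` P <= car pG" by (rule gfs.j_sub[OF P])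
 have sub: "sgp (j ` P) pG" by (rule jh.subgroup_img_is_subgroup[OF P])
 have left: "x \<cdot>\<^sub>pG g : X \<inter> ?N" if "x : j ` car S" "g : X \<inter> ?N" for x g
 proof -
  obtain s where s: "s : car S" "x = j s" using \<open>x : _\<close> by blast
  have "x \<cdot>\<^sub>pG g : ?N"
   using pG.transporter_left_mult[OF jh.img_is_subgroup jP that(1)] that(2) gfs.N_carrier by blast
  moreover have "x \<cdot>\<^sub>pG g : X"
   using step[rule_format, of "Inl s" g] s that(2) by (auto simp: move_elt_def move_dom_def)
  ultimately show ?thesis by blast
 qed
 have "?N <= X \<inter> ?N"
 proof (rule tree.fixed_tree_connected[OF universal_actions sub, where M = "%e. X \<inter> ?N"])
  show "\<one>\<^sub>pG : X \<inter> ?N" using one gfs.j_transporter[OF P gfs.one_trp[OF P sub_le[OF P]]] by simp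
  fix e g assume e: "e : Ph" and g: "g : trp pG (j ` P) (j ` fst e)"
  have d: "sgp (fst e) S" using domain[of "fst e" "snd e"] e by simp
  have "g : ?N" using g sub_le[OF d] unfolding trp_def by blast
  moreover have "inv \<^sub>pG stl e \<cdot>\<^sub>pG g : ?N" by (rule gfs.N_mult[OF P d g stl_transporter[OF e]])
  moreover have "g : X <-> inv \<^sub>pG stl e \<cdot>\<^sub>pG g : X"
   using step[rule_format, of "Inr e" g] e g by (auto simp: move_elt_def move_dom_def)
  ultimately show "g : X \<inter> ?N <-> inv \<^sub>pG stl e \<cdot>\<^sub>pG g : X \<inter> ?N" by blast
 qed (use left in auto)
 thus "?N <= X" by blast
qed

lemma move_transporter:
 assumes "i : car S <+> Ph"
 shows "sgp (move_dom i) S" "move_elt i : trp pG (j ` move_dom i) (j ` car S)"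
proof -
 show "sgp (move_dom i) S" using assms domain S.sub_self by (auto simp: move_dom_def)
 show "move_elt i : trp pG (j ` move_dom i) (j ` car S)"
  using assms stl_transporter gfs.j_transporter[OF S.sub_self gfs.self_transporter[OF S.sub_self]]
  by (auto simp: move_elt_def move_dom_def)
qed

text \<open>The generators of \<open>F\<close> are induced by stable letters and elements of
  \<open>S\<close>, and conversely every move induces a map of \<open>F\<close>. The vertex groups
  are all represented by the image of \<open>S\<close>, so the local condition for the Sylow
  property holds with trivial conjugation.\<close>

lemma leary_stancu_realises:
 assumes p: "Factorial_Ring.prime p" and order: "EX k. order S = p ^ k"
  and F: "fusion_system S F" and Ph: "leary_stancu_data S F Ph"
 shows "realises p S F pG j"
proof -
 interpret F: fusion S F using F S.is_group by (simp add: fusion_def fusion_axioms_def)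
 let ?U = "car S"
 have Ph_F: "ph : F P ?U" if "(P, ph) : Ph" for P ph using Ph that by (auto simp: leary_stancu_data_def)
 have ext: "ph : extensional P" if "(P, ph) : Ph" for P ph using F.F_mon(2)[OF domain[OF that] S.sub_self Ph_F[OF that]] .
 have gen: "fusion_generated S F ((%(P, ph). (P, ?U, ph)) ` Ph \<union> (%ph. (?U, ?U, ph)) ` inner_auts S ?U)"
  using Ph by (simp add: leary_stancu_data_def)
 have self: "s : trp S ?U ?U" if "s : ?U" for s using gfs.self_transporter[OF S.sub_self that] .
 have "ph : group_fusion pG j P ?U" if "(P, ph) : Ph" for P ph
  using gfs.ind_F[OF domain[OF that] S.sub_self, of "inv \<^sub>pG stl (P, ph)"]
   stl_transporter[OF that] ind_stable_letter[OF that ext[OF that]] by simp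
 moreover have "ph : group_fusion pG j ?U ?U" if "ph : inner_auts S ?U" for ph
  using that gfs.F_conj[OF S.sub_self S.sub_self self] by (auto simp: inner_auts_def)
 ultimately have "ALL (P, Q, ph):(%(P, ph). (P, ?U, ph)) ` Ph \<union> (%ph. (?U, ?U, ph)) ` inner_auts S ?U.
   ph : group_fusion pG j P Q" by auto
 hence sub1: "F P Q <= group_fusion pG j P Q" if "sgp P S" "sgp Q S" for P Q
  using gen gfs.fusion_system that unfolding fusion_generated_def by blast
 have sub2: "group_fusion pG j P Q <= F P Q" if "sgp P S" "sgp Q S" for P Q
 proof (rule gfs.fusion_of_moves[OF F connected _ _ _ that])
  fix i assume i: "i : ?U <+> Ph"
  show "sgp (move_dom i) S" "move_elt i : trp pG (j ` move_dom i) (j ` ?U)" using move_transporter[OF i] by auto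
  show "gfs.ind (move_dom i) (move_elt i) : F (move_dom i) ?U"
   using i gfs.ind_j[OF S.sub_self S.sub_self self] F.F_conj[OF S.sub_self S.sub_self self]
    ind_stable_letter[OF _ ext] Ph_F by (auto simp: move_elt_def move_dom_def)
 qed
 have T: "p_subgroup p pG (j ` ?U)"
  using order card_image[OF j_inj] jh.img_is_subgroup finite_S by (auto simp: p_subgroup_def order_def)
 have "sylow_subgroup p pG (j ` ?U)"
 proof (rule tree.sylow_of_vertices[OF p universal_actions universal_actions T order_refl])
  fix Q assume "p_subgroup p pG Q" "Q <= j ` ?U \<or> (EX e:Ph. Q <= j ` ?U)"
  hence "Q <= j ` ?U" "Q <= car pG" using gfs.j_sub[OF S.sub_self] by auto
  hence "(%a. \<one>\<^sub>pG \<cdot>\<^sub>pG a \<cdot>\<^sub>pG inv \<^sub>pG \<one>\<^sub>pG) ` Q <= j ` ?U" by (auto simp: subset_iff)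
  thus "EX g:car pG. (%a. g |>\<^sub>pG a) ` Q <= j ` ?U" by blast
 qed
 thus ?thesis unfolding realises_def using pG.is_group j_mon sub1 sub2 by blast
qed

end

lemma hnn_dataI:
 assumes "group S" "finite (car S)" "fusion_system S F" "leary_stancu_data S F Ph"
 shows "hnn_data S Ph"
proof -
 interpret F: fusion S F using assms by (simp add: fusion_def fusion_axioms_def)
 have Ph: "sgp P S" "ph : F P (car S)" if "(P, ph) : Ph" for P ph
  using assms(4) that F.centric_subgroup by (auto simp: leary_stancu_data_def)
 have "ph : mon (S(|carrier := P|)) S" if "(P, ph) : Ph" for P ph
  using F.F_mon(1)[OF Ph(1)[OF that] group.sub_self[OF assms(1)] Ph(2)[OF that]] by simp
 thus ?thesis using assms Ph by (simp add: hnn_data_def hnn_data_axioms_def)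
qed

section \<open>Lifting the transporters of the Leary-Stancu group\<close>

locale hnn_linking = H: hnn_data S Ph +
 realised_linking S F "leary_stancu_group S Ph" "leary_stancu_incl S Ph" LL pr dl
 for S :: "'a monoid" (structure) and F and Ph and LL :: "('a set, 'm) cat" and pr and dl +
 assumes Ph_cen: "!!P ph. (P, ph) : Ph ==> centric S F P" and Ph_F: "!!P ph. (P, ph) : Ph ==> ph : F P (car S)"
begin

abbreviation "pG == leary_stancu_group S Ph"
abbreviation "j == leary_stancu_incl S Ph"

definition lift :: "'a set \<times> ('a => 'a) => 'm" where
 "lift e = (SOME l. l : mor (fst e) U & pr (fst e) U l = snd e)"

lemma lift:
 assumes "e : Ph"
 shows "cen (fst e)" "lift e : mor (fst e) U" "pr (fst e) U (lift e) = snd e"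
  "lift e : over (fst e) (inv \<^sub>pG H.stl e)"
proof -
 have e: "(fst e, snd e) : Ph" using assms by simp
 show c: "cen (fst e)" by (rule Ph_cen[OF e])
 have "EX l. l : mor (fst e) U & pr (fst e) U l = snd e" using pr_surj[OF c U_cen[OF c] Ph_F[OF e]] by blast
 from someI_ex[OF this] show l: "lift e : mor (fst e) U" "pr (fst e) U (lift e) = snd e" unfolding lift_def by auto
 have "snd e : extensional (fst e)" using F_mon(2)[OF cen_sub[OF c] H.S.sub_self Ph_F[OF e]] .
 hence "ind (fst e) (inv \<^sub>pG H.stl e) = snd e" using H.ind_stable_letter[OF e] by simp
 thus "lift e : over (fst e) (inv \<^sub>pG H.stl e)" using l by (simp add: over_def)
qed

text \<open>An arbitrary \<open>S\<close>-equivariant lift \<open>f\<close> exists, but along a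
  stable letter it is off by an element of the centre of \<open>P\<close>. The cocycle theorem on
  the tree fixed by \<open>P\<close>, with the centre as label set, supplies a function
  \<open>c\<close> that repairs all edges at once.\<close>

lemma section_exists:
 assumes P: "cen P"
 shows "EX r. r \<one>\<^sub>pG = inc P U & (ALL g:N P U. r g : over P g &
  (ALL s:U. r (j s \<cdot>\<^sub>pG g) = cmp P U U (dl U U s) (r g))) &
  (ALL e:Ph. ALL g:N P (fst e). r (inv \<^sub>pG H.stl e \<cdot>\<^sub>pG g) = move P (fst e) (lift e) (r g))"
proof -
 note s = cen_sub[OF P]
 note Uc = U_cen[OF P]
 have jP: "sgp (j ` P) pG" "j ` P <= j ` U" using H.jh.subgroup_img_is_subgroup[OF s] cen_U[OF P] by auto
 have jinv: "inv_into U j (j t) = t" if "t : U" for t using that H.j_inj by simp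
 let ?t = "%e. inv \<^sub>pG H.stl e"
 have "EX f. ALL g:N P U. f g : over P g &
  (ALL x:j ` U. x \<cdot>\<^sub>pG g : N P U --> f (x \<cdot>\<^sub>pG g) = cmp P U U (dl U U (inv_into U j x)) (f g))"
 proof (rule H.pG.equivariant_choice[OF H.jh.img_is_subgroup])
  show "N P U <= car pG" using N_carrier by blast
  show "over P g ~= {}" if "g : N P U" for g using over_nonempty[OF P that] .
  show "cmp P U U (dl U U (inv_into U j x)) y : over P (x \<cdot>\<^sub>pG g)"
   if "x : j ` U" "g : N P U" "y : over P g" for x g y using left_dl_over[OF P that(2,3)] that(1) jinv by auto
  show "cmp P U U (dl U U (inv_into U j x')) (cmp P U U (dl U U (inv_into U j x)) y) =
    cmp P U U (dl U U (inv_into U j (x' \<cdot>\<^sub>pG x))) y" if "x : j ` U" "x' : j ` U" "y : over P g" for x x' g y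
  proof -
   obtain a b where ab: "a : U" "x = j a" "b : U" "x' = j b" using \<open>x : _\<close> \<open>x' : _\<close> by blast
   have *: "x' \<cdot>\<^sub>pG x = j (b \<cdot> a)" using ab by (simp add: H.j_mult)
   have "inv_into U j (x' \<cdot>\<^sub>pG x) = b \<cdot> a" unfolding * by (rule jinv) (use ab in simp)
   thus ?thesis using left_dl_mult[OF P _ ab(1,3)] that(3) ab jinv by (simp add: over_def)
  qed
 qed
 then obtain f where f: "!!g. g : N P U ==> f g : over P g"
  "!!g x. g : N P U ==> x : j ` U ==> x \<cdot>\<^sub>pG g : N P U ==>
   f (x \<cdot>\<^sub>pG g) = cmp P U U (dl U U (inv_into U j x)) (f g)" by blast
 have left_N: "j a \<cdot>\<^sub>pG g : N P U" if "a : U" "g : N P U" for a g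
  using H.pG.transporter_left_mult[OF H.jh.img_is_subgroup j_sub[OF s], of "j a" g] that N_carrier by blast
 have f_left: "f (j a \<cdot>\<^sub>pG g) = cmp P U U (dl U U a) (f g)" if "a : U" "g : N P U" for a g
  using f(2)[OF that(2) _ left_N[OF that]] that(1) jinv by simp
 have f_mor: "f g : mor P U" if "g : N P U" for g using f(1)[OF that] by (simp add: over_def)
 have e_facts: "g : N P U" "?t e \<cdot>\<^sub>pG g : N P U" if "e : Ph" "g : N P (fst e)" for e g
  using N_into_U[OF lift(1)[OF that(1)] that(2)]
   N_mult[OF s cen_sub[OF lift(1)[OF that(1)]] that(2) H.stl_transporter[OF that(1)]] by auto
 \<comment> \<open>The label \<open>z\<close> at \<open>g\<close> stands for the lift
   \<open>scale P (f g) z\<close>. Moving this lift along the edge and comparing it with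
   \<open>f\<close> at the far end gives the new label. Off the centre \<open>ze\<close> is the
   identity, so that the invariance below is an equality of functions.\<close>
 define ze where "ze = (%e g z. if z : centre S P
   then ratio P (f (?t e \<cdot>\<^sub>pG g)) (move P (fst e) (lift e) (scale P (f g) z)) else z)"
 have mv: "move P (fst e) (lift e) y : over P (?t e \<cdot>\<^sub>pG g)"
  if "e : Ph" "g : N P (fst e)" "y : over P g" for e g y
  using move_over[OF P lift(1)[OF that(1)] that(2,3) lift(4)[OF that(1)] H.stl_transporter[OF that(1)]] .
 have ze: "ze e g z : centre S P" "scale P (f (?t e \<cdot>\<^sub>pG g)) (ze e g z) = move P (fst e) (lift e) (scale P (f g) z)"
  if e: "e : Ph" and g: "g : N P (fst e)" and z: "z : centre S P" for e g z
  using z ratio[OF P f(1)[OF e_facts(2)[OF e g]] mv[OF e g scale_over[OF P f(1)[OF e_facts(1)[OF e g]] z]]]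
  by (auto simp: ze_def)
 have ze_bij: "bij_betw (ze e g) (centre S P) (centre S P)" if e: "e : Ph" and g: "g : N P (fst e)" for e g
 proof -
  have "inj_on (ze e g) (centre S P)"
  proof (rule inj_onI)
   fix z z' assume z: "z : centre S P" "z' : centre S P" "ze e g z = ze e g z'"
   hence "move P (fst e) (lift e) (scale P (f g) z) = move P (fst e) (lift e) (scale P (f g) z')"
    using ze(2)[OF e g z(1)] ze(2)[OF e g z(2)] by simp
   hence "scale P (f g) z = scale P (f g) z'"
    using move_cancel[OF P lift(1)[OF e] g] scale_over[OF P f(1)[OF e_facts(1)[OF e g]]] lift(2)[OF e] z by blast
   thus "z = z'" using scale_inj[OF P f_mor[OF e_facts(1)[OF e g]] z(1,2)] by blast
  qed
  moreover have "ze e g ` centre S P <= centre S P" using ze(1)[OF e g] by blast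
  moreover have "finite (centre S P)" using finite_subset[OF _ H.finite_S] sub_le[OF centre_subgroup[OF s]] by blast
  ultimately show ?thesis by (simp add: bij_betw_def endo_inj_surj)
 qed
 \<comment> \<open>An element \<open>u\<close> of the edge group changes \<open>f\<close> at the
   near end by \<open>u\<close> and at the far end by the image of \<open>u\<close>. By
   \<open>move_left\<close> these changes match, so the comparison is unaffected.\<close>
 have ze_left: "ze e (x \<cdot>\<^sub>pG g) = ze e g" if e: "e : Ph" and g: "g : N P (fst e)" and x: "x : j ` fst e" for e g x
 proof
  fix z
  have e': "(fst e, snd e) : Ph" using e by simp
  obtain u where u: "u : fst e" "x = j u" using x by blast
  have uU: "u : U" "snd e u : U" using H.domain_in_S[OF e' u(1)] H.image_in_S[OF e' u(1)] by auto
  have gN: "g : car pG" "g : N P U" "?t e \<cdot>\<^sub>pG g : N P U" using e_facts[OF e g] N_carrier by auto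
  have tc: "H.stl e : car pG" using H.stl_closed[OF e] .
  have "?t e \<cdot>\<^sub>pG (x \<cdot>\<^sub>pG g) = (?t e \<cdot>\<^sub>pG j u \<cdot>\<^sub>pG H.stl e) \<cdot>\<^sub>pG (?t e \<cdot>\<^sub>pG g)"
   using tc gN(1) uU(1) u(2) H.j_closed by (simp add: H.pG.gnorm)
  also have "... = j (snd e u) \<cdot>\<^sub>pG (?t e \<cdot>\<^sub>pG g)" using H.stl_conj_inv[OF e' u(1)] by simp
  finally have 1: "f (?t e \<cdot>\<^sub>pG (x \<cdot>\<^sub>pG g)) = cmp P U U (dl U U (snd e u)) (f (?t e \<cdot>\<^sub>pG g))"
   using f_left[OF uU(2) gN(3)] by simp
  have 2: "f (x \<cdot>\<^sub>pG g) = cmp P U U (dl U U u) (f g)" using f_left[OF uU(1) gN(2)] u(2) by simp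
  have d: "dl U U u : mor U U" "dl U U (snd e u) : mor U U" using dl_self_closed[OF Uc] uU by auto
  show "ze e (x \<cdot>\<^sub>pG g) z = ze e g z"
  proof (cases "z : centre S P")
   case True
   have "move P (fst e) (lift e) (scale P (f (x \<cdot>\<^sub>pG g)) z) =
     cmp P U U (dl U U (snd e u)) (move P (fst e) (lift e) (scale P (f g) z))"
    using move_left[OF P lift(1)[OF e] g scale_over[OF P f(1)[OF gN(2)] True] lift(2)[OF e] u(1)]
     left_scale[OF P d(1) f_mor[OF gN(2)] True] 2 lift(3)[OF e] by simp
   also have "... = scale P (f (?t e \<cdot>\<^sub>pG (x \<cdot>\<^sub>pG g))) (ze e g z)"
    using left_scale[OF P d(2) f_mor[OF gN(3)] ze(1)[OF e g True]] ze(2)[OF e g True] 1 by simp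
   finally have 3: "scale P (f (?t e \<cdot>\<^sub>pG (x \<cdot>\<^sub>pG g))) (ze e g z) =
     move P (fst e) (lift e) (scale P (f (x \<cdot>\<^sub>pG g)) z)" by simp
   have "f (?t e \<cdot>\<^sub>pG (x \<cdot>\<^sub>pG g)) : over P (j (snd e u) \<cdot>\<^sub>pG (?t e \<cdot>\<^sub>pG g))"
    unfolding 1 by (rule left_dl_over[OF P gN(3) f(1)[OF gN(3)] uU(2)])
   from ratio_unique[OF P this ze(1)[OF e g True] 3] show ?thesis using True by (simp add: ze_def)
  qed (simp add: ze_def)
 qed
 \<comment> \<open>This starting label makes the corrected lift over 1 the inclusion.\<close>
 define lz where "lz = ratio P (f \<one>\<^sub>pG) (inc P U)"
 have one: "\<one>\<^sub>pG : N P U" using dl_over(2)[OF P H.S.one_closed] by simp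
 have lz: "lz : centre S P" "scale P (f \<one>\<^sub>pG) lz = inc P U"
  using ratio[OF P f(1)[OF one] inc_over[OF P]] by (auto simp: lz_def)
 have "EX c ce. c \<one>\<^sub>pG = lz & (ALL g:N P U. c g : centre S P & (ALL x:j ` U. c (x \<cdot>\<^sub>pG g) = c g)) &
   (ALL e:Ph. (ALL g:N P U. ce e g : centre S P & (ALL x:j ` U. ce e (x \<cdot>\<^sub>pG g) = ce e g)) &
    (ALL g:N P (fst e). ce e (?t e \<cdot>\<^sub>pG g) = ze e g (c g)) & (e : Ph --> (ALL g:N P U. ce e g = c g)))"
  by (rule H.tree.fixed_tree_cocycle[OF H.universal_actions jP])
   (rule ze_bij ze_left lz(1); assumption)+
 then obtain c ce where c: "c \<one>\<^sub>pG = lz"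
   "!!g. g : N P U ==> c g : centre S P" "!!g x. g : N P U ==> x : j ` U ==> c (x \<cdot>\<^sub>pG g) = c g"
   "!!e g. e : Ph ==> g : N P (fst e) ==> ce e (?t e \<cdot>\<^sub>pG g) = ze e g (c g)"
   "!!e g. e : Ph ==> g : N P U ==> ce e g = c g" by (elim exE conjE) blast
 define r where "r = (%g. scale P (f g) (c g))"
 have "r \<one>\<^sub>pG = inc P U" using c(1) lz(2) by (simp add: r_def)
 moreover have "r g : over P g" if "g : N P U" for g using scale_over[OF P f(1)[OF that] c(2)[OF that]] by (simp add: r_def)
 moreover have "r (j a \<cdot>\<^sub>pG g) = cmp P U U (dl U U a) (r g)" if g: "g : N P U" and a: "a : U" for g a
  using f_left[OF a g] c(3)[OF g imageI[OF a]] left_scale[OF P dl_self_closed[OF Uc a] f_mor[OF g] c(2)[OF g]]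
  by (simp add: r_def)
 moreover have "r (?t e \<cdot>\<^sub>pG g) = move P (fst e) (lift e) (r g)" if e: "e : Ph" and g: "g : N P (fst e)" for e g
  using ze(2)[OF e g c(2)[OF e_facts(1)[OF e g]]] c(4)[OF e g] c(5)[OF e e_facts(2)[OF e g]] by (simp add: r_def)
 ultimately show ?thesis by blast
qed

theorem signaliser_exists: "EX Th. signaliser_functor S F pG j Th & induces S F pG j Th LL pr"
proof -
 obtain r where r: "!!P. cen P ==> r P \<one>\<^sub>pG = inc P U"
  "!!P g. cen P ==> g : N P U ==> r P g : over P g"
  "!!P g s. cen P ==> g : N P U ==> s : U ==> r P (j s \<cdot>\<^sub>pG g) = cmp P U U (dl U U s) (r P g)"
  "!!P e g. cen P ==> e : Ph ==> g : N P (fst e) ==>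
   r P (inv \<^sub>pG H.stl e \<cdot>\<^sub>pG g) = move P (fst e) (lift e) (r P g)"
 proof -
  have "ALL P. EX r. cen P --> r \<one>\<^sub>pG = inc P U & (ALL g:N P U. r g : over P g &
   (ALL s:U. r (j s \<cdot>\<^sub>pG g) = cmp P U U (dl U U s) (r g))) &
   (ALL e:Ph. ALL g:N P (fst e). r (inv \<^sub>pG H.stl e \<cdot>\<^sub>pG g) = move P (fst e) (lift e) (r g))"
   using section_exists by blast
  then obtain r where "ALL P. cen P --> r P \<one>\<^sub>pG = inc P U & (ALL g:N P U. r P g : over P g &
   (ALL s:U. r P (j s \<cdot>\<^sub>pG g) = cmp P U U (dl U U s) (r P g))) &
   (ALL e:Ph. ALL g:N P (fst e). r P (inv \<^sub>pG H.stl e \<cdot>\<^sub>pG g) = move P (fst e) (lift e) (r P g))"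
   unfolding choice_iff by (elim exE)
  thus thesis by (intro that[of r]) blast+
 qed
 have "transporter_functor S F pG j LL pr dl r"
 proof (cases "EX P. cen P")
  case True
  hence U: "cen U" using U_cen by blast
  show ?thesis
  proof (rule functor_of_moves[OF H.connected, where l = "case_sum (dl U U) lift"])
   fix i assume i: "i : U <+> Ph"
   show "cen (H.move_dom i)" using i U lift(1) by (auto simp: H.move_dom_def)
   show "H.move_elt i : N (H.move_dom i) U" by (rule H.move_transporter(2)[OF i])
   show "case_sum (dl U U) lift i : over (H.move_dom i) (H.move_elt i)"
    using i dl_over(1)[OF U] lift(4) by (auto simp: H.move_dom_def H.move_elt_def)
  next
   fix P g i assume P: "cen P" and i: "i : U <+> Ph" and g: "g : N P (H.move_dom i)"
   show "r P (H.move_elt i \<cdot>\<^sub>pG g) = move P (H.move_dom i) (case_sum (dl U U) lift i) (r P g)"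
   proof (cases i)
    case (Inl s)
    hence "g : N P U" "s : U" using g i by (auto simp: H.move_dom_def)
    thus ?thesis using r(2)[OF P] r(3)[OF P] move_dl[OF P U] Inl by (simp add: H.move_dom_def H.move_elt_def)
   next
    case (Inr e)
    thus ?thesis using r(4)[OF P] g i by (auto simp: H.move_dom_def H.move_elt_def)
   qed
  qed (use r in auto)
 next
  \<comment> \<open>All conditions concern centric subgroups and are vacuous here.\<close>
  case False
  thus ?thesis by unfold_locales auto
 qed
 from transporter_functor.signaliser_signal[OF this] transporter_functor.signal_induces[OF this]
 show ?thesis by blast
qed

end

theorem leary_stancu_signaliser:
 fixes S :: "'a monoid" and LL :: "('a set, 'm) cat"
 assumes p: "Factorial_Ring.prime p" "group S" "finite (car S)" "EX k. order S = p ^ k" "fusion_system S F"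
  and Ph: "leary_stancu_data S F Ph"
 defines "pG == leary_stancu_group S Ph" and "j == leary_stancu_incl S Ph"
 shows "realises p S F pG j"
  and "(EX dl. centric_linking_system S F LL pr dl) <->
   (EX Th. signaliser_functor S F pG j Th & induces S F pG j Th LL pr)"
proof -
 interpret H: hnn_data S Ph by (rule hnn_dataI[OF p(2,3,5) Ph])
 show real: "realises p S F pG j" unfolding pG_def j_def by (rule H.leary_stancu_realises[OF p(1,4,5) Ph])
 interpret R: realised S F pG j
  using real p(2,5) by (simp add: realised_def fusion_def fusion_axioms_def realised_axioms_def realises_def)
 show "(EX dl. centric_linking_system S F LL pr dl) <->
   (EX Th. signaliser_functor S F pG j Th & induces S F pG j Th LL pr)"
 proof
  assume "EX dl. centric_linking_system S F LL pr dl"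
  then obtain dl where dl: "centric_linking_system S F LL pr dl" ..
  interpret linking S F LL pr dl by unfold_locales (rule dl)
  interpret hnn_linking S F Ph LL pr dl
  proof (intro hnn_linking.intro realised_linking.intro hnn_linking_axioms.intro)
   show "realised S F (leary_stancu_group S Ph) (leary_stancu_incl S Ph)"
    using R.realised_axioms by (simp add: pG_def j_def)
   show "centric S F P" "ph : F P (car S)" if "(P, ph) : Ph" for P ph using Ph that by (auto simp: leary_stancu_data_def)
  qed (fact H.hnn_data_axioms linking_axioms)+
  show "EX Th. signaliser_functor S F pG j Th & induces S F pG j Th LL pr"
   using signaliser_exists by (simp add: pG_def j_def)
 next
  assume "EX Th. signaliser_functor S F pG j Th & induces S F pG j Th LL pr"
  then obtain Th where *: "signaliser_functor S F pG j Th" "induces S F pG j Th LL pr" by blast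
  interpret signaliser S F pG j Th by unfold_locales (rule *(1))
  show "EX dl. centric_linking_system S F LL pr dl" by (rule linking_of_signaliser[OF *(2)])
 qed
qed

section \<open>Saturated fusion systems\<close>

lemma (in group) normalizer_iff:
 assumes "A <= car G" "finite A"
 shows "g : normalizer G A <-> g : car G & (ALL a:A. g |> a : A)"
proof -
 have "(%a. g |> a) ` A = A" if "g : car G" "ALL a:A. g |> a : A"
  using that inj_on_subset[OF conj_inj[OF that(1)] assms(1)] by (intro endo_inj_surj[OF assms(2)]) auto
 thus ?thesis using assms(1) conj_set[OF _ assms(1)] by (auto simp: normalizer_def stabilizer_def)
qed

lemma (in group_hom) p_subgroup_image:
 assumes "Factorial_Ring.prime p" "finite (car G)" "order G = p ^ k"
 shows "p_subgroup p H (h ` car G)"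
proof -
 interpret im: group_hom G "H(|carrier := h ` car G|)" h using H.subgroup_imp_group[OF img_is_subgroup] is_group
  by (simp add: group_hom_def group_hom_axioms_def hom_def)
 have "bij_betw (%X. the_elem (h ` X)) (rcosets (kernel G (H(|carrier := h ` car G|)) h)) (h ` car G)"
  using im.FactGroup_iso_set by (simp add: iso_def FactGroup_def)
 hence "card (h ` car G) = card (rcosets (kernel G (H(|carrier := h ` car G|)) h))" by (simp add: bij_betw_same_card)
 hence "card (h ` car G) dvd p ^ k" using G.lagrange[OF im.subgroup_kernel] assms(3) by (metis dvd_triv_left)
 thus ?thesis using assms divides_primepow_nat img_is_subgroup by (auto simp: p_subgroup_def)
qed

context fusion
begin

lemma F_widen:
 assumes "sgp P S" "sgp Q S" "sgp R S" "ph : F P Q" "Q <= R"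
 shows "ph : F P R"
proof -
 have "compose P (\<lambda>x\<in>Q. x) ph = ph"
  using F_in[OF assms(1,2,4)] F_mon(2)[OF assms(1,2,4)] by (intro extensionalityI[of _ P]) (auto simp: compose_def)
 thus ?thesis using F_comp[OF assms(1,2,3,4) F_incl[OF assms(2,3,5)]] by simp
qed

end

locale saturated_fusion = fusion S F for S :: "'a monoid" (structure) and F +
 fixes p :: nat
 assumes p: "Factorial_Ring.prime p" and finite_S: "finite (car S)" and order_S: "EX k. order S = p ^ k"
  and saturated: "saturated p S F"
begin

lemma sub_finite: "sgp P S ==> finite P" using finite_subset[OF sub_le finite_S] .

lemma sub_order:
 assumes "sgp P S"
 shows "EX k. card P = p ^ k"
proof -
 obtain k where "order S = p ^ k" using order_S by blast
 hence "card P dvd p ^ k" using lagrange[OF assms] by (metis dvd_triv_right)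
 thus ?thesis using divides_primepow_nat[OF p] by blast
qed

lemma norm_iff: "sgp P S ==> g : normalizer S P <-> g : car S & (ALL a:P. g |> a : P)"
 by (rule normalizer_iff[OF sub_le sub_finite])

lemma norm_subgroup: "sgp P S ==> sgp (normalizer S P) S" by (rule normalizer_imp_subgroup[OF sub_le])

lemma sub_norm: "sgp P S ==> P <= normalizer S P" using norm_iff sub_car sub_mult sub_inv by (metis subsetI)

lemma norm_transporter: "sgp P S ==> g : normalizer S P <-> g : trp S P P" by (simp add: norm_iff trp_iff')

lemma aut_simps:
 "car (aut_fusion F P) = F P P" "\<one>\<^bsub>aut_fusion F P\<^esub> = (\<lambda>x\<in>P. x)"
 by (simp_all add: aut_fusion_def BijGroup_def)

lemma F_Bij: "sgp P S ==> F P P <= Bij P"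
proof
 fix ph assume P: "sgp P S" and "ph : F P P"
 hence "ph : extensional P" "inj_on ph P" "ph ` P <= P" using F_mon(2) F_inj F_in by blast+
 thus "ph : Bij P" using endo_inj_surj[OF sub_finite[OF P]] by (simp add: Bij_def bij_betw_def)
qed

lemma aut_image: "sgp P S ==> ph : F P P ==> ph ` P = P" using F_Bij by (force simp: Bij_def bij_betw_def)

lemma aut_mult:
 assumes "sgp P S" "ph : F P P" "ps : F P P"
 shows "ps \<cdot>\<^bsub>aut_fusion F P\<^esub> ph = compose P ps ph"
proof -
 have "ph : Bij P" "ps : Bij P" using F_Bij[OF assms(1)] assms(2,3) by auto
 thus ?thesis by (simp add: aut_fusion_def BijGroup_def)
qed

lemma group_aut: 
 assumes P: "sgp P S"
 shows "group (aut_fusion F P)"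
proof (rule groupI)
 let ?A = "aut_fusion F P"
 have id: "(\<lambda>x\<in>P. x) : F P P" using F_incl[OF P P] by simp
 show "\<one>\<^bsub>?A\<^esub> : carrier ?A" using id by (simp add: aut_simps)
 fix x y assume "x : carrier ?A" "y : carrier ?A"
 hence xy: "x : F P P" "y : F P P" by (simp_all add: aut_simps)
 have m: "x \<cdot>\<^bsub>?A\<^esub> y = compose P x y" by (rule aut_mult[OF P xy(2,1)])
 have c: "compose P x y : F P P" by (rule F_comp[OF P P P xy(2,1)])
 show "x \<cdot>\<^bsub>?A\<^esub> y : carrier ?A" using m c by (simp add: aut_simps)
 fix z assume "z : carrier ?A"
 hence z: "z : F P P" by (simp add: aut_simps)
 have "compose P (compose P x y) z = compose P x (compose P y z)" using F_in[OF P P z] by (auto simp: compose_def)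
 thus "x \<cdot>\<^bsub>?A\<^esub> y \<cdot>\<^bsub>?A\<^esub> z = x \<cdot>\<^bsub>?A\<^esub> (y \<cdot>\<^bsub>?A\<^esub> z)"
  using m aut_mult[OF P z c] aut_mult[OF P z xy(2)] aut_mult[OF P F_comp[OF P P P z xy(2)] xy(1)] by simp
next
 let ?A = "aut_fusion F P"
 have id: "(\<lambda>x\<in>P. x) : F P P" using F_incl[OF P P] by simp
 fix x assume "x : carrier ?A"
 hence x: "x : F P P" by (simp add: aut_simps)
 have ex: "x : extensional P" using F_mon(2)[OF P P x] .
 show "\<one>\<^bsub>?A\<^esub> \<cdot>\<^bsub>?A\<^esub> x = x" using aut_mult[OF P x id] ex F_in[OF P P x] 
  by (auto simp: aut_simps compose_def intro!: extensionalityI[of _ P])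
 obtain y where y: "y : fusion_iso F P P" "ALL t:P. y (x t) = t"
  using fusion_iso_inverse[OF F_isoI[OF P P x aut_image[OF P x]]] by blast
 have yF: "y : F P P" using y(1) by (simp add: fusion_iso_def)
 have "compose P y x = (\<lambda>t\<in>P. t)" using y(2) by (auto simp: compose_def)
 thus "EX y:carrier ?A. y \<cdot>\<^bsub>?A\<^esub> x = \<one>\<^bsub>?A\<^esub>"
  using yF aut_mult[OF P x yF] by (auto simp: aut_simps)
qed

text \<open>The map \<open>\<phi> c_g \<phi>^-1\<close> from the definition of the extender. It is a
  homomorphism in \<open>g\<close>, so the normalizer of \<open>P\<close> has a
  \<open>p\<close>-subgroup of \<open>Aut_F(\<phi>(P))\<close> as its image, to which Sylow
  conjugacy applies.\<close>

definition transport :: "'a set => ('a => 'a) => 'a => 'a => 'a" where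
 "transport P ph g = (\<lambda>y\<in>ph ` P. ph (conj_map S P g (inv_into P ph y)))"

lemma transport_apply:
 assumes P: "sgp P S" and ph: "ph : F P (car S)" and x: "x : P"
 shows "transport P ph g (ph x) = ph (g |> x)" using x F_inj[OF P sub_self ph] by (simp add: transport_def conj_map_def)

lemma transport_closed:
 assumes P: "sgp P S" and ph: "ph : F P (car S)" and g: "g : normalizer S P"
 shows "transport P ph g : F (ph ` P) (ph ` P)"
proof -
 have im: "sgp (ph ` P) S" using F_image[OF P sub_self ph P] by simp
 have ph': "ph : F P (ph ` P)" using F_corestrict[OF P sub_self ph im] by simp
 obtain bt where bt: "bt : fusion_iso F (ph ` P) P" "ALL x:P. bt (ph x) = x"
  using fusion_iso_inverse[OF F_image_iso[OF P sub_self ph]] by blast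
 have btF: "bt : F (ph ` P) P" using bt(1) by (simp add: fusion_iso_def)
 have c: "conj_map S P g : F P P" using F_conj[OF P P] g by (simp add: norm_transporter[OF P])
 have "compose (ph ` P) (compose P ph (conj_map S P g)) bt : F (ph ` P) (ph ` P)"
  by (rule F_comp[OF im P im btF F_comp[OF P P im c ph']])
 moreover have "compose (ph ` P) (compose P ph (conj_map S P g)) bt = transport P ph g"
 proof (rule extensionalityI[of _ "ph ` P"])
  fix y assume "y : ph ` P"
  then obtain x where x: "x : P" "y = ph x" by blast
  thus "compose (ph ` P) (compose P ph (conj_map S P g)) bt y = transport P ph g y"
   using bt(2) transport_apply[OF P ph x(1)] by (simp add: compose_def conj_map_def)
 qed (simp_all add: transport_def compose_def)
 ultimately show ?thesis by simp
qed

lemma transport_hom: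
 assumes P: "sgp P S" and ph: "ph : F P (car S)"
 shows "group_hom (S(|carrier := normalizer S P|)) (aut_fusion F (ph ` P)) (transport P ph)"
proof -
 have im: "sgp (ph ` P) S" using F_image[OF P sub_self ph P] by simp
 have "transport P ph (g \<cdot> h) = transport P ph g \<cdot>\<^bsub>aut_fusion F (ph ` P)\<^esub> transport P ph h"
  if g: "g : normalizer S P" and h: "h : normalizer S P" for g h
 proof -
  have gh: "g : car S" "h : car S" using g h norm_iff[OF P] by auto
  have "transport P ph (g \<cdot> h) = compose (ph ` P) (transport P ph g) (transport P ph h)"
  proof (rule extensionalityI[of _ "ph ` P"])
   fix y assume "y : ph ` P"
   then obtain x where x: "x : P" "y = ph x" by blast
   have hx: "h |> x : P" "x : car S" using h x norm_iff[OF P] sub_car[OF P] by auto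
   show "transport P ph (g \<cdot> h) y = compose (ph ` P) (transport P ph g) (transport P ph h) y"
    using x hx gh transport_apply[OF P ph x(1)] transport_apply[OF P ph hx(1)] by (simp add: compose_def gnorm)
  qed (simp_all add: transport_def compose_def)
  thus ?thesis using aut_mult[OF im transport_closed[OF P ph h] transport_closed[OF P ph g]] by simp
 qed
 hence "transport P ph : hom (S(|carrier := normalizer S P|)) (aut_fusion F (ph ` P))"
  using transport_closed[OF P ph] by (intro homI) (auto simp: aut_simps)
 thus ?thesis
  using subgroup_imp_group[OF norm_subgroup[OF P]] group_aut[OF im] by (simp add: group_hom_def group_hom_axioms_def)
qed

lemma transport_id:
 assumes P: "sgp P S"
  and g: "g : normalizer S P"
 shows "transport P (\<lambda>x\<in>P. x) g = conj_map S P g"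
proof (rule extensionalityI[of _ P])
 have id: "(\<lambda>x\<in>P. x) : F P (car S)" using F_incl[OF P sub_self sub_le[OF P]] .
 fix x assume "x : P"
 thus "transport P (\<lambda>x\<in>P. x) g x = conj_map S P g x"
  using transport_apply[OF P id] norm_iff[OF P] g by (auto simp: conj_map_def)
qed (auto simp: transport_def conj_map_def)

text \<open>Transport along the identity is conjugation, so this is the image of a finite
  \<open>p\<close>-group under a homomorphism.\<close>

lemma inner_p_subgroup:
 assumes P: "sgp P S" and K: "sgp K S" "K <= normalizer S P"
 shows "p_subgroup p (aut_fusion F P) (conj_map S P ` K)"
proof -
 have id: "(\<lambda>x\<in>P. x) : F P (car S)" using F_incl[OF P sub_self sub_le[OF P]] .
 interpret t: group_hom "S(|carrier := normalizer S P|)" "aut_fusion F P" "transport P (\<lambda>x\<in>P. x)"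
  using transport_hom[OF P id] by simp
 have "transport P (\<lambda>x\<in>P. x) : hom (S(|carrier := K|)) (aut_fusion F P)"
  using K(2) t.hom_closed t.hom_mult by (intro homI) auto
 then interpret k: group_hom "S(|carrier := K|)" "aut_fusion F P" "transport P (\<lambda>x\<in>P. x)"
  using subgroup_imp_group[OF K(1)] group_aut[OF P] by (simp add: group_hom_def group_hom_axioms_def)
 obtain k where k: "card K = p ^ k" using sub_order[OF K(1)] by blast
 have "p_subgroup p (aut_fusion F P) (transport P (\<lambda>x\<in>P. x) ` K)"
  using k.p_subgroup_image[OF p] sub_finite[OF K(1)] k by (simp add: order_def)
 moreover have "transport P (\<lambda>x\<in>P. x) ` K = conj_map S P ` K"
  using transport_id[OF P] K(2) by (intro image_cong) auto
 ultimately show ?thesis by simp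
qed

text \<open>Conjugating \<open>c_u\<close> by an automorphism \<open>al\<close> gives conjugation by
  \<open>al u\<close>.\<close>

lemma inner_normal:
 assumes P: "sgp P S"
 shows "inner_auts S P \<lhd> aut_fusion F P"
proof -
 interpret A: group "aut_fusion F P" by (rule group_aut[OF P])
 have sub: "sgp (inner_auts S P) (aut_fusion F P)"
  using inner_p_subgroup[OF P P sub_norm[OF P]] by (simp add: p_subgroup_def inner_auts_def)
 have "al |>\<^bsub>aut_fusion F P\<^esub> conj_map S P u = conj_map S P (al u)" if al: "al : F P P" and u: "u : P" for al u
 proof -
  have cl: "conj_map S P u : F P P" "conj_map S P (al u) : F P P"
   using F_conj[OF P P self_transporter[OF P]] u F_in[OF P P al u] by auto
  have "compose P al (conj_map S P u) = compose P (conj_map S P (al u)) al"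
   using F_mult[OF P P al] F_inv[OF P P al] u F_in[OF P P al] sub_mult[OF P] sub_inv[OF P]
   by (auto simp: compose_def conj_map_def)
  hence "al \<cdot>\<^bsub>aut_fusion F P\<^esub> conj_map S P u = conj_map S P (al u) \<cdot>\<^bsub>aut_fusion F P\<^esub> al"
   using aut_mult[OF P] al cl by simp
  moreover have "al : car (aut_fusion F P)" "conj_map S P (al u) : car (aut_fusion F P)"
   using al cl by (simp_all add: aut_simps)
  ultimately show ?thesis by (simp add: A.m_assoc)
 qed
 thus ?thesis unfolding A.normal_inv_iff using sub F_in[OF P P] by (auto simp: inner_auts_def aut_simps)
qed

text \<open>An \<open>h\<close> in \<open>S\<close> that satisfies the equation on \<open>P\<close>
  automatically normalises the image, so the condition can be tested on elements without mention of
  automorphism groups.\<close>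

lemma extender_iff:
 assumes P: "sgp P S" and ph: "ph : F P (car S)"
 shows "g : extender S P ph <-> g : normalizer S P &
  (EX h:car S. ALL x:P. ph (g |> x) = h |> ph x)"
proof -
 have im: "sgp (ph ` P) S" using F_image[OF P sub_self ph P] by simp
 have "transport P ph g : aut_S S (ph ` P) <-> (EX h:car S. ALL x:P. ph (g |> x) = h |> ph x)" if g: "g : normalizer S P"
 proof
  assume "transport P ph g : aut_S S (ph ` P)"
  then obtain h where h: "h : normalizer S (ph ` P)" "transport P ph g = conj_map S (ph ` P) h" by (auto simp: aut_S_def)
  have "ph (g |> x) = h |> ph x" if "x : P" for x
   using transport_apply[OF P ph that, of g] fun_cong[OF h(2), of "ph x"] that by (simp add: conj_map_def)
  thus "EX h:car S. ALL x:P. ph (g |> x) = h |> ph x" using h(1) norm_iff[OF im] by blast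
 next
  assume "EX h:car S. ALL x:P. ph (g |> x) = h |> ph x"
  then obtain h where h: "h : car S" "!!x. x : P ==> ph (g |> x) = h |> ph x" by blast
  have "h |> ph x : ph ` P" if "x : P" for x
  proof -
   have "g |> x : P" using g that norm_iff[OF P] by blast
   thus ?thesis using h(2)[OF that] by (metis imageI)
  qed
  hence "h : normalizer S (ph ` P)" using h(1) norm_iff[OF im] by blast
  moreover have "transport P ph g = conj_map S (ph ` P) h"
  proof (rule extensionalityI[of _ "ph ` P"])
   fix y assume "y : ph ` P"
   then obtain x where "x : P" "y = ph x" by blast
   thus "transport P ph g y = conj_map S (ph ` P) h y" using transport_apply[OF P ph] h(2) by (simp add: conj_map_def)
  qed (auto simp: transport_def conj_map_def)
  ultimately show "transport P ph g : aut_S S (ph ` P)" by (auto simp: aut_S_def)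
 qed
 thus ?thesis unfolding extender_def transport_def by blast
qed

lemma extender_subgroup:
 assumes P: "sgp P S" and ph: "ph : F P (car S)"
 shows "sgp (extender S P ph) S" "P <= extender S P ph"
proof -
 note N = norm_subgroup[OF P]
 have phS: "ph x : car S" if "x : P" for x using F_in[OF P sub_self ph that] .
 show "P <= extender S P ph"
 proof
  fix g assume g: "g : P"
  have "ph (g |> x) = ph g |> ph x" if "x : P" for x using F_mult[OF P sub_self ph] F_inv[OF P sub_self ph] g that
    sub_mult[OF P] sub_inv[OF P] by simp
  thus "g : extender S P ph" unfolding extender_iff[OF P ph] using g sub_norm[OF P] phS by blast
 qed
 hence ne: "extender S P ph ~= {}" using sub_one[OF P] by blast
 show "sgp (extender S P ph) S"
 proof (rule subgroupI[OF _ ne])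
  show "extender S P ph <= car S" using sub_le[OF N] extender_iff[OF P ph] by blast
  fix a assume a: "a : extender S P ph"
  then obtain h where h: "h : car S" "!!x. x : P ==> ph (a |> x) = h |> ph x" and aN: "a : normalizer S P"
   using extender_iff[OF P ph] by blast
  have ac: "a : car S" using aN norm_iff[OF P] by blast
  have iN: "inv a : normalizer S P" using sub_inv[OF N aN] .
  have "ph (inv a |> x) = inv h |> ph x" if x: "x : P" for x
  proof -
   have y: "inv a |> x : P" using iN x norm_iff[OF P] by blast
   have "ph x = h |> ph (inv a |> x)" using h(2)[OF y] ac sub_car[OF P x] by (simp add: gnorm)
   thus ?thesis using h(1) phS[OF y] by (simp add: gnorm)
  qed
  thus "inv a : extender S P ph" unfolding extender_iff[OF P ph] using iN inv_closed[OF h(1)] by blast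
  fix b assume b: "b : extender S P ph"
  then obtain k where k: "k : car S" "!!x. x : P ==> ph (b |> x) = k |> ph x" and bN: "b : normalizer S P"
   using extender_iff[OF P ph] by blast
  have bc: "b : car S" using bN norm_iff[OF P] by blast
  have "ph (a \<cdot> b |> x) = h \<cdot> k |> ph x" if x: "x : P" for x
  proof -
   have y: "b |> x : P" using bN x norm_iff[OF P] by blast
   have "ph (a \<cdot> b |> x) = ph (a |> (b |> x))" using ac bc sub_car[OF P x] by (simp add: gnorm)
   thus ?thesis using h(2)[OF y] k(2)[OF x] h(1) k(1) phS[OF x] by (simp add: gnorm)
  qed
  thus "a \<cdot> b : extender S P ph"
   unfolding extender_iff[OF P ph] using sub_mult[OF N aN bN] m_closed[OF h(1) k(1)] by blast
 qed
qed

lemma extension: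
 assumes "sgp P S" "ph : F P (car S)" "fully_normalized S F (ph ` P)"
 shows "EX ps:F (extender S P ph) (car S). ALL x:P. ps x = ph x"
proof -
 have "fully_centralized S F (ph ` P)"
  using saturated[unfolded saturated_def, THEN conjunct1, rule_format, OF assms(3)] by (rule conjunct1)
 thus ?thesis using saturated[unfolded saturated_def, THEN conjunct2, rule_format, of P ph] assms(1,2) by blast
qed

text \<open>An isomorphism onto \<open>P'\<close> carries \<open>Aut_S(P)\<close> to a
  \<open>p\<close>-subgroup of \<open>Aut_F(P')\<close>, and some automorphism \<open>ci\<close>
  conjugates this into the Sylow subgroup \<open>Aut_S(P')\<close>. After composition with
  \<open>ci\<close> the extender is the whole normalizer.\<close>

lemma extends_to_normalizer:
 assumes P: "sgp P S" and P': "fully_normalized S F P'" and c: "fusion_conj S F P P'"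
 shows "EX ps:F (normalizer S P) (car S). ps ` P = P'"
proof -
 have sP': "sgp P' S" using P' by (simp add: fully_normalized_def)
 obtain ph where ph: "ph : fusion_iso F P P'" using c by (auto simp: fusion_conj_def)
 have im: "ph ` P = P'" by (rule fusion_iso_image[OF P sP' ph])
 have into: "al : F P (car S)" if "al : F P P'" for al by (rule F_widen[OF P sP' sub_self that sub_le[OF sP']])
 have phF: "ph : F P P'" using ph by (simp add: fusion_iso_def)
 interpret t: group_hom "S(|carrier := normalizer S P|)" "aut_fusion F P'" "transport P ph"
  using transport_hom[OF P into[OF phF]] im by simp
 obtain k where k: "card (normalizer S P) = p ^ k" using sub_order[OF norm_subgroup[OF P]] by blast
 have "p_subgroup p (aut_fusion F P') (transport P ph ` normalizer S P)"
  using t.p_subgroup_image[OF p] sub_finite[OF norm_subgroup[OF P]] k by (simp add: order_def)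
 moreover have "sylow_subgroup p (aut_fusion F P') (aut_S S P')"
  using saturated[unfolded saturated_def, THEN conjunct1, rule_format, OF P'] by (rule conjunct2)
 ultimately obtain ci where ci: "ci : car (aut_fusion F P')"
  "ci <#\<^bsub>aut_fusion F P'\<^esub> (transport P ph ` normalizer S P) #>\<^bsub>aut_fusion F P'\<^esub> inv\<^bsub>aut_fusion F P'\<^esub> ci <= aut_S S P'"
  unfolding sylow_subgroup_def by blast
 have ciF: "ci : F P' P'" using ci(1) by (simp add: aut_simps)
 define th where "th = compose P ci ph"
 have th: "th : F P P'" unfolding th_def by (rule F_comp[OF P sP' sP' phF ciF])
 have thim: "th ` P = P'"
  using im aut_image[OF sP' ciF] by (simp add: th_def compose_def image_image[symmetric] del: image_image)
 have "g : extender S P th" if g: "g : normalizer S P" for g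
 proof -
  have tg: "transport P ph g : car (aut_fusion F P')" using t.hom_closed g by simp
  have "ci |>\<^bsub>aut_fusion F P'\<^esub> transport P ph g : aut_S S P'"
  proof -
   have "transport P ph ` normalizer S P <= car (aut_fusion F P')" using t.hom_closed by auto
   from ci(2)[unfolded t.H.conj_set[OF ci(1) this]] show ?thesis using g by blast
  qed
  then obtain h where h: "h : normalizer S P'"
   "ci |>\<^bsub>aut_fusion F P'\<^esub> transport P ph g = conj_map S P' h" by (auto simp: aut_S_def)
  have ch: "conj_map S P' h : F P' P'" using F_conj[OF sP' sP'] h(1) by (simp add: norm_transporter[OF sP'])
  have "ci \<cdot>\<^bsub>aut_fusion F P'\<^esub> transport P ph g = conj_map S P' h \<cdot>\<^bsub>aut_fusion F P'\<^esub> ci"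
   unfolding h(2)[symmetric] using ci(1) tg by (simp add: t.H.gnorm)
  hence eq: "compose P' ci (transport P ph g) = compose P' (conj_map S P' h) ci"
   using aut_mult[OF sP' _ ciF, of "transport P ph g"] aut_mult[OF sP' ciF ch] tg by (simp add: aut_simps)
  have "th (g |> x) = h |> th x" if x: "x : P" for x
  proof -
   have gx: "g |> x : P" using g x norm_iff[OF P] by blast
   have phx: "ph x : P'" using F_in[OF P sP' phF x] .
   have "ci (transport P ph g (ph x)) = conj_map S P' h (ci (ph x))"
    using fun_cong[OF eq, of "ph x"] phx by (simp add: compose_def)
   thus ?thesis using transport_apply[OF P into[OF phF] x] gx x F_in[OF sP' sP' ciF phx]
    by (simp add: th_def compose_def conj_map_def)
  qed
  thus ?thesis unfolding extender_iff[OF P into[OF th]] using g h(1) norm_iff[OF sP'] by blast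
 qed
 moreover have "extender S P th <= normalizer S P" using extender_iff[OF P into[OF th]] by blast
 ultimately have "extender S P th = normalizer S P" by blast
 then obtain ps where "ps : F (normalizer S P) (car S)" "ALL x:P. ps x = th x"
  using extension[OF P into[OF th]] P' thim by auto
 thus ?thesis using thim by (intro bexI[of _ ps]) (auto simp: image_def)
qed

section \<open>Ingredients of Alperin's fusion theorem\<close>

lemma norm_grows:
 assumes P: "sgp P S" "P ~= car S"
 shows "P \<subset> normalizer S P"
proof -
 have "p_subgroup p S (car S)" using sub_self finite_S order_S by (simp add: p_subgroup_def order_def)
 moreover have "P \<subset> car S" using sub_le[OF P(1)] P(2) by blast
 ultimately obtain x where "x : car S - P" "ALL h:P. x |> h : P" using p_group_normalizer_grows[OF p _ P(1)] by blast
 thus ?thesis using sub_norm[OF P(1)] norm_iff[OF P(1)] by blast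
qed

lemma fully_normalized_exists:
 assumes P: "sgp P S"
 shows "EX P'. fusion_conj S F P P' & fully_normalized S F P'"
proof -
 have "EX P'. fusion_conj S F P P' & (ALL Q. fusion_conj S F P Q --> card (normalizer S Q) <= card (normalizer S P'))"
 proof (rule ex_has_greatest_nat[where b = "Suc (card (car S))"])
  show "fusion_conj S F P P" by (rule fusion_conj_refl[OF P])
  show "ALL Q. fusion_conj S F P Q --> card (normalizer S Q) < Suc (card (car S))"
   using card_mono[OF finite_S sub_le[OF norm_subgroup]] by (auto simp: fusion_conj_def less_Suc_eq_le)
 qed
 then obtain P' where P': "fusion_conj S F P P'" "!!Q. fusion_conj S F P Q ==> card (normalizer S Q) <= card (normalizer S P')" by blast
 have "fully_normalized S F P'"
  unfolding fully_normalized_def using P' fusion_conj_trans[OF P'(1)] by (auto simp: fusion_conj_def)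
 thus ?thesis using P'(1) by blast
qed


text \<open>Otherwise \<open>P\<close> contains its centralizer. The image of that centralizer
  centralizes each conjugate \<open>Q\<close>, and since \<open>P\<close> is fully centralized it is
  the entire centralizer of \<open>Q\<close>, contained in \<open>Q\<close>; so \<open>P\<close>
  would be centric.\<close>

lemma not_centric_moves:
 assumes P: "fully_normalized S F P" "\<not> centric S F P"
 shows "EX g:normalizer S P - P. ALL x:P. g |> x = x"
proof (rule ccontr)
 assume no: "\<not> ?thesis"
 have sP: "sgp P S" using P(1) by (simp add: fully_normalized_def)
 have C: "centralizer S P <= P"
 proof
  fix g assume g: "g : centralizer S P"
  hence fix_P: "g |> x = x" if "x : P" for x using that sub_car[OF sP that] by (simp add: centralizer_def m_assoc)
  hence "g : normalizer S P" using g by (simp add: norm_iff[OF sP] centralizer_def)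
  thus "g : P" using no fix_P by blast
 qed
 have "fully_centralized S F P"
  using saturated[unfolded saturated_def, THEN conjunct1, rule_format, OF P(1)] by (rule conjunct1)
 hence max: "card (centralizer S Q) <= card (centralizer S P)" if "fusion_conj S F P Q" for Q
  using that by (simp add: fully_centralized_def)
 have "centralizer S Q <= Q" if Q: "fusion_conj S F P Q" for Q
 proof -
  obtain ph where ph: "ph : fusion_iso F P Q" using Q by (auto simp: fusion_conj_def)
  have sQ: "sgp Q S" using Q by (simp add: fusion_conj_def)
  have phF: "ph : F P Q" using ph by (simp add: fusion_iso_def)
  have im: "ph ` P = Q" by (rule fusion_iso_image[OF sP sQ ph])
  have "ph ` centralizer S P <= centralizer S Q \<inter> Q"
  proof
   fix y assume "y : ph ` centralizer S P"
   then obtain z where z: "z : centralizer S P" "y = ph z" by blast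
   have zP: "z : P" using C z(1) by blast
   have "y \<cdot> q = q \<cdot> y" if "q : Q" for q
   proof -
    obtain x where x: "x : P" "q = ph x" using im \<open>q : Q\<close> by blast
    have "z \<cdot> x = x \<cdot> z" using z(1) x(1) by (simp add: centralizer_def)
    thus ?thesis using F_mult[OF sP sQ phF] zP x z(2) by metis
   qed
   moreover have "y : Q" using im zP z(2) by blast
   ultimately show "y : centralizer S Q \<inter> Q" using sub_car[OF sQ] by (simp add: centralizer_def)
  qed
  moreover have "card (ph ` centralizer S P) = card (centralizer S P)"
   using inj_on_subset[OF F_inj[OF sP sQ phF] C] by (rule card_image)
  moreover have "finite (centralizer S Q)" using finite_subset[OF _ finite_S] by (auto simp: centralizer_def)
  ultimately have "ph ` centralizer S P = centralizer S Q" using max[OF Q] by (intro card_seteq) auto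
  thus ?thesis using C im by blast
 qed
 hence "centric S F P" using sP C by (simp add: centric_def)
 thus False using P(2) by blast
qed

text \<open>A normal \<open>p\<close>-subgroup \<open>K\<close> of \<open>Aut_F(P)\<close> not
  contained in the inner automorphisms is conjugate into the Sylow subgroup \<open>Aut_S(P)\<close>,
  hence contained in it. Take \<open>c_g\<close> in \<open>K\<close> that is not inner: each
  automorphism conjugates it within \<open>K\<close>, so \<open>g\<close> lies in the extender of
  every automorphism.\<close>

lemma not_radical_moves:
 assumes P: "fully_normalized S F P" "\<not> radical p S F P"
 shows "EX g:normalizer S P - P. ALL al:F P P. EX h:car S. ALL x:P. al (g |> x) = h |> al x"
proof -
 have sP: "sgp P S" using P(1) by (simp add: fully_normalized_def)
 interpret A: group "aut_fusion F P" by (rule group_aut[OF sP])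
 have "p_subgroup p (aut_fusion F P) (inner_auts S P)"
  unfolding inner_auts_def by (rule inner_p_subgroup[OF sP sP sub_norm[OF sP]])
 then obtain K where K: "K \<lhd> aut_fusion F P" "p_subgroup p (aut_fusion F P) K" "\<not> K <= inner_auts S P"
  using P(2) sP inner_normal[OF sP] unfolding radical_def by blast
 have "sylow_subgroup p (aut_fusion F P) (aut_S S P)"
  using saturated[unfolded saturated_def, THEN conjunct1, rule_format, OF P(1)] by (rule conjunct2)
 then obtain ci where ci: "ci : car (aut_fusion F P)"
  "ci <#\<^bsub>aut_fusion F P\<^esub> K #>\<^bsub>aut_fusion F P\<^esub> inv\<^bsub>aut_fusion F P\<^esub> ci <= aut_S S P"
  using K(2) unfolding sylow_subgroup_def by blast
 have sK: "sgp K (aut_fusion F P)" using K(1) by (rule normal_imp_subgroup)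
 have conjK: "a |>\<^bsub>aut_fusion F P\<^esub> k : K" if "a : car (aut_fusion F P)" "k : K" for a k
  using K(1) that A.normal_inv_iff by blast
 have KS: "K <= aut_S S P"
 proof
  fix k assume k: "k : K"
  have kc: "k : car (aut_fusion F P)" using sK k by (rule sub_mem)
  define k' where "k' = inv\<^bsub>aut_fusion F P\<^esub> ci \<cdot>\<^bsub>aut_fusion F P\<^esub> k \<cdot>\<^bsub>aut_fusion F P\<^esub> inv\<^bsub>aut_fusion F P\<^esub> (inv\<^bsub>aut_fusion F P\<^esub> ci)"
  have k': "k' : K" unfolding k'_def by (rule conjK[OF A.inv_closed[OF ci(1)] k])
  have "k = ci |>\<^bsub>aut_fusion F P\<^esub> k'" using ci(1) kc by (simp add: k'_def A.gnorm)
  thus "k : aut_S S P" using ci(2)[unfolded A.conj_set[OF ci(1) sub_le[OF sK]]] k' by blast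
 qed
 obtain k where k: "k : K" "k ~: inner_auts S P" using K(3) by blast
 obtain g where g: "k : K" "k ~: inner_auts S P" "g : normalizer S P" "k = conj_map S P g"
  using k subsetD[OF KS k(1)] by (auto simp: aut_S_def)
 have "EX h:car S. ALL x:P. al (g |> x) = h |> al x" if al: "al : F P P" for al
 proof -
  have c: "al : car (aut_fusion F P)" "k : car (aut_fusion F P)" using al sub_mem[OF sK g(1)] by (auto simp: aut_simps)
  have kF: "k : F P P" using c(2) by (simp add: aut_simps)
  obtain h where h: "h : normalizer S P"
   "al |>\<^bsub>aut_fusion F P\<^esub> k = conj_map S P h" using conjK[OF c(1) g(1)] KS by (auto simp: aut_S_def)
  have ch: "conj_map S P h : F P P" using F_conj[OF sP sP] h(1) by (simp add: norm_transporter[OF sP])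
  have "al \<cdot>\<^bsub>aut_fusion F P\<^esub> k = conj_map S P h \<cdot>\<^bsub>aut_fusion F P\<^esub> al"
   unfolding h(2)[symmetric] using c by (simp add: A.gnorm)
  hence eq: "compose P al k = compose P (conj_map S P h) al" using aut_mult[OF sP kF al] aut_mult[OF sP al ch] by simp
  have "al (g |> x) = h |> al x" if "x : P" for x
   using fun_cong[OF eq, of x] that F_in[OF sP sP al that] by (simp add: compose_def conj_map_def g(4))
  thus ?thesis using h(1) norm_iff[OF sP] by blast
 qed
 moreover have "g ~: P" using g(2,4) by (auto simp: inner_auts_def)
 ultimately show ?thesis using g(3) by blast
qed

text \<open>
  The form of Alperin's fusion theorem that is needed: \<open>F\<close> is contained in any fusion system that
  contains the automorphisms of one fully normalized member of each class of centric radical subgroups.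
\<close>

theorem alperin:
 assumes E: "fusion_system S E"
  and auts: "!!P. centric S F P ==> radical p S F P ==>
   EX Q. fusion_conj S F P Q & fully_normalized S F Q & F Q Q <= E Q Q"
  and P: "sgp P S"
 shows "F P (car S) <= E P (car S)" using P
proof (induction "card (car S) - card P" arbitrary: P rule: less_induct)
 case less
 let ?U = "car S"
 interpret E: fusion S E using E is_group by (simp add: fusion_def fusion_axioms_def)
 note P = less.prems
 note U = sub_self
 have IH: "F Q ?U <= E Q ?U" if "sgp Q S" "card P < card Q" for Q
 proof -
  have "card Q <= card ?U" using card_mono[OF finite_S sub_le[OF that(1)]] .
  thus ?thesis using less.hyps[of Q] that by simp
 qed
 have conj_card: "card Q = card P" if "fusion_conj S F P Q" for Q
 proof -
  obtain ph where ph: "ph : fusion_iso F P Q" "sgp Q S" using \<open>fusion_conj S F P Q\<close> by (auto simp: fusion_conj_def)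
  hence "inj_on ph P" using F_inj[OF P ph(2)] by (simp add: fusion_iso_def)
  thus ?thesis using card_image fusion_iso_image[OF P ph(2,1)] by fastforce
 qed
 \<comment> \<open>For proper \<open>Q\<close> the map onto \<open>P'\<close> comes from a map on
   the strictly larger normalizer of \<open>Q\<close>, to which the induction hypothesis
   applies.\<close>
 have to: "EX ps:E Q ?U. ps : F Q ?U & ps ` Q = P'"
  if P': "fully_normalized S F P'" and Q: "fusion_conj S F P Q" and QP': "fusion_conj S F Q P'" for Q P'
 proof (cases "Q = ?U")
  case True
  have "sgp P' S" "card P' = card ?U"
   using P' conj_card[OF Q] conj_card[OF fusion_conj_trans[OF Q QP']] True by (auto simp: fully_normalized_def)
  hence "P' = ?U" using card_seteq[OF finite_S sub_le] by simp
  thus ?thesis using True E.F_incl[OF U U] F_incl[OF U U] by (intro bexI[of _ "\<lambda>x\<in>?U. x"]) auto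
 next
  case False
  have sQ: "sgp Q S" using Q by (simp add: fusion_conj_def)
  note N = norm_subgroup[OF sQ] norm_grows[OF sQ False]
  obtain ps where ps: "ps : F (normalizer S Q) ?U" "ps ` Q = P'" using extends_to_normalizer[OF sQ P' QP'] by blast
  have "card Q < card (normalizer S Q)" using psubset_card_mono[OF sub_finite[OF N(1)] N(2)] .
  hence "ps : E (normalizer S Q) ?U" using IH[OF N(1)] conj_card[OF Q] ps(1) by auto
  hence "restrict ps Q : E Q ?U" "restrict ps Q : F Q ?U"
   using E.F_restrict[OF N(1) U _ sQ] F_restrict[OF N(1) U ps(1) sQ] N(2) by auto
  thus ?thesis using ps(2) by auto
 qed
 \<comment> \<open>Composed with such maps on both sides, a morphism out of \<open>P\<close> becomes
   an automorphism of \<open>P'\<close>; so only these have to be found in \<open>E\<close>.\<close>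
 have reduce: "F P ?U <= E P ?U"
  if P': "fully_normalized S F P'" and c: "fusion_conj S F P P'" and A: "F P' P' <= E P' P'" for P'
 proof
  fix th assume th: "th : F P ?U"
  have sP': "sgp P' S" using c by (simp add: fusion_conj_def)
  define Q where "Q = th ` P"
  have sQ: "sgp Q S" using F_image[OF P U th P] by (simp add: Q_def)
  have thQ: "th : F P Q" using F_corestrict[OF P U th sQ] by (simp add: Q_def)
  have PQ: "fusion_conj S F P Q" using fusion_conjI[OF P U th P] by (simp add: Q_def)
  obtain ps where ps: "ps : E P ?U" "ps : F P ?U" "ps ` P = P'" using to[OF P' fusion_conj_refl[OF P] c] by blast
  obtain ps' where ps': "ps' : E Q ?U" "ps' : F Q ?U" "ps' ` Q = P'"
   using to[OF P' PQ fusion_conj_trans[OF fusion_conj_sym[OF PQ] c]] by blast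
  have into: "ps : F P P'" "ps' : F Q P'" "ps : E P P'"
   using F_corestrict[OF P U ps(2) sP'] F_corestrict[OF sQ U ps'(2) sP'] E.F_corestrict[OF P U ps(1) sP'] ps(3) ps'(3) by auto
  obtain bt where bt: "bt : fusion_iso F P' P" "ALL x:P. bt (ps x) = x"
   using fusion_iso_inverse[OF F_isoI[OF P sP' into(1) ps(3)]] by blast
  have btF: "bt : F P' P" using bt(1) by (simp add: fusion_iso_def)
  have "compose P' (compose P ps' th) bt : E P' P'"
   using F_comp[OF sP' P sP' btF F_comp[OF P sQ sP' thQ into(2)]] A by blast
  from E.F_comp[OF P sP' sP' into(3) this]
  have "compose P (compose P' (compose P ps' th) bt) ps : E P P'" .
  moreover have "compose P (compose P' (compose P ps' th) bt) ps = compose P ps' th"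
   using bt(2) ps(3) by (intro extensionalityI[of _ P]) (auto simp: compose_def)
  ultimately have "compose P ps' th : E P ?U" using E.F_widen[OF P sP' U _ sub_le[OF sP']] by simp
  moreover have "th : P \<rightarrow>\<^sub>E Q" using F_in[OF P sQ thQ] F_mon(2)[OF P sQ thQ] by (auto simp: PiE_def)
  ultimately have "th : E P Q" using E.F_left_cancel[OF P sQ U ps'(1)] by blast
  thus "th : E P ?U" using E.F_widen[OF P sQ U _ sub_le[OF sQ]] by blast
 qed
 obtain P' where P': "fusion_conj S F P P'" "fully_normalized S F P'" using fully_normalized_exists[OF P] by blast
 have sP': "sgp P' S" using P'(1) by (simp add: fusion_conj_def)
 show ?case
 proof (cases "centric S F P' & radical p S F P'")
  case True
  then obtain Q where "fusion_conj S F P' Q" "fully_normalized S F Q" "F Q Q <= E Q Q" using auts by blast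
  thus ?thesis using reduce fusion_conj_trans[OF P'(1)] by blast
 next
  case False
  \<comment> \<open>Failure of either condition yields one element outside \<open>P'\<close> that
    lies in all extenders. Every automorphism of \<open>P'\<close> therefore extends to a larger
    subgroup and is in \<open>E\<close> by induction.\<close>
  have "EX g:normalizer S P' - P'. ALL al:F P' P'. EX h:?U. ALL x:P'. al (g |> x) = h |> al x"
  proof (cases "centric S F P'")
   case True
   thus ?thesis using not_radical_moves[OF P'(2)] False by blast
  next
   case False
   obtain g where g: "g : normalizer S P' - P'" "ALL x:P'. g |> x = x" using not_centric_moves[OF P'(2) False] by blast
   have "al (g |> x) = \<one> \<cdot> al x \<cdot> inv \<one>" if "al : F P' P'" "x : P'" for al x
    using g(2) that sub_car[OF sP' F_in[OF sP' sP' that]] by simp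
   thus ?thesis using g(1) by (intro bexI[of _ g] ballI bexI[of _ \<one>]) auto
  qed
  then obtain g where g: "g : normalizer S P'" "g ~: P'"
   "!!al. al : F P' P' ==> EX h:?U. ALL x:P'. al (g |> x) = h |> al x" by blast
  have "al : E P' P'" if al: "al : F P' P'" for al
  proof -
   have alU: "al : F P' ?U" by (rule F_widen[OF sP' sP' U al sub_le[OF sP']])
   have im: "al ` P' = P'" by (rule aut_image[OF sP' al])
   note ex = extender_subgroup[OF sP' alU]
   have "g : extender S P' al" unfolding extender_iff[OF sP' alU] using g(1) g(3)[OF al] by blast
   hence "card P' < card (extender S P' al)" using psubset_card_mono[OF sub_finite[OF ex(1)]] ex(2) g(2) by blast
   moreover obtain ps where ps: "ps : F (extender S P' al) ?U" "ALL x:P'. ps x = al x"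
    using extension[OF sP' alU] P'(2) im by auto
   ultimately have "ps : E (extender S P' al) ?U" using IH[OF ex(1)] conj_card[OF P'(1)] by auto
   hence "restrict ps P' : E P' ?U" by (rule E.F_restrict[OF ex(1) U _ sP' ex(2)])
   moreover have "restrict ps P' = al" using ps(2) F_mon(2)[OF sP' sP' al] by (intro extensionalityI[of _ P']) auto
   ultimately show ?thesis using E.F_corestrict[OF sP' U _ sP'] im by auto
  qed
  thus ?thesis using reduce[OF P'(2,1)] by blast
 qed
qed

end

section \<open>Averaging over the cosets of a Sylow subgroup\<close>

text \<open>Intended for \<open>A\<close> an automorphism group in the linking system,
  \<open>H\<close> a model or a subgroup of it, \<open>N\<close> a Sylow subgroup of
  \<open>H\<close> and \<open>Z\<close> the image of the centre, an abelian
  \<open>p\<close>-group.\<close>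

locale coset_average = A: group A + H: group H for A :: "('x, 'k) monoid_scheme" and H :: "('y, 'l) monoid_scheme" +
 fixes N :: "'y set" and Z :: "'x set" and m :: nat
 assumes H_finite: "finite (car H)" and N: "sgp N H" and index: "order H = card N * m"
  and Z: "sgp Z A" "finite Z" "!!a b. a : Z ==> b : Z ==> a \<cdot>\<^sub>A b = b \<cdot>\<^sub>A a"
  and m: "coprime m (card Z)"
begin

abbreviation "Zg == A(|carrier := Z|)"

sublocale Zc: comm_group Zg
proof -
 interpret g: group Zg by (rule A.subgroup_imp_group[OF Z(1)])
 show "comm_group Zg" by (rule g.group_comm_groupI) (simp add: Z(3))
qed

definition rep :: "'y set => 'y" where "rep C = (SOME x. x : C)"

text \<open>A product over the cosets, not divided by their number \<open>m\<close>. Division means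
  extracting an \<open>m\<close>-th root in \<open>Z\<close>, which is done with \<open>root\<close>
  at the end.\<close>

definition avg :: "('y => 'x) => 'x" where
 "avg f = finprod Zg (%C. f (rep C)) (rcosets\<^bsub>H\<^esub> N)"

lemma cosets_finite: "finite (rcosets\<^bsub>H\<^esub> N)" using H_finite by (simp add: RCOSETS_def)

lemma rep: "C : rcosets\<^bsub>H\<^esub> N ==> rep C : C & rep C : car H & N #>\<^sub>H rep C = C"
proof -
 assume C: "C : rcosets\<^bsub>H\<^esub> N"
 then obtain a where a: "a : car H" "C = N #>\<^sub>H a" by (auto simp: RCOSETS_def)
 have 1: "rep C : C" unfolding rep_def using H.rcos_self[OF a(1) N] a(2) by (auto intro: someI)
 have "rep C : car H" using 1 a(2) H.r_coset_subset_G[OF sub_le[OF N] a(1)] by blast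
 thus ?thesis using 1 a H.repr_independence[OF _ a(1) N] by metis
qed

lemma avg_closed: "(!!x. x : car H ==> f x : Z) ==> avg f : Z"
 unfolding avg_def using Zc.finprod_closed[of "%C. f (rep C)" "rcosets\<^bsub>H\<^esub> N"] rep by auto

lemma avg_cong: "(!!x. x : car H ==> f x : Z) ==> (!!x. x : car H ==> f x = g x) ==> avg f = avg g"
 unfolding avg_def using rep by (intro Zc.finprod_cong') auto

lemma avg_mult:
 assumes "!!x. x : car H ==> f x : Z" "!!x. x : car H ==> g x : Z"
 shows "avg (%x. f x \<cdot>\<^sub>A g x) = avg f \<cdot>\<^sub>A avg g" unfolding avg_def
 using Zc.finprod_multf[of "%C. f (rep C)" "rcosets\<^bsub>H\<^esub> N" "%C. g (rep C)"] rep assms by auto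

lemma avg_const: "a : Z ==> avg (%_. a) = a [^]\<^sub>A m"
proof -
 assume a: "a : Z"
 have "card (rcosets\<^bsub>H\<^esub> N) * card N = card N * m" using H.lagrange[OF N] index by simp
 moreover have "card N ~= 0" using finite_subset[OF sub_le[OF N] H_finite] sub_one[OF N] by auto
 ultimately have "card (rcosets\<^bsub>H\<^esub> N) = m" by simp
 thus ?thesis using a A.nat_pow_consistent[of a m Z] by (simp add: avg_def Zc.finprod_const)
qed

lemma avg_hom:
 assumes f: "!!x. x : car H ==> f x : Z" and h: "h : hom Zg Zg"
 shows "h (avg f) = avg (%x. h (f x))"
proof -
 interpret h: group_hom Zg Zg h using h Zc.is_group by (simp add: group_hom_def group_hom_axioms_def)
 have hZ: "h z : Z" if "z : Z" for z using h.hom_closed that by simp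
 have "h (finprod Zg (%C. f (rep C)) X) = finprod Zg (%C. h (f (rep C))) X" if "finite X" "X <= rcosets\<^bsub>H\<^esub> N" for X
  using that
 proof (induction X rule: finite_induct)
  case empty
  thus ?case using h.hom_one by simp
 next
  case (insert C X)
  have c: "(%C. f (rep C)) : X \<rightarrow> Z" "f (rep C) : Z" using insert.prems rep f by auto
  hence c': "(%C. h (f (rep C))) : X \<rightarrow> Z" "h (f (rep C)) : Z" using hZ by auto
  have "finprod Zg (%C. f (rep C)) X : Z" using Zc.finprod_closed[of _ X] c(1) by auto
  thus ?case using insert c c' h.hom_mult by simp
 qed
 thus ?thesis using cosets_finite by (simp add: avg_def)
qed

text \<open>Right multiplication by \<open>y\<close> permutes the cosets \<open>N x\<close>, and
  invariance of \<open>f\<close> under \<open>N\<close> makes the choice of representatives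
  irrelevant.\<close>

lemma avg_shift:
 assumes f: "!!x. x : car H ==> f x : Z" "!!n x. n : N ==> x : car H ==> f (n \<cdot>\<^sub>H x) = f x"
  and y: "y : car H"
 shows "avg (%x. f (x \<cdot>\<^sub>H y)) = avg f"
proof -
 let ?R = "rcosets\<^bsub>H\<^esub> N" and ?s = "%C. C #>\<^sub>H y"
 have NH: "N <= car H" using sub_le[OF N] .
 have shift: "N #>\<^sub>H x #>\<^sub>H u = N #>\<^sub>H (x \<cdot>\<^sub>H u)" if "x : car H" "u : car H" for x u
  using H.coset_mult_assoc[OF NH that] .
 have cos: "x : car H & C = N #>\<^sub>H x" if "C : ?R" "x = rep C" for C x using rep[OF that(1)] that(2) by auto
 have into: "?s C : ?R" if "C : ?R" for C
 proof -
  have "?s C = N #>\<^sub>H (rep C \<cdot>\<^sub>H y)" using cos[OF that HOL.refl] shift[OF _ y] by metis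
  thus ?thesis using cos[OF that HOL.refl] y by (auto simp: RCOSETS_def)
 qed
 have inj: "inj_on ?s ?R"
 proof (rule inj_onI)
  fix C D assume CD: "C : ?R" "D : ?R" "?s C = ?s D"
  have "C <= car H" if "C : ?R" for C using H.rcosets_part_G[OF N] that by blast
  hence "?s C #>\<^sub>H inv \<^sub>H y = C" if "C : ?R" for C using that y by (simp add: H.coset_mult_assoc)
  thus "C = D" using CD by metis
 qed
 have surj: "?s ` ?R = ?R" using endo_inj_surj[OF cosets_finite _ inj] into by blast
 have same: "f (rep C \<cdot>\<^sub>H y) = f (rep (?s C))" if C: "C : ?R" for C
 proof -
  have "rep (?s C) : N #>\<^sub>H (rep C \<cdot>\<^sub>H y)"
   using rep[OF into[OF C]] cos[OF C HOL.refl] shift[OF _ y] by metis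
  then obtain n where "n : N" "rep (?s C) = n \<cdot>\<^sub>H (rep C \<cdot>\<^sub>H y)" by (auto simp: r_coset_def)
  thus ?thesis using f(2) rep[OF C] y by simp
 qed
 have "finprod Zg (%C. f (rep C)) (?s ` ?R) = finprod Zg (%C. f (rep (?s C))) ?R"
  using f(1) rep surj by (intro Zc.finprod_reindex inj) auto
 moreover have "finprod Zg (%C. f (rep C \<cdot>\<^sub>H y)) ?R = finprod Zg (%C. f (rep (?s C))) ?R"
  using same f(1) rep into by (intro Zc.finprod_cong') auto
 ultimately show ?thesis unfolding avg_def surj by simp
qed

text \<open>As \<open>m\<close> is prime to the order of \<open>Z\<close>, an inverse of
  \<open>m\<close> modulo that order is the exponent.\<close>

lemma root: "EX k. ALL a:Z. (a [^]\<^sub>A m) [^]\<^sub>A (k::nat) = a"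
proof -
 have cz: "card Z ~= 0" using Z(2) sub_one[OF Z(1)] by auto
 obtain x y where xy: "m * x = card Z * y + 1"
 proof -
  have "order H ~= 0" using H_finite H.one_closed by (auto simp: order_def)
  hence "m ~= 0" using index by auto
  thus ?thesis using bezout_nat[of m "card Z"] m that by auto
 qed
 have "(a [^]\<^sub>A m) [^]\<^sub>A x = a" if "a : Z" for a
 proof -
  have a: "a : car A" using sub_mem[OF Z(1) that] .
  have "(a [^]\<^sub>A m) [^]\<^sub>A x = a [^]\<^sub>A (card Z * y) \<cdot>\<^sub>A a"
   using a xy by (simp add: A.nat_pow_pow)
  moreover have "a [^]\<^sub>A (card Z * y) = \<one>\<^sub>A"
   using A.subgroup_pow_card[OF Z(1,2) that] a A.nat_pow_pow[OF a, of "card Z" y] by simp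
  ultimately show ?thesis using a by simp
 qed
 thus ?thesis by blast
qed

lemma Z_carrier: "z : Z ==> z : car A" using sub_mem[OF Z(1)] .
lemma Z_mult: "z : Z ==> w : Z ==> z \<cdot>\<^sub>A w : Z" using sub_mult[OF Z(1)] .
lemma Z_inv: "z : Z ==> inv \<^sub>A z : Z" using sub_inv[OF Z(1)] .
lemma Z_pow: "z : Z ==> z [^]\<^sub>A (k::nat) : Z" by (induction k) (simp_all add: sub_one[OF Z(1)] Z_mult)

lemma Z_pow_mult: "z : Z ==> w : Z ==> (z \<cdot>\<^sub>A w) [^]\<^sub>A (k::nat) = z [^]\<^sub>A k \<cdot>\<^sub>A w [^]\<^sub>A k"
 by (rule A.pow_mult_distrib[OF Z(3)]) (simp_all add: Z_carrier)

lemma conj_hom: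
 assumes a: "a : car A" "!!z. z : Z ==> inv \<^sub>A a \<cdot>\<^sub>A z \<cdot>\<^sub>A a : Z"
 shows "(%z. inv \<^sub>A a \<cdot>\<^sub>A z \<cdot>\<^sub>A a) : hom Zg Zg"
 using a Z_carrier by (intro homI) (simp_all add: A.gnorm)

text \<open>The defect \<open>d\<close> of \<open>mu\<close> is a 2-cocycle in \<open>Z\<close>.
  Multiplying the cocycle identity over representatives of the cosets shows that the
  \<open>m\<close>-th power of \<open>d\<close> is a coboundary, and an \<open>m\<close>-th root
  makes \<open>d\<close> itself one. Multiplicativity with factors from \<open>N\<close> on the left
  makes \<open>d\<close> a function of cosets; on the right it makes the correction trivial on
  \<open>N\<close>.\<close>

theorem lift_average:
 assumes mu: "!!x. x : car H ==> mu x : car A"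
  and quasi: "!!x y. x : car H ==> y : car H ==> EX z:Z. mu x \<cdot>\<^sub>A mu y = mu (x \<cdot>\<^sub>H y) \<cdot>\<^sub>A z"
  and left: "!!x n. x : car H ==> n : N ==> mu (n \<cdot>\<^sub>H x) = mu n \<cdot>\<^sub>A mu x"
  and right: "!!x n. x : car H ==> n : N ==> mu (x \<cdot>\<^sub>H n) = mu x \<cdot>\<^sub>A mu n"
  and normal: "!!x z. x : car H ==> z : Z ==> inv \<^sub>A (mu x) \<cdot>\<^sub>A z \<cdot>\<^sub>A mu x : Z"
 shows "EX t. (ALL x:car H. t x : Z) & (ALL n:N. t n = \<one>\<^sub>A) & (%x. mu x \<cdot>\<^sub>A t x) : hom H A"
proof -
 define d where "d = (%x y. inv \<^sub>A (mu (x \<cdot>\<^sub>H y)) \<cdot>\<^sub>A (mu x \<cdot>\<^sub>A mu y))"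
 have NH: "n : car H" if "n : N" for n using sub_mem[OF N that] .
 have d: "d x y : Z" if xy: "x : car H" "y : car H" for x y
 proof -
  obtain z where z: "z : Z" "mu x \<cdot>\<^sub>A mu y = mu (x \<cdot>\<^sub>H y) \<cdot>\<^sub>A z" using quasi[OF xy] by blast
  have "d x y = z" unfolding d_def z(2) using mu xy Z_carrier[OF z(1)] by (simp add: A.inv_cancel_left)
  thus ?thesis using z(1) by simp
 qed
 have d_left: "d (n \<cdot>\<^sub>H x) y = d x y" if "n : N" "x : car H" "y : car H" for n x y
  using that NH mu left by (simp add: d_def H.m_assoc A.gnorm)
 have d_right: "d x n = \<one>\<^sub>A" if "n : N" "x : car H" for n x using that NH mu right by (simp add: d_def)
 define ka where "ka = (%y z. inv \<^sub>A (mu y) \<cdot>\<^sub>A z \<cdot>\<^sub>A mu y)"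
 have kaZ: "ka y z : Z" if "y : car H" "z : Z" for y z using normal that by (simp add: ka_def)
 have ka_hom: "ka y : hom Zg Zg" if "y : car H" for y unfolding ka_def using conj_hom[OF mu[OF that] normal[OF that]] .
 \<comment> \<open>This is associativity of the product of \<open>mu r\<close>, \<open>mu x\<close>
   and \<open>mu y\<close>.\<close>
 have cocycle: "d r (x \<cdot>\<^sub>H y) \<cdot>\<^sub>A d x y = d (r \<cdot>\<^sub>H x) y \<cdot>\<^sub>A ka y (d r x)"
  if "r : car H" "x : car H" "y : car H" for r x y using that mu by (simp add: d_def ka_def H.m_assoc A.gnorm)
 define t0 where "t0 = (%y. avg (%r. d r y))"
 have t0: "t0 y : Z" if "y : car H" for y unfolding t0_def using d that by (intro avg_closed)
 obtain k where k: "!!a. a : Z ==> (a [^]\<^sub>A m) [^]\<^sub>A (k::nat) = a" using root by blast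
 define u where "u = (%y. t0 y [^]\<^sub>A k)"
 have u: "u y : Z" if "y : car H" for y unfolding u_def using t0[OF that] by (rule Z_pow)
 have ka_inv: "ka y (inv \<^sub>A z) = inv \<^sub>A (ka y z)" if "y : car H" "z : Z" for y z
  using that mu Z_carrier by (simp add: ka_def A.gnorm)
 have ka_pow: "ka y (z [^]\<^sub>A k) = ka y z [^]\<^sub>A k" if y: "y : car H" and z: "z : Z" for y z and k :: nat
 proof (induction k)
  case 0
  thus ?case using mu[OF y] by (simp add: ka_def)
 next
  case (Suc k)
  thus ?case using ka_hom[OF y] z Z_pow[OF z] by (simp add: hom_def)
 qed
 have key: "u (x \<cdot>\<^sub>H y) \<cdot>\<^sub>A d x y = u y \<cdot>\<^sub>A ka y (u x)" if x: "x : car H" and y: "y : car H" for x y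
 proof -
  have xy: "x \<cdot>\<^sub>H y : car H" using x y by simp
  have "t0 (x \<cdot>\<^sub>H y) \<cdot>\<^sub>A d x y [^]\<^sub>A m = avg (%r. d r (x \<cdot>\<^sub>H y) \<cdot>\<^sub>A d x y)"
   using avg_mult[of "%r. d r (x \<cdot>\<^sub>H y)" "%r. d x y"] avg_const[OF d[OF x y]] d xy d[OF x y] by (simp add: t0_def)
  also have "... = avg (%r. d (r \<cdot>\<^sub>H x) y \<cdot>\<^sub>A ka y (d r x))"
   using cocycle x y xy d Z_mult kaZ by (intro avg_cong) auto
  also have "... = avg (%r. d (r \<cdot>\<^sub>H x) y) \<cdot>\<^sub>A avg (%r. ka y (d r x))"
   using x y d kaZ by (intro avg_mult) auto
  also have "avg (%r. d (r \<cdot>\<^sub>H x) y) = t0 y"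
   unfolding t0_def using avg_shift[of "%r. d r y" x] d d_left x y by simp
  also have "avg (%r. ka y (d r x)) = ka y (t0 x)"
   unfolding t0_def using avg_hom[of "%r. d r x", OF _ ka_hom[OF y]] d x by simp
  finally have eq: "t0 (x \<cdot>\<^sub>H y) \<cdot>\<^sub>A d x y [^]\<^sub>A m = t0 y \<cdot>\<^sub>A ka y (t0 x)" .
  have "(t0 (x \<cdot>\<^sub>H y) \<cdot>\<^sub>A d x y [^]\<^sub>A m) [^]\<^sub>A k = u (x \<cdot>\<^sub>H y) \<cdot>\<^sub>A d x y"
   using Z_pow_mult[OF t0[OF xy] Z_pow[OF d[OF x y]]] k[OF d[OF x y]] by (simp add: u_def)
  moreover have "(t0 y \<cdot>\<^sub>A ka y (t0 x)) [^]\<^sub>A k = u y \<cdot>\<^sub>A ka y (u x)"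
   using Z_pow_mult[OF t0[OF y] kaZ[OF y t0[OF x]]] ka_pow[OF y t0[OF x]] by (simp add: u_def)
  ultimately show ?thesis using eq by simp
 qed
 have "(%x. mu x \<cdot>\<^sub>A inv \<^sub>A (u x)) : hom H A"
 proof (rule homI)
  show "mu x \<cdot>\<^sub>A inv \<^sub>A (u x) : car A" if "x : car H" for x
   using mu[OF that] Z_carrier[OF u[OF that]] by simp
  fix x y assume x: "x : car H" and y: "y : car H"
  let ?a = "u x" and ?b = "u y" and ?c = "u (x \<cdot>\<^sub>H y)" and ?k = "ka y (u x)"
  have xy: "x \<cdot>\<^sub>H y : car H" using x y by simp
  note cl = Z_carrier[OF u[OF x]] Z_carrier[OF u[OF y]] Z_carrier[OF u[OF xy]] Z_carrier[OF kaZ[OF y u[OF x]]]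
   Z_carrier[OF d[OF x y]] mu[OF x] mu[OF y] mu[OF xy]
  have "d x y = inv \<^sub>A ?c \<cdot>\<^sub>A (?c \<cdot>\<^sub>A d x y)" using cl by (simp add: A.inv_cancel_left)
  also have "... = inv \<^sub>A ?c \<cdot>\<^sub>A (?b \<cdot>\<^sub>A ?k)" unfolding key[OF x y] ..
  finally have "d x y \<cdot>\<^sub>A (inv \<^sub>A ?k \<cdot>\<^sub>A inv \<^sub>A ?b) = inv \<^sub>A ?c" using cl by (simp add: A.gnorm)
  hence 1: "mu (x \<cdot>\<^sub>H y) \<cdot>\<^sub>A inv \<^sub>A ?c =
    mu (x \<cdot>\<^sub>H y) \<cdot>\<^sub>A (d x y \<cdot>\<^sub>A (inv \<^sub>A ?k \<cdot>\<^sub>A inv \<^sub>A ?b))" by simp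
  have "mu x \<cdot>\<^sub>A inv \<^sub>A ?a \<cdot>\<^sub>A (mu y \<cdot>\<^sub>A inv \<^sub>A ?b) =
    (mu x \<cdot>\<^sub>A mu y) \<cdot>\<^sub>A (inv \<^sub>A ?k \<cdot>\<^sub>A inv \<^sub>A ?b)"
   using cl by (simp add: ka_def A.gnorm)
  also have "mu x \<cdot>\<^sub>A mu y = mu (x \<cdot>\<^sub>H y) \<cdot>\<^sub>A d x y" using cl by (simp add: d_def A.inv_cancel_left)
  finally show "mu (x \<cdot>\<^sub>H y) \<cdot>\<^sub>A inv \<^sub>A ?c = mu x \<cdot>\<^sub>A inv \<^sub>A ?a \<cdot>\<^sub>A (mu y \<cdot>\<^sub>A inv \<^sub>A ?b)"
   using 1 cl by (simp add: A.m_assoc)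
 qed
 moreover have "inv \<^sub>A (u n) = \<one>\<^sub>A" if "n : N" for n
 proof -
  have "t0 n = avg (%r. \<one>\<^sub>A)"
   unfolding t0_def using d d_right that NH[OF that] sub_one[OF Z(1)] by (intro avg_cong) auto
  thus ?thesis using avg_const[OF sub_one[OF Z(1)]] by (simp add: u_def)
 qed
 ultimately show ?thesis using u Z_inv by (intro exI[of _ "%x. inv \<^sub>A (u x)"]) blast
qed

text \<open>The same argument one degree lower: the quotient of the homomorphisms is a 1-cocycle in
  \<open>Z\<close> that vanishes on \<open>N\<close>. Averaging writes it as a coboundary, and this
  amounts to conjugation by an element of \<open>Z\<close>.\<close>

theorem conj_average:
 assumes hom: "h1 : hom H A" "h2 : hom H A"
  and same: "!!x. x : car H ==> EX z:Z. h2 x = h1 x \<cdot>\<^sub>A z"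
  and on_N: "!!n. n : N ==> h2 n = h1 n"
  and normal: "!!x z. x : car H ==> z : Z ==> inv \<^sub>A (h1 x) \<cdot>\<^sub>A z \<cdot>\<^sub>A h1 x : Z"
 shows "EX b:Z. ALL x:car H. h2 x = inv \<^sub>A b \<cdot>\<^sub>A h1 x \<cdot>\<^sub>A b"
proof -
 have c: "h1 x : car A" "h2 x : car A" if "x : car H" for x using hom that by (auto simp: hom_def)
 have m1: "h1 (x \<cdot>\<^sub>H y) = h1 x \<cdot>\<^sub>A h1 y" "h2 (x \<cdot>\<^sub>H y) = h2 x \<cdot>\<^sub>A h2 y"
  if "x : car H" "y : car H" for x y using hom that by (auto simp: hom_def)
 have NH: "n : car H" if "n : N" for n using sub_mem[OF N that] .
 define a where "a = (%x. inv \<^sub>A (h1 x) \<cdot>\<^sub>A h2 x)"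
 have a: "a x : Z" if x: "x : car H" for x
 proof -
  obtain z where z: "z : Z" "h2 x = h1 x \<cdot>\<^sub>A z" using same[OF x] by blast
  have "a x = z" unfolding a_def z(2) using c(1)[OF x] Z_carrier[OF z(1)] by (simp add: A.inv_cancel_left)
  thus ?thesis using z(1) by simp
 qed
 define ka where "ka = (%y z. inv \<^sub>A (h1 y) \<cdot>\<^sub>A z \<cdot>\<^sub>A h1 y)"
 have kaZ: "ka y z : Z" if "y : car H" "z : Z" for y z using normal that by (simp add: ka_def)
 have ka_hom: "ka y : hom Zg Zg" if "y : car H" for y unfolding ka_def using conj_hom[OF c(1)[OF that] normal[OF that]] .
 have ka_pow: "ka y (z [^]\<^sub>A k) = ka y z [^]\<^sub>A k" if y: "y : car H" and z: "z : Z" for y z and k :: nat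
 proof (induction k)
  case 0
  thus ?case using c(1)[OF y] by (simp add: ka_def)
 next
  case (Suc k)
  thus ?case using ka_hom[OF y] z Z_pow[OF z] by (simp add: hom_def)
 qed
 have a_mult: "a (x \<cdot>\<^sub>H y) = ka y (a x) \<cdot>\<^sub>A a y" if "x : car H" "y : car H" for x y
  using that c m1 by (simp add: a_def ka_def A.gnorm)
 have a_left: "a (n \<cdot>\<^sub>H x) = a x" if "n : N" "x : car H" for n x
  using that NH c m1 on_N by (simp add: a_def A.gnorm)
 define b0 where "b0 = avg a"
 have b0: "b0 : Z" unfolding b0_def using a by (intro avg_closed)
 obtain k where k: "!!a. a : Z ==> (a [^]\<^sub>A m) [^]\<^sub>A (k::nat) = a" using root by blast
 define b where "b = b0 [^]\<^sub>A k"
 have b: "b : Z" unfolding b_def by (rule Z_pow[OF b0])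
 have "h2 y = inv \<^sub>A b \<cdot>\<^sub>A h1 y \<cdot>\<^sub>A b" if y: "y : car H" for y
 proof -
  have "b0 = avg (%x. a (x \<cdot>\<^sub>H y))" unfolding b0_def using avg_shift[of a y] a a_left y by simp
  also have "... = avg (%x. ka y (a x) \<cdot>\<^sub>A a y)" using a a_mult y kaZ Z_mult by (intro avg_cong) auto
  also have "... = ka y b0 \<cdot>\<^sub>A a y [^]\<^sub>A m"
   using avg_mult[of "%x. ka y (a x)" "%_. a y"] avg_hom[of a, OF _ ka_hom[OF y]] avg_const[OF a[OF y]] a kaZ y
   by (simp add: b0_def)
  finally have "b = (ka y b0 \<cdot>\<^sub>A a y [^]\<^sub>A m) [^]\<^sub>A k" by (simp add: b_def)
  hence 1: "b = ka y b \<cdot>\<^sub>A a y"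
   using Z_pow_mult[OF kaZ[OF y b0] Z_pow[OF a[OF y]]] k[OF a[OF y]] ka_pow[OF y b0, of k, folded b_def] by simp
  have "inv \<^sub>A b \<cdot>\<^sub>A h1 y \<cdot>\<^sub>A b = inv \<^sub>A b \<cdot>\<^sub>A h1 y \<cdot>\<^sub>A (ka y b \<cdot>\<^sub>A a y)" using 1 by simp
  also have "... = h2 y" using c[OF y] Z_carrier[OF b] by (simp add: ka_def a_def A.gnorm)
  finally show ?thesis by simp
 qed
 thus ?thesis using b by blast
qed

end

section \<open>Models\<close>

locale model = saturated_fusion S F p for S :: "'a monoid" (structure) and F and p +
 fixes R :: "'a set" and M :: "'b monoid" and e :: "'a => 'b"
 assumes R_cen: "centric S F R" and is_model: "is_model p S F R M e"
begin

abbreviation "NR == normalizer S R"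

lemma R_sub: "sgp R S" by (rule centric_subgroup[OF R_cen])
lemma NR_sub: "sgp NR S" by (rule norm_subgroup[OF R_sub])
lemma R_NR: "R <= NR" by (rule sub_norm[OF R_sub])
lemma NR_S: "s : NR ==> s : car S" using sub_car[OF NR_sub] .

sublocale M: group M using is_model by (simp add: is_model_def)

lemma M_finite: "finite (car M)" using is_model by (simp add: is_model_def)
lemma e_inj: "inj_on e NR" using is_model by (simp add: is_model_def mon_def)
lemma e_hom: "e : hom (S(|carrier := NR|)) M" using is_model by (simp add: is_model_def mon_def)
lemma e_closed: "s : NR ==> e s : car M" using e_hom by (auto simp: hom_def)
lemma e_mult: "s : NR ==> t : NR ==> e (s \<cdot> t) = e s \<cdot>\<^sub>M e t" using e_hom by (auto simp: hom_def)

sublocale eh: group_hom "S(|carrier := NR|)" M e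
 using subgroup_imp_group[OF NR_sub] e_hom by (simp add: group_hom_def group_hom_axioms_def M.is_group)

lemma e_inv: "s : NR ==> e (inv s) = inv \<^sub>M (e s)" using eh.hom_inv[of s] m_inv_consistent[OF NR_sub] by simp

lemma NR_closed:
 "s : NR ==> t : NR ==> s \<cdot> t : NR" "s : NR ==> inv s : NR" "\<one> : NR"
 using sub_mult[OF NR_sub] sub_inv[OF NR_sub] sub_one[OF NR_sub] by auto

lemma e_sylow: "sylow_subgroup p M (e ` NR)" using is_model by (simp add: is_model_def)

lemma e_NR_subgroup: "sgp (e ` NR) M" using e_sylow by (simp add: sylow_subgroup_def p_subgroup_def)

text \<open>The largest part of the normalizer of \<open>R\<close> on which conjugation by
  \<open>x\<close> takes values in that normalizer again. It contains \<open>R\<close>, because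
  \<open>R\<close> is normal in the model, and is therefore centric.\<close>

definition dom :: "'b => 'a set" where "dom x = {s : NR. x |>\<^sub>M e s : e ` NR}"

definition act :: "'b => 'a => 'a" where "act x s = inv_into NR e (x |>\<^sub>M e s)"

lemma dom_NR: "s : dom x ==> s : NR" by (simp add: dom_def)

lemma act:
 assumes "s : dom x"
 shows "act x s : NR" "e (act x s) = x |>\<^sub>M e s"
 using assms by (auto simp: dom_def act_def inv_into_into f_inv_into_f)

lemma act_unique:
 assumes "s : NR" "t : NR" "e t = x |>\<^sub>M e s"
 shows "s : dom x" "act x s = t"
proof -
 show "s : dom x" using assms(1,2) assms(3)[symmetric] by (simp add: dom_def)
 show "act x s = t" using assms(2) assms(3)[symmetric] e_inj by (simp add: act_def)
qed

lemma R_dom: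
 assumes x: "x : car M" and r: "r : R"
 shows "r : dom x" "act x r : R"
proof -
 have "e ` R \<lhd> M" using is_model by (simp add: is_model_def)
 hence "x |>\<^sub>M e r : e ` R" using x r M.normal_inv_iff by blast
 then obtain t where "t : R" "e t = x |>\<^sub>M e r" by auto
 thus "r : dom x" "act x r : R" using act_unique[of r t x] r R_NR by auto
qed

lemma act_mult:
 assumes x: "x : car M" "y : car M" and s: "s : dom y" "act y s : dom x"
 shows "s : dom (x \<cdot>\<^sub>M y)" "act (x \<cdot>\<^sub>M y) s = act x (act y s)"
proof -
 have "e (act x (act y s)) = (x \<cdot>\<^sub>M y) |>\<^sub>M e s"
  using act(2)[OF s(2)] act(2)[OF s(1)] x e_closed[OF dom_NR[OF s(1)]] by (simp add: M.gnorm)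
 from act_unique[OF dom_NR[OF s(1)] act(1)[OF s(2)] this]
 show "s : dom (x \<cdot>\<^sub>M y)" "act (x \<cdot>\<^sub>M y) s = act x (act y s)" by auto
qed

lemma act_e:
 assumes "n : NR" "s : NR"
 shows "s : dom (e n)" "act (e n) s = n |> s"
proof -
 have "e (n |> s) = e n |>\<^sub>M e s" using assms NR_closed e_mult e_inv by simp
 from act_unique[OF assms(2) _ this] show "s : dom (e n)" "act (e n) s = n |> s" using assms NR_closed by auto
qed

lemma act_hom:
 assumes x: "x : car M" and s: "s : dom x" "t : dom x"
 shows "s \<cdot> t : dom x" "act x (s \<cdot> t) = act x s \<cdot> act x t"
proof -
 note n = dom_NR[OF s(1)] dom_NR[OF s(2)] act(1)[OF s(1)] act(1)[OF s(2)]
 have "e (act x s \<cdot> act x t) = x |>\<^sub>M e (s \<cdot> t)"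
  using e_mult[OF n(3,4)] e_mult[OF n(1,2)] act(2)[OF s(1)] act(2)[OF s(2)] x e_closed[OF n(1)] e_closed[OF n(2)]
  by (simp add: M.gnorm)
 from act_unique[OF _ _ this] show "s \<cdot> t : dom x" "act x (s \<cdot> t) = act x s \<cdot> act x t"
  using n NR_closed by auto
qed

lemma dom_subgroup:
 assumes x: "x : car M"
 shows "sgp (dom x) S"
proof (rule subgroupI)
 show "dom x <= car S" using dom_NR NR_S by blast
 show "dom x ~= {}" using R_dom(1)[OF x] sub_one[OF R_sub] by blast
 fix s t assume s: "s : dom x"
 note n = dom_NR[OF s] act(1)[OF s]
 have "e (inv (act x s)) = x |>\<^sub>M e (inv s)"
  using e_inv[OF n(1)] e_inv[OF n(2)] act(2)[OF s] x e_closed[OF n(1)] by (simp add: M.gnorm)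
 from act_unique(1)[OF _ _ this] show "inv s : dom x" using n NR_closed by auto
 assume "t : dom x"
 thus "s \<cdot> t : dom x" using act_hom(1)[OF x s] by blast
qed

lemma dom_cen: "x : car M ==> centric S F (dom x)" using centric_overgroup[OF R_cen dom_subgroup] R_dom(1) by blast

lemma NR_cen: "centric S F NR" by (rule centric_overgroup[OF R_cen NR_sub R_NR])

lemma act_F:
 assumes x: "x : car M"
 shows "restrict (act x) (dom x) : F (dom x) NR"
proof -
 note D = dom_subgroup[OF x]
 have "e ` dom x <= car M" using dom_NR e_closed by blast
 hence "x : trp M (e ` dom x) (e ` NR)" using x by (simp add: M.trp_iff dom_def)
 hence "restrict (act x) (dom x) : group_fusion M e (dom x) NR"
  unfolding group_fusion_def using act by (auto intro!: bexI[of _ x])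
 moreover have "group_fusion M e (dom x) NR = normalizer_fusion S F R (dom x) NR"
  using is_model D NR_sub dom_NR by (simp add: is_model_def subset_iff)
 ultimately show ?thesis by (simp add: normalizer_fusion_def)
qed

text \<open>For \<open>R\<close> itself the extension condition in the normalizer fusion system is
  void: the product of \<open>R\<close> with itself is \<open>R\<close>, and an automorphism maps
  \<open>R\<close> onto \<open>R\<close>. So the model realises all of
  \<open>Aut_F(R)\<close>.\<close>

lemma aut_model:
 assumes ph: "ph : F R R"
 shows "EX x:car M. ALL r:R. e (ph r) = x |>\<^sub>M e r"
proof -
 have RR: "R <#> R = R"
 proof
  show "R <#> R <= R" using sub_mult[OF R_sub] by (auto simp: set_mult_def)
  have "r = r \<cdot> \<one>" if "r : R" for r using sub_car[OF R_sub that] by simp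
  thus "R <= R <#> R" unfolding set_mult_def using sub_one[OF R_sub] by blast
 qed
 have "ph : normalizer_fusion S F R R R" unfolding normalizer_fusion_def RR using ph aut_image[OF R_sub ph] by blast
 hence "ph : group_fusion M e R R" using is_model R_sub R_NR by (simp add: is_model_def)
 thus ?thesis by (auto simp: group_fusion_def trp_def)
qed

end

section \<open>Automorphism groups in a linking system and the lift of a model\<close>

context linking
begin

definition aut_link :: "'a set => 'm monoid" where
 "aut_link P = (|carrier = mor P P, mult = %g f. cmp P P P g f, one = ident LL P|)"

lemma aut_simps:
 "car (aut_link P) = mor P P" "g \<cdot>\<^bsub>aut_link P\<^esub> f = cmp P P P g f" "\<one>\<^bsub>aut_link P\<^esub> = ident LL P"
 by (simp_all add: aut_link_def)

lemma centre_conj: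
 assumes P: "cen P" and ph: "ph : F P P" "ph ` P = P" and z: "z : centre S P"
 shows "ph z : centre S P"
proof (rule centreI[OF cen_sub[OF P]])
 note s = cen_sub[OF P]
 show "ph z : P" using F_in[OF s s ph(1) centreD(1)[OF z]] .
 fix y assume "y : P"
 then obtain x where x: "x : P" "y = ph x" using ph(2) by blast
 thus "ph z \<cdot> y = y \<cdot> ph z"
  using F_mult[OF s s ph(1) centreD(1)[OF z] x(1)] F_mult[OF s s ph(1) x(1) centreD(1)[OF z]] centreD(2)[OF z x(1)] by simp
qed

text \<open>An inverse is obtained from a lift of the inverse of the projection, corrected by an
  element of the centre.\<close>

lemma group_aut_link:
 assumes P: "cen P" and fin: "finite P"
 shows "group (aut_link P)"
proof (rule groupI; (simp only: aut_simps)?)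
 note s = cen_sub[OF P]
 show "ident LL P : mor P P" by (rule ident_closed[OF P])
 fix f assume f: "f : mor P P"
 show "cmp P P P (ident LL P) f = f" by (rule cmp_ident(2)[OF P P f])
 have ph: "pr P P f : F P P" by (rule pr_closed[OF P P f])
 have "pr P P f ` P = P" using endo_inj_surj[OF fin _ F_inj[OF s s ph]] F_in[OF s s ph] by blast
 then obtain bt where bt: "bt : fusion_iso F P P" "ALL x:P. bt (pr P P f x) = x"
  using fusion_iso_inverse[OF F_isoI[OF s s ph]] by blast
 have "bt : F P P" using bt(1) by (simp add: fusion_iso_def)
 then obtain g where g: "g : mor P P" "pr P P g = bt" using pr_surj[OF P P] by blast
 have gf: "cmp P P P g f : mor P P" by (rule cmp_closed[OF P P P f g(1)])
 have "pr P P (ident LL P) = pr P P (cmp P P P g f)"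
  using bt(2) by (auto simp: pr_cmp[OF P P P f g(1)] g(2) pr_ident[OF P] compose_def)
 then obtain z where z: "z : centre S P" "cmp P P P g f = cmp P P P (ident LL P) (dl P P z)"
  using fibre[OF P P ident_closed[OF P] gf] by blast
 have t: "z : trp S P P" "inv z : trp S P P" using self_transp[OF P] centreD(1)[OF z(1)] sub_inv[OF s] by auto
 have "z : car S" using sub_car[OF s centreD(1)[OF z(1)]] .
 hence "cmp P P P (dl P P (inv z)) (cmp P P P g f) = ident LL P"
  using z(2) cmp_ident(2)[OF P P dl_closed[OF P P t(1)]] dl_cmp[OF P P P t] dl_one[OF P] by simp
 hence "cmp P P P (cmp P P P (dl P P (inv z)) g) f = ident LL P"
  using cmp_assoc[OF P P P P f g(1) dl_closed[OF P P t(2)]] by simp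
 thus "EX h:mor P P. cmp P P P h f = ident LL P" using cmp_closed[OF P P P g(1) dl_closed[OF P P t(2)]] by blast
qed (use P in \<open>auto simp: cmp_closed cmp_assoc\<close>)

end

locale model_linking = model S F p R M e + linking S F LL pr dl
 for S :: "'a monoid" (structure) and F and p and R and M :: "'b monoid" and e
  and LL :: "('a set, 'm) cat" and pr and dl
begin

abbreviation "A == aut_link R"

sublocale A: group A by (rule group_aut_link[OF R_cen sub_finite[OF R_sub]])

lemma NR_trans: "n : NR ==> n : trp S R R" by (simp add: norm_transporter[OF R_sub])

lemma dl_A:
 "n : NR ==> dl R R n : car A" "n : NR ==> n' : NR ==> dl R R (n \<cdot> n') = dl R R n \<cdot>\<^sub>A dl R R n'"
 using dl_closed[OF R_cen R_cen] dl_cmp[OF R_cen R_cen R_cen] NR_trans by (auto simp: aut_simps)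

text \<open>The commutation with \<open>dom x\<close> is the consistency condition for extending the
  value at \<open>x\<close> to the double coset of \<open>x\<close> under the image of
  \<open>NR\<close>, equivariantly on both sides.\<close>

definition pre_lift :: "'b => 'm => bool" where
 "pre_lift x f <-> f : car A & (ALL r:R. pr R R f r = act x r) &
   (ALL d:dom x. f \<cdot>\<^sub>A dl R R d = dl R R (act x d) \<cdot>\<^sub>A f)"

text \<open>
  The required \<open>f\<close> is the restriction to \<open>R\<close> of a lift of the conjugation map defined on all of \<open>dom x\<close>.
\<close>

lemma pre_lift_exists:
 assumes x: "x : car M"
 shows "EX f. pre_lift x f"
proof -
 let ?D = "dom x"
 note D = dom_cen[OF x] and N = NR_cen and R = R_cen
 have RD: "R <= ?D" using R_dom(1)[OF x] by blast
 obtain g where g: "g : mor ?D NR" "pr ?D NR g = restrict (act x) ?D" using pr_surj[OF D N act_F[OF x]] by blast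
 define k where "k = cmp R ?D NR g (inc R ?D)"
 note i = inc_closed[OF R D RD] inc_closed[OF R N R_NR]
 have k: "k : mor R NR" unfolding k_def by (rule cmp_closed[OF R D N i(1) g(1)])
 have pk: "pr R NR k r = act x r" if "r : R" for r
  using pr_cmp_apply[OF R D N i(1) g(1) that] pr_inc[OF R D RD that] g(2) RD that by (auto simp: k_def)
 hence im: "pr R NR k ` R <= R" using R_dom(2)[OF x] by auto
 note f = res[OF R R N k im R_NR]
 let ?f = "res R R NR k"
 have "pr R R ?f r = act x r" if "r : R" for r using pr_res[OF R R N k im R_NR] pk[OF that] by simp
 moreover have "cmp R R R ?f (dl R R d) = cmp R R R (dl R R (act x d)) ?f" if d: "d : ?D" for d
 proof -
  let ?d = "act x d"
  have n: "d : NR" "?d : NR" "d : car S" "?d : car S" using d dom_NR act(1)[OF d] NR_S by auto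
  note tr = NR_trans[OF n(1)] NR_trans[OF n(2)]
  note dR = dl_closed[OF R R tr(1)] dl_closed[OF R R tr(2)]
  have tD: "d : trp S ?D ?D" "?d : trp S NR NR" "\<one> : trp S R ?D" "\<one> : trp S R NR"
   using self_transp[OF D d] self_transp[OF N n(2)] one_trp[OF R_sub] RD R_NR by auto
  note dD = dl_closed[OF D D tD(1)] dl_closed[OF N N tD(2)]
  have "cmp R R NR (inc R NR) (cmp R R R ?f (dl R R d)) = cmp R R NR k (dl R R d)"
   using cmp_assoc[OF R R R N dR(1) f(1) i(2)] f(2) by simp
  also have "... = cmp R ?D NR g (cmp R R ?D (inc R ?D) (dl R R d))"
   unfolding k_def using cmp_assoc[OF R R D N dR(1) i(1) g(1)] by simp
  also have "cmp R R ?D (inc R ?D) (dl R R d) = cmp R ?D ?D (dl ?D ?D d) (inc R ?D)"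
   using dl_cmp[OF R R D tr(1) tD(3)] dl_cmp[OF R D D tD(3,1)] n by simp
  also have "cmp R ?D NR g (cmp R ?D ?D (dl ?D ?D d) (inc R ?D)) = cmp R ?D NR (cmp ?D ?D NR g (dl ?D ?D d)) (inc R ?D)"
   using cmp_assoc[OF R D D N i(1) dD(1) g(1)] by simp
  also have "cmp ?D ?D NR g (dl ?D ?D d) = cmp ?D NR NR (dl NR NR ?d) g" using dl_commute[OF D N g(1) d] g(2) d by simp
  also have "cmp R ?D NR (cmp ?D NR NR (dl NR NR ?d) g) (inc R ?D) = cmp R NR NR (dl NR NR ?d) k"
   unfolding k_def using cmp_assoc[OF R D N N i(1) g(1) dD(2)] by simp
  also have "... = cmp R NR NR (dl NR NR ?d) (cmp R R NR (inc R NR) ?f)" using f(2) by simp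
  also have "... = cmp R R NR (cmp R NR NR (dl NR NR ?d) (inc R NR)) ?f" using cmp_assoc[OF R R N N f(1) i(2) dD(2)] by simp
  also have "cmp R NR NR (dl NR NR ?d) (inc R NR) = cmp R R NR (inc R NR) (dl R R ?d)"
   using dl_cmp[OF R R N tr(2) tD(4)] dl_cmp[OF R N N tD(4,2)] n by simp
  also have "cmp R R NR (cmp R R NR (inc R NR) (dl R R ?d)) ?f = cmp R R NR (inc R NR) (cmp R R R (dl R R ?d) ?f)"
   using cmp_assoc[OF R R R N f(1) dR(2) i(2)] by simp
  finally show ?thesis using mono[OF R R N cmp_closed[OF R R R dR(1) f(1)] cmp_closed[OF R R R f(1) dR(2)] i(2)] by simp
 qed
 ultimately show ?thesis using f(1) by (auto simp: pre_lift_def aut_simps)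
qed

lemma pre_lift_dl:
 assumes n: "n : NR"
 shows "pre_lift (e n) (dl R R n)"
proof -
 have "pr R R (dl R R n) r = act (e n) r" if "r : R" for r
  using pr_dl_apply[OF R_cen R_cen NR_trans[OF n] that] act_e(2)[OF n, of r] R_NR that by auto
 moreover have "dl R R n \<cdot>\<^sub>A dl R R d = dl R R (act (e n) d) \<cdot>\<^sub>A dl R R n" if "d : dom (e n)" for d
 proof -
  have d: "d : NR" by (rule dom_NR[OF that])
  have "n |> d \<cdot> n = n \<cdot> d" using n d NR_S by (simp add: gnorm)
  moreover have "dl R R (n |> d) \<cdot>\<^sub>A dl R R n = dl R R (n |> d \<cdot> n)"
   using dl_A(2)[of "n |> d" n] n d NR_closed by simp
  ultimately show ?thesis using dl_A(2)[OF n d] act_e(2)[OF n d] by simp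
 qed
 ultimately show ?thesis using dl_A(1)[OF n] by (simp add: pre_lift_def)
qed

text \<open>On the image of \<open>NR\<close> the value is dictated by \<open>\<delta>\<close>, not
  chosen, so that the final lift agrees with \<open>\<delta>\<close> there.\<close>

definition mu0 :: "'b => 'm" where
 "mu0 x = (if x : e ` NR then dl R R (inv_into NR e x) else SOME f. pre_lift x f)"

definition same_double_coset :: "'b => 'b => bool" where
 "same_double_coset y x <-> x : car M & (EX a:NR. EX b:NR. y = e a \<cdot>\<^sub>M x \<cdot>\<^sub>M e b)"

definition dc_rep :: "'b => 'b" where "dc_rep y = (SOME x. same_double_coset y x)"

text \<open>Values at representatives of double cosets, extended equivariantly under
  \<open>NR\<close> on both sides. The decomposition of \<open>y\<close> that \<open>SOME\<close>
  picks is irrelevant by \<open>mu_eq\<close>.\<close>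

definition mu :: "'b => 'm" where
 "mu y = (SOME f. EX a:NR. EX b:NR. y = e a \<cdot>\<^sub>M dc_rep y \<cdot>\<^sub>M e b &
   f = dl R R a \<cdot>\<^sub>A mu0 (dc_rep y) \<cdot>\<^sub>A dl R R b)"

lemma mu0: "x : car M ==> pre_lift x (mu0 x)" using someI_ex[OF pre_lift_exists] pre_lift_dl e_inj by (auto simp: mu0_def)

lemma dc_rep: "y : car M ==> same_double_coset y (dc_rep y)"
proof -
 assume y: "y : car M"
 have "e \<one> = \<one>\<^sub>M" using eh.hom_one by simp
 hence "same_double_coset y y" unfolding same_double_coset_def using y NR_closed(3) by (intro conjI bexI[of _ \<one>]) auto
 thus ?thesis unfolding dc_rep_def by (rule someI)
qed

lemma dc_repE:
 assumes "y : car M"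
 obtains r a b where "dc_rep y = r" "r : car M" "a : NR" "b : NR" "y = e a \<cdot>\<^sub>M r \<cdot>\<^sub>M e b"
 using dc_rep[OF assms] that[OF HOL.refl] unfolding same_double_coset_def by blast

lemma dc_rep_shift:
 assumes y: "y : car M" and n: "n : NR" "n' : NR"
 shows "dc_rep (e n \<cdot>\<^sub>M y \<cdot>\<^sub>M e n') = dc_rep y"
proof -
 have "same_double_coset (e n \<cdot>\<^sub>M y \<cdot>\<^sub>M e n') x <-> same_double_coset y x" for x
 proof
  assume "same_double_coset (e n \<cdot>\<^sub>M y \<cdot>\<^sub>M e n') x"
  then obtain a b where x: "x : car M" and ab: "a : NR" "b : NR"
   "e n \<cdot>\<^sub>M y \<cdot>\<^sub>M e n' = e a \<cdot>\<^sub>M x \<cdot>\<^sub>M e b" by (auto simp: same_double_coset_def)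
  have "y = inv \<^sub>M (e n) \<cdot>\<^sub>M (e n \<cdot>\<^sub>M y \<cdot>\<^sub>M e n') \<cdot>\<^sub>M inv \<^sub>M (e n')"
   using y n e_closed by (simp add: M.gnorm)
  also have "... = e (inv n \<cdot> a) \<cdot>\<^sub>M x \<cdot>\<^sub>M e (b \<cdot> inv n')"
   unfolding ab(3) using x ab(1,2) n e_closed e_mult e_inv NR_closed by (simp add: M.m_assoc)
  finally show "same_double_coset y x" unfolding same_double_coset_def using x ab(1,2) n NR_closed by blast
 next
  assume "same_double_coset y x"
  then obtain a b where x: "x : car M" and ab: "a : NR" "b : NR" "y = e a \<cdot>\<^sub>M x \<cdot>\<^sub>M e b"
   by (auto simp: same_double_coset_def)
  have "e n \<cdot>\<^sub>M y \<cdot>\<^sub>M e n' = e (n \<cdot> a) \<cdot>\<^sub>M x \<cdot>\<^sub>M e (b \<cdot> n')"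
   unfolding ab(3) using x ab(1,2) n e_closed e_mult by (simp add: M.m_assoc)
  thus "same_double_coset (e n \<cdot>\<^sub>M y \<cdot>\<^sub>M e n') x"
   unfolding same_double_coset_def using x ab(1,2) n NR_closed by blast
 qed
 thus ?thesis by (simp add: dc_rep_def)
qed

text \<open>If \<open>y\<close> is also \<open>e c r e d\<close>, then \<open>r\<close> conjugates
  \<open>e\<close> of \<open>b d^-1\<close> to \<open>e\<close> of \<open>a^-1 c\<close>. So
  \<open>b d^-1\<close> lies in \<open>dom r\<close>, and the commutation in \<open>pre_lift\<close>
  identifies the two values.\<close>

lemma mu_eq:
 assumes y: "y : car M" and a: "a : NR" "b : NR" and rep: "dc_rep y = r" and eq: "y = e a \<cdot>\<^sub>M r \<cdot>\<^sub>M e b"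
 shows "mu y = dl R R a \<cdot>\<^sub>A mu0 r \<cdot>\<^sub>A dl R R b"
proof -
 let ?r = r and ?P = "%f. EX a:NR. EX b:NR. y = e a \<cdot>\<^sub>M r \<cdot>\<^sub>M e b &
   f = dl R R a \<cdot>\<^sub>A mu0 r \<cdot>\<^sub>A dl R R b"
 have r: "?r : car M" using dc_repE[OF y] rep by metis
 have m: "mu0 ?r : car A" using mu0[OF r] by (simp add: pre_lift_def)
 have "?P (dl R R a \<cdot>\<^sub>A mu0 ?r \<cdot>\<^sub>A dl R R b)"
  by (rule bexI[OF _ a(1)], rule bexI[OF _ a(2)], rule conjI, rule eq, rule HOL.refl)
 from someI[of ?P, OF this] have "?P (mu y)" unfolding mu_def rep .
 then obtain c d where cd: "c : NR" "d : NR" "y = e c \<cdot>\<^sub>M ?r \<cdot>\<^sub>M e d"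
  "mu y = dl R R c \<cdot>\<^sub>A mu0 ?r \<cdot>\<^sub>A dl R R d" by (elim bexE conjE) (rule that)
 have bd: "b \<cdot> inv d : NR" "inv a \<cdot> c : NR" using a cd(1,2) NR_closed by auto
 have "inv \<^sub>M (e a) \<cdot>\<^sub>M (e a \<cdot>\<^sub>M ?r \<cdot>\<^sub>M e b) \<cdot>\<^sub>M inv \<^sub>M (e d) \<cdot>\<^sub>M inv \<^sub>M ?r =
   inv \<^sub>M (e a) \<cdot>\<^sub>M (e c \<cdot>\<^sub>M ?r \<cdot>\<^sub>M e d) \<cdot>\<^sub>M inv \<^sub>M (e d) \<cdot>\<^sub>M inv \<^sub>M ?r"
  unfolding eq[symmetric] cd(3)[symmetric] ..
 hence "e (inv a \<cdot> c) = ?r \<cdot>\<^sub>M e (b \<cdot> inv d) \<cdot>\<^sub>M inv \<^sub>M ?r"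
  using a cd(1,2) r e_closed e_mult e_inv NR_closed by (simp add: M.gnorm)
 note u = act_unique[OF bd this]
 have "mu0 ?r \<cdot>\<^sub>A dl R R (b \<cdot> inv d) = dl R R (inv a \<cdot> c) \<cdot>\<^sub>A mu0 ?r"
  using mu0[OF r] u by (simp add: pre_lift_def)
 hence eq2: "dl R R a \<cdot>\<^sub>A (mu0 ?r \<cdot>\<^sub>A dl R R (b \<cdot> inv d)) \<cdot>\<^sub>A dl R R d =
   dl R R a \<cdot>\<^sub>A (dl R R (inv a \<cdot> c) \<cdot>\<^sub>A mu0 ?r) \<cdot>\<^sub>A dl R R d" by simp
 have "dl R R (b \<cdot> inv d) \<cdot>\<^sub>A dl R R d = dl R R b" "dl R R a \<cdot>\<^sub>A dl R R (inv a \<cdot> c) = dl R R c"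
  using dl_A(2)[OF bd(1) cd(2)] dl_A(2)[OF a(1) bd(2)] a cd(1,2) NR_S by (simp_all add: gnorm)
 moreover have "dl R R a \<cdot>\<^sub>A (mu0 ?r \<cdot>\<^sub>A dl R R (b \<cdot> inv d)) \<cdot>\<^sub>A dl R R d =
   dl R R a \<cdot>\<^sub>A mu0 ?r \<cdot>\<^sub>A (dl R R (b \<cdot> inv d) \<cdot>\<^sub>A dl R R d)"
  "dl R R a \<cdot>\<^sub>A (dl R R (inv a \<cdot> c) \<cdot>\<^sub>A mu0 ?r) \<cdot>\<^sub>A dl R R d =
   dl R R a \<cdot>\<^sub>A dl R R (inv a \<cdot> c) \<cdot>\<^sub>A mu0 ?r \<cdot>\<^sub>A dl R R d"
  using dl_A(1)[OF a(1)] dl_A(1)[OF cd(2)] dl_A(1)[OF bd(1)] dl_A(1)[OF bd(2)] m by (simp_all add: A.m_assoc)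
 ultimately have "dl R R a \<cdot>\<^sub>A mu0 ?r \<cdot>\<^sub>A dl R R b = dl R R c \<cdot>\<^sub>A mu0 ?r \<cdot>\<^sub>A dl R R d"
  using eq2 by simp
 thus ?thesis using cd(4) by simp
qed

lemma mu_shift:
 assumes y: "y : car M" and n: "n : NR" "n' : NR"
 shows "mu (e n \<cdot>\<^sub>M y \<cdot>\<^sub>M e n') = dl R R n \<cdot>\<^sub>A mu y \<cdot>\<^sub>A dl R R n'"
proof -
 obtain x a b where x: "dc_rep y = x" "x : car M" and ab: "a : NR" "b : NR" "y = e a \<cdot>\<^sub>M x \<cdot>\<^sub>M e b"
  by (rule dc_repE[OF y])
 have m: "mu0 x : car A" using mu0[OF x(2)] by (simp add: pre_lift_def)
 have y': "e n \<cdot>\<^sub>M y \<cdot>\<^sub>M e n' : car M" using y n e_closed by simp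
 have "e n \<cdot>\<^sub>M (e a \<cdot>\<^sub>M x \<cdot>\<^sub>M e b) \<cdot>\<^sub>M e n' = e (n \<cdot> a) \<cdot>\<^sub>M x \<cdot>\<^sub>M e (b \<cdot> n')"
  using ab(1,2) x(2) n e_closed e_mult by (simp add: M.m_assoc)
 hence eq: "e n \<cdot>\<^sub>M y \<cdot>\<^sub>M e n' = e (n \<cdot> a) \<cdot>\<^sub>M x \<cdot>\<^sub>M e (b \<cdot> n')"
  unfolding ab(3)[symmetric] .
 have "dc_rep (e n \<cdot>\<^sub>M y \<cdot>\<^sub>M e n') = x" using dc_rep_shift[OF y n] x(1) by simp
 from mu_eq[OF y' NR_closed(1)[OF n(1) ab(1)] NR_closed(1)[OF ab(2) n(2)] this eq]
 have "mu (e n \<cdot>\<^sub>M y \<cdot>\<^sub>M e n') = dl R R (n \<cdot> a) \<cdot>\<^sub>A mu0 x \<cdot>\<^sub>A dl R R (b \<cdot> n')" .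
 thus ?thesis using mu_eq[OF y ab(1,2) x(1) ab(3)] dl_A(2)[OF n(1) ab(1)] dl_A(2)[OF ab(2) n(2)] m
   dl_A(1)[OF ab(1)] dl_A(1)[OF ab(2)] dl_A(1)[OF n(1)] dl_A(1)[OF n(2)] by (simp add: A.m_assoc)
qed

lemma mu_closed: "y : car M ==> mu y : car A"
proof -
 assume y: "y : car M"
 obtain x a b where x: "dc_rep y = x" "x : car M" and ab: "a : NR" "b : NR" "y = e a \<cdot>\<^sub>M x \<cdot>\<^sub>M e b"
  by (rule dc_repE[OF y])
 show ?thesis using x(2) mu_eq[OF y ab(1,2) x(1) ab(3)] mu0 dl_A(1) ab(1,2) by (simp add: pre_lift_def)
qed

lemma mu_e: "n : NR ==> mu (e n) = dl R R n"
proof -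
 assume n: "n : NR"
 have y: "e n : car M" by (rule e_closed[OF n])
 obtain x a b where x: "dc_rep (e n) = x" "x : car M" and ab: "a : NR" "b : NR" "e n = e a \<cdot>\<^sub>M x \<cdot>\<^sub>M e b"
  by (rule dc_repE[OF y])
 define c where "c = inv a \<cdot> n \<cdot> inv b"
 have c: "c : NR" using ab n NR_closed by (simp add: c_def)
 have "e c = inv \<^sub>M (e a) \<cdot>\<^sub>M e n \<cdot>\<^sub>M inv \<^sub>M (e b)"
  using ab(1,2) n NR_closed e_mult e_inv by (simp add: c_def)
 also have "... = x" unfolding ab(3) using ab(1,2) x(2) e_closed by (simp add: M.gnorm)
 \<comment> \<open>The representative of this double coset is itself in the image of
   \<open>NR\<close>, where \<open>mu0\<close> is given by \<open>dl\<close>.\<close>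
 finally have rc: "x = e c" by simp
 hence "mu0 x = dl R R c" using c e_inj by (simp add: mu0_def)
 hence "mu (e n) = dl R R (a \<cdot> c \<cdot> b)"
  using mu_eq[OF y ab(1,2) x(1) ab(3)] dl_A(2)[of "a \<cdot> c" b] dl_A(2)[of a c] ab(1,2) c NR_closed by simp
 moreover have "a \<cdot> c \<cdot> b = n" using ab(1,2) n NR_S by (simp add: c_def gnorm)
 ultimately show ?thesis by simp
qed

lemma pr_mu:
 assumes y: "y : car M" and r: "r : R"
 shows "pr R R (mu y) r = act y r"
proof -
 obtain x a b where x: "dc_rep y = x" "x : car M" and ab: "a : NR" "b : NR" "y = e a \<cdot>\<^sub>M x \<cdot>\<^sub>M e b"
  by (rule dc_repE[OF y])
 note m = mu0[OF x(2), unfolded pre_lift_def aut_simps]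
 let ?f = "mu0 x"
 have f: "?f : mor R R" using m by blast
 have d: "dl R R a : mor R R" "dl R R b : mor R R" using dl_A(1) ab(1,2) by (auto simp: aut_simps)
 have br: "b |> r : R" using ab(2) r norm_iff[OF R_sub] by blast
 have ar: "act x (b |> r) : R" using R_dom(2)[OF x(2) br] .
 have "mu y = cmp R R R (cmp R R R (dl R R a) ?f) (dl R R b)" using mu_eq[OF y ab(1,2) x(1) ab(3)] by (simp add: aut_simps)
 hence "pr R R (mu y) r = a |> act x (b |> r)"
  using pr_cmp_apply[OF R_cen R_cen R_cen d(2) cmp_closed[OF R_cen R_cen R_cen f d(1)] r]
   pr_cmp_apply[OF R_cen R_cen R_cen f d(1) br] pr_dl_apply[OF R_cen R_cen NR_trans[OF ab(2)] r]
   pr_dl_apply[OF R_cen R_cen NR_trans[OF ab(1)] ar] m br by simp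
 also have "... = act (e a) (act x (act (e b) r))"
  using act_e(2)[OF ab(1) subsetD[OF R_NR ar]] act_e(2)[OF ab(2) subsetD[OF R_NR r]] by simp
 also have "... = act y r"
 proof -
  have rb: "act (e b) r = b |> r" by (rule act_e(2)[OF ab(2) subsetD[OF R_NR r]])
  have 1: "act (x \<cdot>\<^sub>M e b) r = act x (act (e b) r)" "r : dom (x \<cdot>\<^sub>M e b)"
   using act_mult[OF x(2) e_closed[OF ab(2)] R_dom(1)[OF e_closed[OF ab(2)] r]] R_dom(1)[OF x(2) br] rb by auto
  have 2: "act (e a \<cdot>\<^sub>M (x \<cdot>\<^sub>M e b)) r = act (e a) (act (x \<cdot>\<^sub>M e b) r)"
   using act_mult(2)[OF e_closed[OF ab(1)] M.m_closed[OF x(2) e_closed[OF ab(2)]] 1(2)] 1(1) rb R_dom(1)[OF e_closed[OF ab(1)] ar] by simp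
  have "y = e a \<cdot>\<^sub>M (x \<cdot>\<^sub>M e b)" using ab x(2) e_closed by (simp add: M.m_assoc)
  thus ?thesis using 1 2 by simp
 qed
 finally show ?thesis .
qed

abbreviation "Z == dl R R ` centre S R"

lemma centre_NR: "z : centre S R ==> z : NR" using centreD(1) R_NR by blast

lemma Z_subgroup: "sgp Z A"
proof (rule A.subgroupI)
 note zs = centre_subgroup[OF R_sub]
 show "Z <= car A" using dl_A(1) centre_NR by blast
 show "Z ~= {}" using sub_one[OF zs] by blast
 have one: "dl R R \<one> = \<one>\<^sub>A" using dl_one[OF R_cen] by (simp add: aut_simps)
 show "inv \<^sub>A a : Z" if "a : Z" for a
 proof -
  obtain z where z: "z : centre S R" "a = dl R R z" using \<open>a : Z\<close> by blast
  have iz: "inv z : centre S R" using sub_inv[OF zs z(1)] .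
  have "dl R R (inv z) \<cdot>\<^sub>A dl R R z = \<one>\<^sub>A"
   using dl_A(2)[OF centre_NR[OF iz] centre_NR[OF z(1)]] one NR_S[OF centre_NR[OF z(1)]] by simp
  hence "inv \<^sub>A a = dl R R (inv z)" unfolding z(2) by (rule A.inv_equality) (use dl_A(1) centre_NR z iz in auto)
  thus ?thesis using iz by blast
 qed
 show "a \<cdot>\<^sub>A b : Z" if ab: "a : Z" "b : Z" for a b
 proof -
  obtain z w where "z : centre S R" "w : centre S R" "a = dl R R z" "b = dl R R w" using ab by blast
  thus ?thesis using dl_A(2)[OF centre_NR centre_NR] sub_mult[OF zs] by (metis imageI)
 qed
qed

lemma Z_normal:
 assumes f: "f : car A" and z: "z : Z"
 shows "inv \<^sub>A f \<cdot>\<^sub>A z \<cdot>\<^sub>A f : Z"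
proof -
 let ?g = "inv \<^sub>A f"
 obtain w where w: "w : centre S R" "z = dl R R w" using z by blast
 have g: "?g : mor R R" using A.inv_closed[OF f] by (simp add: aut_simps)
 have ph: "pr R R ?g : F R R" by (rule pr_closed[OF R_cen R_cen g])
 have pw: "pr R R ?g w : centre S R" by (rule centre_conj[OF R_cen ph aut_image[OF R_sub ph] w(1)])
 have "dl R R (pr R R ?g w) \<cdot>\<^sub>A ?g = ?g \<cdot>\<^sub>A z"
  using dl_commute[OF R_cen R_cen g centreD(1)[OF w(1)]] w(2) by (simp add: aut_simps)
 hence "?g \<cdot>\<^sub>A z \<cdot>\<^sub>A f = dl R R (pr R R ?g w) \<cdot>\<^sub>A ?g \<cdot>\<^sub>A f" by simp
 also have "... = dl R R (pr R R ?g w)" using f dl_A(1)[OF centre_NR[OF pw]] by (simp add: A.m_assoc)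
 finally show ?thesis using pw by blast
qed

lemma Z_comm: "a : Z ==> b : Z ==> a \<cdot>\<^sub>A b = b \<cdot>\<^sub>A a"
proof -
 assume "a : Z" "b : Z"
 then obtain z w where zw: "z : centre S R" "w : centre S R" "a = dl R R z" "b = dl R R w" by blast
 have "z \<cdot> w = w \<cdot> z" using centreD(2)[OF zw(1) centreD(1)[OF zw(2)]] .
 thus ?thesis using dl_A(2)[OF centre_NR[OF zw(1)] centre_NR[OF zw(2)]] dl_A(2)[OF centre_NR[OF zw(2)] centre_NR[OF zw(1)]] zw(3,4) by simp
qed

lemma same_pr:
 assumes f: "f : car A" "f' : car A" and eq: "!!r. r : R ==> pr R R f r = pr R R f' r"
 shows "EX z:Z. f' = f \<cdot>\<^sub>A z"
proof -
 have m: "f : mor R R" "f' : mor R R" using f by (auto simp: aut_simps)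
 have "pr R R f = pr R R f'"
  using F_mon(2)[OF R_sub R_sub pr_closed[OF R_cen R_cen]] m eq by (intro extensionalityI[of _ R]) auto
 thus ?thesis using fibre[OF R_cen R_cen m] by (auto simp: aut_simps)
qed

lemma averaging:
 assumes H: "group H" "finite (car H)" and T: "sgp T H" and m: "order H = card T * m" "\<not> p dvd m"
 shows "coset_average A H T Z m"
proof -
 obtain k where k: "card (centre S R) = p ^ k" using sub_order[OF centre_subgroup[OF R_sub]] by blast
 have fin: "finite (centre S R)" using sub_finite[OF centre_subgroup[OF R_sub]] .
 have "card Z = p ^ k" using k card_image[OF inj_on_subset[OF dl_inj[OF R_cen R_cen]]] centre_NR NR_trans by (metis subsetI)
 moreover have "coprime m (p ^ k)" using prime_imp_coprime[OF p m(2)] by (simp add: coprime_commute)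
 ultimately show ?thesis
  using T m(1) H Z_subgroup fin Z_comm A.is_group by (simp add: coset_average_def coset_average_axioms_def)
qed

text \<open>\<open>mu\<close> is multiplicative up to \<open>Z\<close> because its projection is
  multiplicative, and exactly so when one factor comes from the Sylow subgroup; averaging removes
  the defect. The correction lies in \<open>Z\<close> and leaves the projection unchanged.\<close>

theorem model_lift:
 "EX h:hom M A. (ALL s:NR. h (e s) = dl R R s) & (ALL x:car M. ALL r:R. pr R R (h x) r = act x r)"
proof -
 obtain m where m: "order M = card (e ` NR) * m" "\<not> p dvd m"
  using M.sylow_subgroup_index[OF p M_finite e_sylow] by blast
 interpret c: coset_average A M "e ` NR" Z m by (rule averaging[OF M.is_group M_finite e_NR_subgroup m])
 have one: "e \<one> = \<one>\<^sub>M" "dl R R \<one> = \<one>\<^sub>A" using eh.hom_one dl_one[OF R_cen] by (auto simp: aut_simps)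
 have quasi: "EX z:Z. mu x \<cdot>\<^sub>A mu y = mu (x \<cdot>\<^sub>M y) \<cdot>\<^sub>A z" if xy: "x : car M" "y : car M" for x y
 proof (rule same_pr)
  have m: "mu x : mor R R" "mu y : mor R R" using mu_closed xy by (auto simp: aut_simps)
  show "mu (x \<cdot>\<^sub>M y) : car A" "mu x \<cdot>\<^sub>A mu y : car A" using mu_closed xy by auto
  fix r assume r: "r : R"
  note yr = R_dom[OF xy(2) r]
  show "pr R R (mu (x \<cdot>\<^sub>M y)) r = pr R R (mu x \<cdot>\<^sub>A mu y) r"
   using pr_cmp_apply[OF R_cen R_cen R_cen m(2,1) r] pr_mu[OF xy(2) r] pr_mu[OF xy(1) yr(2)] pr_mu[OF M.m_closed[OF xy] r]
    act_mult(2)[OF xy yr(1) R_dom(1)[OF xy(1) yr(2)]] by (simp add: aut_simps)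
 qed
 have "EX t. (ALL x:car M. t x : Z) & (ALL n:e ` NR. t n = \<one>\<^sub>A) & (%x. mu x \<cdot>\<^sub>A t x) : hom M A"
 proof (rule c.lift_average[OF mu_closed quasi _ _ Z_normal[OF mu_closed]])
  fix x n assume x: "x : car M" and "n : e ` NR"
  then obtain s where s: "s : NR" "n = e s" by blast
  show "mu (n \<cdot>\<^sub>M x) = mu n \<cdot>\<^sub>A mu x"
   using mu_shift[OF x s(1) NR_closed(3)] mu_e[OF s(1)] s mu_closed[OF x] dl_A(1)[OF s(1)] e_closed[OF s(1)] x one by simp
  show "mu (x \<cdot>\<^sub>M n) = mu x \<cdot>\<^sub>A mu n"
   using mu_shift[OF x NR_closed(3) s(1)] mu_e[OF s(1)] s mu_closed[OF x] dl_A(1)[OF s(1)] e_closed[OF s(1)] x one by simp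
 qed
 then obtain t where t: "!!x. x : car M ==> t x : Z" "!!n. n : e ` NR ==> t n = \<one>\<^sub>A"
  "(%x. mu x \<cdot>\<^sub>A t x) : hom M A" by blast
 have "mu (e s) \<cdot>\<^sub>A t (e s) = dl R R s" if "s : NR" for s using t(2) mu_e[OF that] dl_A(1)[OF that] that by simp
 moreover have "pr R R (mu x \<cdot>\<^sub>A t x) r = act x r" if x: "x : car M" and r: "r : R" for x r
 proof -
  obtain z where z: "z : centre S R" "t x = dl R R z" using t(1)[OF x] by blast
  have zR: "z : R" "z : trp S R R" using centreD(1)[OF z(1)] NR_trans[OF centre_NR[OF z(1)]] by auto
  have "z |> r = r" using centreD(2)[OF z(1) r] sub_car[OF R_sub r] sub_car[OF R_sub zR(1)] by (simp add: m_assoc)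
  thus ?thesis using pr_cmp_apply[OF R_cen R_cen R_cen dl_closed[OF R_cen R_cen zR(2)] _ r, of "mu x"] mu_closed[OF x]
    pr_dl_apply[OF R_cen R_cen zR(2) r] pr_mu[OF x r] z(2) by (simp add: aut_simps)
 qed
 ultimately show ?thesis using t(3) by (intro bexI[of _ "%x. mu x \<cdot>\<^sub>A t x"]) auto
qed

end

lemma (in linking) inc_slide:
 assumes "cen P" "cen Q" "P <= Q" "d : Q" "d : trp S P P"
 shows "cmp P P Q (inc P Q) (dl P P d) = cmp P Q Q (dl Q Q d) (inc P Q)"
 using dl_cmp[OF assms(1,1,2,5) one_trp[OF cen_sub[OF assms(1)] assms(3)]]
  dl_cmp[OF assms(1,2,2) one_trp[OF cen_sub[OF assms(1)] assms(3)] self_transp[OF assms(2,4)]]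
  sub_car[OF cen_sub[OF assms(2)] assms(4)] by simp

lemma (in linking) inc_inc:
 assumes "cen P" "cen Q" "cen T" "P <= Q" "Q <= T"
 shows "cmp P Q T (inc Q T) (inc P Q) = inc P T"
 using dl_cmp[OF assms(1-3) one_trp[OF cen_sub[OF assms(1)] assms(4)] one_trp[OF cen_sub[OF assms(2)] assms(5)]] by simp

context model_linking
begin

text \<open>On \<open>K\<close>, a lift of the whole model and the prescribed \<open>et\<close> have
  the same projection and agree on the Sylow subgroup, so an element of \<open>Z\<close> conjugates
  one to the other. Conjugating the whole lift by it preserves the projection and yields the
  prescribed values on \<open>K\<close>.\<close>

theorem model_lift_extending:
 assumes K: "sgp K M" "e ` NR <= K"
  and et: "et : hom (M(|carrier := K|)) A" "!!s. s : NR ==> et (e s) = dl R R s"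
   "!!x r. x : K ==> r : R ==> pr R R (et x) r = act x r"
 shows "EX h:hom M A. (ALL s:NR. h (e s) = dl R R s) & (ALL x:car M. ALL r:R. pr R R (h x) r = act x r) &
  (ALL x:K. h x = et x)"
proof -
 obtain h where h: "h : hom M A" "!!s. s : NR ==> h (e s) = dl R R s"
  "!!x r. x : car M ==> r : R ==> pr R R (h x) r = act x r" using model_lift by blast
 have Kc: "x : car M" if "x : K" for x using sub_mem[OF K(1) that] .
 have hc: "h x : car A" if "x : car M" for x using h(1) that by (auto simp: hom_def)
 have hK: "h : hom (M(|carrier := K|)) A" using h(1) Kc by (auto simp: hom_def)
 interpret K: group "M(|carrier := K|)" by (rule M.subgroup_imp_group[OF K(1)])
 have NK: "sgp (e ` NR) (M(|carrier := K|))" by (rule M.subgroup_incl[OF e_NR_subgroup K(1) K(2)])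
 obtain m where m: "order M = card (e ` NR) * m" "\<not> p dvd m" using M.sylow_subgroup_index[OF p M_finite e_sylow] by blast
 define m' where "m' = card (rcosets\<^bsub>M(|carrier := K|)\<^esub> (e ` NR))"
 have oK: "order (M(|carrier := K|)) = card (e ` NR) * m'" using K.lagrange[OF NK] by (simp add: m'_def mult.commute)
 have "card K dvd order M" using M.lagrange[OF K(1)] by (metis dvd_triv_right)
 hence "card (e ` NR) * m' dvd card (e ` NR) * m" using oK m(1) by (simp add: order_def)
 moreover have "card (e ` NR) ~= 0" using finite_imageI[OF sub_finite[OF NR_sub], of e] NR_closed(3) by auto
 ultimately have "m' dvd m" by simp
 hence "\<not> p dvd m'" using m(2) dvd_trans by blast
 moreover have "finite (car (M(|carrier := K|)))" using finite_subset[OF sub_le[OF K(1)] M_finite] by simp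
 ultimately interpret c: coset_average A "M(|carrier := K|)" "e ` NR" Z m' by (intro averaging[OF K.is_group _ NK oK]) auto
 have "EX b:Z. ALL x:car (M(|carrier := K|)). et x = inv \<^sub>A b \<cdot>\<^sub>A h x \<cdot>\<^sub>A b"
 proof (rule c.conj_average[OF hK et(1)])
  fix x assume "x : car (M(|carrier := K|))"
  hence x: "x : K" "x : car M" using Kc by auto
  have "et x : car A" using et(1) x by (auto simp: hom_def)
  thus "EX z:Z. et x = h x \<cdot>\<^sub>A z" using same_pr[OF hc[OF x(2)]] et(3)[OF x(1)] h(3)[OF x(2)] by simp
  show "inv \<^sub>A h x \<cdot>\<^sub>A z \<cdot>\<^sub>A h x : Z" if "z : Z" for z by (rule Z_normal[OF hc[OF x(2)] that])
 qed (use et(2) h(2) in auto)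
 then obtain b where b: "b : Z" "!!x. x : K ==> et x = inv \<^sub>A b \<cdot>\<^sub>A h x \<cdot>\<^sub>A b" by auto
 have bc: "b : car A" using sub_mem[OF Z_subgroup b(1)] .
 define h' where "h' = (%x. inv \<^sub>A b \<cdot>\<^sub>A h x \<cdot>\<^sub>A b)"
 have "h' : hom M A"
 proof (rule homI)
  show "h' x : car A" if "x : car M" for x using hc[OF that] bc by (simp add: h'_def)
  fix x y assume xy: "x : car M" "y : car M"
  have "h (x \<cdot>\<^sub>M y) = h x \<cdot>\<^sub>A h y" using h(1) xy by (auto simp: hom_def)
  thus "h' (x \<cdot>\<^sub>M y) = h' x \<cdot>\<^sub>A h' y" using hc xy bc by (simp add: h'_def A.gnorm)
 qed
 moreover have eqK: "h' x = et x" if "x : K" for x using b(2)[OF that] by (simp add: h'_def)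
 moreover have "h' (e s) = dl R R s" if "s : NR" for s using eqK[of "e s"] et(2)[OF that] K(2) that by auto
 moreover have "pr R R (h' x) r = act x r" if x: "x : car M" and r: "r : R" for x r
 proof -
  obtain z where z: "z : centre S R" "b = dl R R z" using b(1) by blast
  have ib: "inv \<^sub>A b : Z" using sub_inv[OF Z_subgroup b(1)] .
  then obtain w where w: "w : centre S R" "inv \<^sub>A b = dl R R w" by blast
  have fixes_R: "pr R R (dl R R u) t = t" if u: "u : centre S R" and t: "t : R" for u t
  proof -
   have uR: "u : R" using centreD(1)[OF u] .
   have "u |> t = t" using centreD(2)[OF u t] sub_car[OF R_sub t] sub_car[OF R_sub uR] by (simp add: m_assoc)
   thus ?thesis using pr_dl_apply[OF R_cen R_cen NR_trans[OF centre_NR[OF u]] t] by simp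
  qed
  have m: "h x : mor R R" "dl R R z : mor R R" "dl R R w : mor R R"
   using hc[OF x] dl_A(1)[OF centre_NR[OF z(1)]] dl_A(1)[OF centre_NR[OF w(1)]] by (auto simp: aut_simps)
  have "h' x = cmp R R R (cmp R R R (dl R R w) (h x)) (dl R R z)" by (simp add: h'_def aut_simps w(2)[symmetric] z(2)[symmetric])
  thus ?thesis using pr_cmp_apply[OF R_cen R_cen R_cen m(2) cmp_closed[OF R_cen R_cen R_cen m(1,3)] r]
    pr_cmp_apply[OF R_cen R_cen R_cen m(1,3) r] fixes_R[OF z(1) r] fixes_R[OF w(1) R_dom(2)[OF x r]] h(3)[OF x r] by simp
 qed
 ultimately show ?thesis by blast
qed

end

section \<open>Extending the lift from \<open>R\<close> to the domains of the elements of the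
  model\<close>

locale lifted_model = model_linking S F p R M e LL pr dl
 for S :: "'a monoid" (structure) and F and p and R and M :: "'b monoid" and e
  and LL :: "('a set, 'm) cat" and pr and dl +
 fixes h :: "'b => 'm"
 assumes h_hom: "h : hom M (aut_link R)" and h_e: "!!s. s : NR ==> h (e s) = dl R R s"
  and pr_h: "!!x r. x : car M ==> r : R ==> pr R R (h x) r = act x r"
begin

abbreviation "US == car S"

lemma US_cen: "cen US" by (rule centric_overgroup[OF R_cen sub_self sub_le[OF R_sub]])

lemma h_closed: "x : car M ==> h x : mor R R" using h_hom by (auto simp: hom_def aut_simps)

lemma h_mult: "x : car M ==> y : car M ==> h (x \<cdot>\<^sub>M y) = cmp R R R (h x) (h y)"
 using h_hom by (auto simp: hom_def aut_simps)

lemma h_commute: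
 assumes x: "x : car M" and d: "d : dom x"
 shows "cmp R R R (h x) (dl R R d) = cmp R R R (dl R R (act x d)) (h x)"
proof -
 note n = dom_NR[OF d] act(1)[OF d]
 have "x \<cdot>\<^sub>M e d = e (act x d) \<cdot>\<^sub>M x" using act(2)[OF d] x e_closed[OF n(1)] by (simp add: M.gnorm)
 thus ?thesis using h_mult[OF x e_closed[OF n(1)]] h_mult[OF e_closed[OF n(2)] x] h_e[OF n(1)] h_e[OF n(2)] by simp
qed

lemma incs: "inc R US : mor R US" "R <= US" "NR <= US"
 using inc_closed[OF R_cen US_cen] sub_le[OF R_sub] sub_le[OF NR_sub] by auto

definition extends :: "'b => 'm => bool" where
 "extends x f <-> f : mor (dom x) US & (ALL d:dom x. pr (dom x) US f d = act x d) &
   cmp R (dom x) US f (inc R (dom x)) = cmp R R US (inc R US) (h x)"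

text \<open>
  A lift of the conjugation map on \<open>dom x\<close> restricts to \<open>h x\<close> only up to an element \<open>z\<close> of \<open>Z(R)\<close>. As
  both commute with \<open>dom x\<close> in the same way, \<open>z\<close> centralizes \<open>dom x\<close>, so it can be absorbed in the lift.
\<close>

lemma extends_exists:
 assumes x: "x : car M"
 shows "EX f. extends x f"
proof -
 let ?D = "dom x"
 note D = dom_cen[OF x] and R = R_cen and U = US_cen
 have RD: "R <= ?D" using R_dom(1)[OF x] by blast
 note sD = dom_subgroup[OF x]
 have "restrict (act x) ?D : F ?D US" by (rule F_widen[OF sD NR_sub sub_self act_F[OF x] incs(3)])
 then obtain g where g: "g : mor ?D US" "pr ?D US g = restrict (act x) ?D" using pr_surj[OF D U] by blast
 note iD = inc_closed[OF R D RD]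
 define k where "k = cmp R ?D US g (inc R ?D)"
 define k' where "k' = cmp R R US (inc R US) (h x)"
 have km: "k : mor R US" "k' : mor R US"
  unfolding k_def k'_def using cmp_closed[OF R D U iD g(1)] cmp_closed[OF R R U h_closed[OF x] incs(1)] by auto
 have "pr R US k = pr R US k'"
 proof (rule extensionalityI[of _ R])
  show "pr R US k : extensional R" "pr R US k' : extensional R"
   using F_mon(2)[OF R_sub sub_self pr_closed[OF R U]] km by auto
  fix r assume r: "r : R"
  have "r : ?D" using RD r by blast
  thus "pr R US k r = pr R US k' r"
   using pr_cmp_apply[OF R D U iD g(1) r] pr_inc[OF R D RD r] g(2) pr_cmp_apply[OF R R U h_closed[OF x] incs(1) r]
    pr_h[OF x r] pr_inc[OF R U incs(2) R_dom(2)[OF x r]] by (simp add: k_def k'_def)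
 qed
 then obtain z where z: "z : centre S R" "k' = cmp R R US k (dl R R z)" using fibre[OF R U km] by blast
 have zD: "z : ?D" "z : NR" using RD centreD(1)[OF z(1)] centre_NR[OF z(1)] by auto
 have slide: "cmp R R US k (dl R R d) = cmp R US US (dl US US (act x d)) k"
  "cmp R R US k' (dl R R d) = cmp R US US (dl US US (act x d)) k'"
  "cmp R R US k (dl R R d) = cmp R ?D US (cmp ?D ?D US g (dl ?D ?D d)) (inc R ?D)" if d: "d : ?D" for d
 proof -
  let ?d = "act x d"
  have n: "d : NR" "?d : NR" "?d : US" using dom_NR[OF d] act(1)[OF d] NR_S by auto
  note m = dl_closed[OF R R NR_trans[OF n(1)]] dl_closed[OF R R NR_trans[OF n(2)]]
  note mD = dl_self_closed[OF D d] dl_self_closed[OF U n(3)]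
  show 3: "cmp R R US k (dl R R d) = cmp R ?D US (cmp ?D ?D US g (dl ?D ?D d)) (inc R ?D)"
   unfolding k_def using cmp_assoc[OF R R D U m(1) iD g(1)] inc_slide[OF R D RD d NR_trans[OF n(1)]]
    cmp_assoc[OF R D D U iD mD(1) g(1)] by simp
  have "cmp ?D ?D US g (dl ?D ?D d) = cmp ?D US US (dl US US ?d) g" using dl_commute[OF D U g(1) d] g(2) d by simp
  thus "cmp R R US k (dl R R d) = cmp R US US (dl US US ?d) k"
   using 3 cmp_assoc[OF R D U U iD g(1) mD(2)] by (simp add: k_def)
  show "cmp R R US k' (dl R R d) = cmp R US US (dl US US ?d) k'"
   unfolding k'_def using cmp_assoc[OF R R R U m(1) h_closed[OF x] incs(1)] h_commute[OF x d]
    cmp_assoc[OF R R R U h_closed[OF x] m(2) incs(1)] inc_slide[OF R U incs(2) n(3) NR_trans[OF n(2)]]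
    cmp_assoc[OF R R U U h_closed[OF x] incs(1) mD(2)] by simp
 qed
 have commute: "z \<cdot> d = d \<cdot> z" if d: "d : ?D" for d
 proof -
  let ?d = "act x d"
  have n: "d : NR" "?d : US" using dom_NR[OF d] act(1)[OF d] NR_S by auto
  note m = dl_closed[OF R R NR_trans[OF n(1)]] dl_closed[OF R R NR_trans[OF zD(2)]]
  have zd: "cmp R R R (dl R R z) (dl R R d) = dl R R (z \<cdot> d)" "cmp R R R (dl R R d) (dl R R z) = dl R R (d \<cdot> z)"
   using dl_A(2)[OF zD(2) n(1)] dl_A(2)[OF n(1) zD(2)] by (auto simp: aut_simps)
  have nn: "z \<cdot> d : NR" "d \<cdot> z : NR" using NR_closed zD(2) n(1) by auto
  note mm = dl_closed[OF R R NR_trans[OF nn(1)]] dl_closed[OF R R NR_trans[OF nn(2)]]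
  have "cmp R R US k (dl R R (z \<cdot> d)) = cmp R R US k' (dl R R d)"
   using cmp_assoc[OF R R R U m(1,2) km(1)] z(2) zd(1) by simp
  also have "... = cmp R US US (dl US US ?d) (cmp R R US k (dl R R z))" using slide(2)[OF d] z(2) by simp
  also have "... = cmp R R US (cmp R R US k (dl R R d)) (dl R R z)"
   using cmp_assoc[OF R R U U m(2) km(1) dl_self_closed[OF U n(2)]] slide(1)[OF d] by simp
  also have "... = cmp R R US k (dl R R (d \<cdot> z))" using cmp_assoc[OF R R R U m(2,1) km(1)] zd(2) by simp
  finally have "dl R R (z \<cdot> d) = dl R R (d \<cdot> z)" by (rule mono[OF R R U mm km(1)])
  thus ?thesis using inj_onD[OF dl_inj[OF R R]] NR_trans nn by blast
 qed
 let ?f = "cmp ?D ?D US g (dl ?D ?D z)"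
 have "?f : mor ?D US" by (rule cmp_closed[OF D D U dl_self_closed[OF D zD(1)] g(1)])
 moreover have "pr ?D US ?f d = act x d" if d: "d : ?D" for d
 proof -
  have "z |> d = d" using commute[OF d] sub_car[OF sD d] sub_car[OF sD zD(1)] by (simp add: m_assoc)
  thus ?thesis
   using pr_cmp_apply[OF D D U dl_self_closed[OF D zD(1)] g(1) d] pr_dl_apply[OF D D self_transp[OF D zD(1)] d] g(2) d by simp
 qed
 moreover have "cmp R ?D US ?f (inc R ?D) = k'" using slide(3)[OF zD(1)] z(2) by simp
 ultimately show ?thesis unfolding extends_def k'_def by blast
qed

definition ext :: "'b => 'm" where "ext x = (SOME f. extends x f)"

lemma ext:
 assumes "x : car M"
 shows "ext x : mor (dom x) US" "d : dom x ==> pr (dom x) US (ext x) d = act x d"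
  "cmp R (dom x) US (ext x) (inc R (dom x)) = cmp R R US (inc R US) (h x)"
 using someI_ex[OF extends_exists[OF assms]] by (auto simp: ext_def extends_def)

text \<open>Subgroups of \<open>NR\<close> normalise \<open>R\<close>, so a morphism on such an
  overgroup of \<open>R\<close> is known from its restriction to \<open>R\<close>.\<close>

lemma determined:
 assumes D: "cen D" "R <= D" "D <= NR" and Q: "cen Q" and f: "f : mor D Q" "f' : mor D Q"
  and eq: "cmp R D Q f (inc R D) = cmp R D Q f' (inc R D)"
 shows "f = f'" by (rule extension_unique[OF R_cen D(1) Q D(2) _ f eq]) (use D(3) NR_trans in blast)

lemma dom_e: "s : NR ==> dom (e s) = NR" using act_e(1) dom_NR by blast

lemma ext_e:
 assumes s: "s : NR"
 shows "ext (e s) = dl NR US s"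
proof -
 note N = NR_cen
 have x: "e s : car M" by (rule e_closed[OF s])
 note E = ext[OF x, unfolded dom_e[OF s]]
 have t: "s : trp S NR US" "\<one> : trp S R NR" "\<one> : trp S R US"
  using NR_S[OF s] NR_S one_trp[OF R_sub R_NR] one_trp[OF R_sub incs(2)] by (auto simp: trp_iff'[OF NR_sub])
 have "cmp R NR US (dl NR US s) (inc R NR) = cmp R R US (inc R US) (dl R R s)"
  using dl_cmp[OF R_cen N US_cen t(2,1)] dl_cmp[OF R_cen R_cen US_cen NR_trans[OF s] t(3)] NR_S[OF s] by simp
 hence "cmp R NR US (ext (e s)) (inc R NR) = cmp R NR US (dl NR US s) (inc R NR)" using E(3) h_e[OF s] by simp
 thus ?thesis by (rule determined[OF N R_NR order_refl US_cen E(1) dl_closed[OF N US_cen t(1)]])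
qed

text \<open>Both sides factor through the subgroup \<open>D\<close> on which first \<open>y\<close>
  and then \<open>x\<close> can be applied. Since \<open>D\<close> contains \<open>R\<close> and
  normalises it, the morphisms on \<open>D\<close> need to be compared on \<open>R\<close> only,
  where their equality is the multiplicativity of \<open>h\<close>.\<close>

lemma ext_mult:
 assumes x: "x : car M" and y: "y : car M" and P: "cen P" and f: "f : mor P US"
  and im: "!!u. u : P ==> pr P US f u : dom y" "!!u. u : P ==> act y (pr P US f u) : dom x"
 defines "k == cmp P (dom y) US (ext y) (res P (dom y) US f)"
 shows "cmp P (dom x) US (ext x) (res P (dom x) US k) =
  cmp P (dom (x \<cdot>\<^sub>M y)) US (ext (x \<cdot>\<^sub>M y)) (res P (dom (x \<cdot>\<^sub>M y)) US f)"
proof -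
 define D where "D = {s : dom y. act y s : dom x}"
 have xy: "x \<cdot>\<^sub>M y : car M" using x y by simp
 note sx = dom_subgroup[OF x] and sy = dom_subgroup[OF y]
 have Dsub: "sgp D S"
 proof (rule subgroupI)
  show "D <= US" using sub_car[OF sy] by (auto simp: D_def)
  show "D ~= {}" using R_dom[OF y] R_dom(1)[OF x] sub_one[OF R_sub] by (auto simp: D_def)
  fix a b assume a: "a : D"
  have ay: "a : dom y" "act y a : dom x" using a by (auto simp: D_def)
  have ia: "inv a : dom y" using sub_inv[OF sy ay(1)] .
  have "act y (inv a) = inv (act y a)" using F_inv[OF sy NR_sub act_F[OF y] ay(1)] ay(1) ia by simp
  thus "inv a : D" using ia sub_inv[OF sx ay(2)] by (simp add: D_def)
  assume "b : D"
  thus "a \<cdot> b : D" using act_hom[OF y ay(1), of b] sub_mult[OF sx ay(2), of "act y b"] by (auto simp: D_def)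
 qed
 have RD: "R <= D" using R_dom[OF y] R_dom(1)[OF x] by (auto simp: D_def)
 have DN: "D <= NR" "D <= dom y" "D <= US" using dom_NR sub_car[OF Dsub] by (auto simp: D_def)
 have Dxy: "D <= dom (x \<cdot>\<^sub>M y)" using act_mult(1)[OF x y] by (auto simp: D_def)
 have Dc: "cen D" by (rule centric_overgroup[OF R_cen Dsub RD])
 note cx = dom_cen[OF x] and cy = dom_cen[OF y] and cxy = dom_cen[OF xy] and U = US_cen and R = R_cen
 have domU: "dom w <= US" for w using dom_NR NR_S by blast
 have Rd: "R <= dom x" "R <= dom y" using R_dom(1) x y by auto
 have imD: "pr P US f ` P <= D" using im by (auto simp: D_def)
 define f' where "f' = res P D US f"
 have f': "f' : mor P D" "cmp P D US (inc D US) f' = f" unfolding f'_def using res[OF P Dc U f imD DN(3)] by auto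
 have restrict_f: "res P T US f = cmp P D T (inc D T) f'" if T: "cen T" "D <= T" for T
 proof -
  have TU: "T <= US" using sub_le[OF cen_sub[OF T(1)]] .
  note iT = inc_closed[OF Dc T] inc_closed[OF T(1) U TU]
  have "cmp P T US (inc T US) (cmp P D T (inc D T) f') = f"
   using cmp_assoc[OF P Dc T(1) U f'(1) iT] inc_inc[OF Dc T(1) U T(2) TU] f'(2) by simp
  thus ?thesis using res_unique[OF P T(1) U cmp_closed[OF P Dc T(1) f'(1) iT(1)] TU] by simp
 qed
 note iy = inc_closed[OF Dc cy DN(2)] and ixy = inc_closed[OF Dc cxy Dxy] and iD = inc_closed[OF R Dc RD]
 define w where "w = cmp D (dom y) US (ext y) (inc D (dom y))"
 have w: "w : mor D US" unfolding w_def by (rule cmp_closed[OF Dc cy U iy ext(1)[OF y]])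
 have "pr D US w s = act y s" if "s : D" for s
  using pr_cmp_apply[OF Dc cy U iy ext(1)[OF y] that] pr_inc[OF Dc cy DN(2) that] ext(2)[OF y] DN(2) that by (auto simp: w_def)
 hence imw: "pr D US w ` D <= dom x" by (auto simp: D_def)
 define w' where "w' = res D (dom x) US w"
 have w': "w' : mor D (dom x)" "cmp D (dom x) US (inc (dom x) US) w' = w"
  unfolding w'_def using res[OF Dc cx U w imw domU] by auto
 have kw: "k = cmp P D US w f'"
  unfolding k_def restrict_f[OF cy DN(2)] w_def by (rule cmp_assoc[OF P Dc cy U f'(1) iy ext(1)[OF y]])
 have "res P (dom x) US k = cmp P D (dom x) w' f'" unfolding kw w'_def by (rule res_cmp[OF Dc P cx U w imw domU f'(1)])
 hence lhs: "cmp P (dom x) US (ext x) (res P (dom x) US k) = cmp P D US (cmp D (dom x) US (ext x) w') f'"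
  using cmp_assoc[OF P Dc cx U f'(1) w'(1) ext(1)[OF x]] by simp
 have rhs: "cmp P (dom (x \<cdot>\<^sub>M y)) US (ext (x \<cdot>\<^sub>M y)) (res P (dom (x \<cdot>\<^sub>M y)) US f) =
   cmp P D US (cmp D (dom (x \<cdot>\<^sub>M y)) US (ext (x \<cdot>\<^sub>M y)) (inc D (dom (x \<cdot>\<^sub>M y)))) f'"
  using restrict_f[OF cxy Dxy] cmp_assoc[OF P Dc cxy U f'(1) ixy ext(1)[OF xy]] by simp
 have "cmp D (dom x) US (ext x) w' = cmp D (dom (x \<cdot>\<^sub>M y)) US (ext (x \<cdot>\<^sub>M y)) (inc D (dom (x \<cdot>\<^sub>M y)))"
 proof (rule determined[OF Dc RD DN(1) U cmp_closed[OF Dc cx U w'(1) ext(1)[OF x]] cmp_closed[OF Dc cxy U ixy ext(1)[OF xy]]])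
  note irx = inc_closed[OF R cx Rd(1)] inc_closed[OF cx U domU]
  have "cmp R (dom x) US (inc (dom x) US) (cmp R D (dom x) w' (inc R D)) = cmp R D US w (inc R D)"
   using cmp_assoc[OF R Dc cx U iD w'(1) irx(2)] w'(2) by simp
  also have "... = cmp R (dom y) US (ext y) (inc R (dom y))"
   unfolding w_def using cmp_assoc[OF R Dc cy U iD iy ext(1)[OF y]] inc_inc[OF R Dc cy RD DN(2)] by simp
  also have "... = cmp R R US (cmp R (dom x) US (inc (dom x) US) (inc R (dom x))) (h y)"
   using ext(3)[OF y] inc_inc[OF R cx U Rd(1) domU] by simp
  also have "... = cmp R (dom x) US (inc (dom x) US) (cmp R R (dom x) (inc R (dom x)) (h y))"
   using cmp_assoc[OF R R cx U h_closed[OF y] irx] by simp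
  finally have w'R: "cmp R D (dom x) w' (inc R D) = cmp R R (dom x) (inc R (dom x)) (h y)"
   by (rule mono[OF R cx U cmp_closed[OF R Dc cx iD w'(1)] cmp_closed[OF R R cx h_closed[OF y] irx(1)] irx(2)])
  have "cmp R D US (cmp D (dom x) US (ext x) w') (inc R D) = cmp R (dom x) US (ext x) (cmp R R (dom x) (inc R (dom x)) (h y))"
   using cmp_assoc[OF R Dc cx U iD w'(1) ext(1)[OF x]] w'R by simp
  also have "... = cmp R R US (cmp R R US (inc R US) (h x)) (h y)"
   using cmp_assoc[OF R R cx U h_closed[OF y] irx(1) ext(1)[OF x]] ext(3)[OF x] by simp
  also have "... = cmp R R US (inc R US) (h (x \<cdot>\<^sub>M y))"
   using cmp_assoc[OF R R R U h_closed[OF y] h_closed[OF x] incs(1)] h_mult[OF x y] by simp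
  also have "... = cmp R D US (cmp D (dom (x \<cdot>\<^sub>M y)) US (ext (x \<cdot>\<^sub>M y)) (inc D (dom (x \<cdot>\<^sub>M y)))) (inc R D)"
   using ext(3)[OF xy] cmp_assoc[OF R Dc cxy U iD ixy ext(1)[OF xy]] inc_inc[OF R Dc cxy RD Dxy] by simp
  finally show "cmp R D US (cmp D (dom x) US (ext x) w') (inc R D) =
    cmp R D US (cmp D (dom (x \<cdot>\<^sub>M y)) US (ext (x \<cdot>\<^sub>M y)) (inc D (dom (x \<cdot>\<^sub>M y)))) (inc R D)" .
 qed
 thus ?thesis using lhs rhs by simp
qed

end

section \<open>The fusion system of Robinson's group\<close>

locale robinson = saturated_fusion S F p for S :: "'a monoid" (structure) and F and p +
 fixes Rs :: "'a set set" and n :: nat and R :: "nat => 'a set" and L :: "nat => 'b monoid"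
  and e :: "nat => 'a => 'b" and io :: "nat => 'b => 'b"
 assumes data: "robinson_data p S F Rs n R L e io"
begin

lemmas data_facts = data[unfolded robinson_data_def]

lemma Rs_facts:
 shows "P : Rs ==> centric S F P"
  and "centric S F P ==> radical p S F P ==> P : Rs"
  and "P : Rs ==> EX i<=n. fusion_conj S F P (R i)"
 using data_facts[THEN conjunct1] data_facts[THEN conjunct2, THEN conjunct2, THEN conjunct1]
  data_facts[THEN conjunct2, THEN conjunct2, THEN conjunct2, THEN conjunct2, THEN conjunct2, THEN conjunct1] by blast+

lemma R_zero: "R 0 = car S" by (rule data_facts[THEN conjunct2, THEN conjunct2, THEN conjunct2, THEN conjunct1])

lemma R_member: "i <= n ==> R i : Rs & fully_normalized S F (R i)"
 by (rule data_facts[THEN conjunct2, THEN conjunct2, THEN conjunct2, THEN conjunct2, THEN conjunct1, rule_format])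

lemma R_model: "i <= n ==> is_model p S F (R i) (L i) (e i)"
 by (rule data_facts[THEN conjunct2, THEN conjunct2, THEN conjunct2, THEN conjunct2, THEN conjunct2, THEN conjunct2,
  THEN conjunct1, rule_format])

lemma io:
 assumes "1 <= i" "i <= n"
 shows "io i : mon ((L 0)(|carrier := edge_group R L e i|)) (L i)"
  and "x : normalizer S (R i) ==> io i (e 0 x) = e i x"
 using data_facts[THEN conjunct2, THEN conjunct2, THEN conjunct2, THEN conjunct2, THEN conjunct2, THEN conjunct2,
  THEN conjunct2, rule_format, of i] assms by blast+

lemma R_centric: "i <= n ==> centric S F (R i)" using Rs_facts(1) R_member by blast

lemma model: "i <= n ==> model S F p (R i) (L i) (e i)"
 by (intro model.intro model_axioms.intro saturated_fusion_axioms R_centric R_model)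

sublocale zero: model S F p "R 0" "L 0" "e 0" by (rule model) simp

abbreviation "US == car S"
abbreviation "NS i == normalizer S (R i)"
abbreviation "dm i == model.dom S (R i) (L i) (e i)"
abbreviation "ac i == model.act S (R i) (L i) (e i)"
abbreviation "pG == robinson_group n R L e io"
abbreviation "j == robinson_incl n R L e io"

lemma NS_zero: "NS 0 = US" using norm_iff[OF sub_self] R_zero by auto

lemma R_sub: "i <= n ==> sgp (R i) S" using centric_subgroup[OF R_centric] .
lemma NS_sub: "i <= n ==> sgp (NS i) S" using norm_subgroup[OF R_sub] .
lemma NS_US: "i <= n ==> s : NS i ==> s : US" using sub_car[OF NS_sub] .

lemma e0_mem: "s : US ==> e 0 s : car (L 0)" using zero.e_closed by (simp add: NS_zero)

lemma edge_iff:
 assumes i: "i <= n"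
 shows "x : edge_group R L e i <-> x : car (L 0) & (ALL r:R i. x |>\<^sub>(L 0) e 0 r : e 0 ` R i)"
proof -
 have "e 0 ` R i <= car (L 0)" using e0_mem sub_car[OF R_sub[OF i]] by blast
 from zero.M.normalizer_iff[OF this finite_imageI[OF sub_finite[OF R_sub[OF i]]]]
 show ?thesis unfolding edge_group_def by simp
qed

lemma edge_e0:
 assumes i: "i <= n"
 shows "s : US ==> e 0 s : edge_group R L e i <-> s : NS i"
proof -
 assume s: "s : US"
 have "e 0 s |>\<^sub>(L 0) e 0 r : e 0 ` R i <-> s |> r : R i" if r: "r : R i" for r
 proof -
  have rU: "r : US" using sub_car[OF R_sub[OF i] r] .
  have N: "s : NS 0" "r : NS 0" "inv s : NS 0" "s \<cdot> r : NS 0" "s |> r : NS 0"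
   unfolding NS_zero using s rU m_closed inv_closed by blast+
  have eq: "e 0 s |>\<^sub>(L 0) e 0 r = e 0 (s |> r)"
   unfolding zero.e_mult[OF N(4,3)] zero.e_mult[OF N(1,2)] zero.e_inv[OF N(1)] ..
  have "R i <= NS 0" unfolding NS_zero by (rule sub_le[OF R_sub[OF i]])
  from inj_on_image_mem_iff[OF zero.e_inj N(5) this] show ?thesis unfolding eq .
 qed
 thus ?thesis unfolding edge_iff[OF i] norm_iff[OF R_sub[OF i]] using s e0_mem[OF s] by blast
qed

sublocale am: amalgam_data n R L e io
proof (rule amalgam_data.intro)
 fix i assume i: "i <= n"
 interpret m: model S F p "R i" "L i" "e i" by (rule model[OF i])
 show "group (L i)" "finite (car (L i))" using m.M.is_group m.M_finite by auto
next
 fix i assume i: "1 <= i" "i <= n"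
 have "e 0 ` R i <= car (L 0)" using e0_mem sub_car[OF R_sub[OF i(2)]] by blast
 thus "sgp (edge_group R L e i) (L 0)" unfolding edge_group_def by (rule zero.M.normalizer_imp_subgroup)
 show "io i : mon ((L 0)(|carrier := edge_group R L e i|)) (L i)" by (rule io(1)[OF i])
qed

lemma j_vert: "j s = am.vert 0 (e 0 s)" by (simp add: robinson_incl_def am.vert_def)

lemma vert_e:
 assumes "i <= n" "s : NS i"
 shows "am.vert i (e i s) = j s"
proof (cases "i = 0")
 case False
 hence i: "1 <= i" by simp
 have "e 0 s : edge_group R L e i" using edge_e0[OF assms(1)] NS_US[OF assms] assms(2) by simp
 from am.vert_edge[OF i assms(1) this] show ?thesis unfolding io(2)[OF i assms(1,2)] j_vert .
qed (simp add: j_vert)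

lemma j_mon: "j : mon S pG"
proof -
 have "j : hom S pG" using am.vert_closed[OF zero_le] am.vert_mult[OF zero_le] e0_mem zero.e_mult
  by (intro homI) (auto simp: j_vert NS_zero)
 moreover have "inj_on j US"
 proof (rule inj_onI)
  fix s t assume st: "s : US" "t : US" "j s = j t"
  hence "e 0 s = e 0 t" using inj_onD[OF am.vert_inj[OF zero_le]] e0_mem j_vert by metis
  thus "s = t" using inj_onD[OF zero.e_inj] st by (simp add: NS_zero)
 qed
 ultimately show ?thesis by (simp add: mon_def)
qed

sublocale gfs: realised S "group_fusion pG j" pG j
proof (intro realised.intro fusion.intro fusion_axioms.intro realised_axioms.intro)
 show "group S" by (rule is_group)
 show "fusion_system S (group_fusion pG j)" by (rule am.pG.group_fusion_system[OF is_group j_mon])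
 show "group pG" by (rule am.pG.is_group)
 show "j : mon S pG" by (rule j_mon)
qed simp

lemma vert_conj:
 assumes "i <= n" "x : car (L i)" "y : car (L i)"
 shows "am.vert i x |>\<^sub>pG am.vert i y = am.vert i (x |>\<^sub>(L i) y)"
proof -
 interpret Li: group "L i" by (rule am.L_group[OF assms(1)])
 interpret v: group_hom "L i" pG "am.vert i" by (rule am.vert_group_hom[OF assms(1)])
 show ?thesis using assms(2,3) by simp
qed

lemma j_conj:
 assumes "i <= n" "x : car (L i)" "s : NS i"
 shows "am.vert i x |>\<^sub>pG j s = am.vert i (x |>\<^sub>(L i) e i s)"
  and "am.vert i x |>\<^sub>pG j s : j ` NS i <-> s : dm i x"
  and "s : dm i x ==> am.vert i x |>\<^sub>pG j s = j (ac i x s)"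
proof -
 interpret m: model S F p "R i" "L i" "e i" by (rule model[OF assms(1)])
 show 1: "am.vert i x |>\<^sub>pG j s = am.vert i (x |>\<^sub>(L i) e i s)"
  using vert_conj[OF assms(1,2) m.e_closed[OF assms(3)]] vert_e[OF assms(1,3)] by simp
 have y: "x |>\<^sub>(L i) e i s : car (L i)" using assms(2) m.e_closed[OF assms(3)] by simp
 have im: "j ` NS i = am.vert i ` e i ` NS i" using vert_e[OF assms(1)] by (force simp: image_image)
 have "e i ` NS i <= car (L i)" using m.e_closed by blast
 thus "am.vert i x |>\<^sub>pG j s : j ` NS i <-> s : dm i x"
  unfolding 1 im using inj_on_image_mem_iff[OF am.vert_inj[OF assms(1)] y] assms(3) by (simp add: m.dom_def)
 show "am.vert i x |>\<^sub>pG j s = j (ac i x s)" if "s : dm i x"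
  unfolding 1 using vert_e[OF assms(1) m.act(1)[OF that]] m.act(2)[OF that] by simp
qed

text \<open>This is the Sylow property of the model, carried over along the embedding of the vertex
  group.\<close>

lemma vertex_p_subgroup:
 assumes i: "i <= n" and Q: "p_subgroup p pG Q" "Q <= am.vert i ` car (L i)"
 shows "EX x:car (L i). ALL q:Q. am.vert i x |>\<^sub>pG q : j ` NS i"
proof -
 interpret m: model S F p "R i" "L i" "e i" by (rule model[OF i])
 interpret v: group_hom "L i" pG "am.vert i" by (rule am.vert_group_hom[OF i])
 define Q' where "Q' = {x : car (L i). am.vert i x : Q}"
 have sQ: "sgp Q pG" using Q by (simp add: p_subgroup_def)
 have "sgp Q' (L i)" by (rule m.M.subgroupI)
   (auto simp: Q'_def sub_one[OF sQ] sub_mult[OF sQ] sub_inv[OF sQ] intro!: exI[of _ "\<one>\<^sub>(L i)"])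
 moreover have vQ: "am.vert i ` Q' = Q" using Q(2) by (auto simp: Q'_def)
 moreover have "card (am.vert i ` Q') = card Q'"
  using inj_on_subset[OF am.vert_inj[OF i], of Q'] by (intro card_image) (auto simp: Q'_def)
 moreover have "finite Q'" using m.M_finite by (simp add: Q'_def)
 ultimately have "p_subgroup p (L i) Q'" using Q(1) by (simp add: p_subgroup_def)
 then obtain x where x: "x : car (L i)" "x <#\<^sub>(L i) Q' #>\<^sub>(L i) inv \<^sub>(L i) x <= e i ` NS i"
  using m.e_sylow unfolding sylow_subgroup_def by blast
 have conj: "x |>\<^sub>(L i) y : e i ` NS i" if "y : Q'" for y
  using x(2) m.M.conj_set[OF x(1), of Q'] that by (auto simp: Q'_def)
 have "am.vert i x |>\<^sub>pG q : j ` NS i" if q: "q : Q" for q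
 proof -
  obtain y where y: "y : Q'" "q = am.vert i y" using q unfolding vQ[symmetric] by blast
  have yc: "y : car (L i)" using y(1) by (simp add: Q'_def)
  obtain s where s: "s : NS i" "x |>\<^sub>(L i) y = e i s" using conj[OF y(1)] by blast
  have "am.vert i x |>\<^sub>pG q = j s" unfolding y(2) vert_conj[OF i x(1) yc] s(2) by (rule vert_e[OF i s(1)])
  thus ?thesis using s(1) by blast
 qed
 thus ?thesis using x(1) by blast
qed

lemma dom_zero:
 assumes "x : car (L 0)"
 shows "dm 0 x = US"
proof
 show "dm 0 x <= US" using zero.dom_NR unfolding NS_zero by blast
 show "US <= dm 0 x" using zero.R_dom(1)[OF assms] unfolding R_zero by blast
qed

text \<open>As \<open>R 0\<close> is \<open>S\<close>, the image of \<open>S\<close> in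
  \<open>L 0\<close> is both Sylow and normal, so it contains every \<open>p\<close>-subgroup of
  that vertex group. Carrying \<open>P\<close> into the base vertex group is thus the same as
  carrying it into \<open>S\<close>.\<close>

lemma base_transporter:
 assumes P: "sgp P S"
 shows "trp pG (j ` P) (am.vert 0 ` car (L 0)) = gfs.N P US"
proof
 show "gfs.N P US <= trp pG (j ` P) (am.vert 0 ` car (L 0))" using e0_mem by (force simp: trp_def j_vert)
 show "trp pG (j ` P) (am.vert 0 ` car (L 0)) <= gfs.N P US"
 proof
  fix g assume g: "g : trp pG (j ` P) (am.vert 0 ` car (L 0))"
  have gc: "g : car pG" "!!u. u : P ==> g |>\<^sub>pG j u : am.vert 0 ` car (L 0)"
   using g am.pG.trp_iff[OF gfs.j_sub[OF P]] by auto
  let ?Q = "(%a. g |>\<^sub>pG a) ` j ` P"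
  have "card (j ` P) = card P" using inj_on_subset[OF gfs.j_inj sub_le[OF P]] by (rule card_image)
  hence "p_subgroup p pG (j ` P)"
   using gfs.jh.subgroup_img_is_subgroup[OF P] sub_finite[OF P] sub_order[OF P] by (simp add: p_subgroup_def)
  hence Q: "p_subgroup p pG ?Q" by (rule am.pG.p_subgroup_conj[OF _ gc(1)])
  have Q0: "?Q <= am.vert 0 ` car (L 0)" using gc(2) by blast
  obtain x where x: "x : car (L 0)"
   "ALL q:?Q. am.vert 0 x |>\<^sub>pG q : j ` US"
   using vertex_p_subgroup[OF zero_le Q Q0, unfolded NS_zero] by (elim bexE) (rule that)
  interpret v: group_hom "L 0" pG "am.vert 0" by (rule am.vert_group_hom[OF zero_le])
  have "g |>\<^sub>pG j u : j ` US" if u: "u : P" for u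
  proof -
   let ?q = "g |>\<^sub>pG j u"
   have qc: "?q : car pG" using gc(1) subsetD[OF gfs.j_sub[OF P] imageI[OF u]] by simp
   obtain s where s: "s : US" "am.vert 0 x \<cdot>\<^sub>pG ?q \<cdot>\<^sub>pG inv \<^sub>pG (am.vert 0 x) = j s"
    using bspec[OF x(2), of ?q] u by blast
   have xc: "am.vert 0 x : car pG" using x(1) by simp
   have ix: "inv \<^sub>(L 0) x : car (L 0)" using x(1) by simp
   have "?q = am.vert 0 (inv \<^sub>(L 0) x) \<cdot>\<^sub>pG (am.vert 0 x \<cdot>\<^sub>pG ?q \<cdot>\<^sub>pG inv \<^sub>pG (am.vert 0 x)) \<cdot>\<^sub>pG
     inv \<^sub>pG (am.vert 0 (inv \<^sub>(L 0) x))" using x(1) xc qc by (simp add: am.pG.m_assoc am.pG.inv_cancel_left)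
   also have "... = j (ac 0 (inv \<^sub>(L 0) x) s)"
    unfolding s(2) using j_conj(3)[OF zero_le ix] s(1) unfolding dom_zero[OF ix] NS_zero by blast
   finally show ?thesis using zero.act(1)[of s "inv \<^sub>(L 0) x"] s(1) unfolding dom_zero[OF ix] NS_zero by blast
  qed
  thus "g : gfs.N P US" using gfs.N_iff[OF P] gc(1) by simp
 qed
qed

text \<open>By the previous result the image of \<open>P\<close> lies in \<open>S\<close>, and an
  element of \<open>S\<close> lies in the edge group exactly when it normalises
  \<open>R i\<close>.\<close>

lemma edge_transporter:
 assumes P: "sgp P S" and i: "i <= n"
 shows "trp pG (j ` P) (am.vert 0 ` edge_group R L e i) = gfs.N P (NS i)"
proof
 show "gfs.N P (NS i) <= trp pG (j ` P) (am.vert 0 ` edge_group R L e i)"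
  using edge_e0[OF i] NS_US[OF i] by (force simp: trp_def j_vert)
 show "trp pG (j ` P) (am.vert 0 ` edge_group R L e i) <= gfs.N P (NS i)"
 proof
  fix g assume g: "g : trp pG (j ` P) (am.vert 0 ` edge_group R L e i)"
  have gc: "g : car pG" "!!u. u : P ==> g |>\<^sub>pG j u : am.vert 0 ` edge_group R L e i"
   using g am.pG.trp_iff[OF gfs.j_sub[OF P]] by auto
  have eL: "edge_group R L e i <= car (L 0)" using edge_iff[OF i] by blast
  have "g : trp pG (j ` P) (am.vert 0 ` car (L 0))" using g image_mono[OF eL, of "am.vert 0"] unfolding trp_def by blast
  hence gU: "g : gfs.N P US" using base_transporter[OF P] by simp
  have "g |>\<^sub>pG j u : j ` NS i" if u: "u : P" for u
  proof -
   obtain t where t: "t : US" "g |>\<^sub>pG j u = j t" using gU gfs.N_iff[OF P] u by blast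
   obtain y where y: "y : edge_group R L e i" "j t = am.vert 0 y" using gc(2)[OF u] t(2) by auto
   have "e 0 t = y" using inj_onD[OF am.vert_inj[OF zero_le]] y eL e0_mem[OF t(1)] j_vert by auto
   hence "t : NS i" using edge_e0[OF i t(1)] y(1) by simp
   thus ?thesis using t(2) by blast
  qed
  thus "g : gfs.N P (NS i)" using gfs.N_iff[OF P] gc(1) by simp
 qed
qed

section \<open>Moves by elements of the vertex groups and the fusion system they realise\<close>

abbreviation "moves == (SIGMA i:{..n}. car (L i))"
abbreviation "move_elt == (%(i, x). am.vert i x)"
abbreviation "move_dom == (%(i, x). dm i x)"

lemma dom_sub: "i <= n ==> x : car (L i) ==> sgp (dm i x) S" using model.dom_subgroup[OF model] .

text \<open>The domain of a move consists of what lies in \<open>NS i\<close> both before and after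
  it. Hence any two elements of one coset of \<open>L i\<close> that carry \<open>P\<close> into
  \<open>NS i\<close> are joined by a single move.\<close>

lemma vert_move:
 assumes P: "sgp P S" and i: "i <= n" "x : car (L i)"
 shows "g : gfs.N P (dm i x) <-> g : gfs.N P (NS i) & am.vert i x \<cdot>\<^sub>pG g : gfs.N P (NS i)"
proof -
 interpret m: model S F p "R i" "L i" "e i" by (rule model[OF i(1)])
 have vc: "am.vert i x : car pG" by (rule am.vert_closed[OF i])
 have "(ALL u:P. g |>\<^sub>pG j u : j ` dm i x) <-> (ALL u:P. g |>\<^sub>pG j u : j ` NS i &
   (am.vert i x \<cdot>\<^sub>pG g) \<cdot>\<^sub>pG j u \<cdot>\<^sub>pG inv \<^sub>pG (am.vert i x \<cdot>\<^sub>pG g) : j ` NS i)" if g: "g : car pG"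
 proof (rule ball_cong[OF HOL.refl])
  fix u assume u: "u : P"
  have ju: "j u : car pG" by (rule subsetD[OF gfs.j_sub[OF P] imageI[OF u]])
  let ?q = "g |>\<^sub>pG j u"
  have eq: "(am.vert i x \<cdot>\<^sub>pG g) |>\<^sub>pG j u =
    am.vert i x \<cdot>\<^sub>pG ?q \<cdot>\<^sub>pG inv \<^sub>pG (am.vert i x)" using g vc ju by (simp add: am.pG.gnorm)
  show "?q : j ` dm i x <-> ?q : j ` NS i &
    (am.vert i x \<cdot>\<^sub>pG g) \<cdot>\<^sub>pG j u \<cdot>\<^sub>pG inv \<^sub>pG (am.vert i x \<cdot>\<^sub>pG g) : j ` NS i"
  proof
   assume "?q : j ` dm i x"
   then obtain s where s: "s : dm i x" "?q = j s" by blast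
   thus "?q : j ` NS i & (am.vert i x \<cdot>\<^sub>pG g) |>\<^sub>pG j u : j ` NS i"
    unfolding eq using j_conj(2)[OF i m.dom_NR[OF s(1)]] m.dom_NR[OF s(1)] by simp
  next
   assume a: "?q : j ` NS i & (am.vert i x \<cdot>\<^sub>pG g) |>\<^sub>pG j u : j ` NS i"
   then obtain s where s: "s : NS i" "?q = j s" by blast
   thus "?q : j ` dm i x" using a j_conj(2)[OF i s(1)] unfolding eq by simp
  qed
 qed
 moreover have "am.vert i x \<cdot>\<^sub>pG g : car pG" if "g : car pG" using vc that by simp
 ultimately show ?thesis unfolding gfs.N_iff[OF P] by blast
qed

lemma NS_transporter: "i <= n ==> g : gfs.N P (NS i) ==> g : gfs.N P US" using NS_US unfolding trp_def by blast

lemma vert_transporter: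
 assumes i: "i <= n" "x : car (L i)"
 shows "am.vert i x : gfs.N (dm i x) (NS i)" "am.vert i x : gfs.N (dm i x) US"
proof -
 interpret m: model S F p "R i" "L i" "e i" by (rule model[OF i(1)])
 show "am.vert i x : gfs.N (dm i x) (NS i)"
  using gfs.N_iff[OF dom_sub[OF i]] am.vert_closed[OF i] j_conj(2)[OF i] m.dom_NR by simp
 thus "am.vert i x : gfs.N (dm i x) US" by (rule NS_transporter[OF i(1)])
qed

lemma ind_vert:
 assumes i: "i <= n" "x : car (L i)"
 shows "gfs.ind (dm i x) (am.vert i x) = restrict (ac i x) (dm i x)"
proof -
 interpret m: model S F p "R i" "L i" "e i" by (rule model[OF i(1)])
 have "restrict (ac i x) (dm i x) = gfs.ind (dm i x) (am.vert i x)" using m.act(1) j_conj(3)[OF i] m.dom_NR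
  by (intro gfs.ind_unique[OF dom_sub[OF i] NS_sub[OF i(1)]]) auto
 thus ?thesis by simp
qed

lemma connected: "connected_moves S pG j moves move_elt move_dom" unfolding connected_moves_def
proof (intro allI impI)
 fix P X
 assume P: "sgp P S" and one: "\<one>\<^sub>pG : X"
  and step: "ALL i:moves. ALL g:gfs.N P (move_dom i). g : X <-> move_elt i \<cdot>\<^sub>pG g : X"
 have step': "g : X <-> am.vert i x \<cdot>\<^sub>pG g : X" if "i <= n" "x : car (L i)" "g : gfs.N P (dm i x)" for i x g
  using step[rule_format, of "(i, x)" g] that by simp
 have sub: "sgp (j ` P) pG" by (rule gfs.jh.subgroup_img_is_subgroup[OF P])
 \<comment> \<open>At a vertex of type \<open>i\<close> the group \<open>P\<close> is carried into
   \<open>L i\<close>, not necessarily into \<open>S\<close>. The condition therefore refers to all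
   translates by \<open>L i\<close> that carry \<open>P\<close> into \<open>NS i\<close>, which
   makes it a property of the coset.\<close>
 define M where "M = (%i. {g : trp pG (j ` P) (am.vert i ` car (L i)).
  ALL x:car (L i). am.vert i x \<cdot>\<^sub>pG g : gfs.N P (NS i) --> am.vert i x \<cdot>\<^sub>pG g : X})"
 have left: "u \<cdot>\<^sub>pG g : trp pG (j ` P) (am.vert i ` car (L i))"
  if "i <= n" "u : am.vert i ` car (L i)" "g : trp pG (j ` P) (am.vert i ` car (L i))" for i u g
 proof -
  have "sgp (am.vert i ` car (L i)) pG" using group_hom.img_is_subgroup[OF am.vert_group_hom[OF that(1)]] .
  moreover have "g : car pG" using that(3) by (simp add: trp_def)
  ultimately show ?thesis using am.pG.transporter_left_mult[OF _ gfs.j_sub[OF P] that(2)] that(3) by blast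
 qed
 have "trp pG (j ` P) (am.vert 0 ` car (L 0)) <= X \<inter> gfs.N P US"
 proof (rule am.tree.fixed_tree_connected[OF am.universal_actions sub, where M = M])
  show "X \<inter> gfs.N P US <= trp pG (j ` P) (am.vert 0 ` car (L 0))" using base_transporter[OF P] by blast
  show "\<one>\<^sub>pG : X \<inter> gfs.N P US" using one gfs.j_transporter[OF P gfs.one_trp[OF P sub_le[OF P]]] by simp
  show "u \<cdot>\<^sub>pG g : X \<inter> gfs.N P US" if u: "u : am.vert 0 ` car (L 0)" and g: "g : X \<inter> gfs.N P US" for u g
  proof -
   obtain x where x: "x : car (L 0)" "u = am.vert 0 x" using u by blast
   have "u \<cdot>\<^sub>pG g : gfs.N P US" using left[OF zero_le u, of g] g base_transporter[OF P] by simp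
   moreover have "u \<cdot>\<^sub>pG g : X" using step'[OF zero_le x(1), of g] g x(2) dom_zero[OF x(1)] by simp
   ultimately show ?thesis by blast
  qed
  show "M i <= trp pG (j ` P) (am.vert i ` car (L i))" for i by (auto simp: M_def)
  show "u \<cdot>\<^sub>pG g : M i" if i: "i : {1..n}" and u: "u : am.vert i ` car (L i)" and g: "g : M i" for i u g
  proof -
   have i': "i <= n" using i by simp
   interpret Li: group "L i" by (rule am.L_group[OF i'])
   obtain y where y: "y : car (L i)" "u = am.vert i y" using u by blast
   have g': "g : trp pG (j ` P) (am.vert i ` car (L i))" "g : car pG"
    "!!x. x : car (L i) ==> am.vert i x \<cdot>\<^sub>pG g : gfs.N P (NS i) ==> am.vert i x \<cdot>\<^sub>pG g : X"
    using g unfolding M_def by (blast, simp add: trp_def, blast)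
   have "am.vert i x \<cdot>\<^sub>pG (u \<cdot>\<^sub>pG g) = am.vert i (x \<cdot>\<^sub>(L i) y) \<cdot>\<^sub>pG g" if "x : car (L i)" for x
    using am.vert_mult[OF i' that y(1)] am.vert_closed[OF i'] that y g'(2) by (simp add: am.pG.m_assoc)
   thus ?thesis using left[OF i' u g'(1)] g'(3) y(1) by (simp add: M_def)
  qed
  show "g : X \<inter> gfs.N P US <-> \<one>\<^sub>pG \<cdot>\<^sub>pG g : M i"
   if i: "i : {1..n}" and g: "g : trp pG (j ` P) (am.vert 0 ` am.edge i)" for i g
  proof -
   have i': "i <= n" using i by simp
   interpret m: model S F p "R i" "L i" "e i" by (rule model[OF i'])
   have gN: "g : gfs.N P (NS i)" using g edge_transporter[OF P i'] by simp
   hence gU: "g : gfs.N P US" "g : car pG" using NS_transporter[OF i'] gfs.N_carrier by auto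
   have gB: "g : trp pG (j ` P) (am.vert i ` car (L i))"
   proof -
    have "j ` NS i <= am.vert i ` car (L i)" using vert_e[OF i'] m.e_closed by (metis image_subsetI imageI)
    thus ?thesis using gN unfolding trp_def by blast
   qed
   have one_i: "am.vert i \<one>\<^sub>(L i) = \<one>\<^sub>pG" using group_hom.hom_one[OF am.vert_group_hom[OF i']] .
   have "g : X <-> g : M i"
   proof
    assume gX: "g : X"
    have "am.vert i x \<cdot>\<^sub>pG g : X" if "x : car (L i)" "am.vert i x \<cdot>\<^sub>pG g : gfs.N P (NS i)" for x
     using step'[OF i' that(1)] vert_move[OF P i' that(1)] gN that(2) gX by blast
    thus "g : M i" using gB by (simp add: M_def)
   next
    assume "g : M i"
    hence "am.vert i \<one>\<^sub>(L i) \<cdot>\<^sub>pG g : gfs.N P (NS i) --> am.vert i \<one>\<^sub>(L i) \<cdot>\<^sub>pG g : X"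
     unfolding M_def using m.M.one_closed by blast
    thus "g : X" using gN gU(2) by (simp add: one_i)
   qed
   thus ?thesis using gU by simp
  qed
 qed simp
 thus "gfs.N P US <= X" using base_transporter[OF P] by blast
qed

text \<open>The models supply every automorphism of the representatives \<open>R i\<close>, which is
  enough for one inclusion. For the other, an element of a model induces a map of \<open>F\<close>
  on its domain, and these are the maps of the moves.\<close>

theorem robinson_realises: "realises p S F pG j"
proof -
 have sub1: "F P Q <= group_fusion pG j P Q" if PQ: "sgp P S" "sgp Q S" for P Q
 proof
  fix ph assume ph: "ph : F P Q"
  have "F P US <= group_fusion pG j P US"
  proof (rule alperin[OF gfs.fusion_system _ PQ(1)])
   fix P' assume P': "centric S F P'" "radical p S F P'"
   then obtain i where i: "i <= n" "fusion_conj S F P' (R i)" using Rs_facts(2,3) by blast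
   interpret m: model S F p "R i" "L i" "e i" by (rule model[OF i(1)])
   have "al : group_fusion pG j (R i) (R i)" if al: "al : F (R i) (R i)" for al
   proof -
    obtain x where x: "x : car (L i)" "!!r. r : R i ==> e i (al r) = x |>\<^sub>(L i) e i r"
     using m.aut_model[OF al] by blast
    have rN: "r : NS i" "al r : NS i" "al r : R i" if "r : R i" for r
     using m.R_NR F_in[OF R_sub[OF i(1)] R_sub[OF i(1)] al] that by auto
    have eq: "j (al r) = am.vert i x |>\<^sub>pG j r" if r: "r : R i" for r
     unfolding j_conj(1)[OF i(1) x(1) rN(1)[OF r]] x(2)[OF r, symmetric] by (rule vert_e[OF i(1) rN(2)[OF r], symmetric])
    have "am.vert i x : gfs.N (R i) (R i)"
     using gfs.N_iff[OF R_sub[OF i(1)]] am.vert_closed[OF i(1) x(1)] rN(3) by (auto simp: eq[symmetric])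
    moreover have "al : R i \<rightarrow>\<^sub>E R i" using rN(3) F_mon(2)[OF R_sub[OF i(1)] R_sub[OF i(1)] al] by (auto simp: PiE_def)
    ultimately show ?thesis unfolding group_fusion_def using eq by blast
   qed
   thus "EX Q. fusion_conj S F P' Q & fully_normalized S F Q & F Q Q <= group_fusion pG j Q Q" using i R_member by blast
  qed
  hence "ph : group_fusion pG j P US" using F_widen[OF PQ sub_self ph sub_le[OF PQ(2)]] by blast
  thus "ph : group_fusion pG j P Q" using gfs.F_corestrict[OF PQ(1) sub_self _ PQ(2)] F_in[OF PQ ph] by blast
 qed
 have sub2: "group_fusion pG j P Q <= F P Q" if "sgp P S" "sgp Q S" for P Q
 proof (rule gfs.fusion_of_moves[OF fusion_system connected _ _ _ that])
  fix i assume "i : moves"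
  then obtain k x where i: "i = (k, x)" "k <= n" "x : car (L k)" by auto
  interpret m: model S F p "R k" "L k" "e k" by (rule model[OF i(2)])
  show "sgp (move_dom i) S" "move_elt i : gfs.N (move_dom i) US"
   using dom_sub[OF i(2,3)] vert_transporter[OF i(2,3)] i(1) by auto
  show "gfs.ind (move_dom i) (move_elt i) : F (move_dom i) US"
   using ind_vert[OF i(2,3)] F_widen[OF dom_sub[OF i(2,3)] NS_sub[OF i(2)] sub_self m.act_F[OF i(3)]]
    sub_le[OF NS_sub[OF i(2)]] i(1) by simp
 qed
 have jU: "j ` US <= am.vert 0 ` car (L 0)" using e0_mem by (auto simp: j_vert)
 have T: "p_subgroup p pG (j ` US)"
  using order_S card_image[OF gfs.j_inj] gfs.jh.img_is_subgroup finite_S by (auto simp: p_subgroup_def order_def)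
 have "sylow_subgroup p pG (j ` US)"
 proof (rule am.tree.sylow_of_vertices[OF p am.universal_actions am.universal_actions T jU])
  fix Q assume Q: "p_subgroup p pG Q" "Q <= am.vert 0 ` car (L 0) \<or> (EX i:{1..n}. Q <= am.vert i ` car (L i))"
  then obtain i where i: "i <= n" "Q <= am.vert i ` car (L i)" by auto
  obtain x where x: "x : car (L i)" "ALL q:Q. am.vert i x |>\<^sub>pG q : j ` NS i"
   using vertex_p_subgroup[OF i(1) Q(1) i(2)] by blast
  have "j ` NS i <= j ` US" using NS_US[OF i(1)] by blast
  hence "(%a. am.vert i x |>\<^sub>pG a) ` Q <= j ` US"
   using x(2) by (intro image_subsetI) (rule subsetD, assumption, rule bspec)
  thus "EX g:car pG. (%a. g |>\<^sub>pG a) ` Q <= j ` US" by (rule bexI[OF _ am.vert_closed[OF i(1) x(1)]])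
 qed
 thus ?thesis unfolding realises_def using am.pG.is_group j_mon sub1 sub2 by blast
qed

end

section \<open>The corollary for Robinson's group\<close>

locale robinson_linking =
 realised_linking S F "robinson_group n R L e io" "robinson_incl n R L e io" LL pr dl + B: robinson S F p Rs n R L e io
 for S :: "'a monoid" (structure) and F and p and Rs and n and R and L :: "nat => 'b monoid" and e and io
  and LL :: "('a set, 'm) cat" and pr and dl
begin

abbreviation "pG == robinson_group n R L e io"
abbreviation "j == robinson_incl n R L e io"
abbreviation "edge i == edge_group R L e i"
abbreviation "v == B.am.vert"

lemma model_linking: "i <= n ==> model_linking S F p (R i) (L i) (e i) LL pr dl"
 by (intro model_linking.intro B.model linking_axioms)

lemma cenU: "cen U" using B.R_centric[OF zero_le] unfolding B.R_zero .

lemma inc_UU: "inc U U = ident LL U" by (rule dl_one[OF cenU])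

text \<open>An element of the edge group normalises the images of both \<open>S\<close> and
  \<open>R i\<close> in \<open>L 0\<close>, hence also that of \<open>NS i\<close>. As
  \<open>io i\<close> is the identity on \<open>NS i\<close>, the two vertex groups act alike there,
  and on the side of \<open>L i\<close> the domain is all of \<open>NS i\<close>.\<close>

lemma edge_zero:
 assumes i: "1 <= i" "i <= n" and x: "x : edge i"
 shows "x : car (L 0)" "io i x : car (L i)"
  and "r : R i ==> B.ac 0 x r : R i"
  and "s : B.NS i ==> s : B.dm i (io i x)" "s : B.NS i ==> B.ac i (io i x) s = B.ac 0 x s"
proof -
 interpret m: model S F p "R i" "L i" "e i" by (rule B.model[OF i(2)])
 show xc: "x : car (L 0)" "io i x : car (L i)" using B.am.edge_in[OF i x] by auto
 note es = B.am.edge_subgroup[OF i]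
 have ac0: "B.ac 0 x s : U" "e 0 (B.ac 0 x s) = x |>\<^sub>(L 0) e 0 s" if "s : U" for s
 proof -
  have s: "s : B.dm 0 x" unfolding B.dom_zero[OF xc(1)] by (rule that)
  show "B.ac 0 x s : U" using B.zero.act(1)[OF s] unfolding B.NS_zero .
  show "e 0 (B.ac 0 x s) = x |>\<^sub>(L 0) e 0 s" by (rule B.zero.act(2)[OF s])
 qed
 show "B.ac 0 x r : R i" if r: "r : R i" for r
 proof -
  have rU: "r : U" using sub_car[OF B.R_sub[OF i(2)] r] .
  have "e 0 (B.ac 0 x r) : e 0 ` R i" unfolding ac0(2)[OF rU] using x r B.edge_iff[OF i(2)] by blast
  then obtain t where t: "t : R i" "e 0 (B.ac 0 x r) = e 0 t" by blast
  have tU: "t : U" using sub_car[OF B.R_sub[OF i(2)] t(1)] .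
  have "B.ac 0 x r = t" using inj_onD[OF B.zero.e_inj t(2)] ac0(1)[OF rU] tU unfolding B.NS_zero by blast
  thus ?thesis using t(1) by simp
 qed
 have both: "s : B.dm i (io i x) & B.ac i (io i x) s = B.ac 0 x s" if s: "s : B.NS i" for s
 proof -
  have sU: "s : U" by (rule B.NS_US[OF i(2) s])
  have es0: "e 0 s : edge i" using B.edge_e0[OF i(2) sU] s by simp
  have "x |>\<^sub>(L 0) e 0 s : edge i" using sub_mult[OF es sub_mult[OF es x es0] sub_inv[OF es x]] .
  hence tN: "B.ac 0 x s : B.NS i" using B.edge_e0[OF i(2) ac0(1)[OF sU]] ac0(2)[OF sU] by simp
  interpret h: group_hom "(L 0)(|carrier := edge i|)" "L i" "io i"
   using B.io(1)[OF i] B.zero.M.subgroup_imp_group[OF es] m.M.is_group by (simp add: group_hom_def group_hom_axioms_def mon_def)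
  have "e i (B.ac 0 x s) = io i (x |>\<^sub>(L 0) e 0 s)"
   unfolding ac0(2)[OF sU, symmetric] by (rule B.io(2)[OF i tN, symmetric])
  also have "... = io i x |>\<^sub>(L i) e i s"
  proof -
   have "io i (inv \<^sub>(L 0) x) = inv \<^sub>(L i) (io i x)"
    using h.hom_inv[of x] x B.zero.M.m_inv_consistent[OF es x] by simp
   moreover have "io i (x |>\<^sub>(L 0) e 0 s) = io i (x \<cdot>\<^sub>(L 0) e 0 s) \<cdot>\<^sub>(L i) io i (inv \<^sub>(L 0) x)"
    using h.hom_mult[of "x \<cdot>\<^sub>(L 0) e 0 s" "inv \<^sub>(L 0) x"] sub_mult[OF es x es0] sub_inv[OF es x] by simp
   moreover have "io i (x \<cdot>\<^sub>(L 0) e 0 s) = io i x \<cdot>\<^sub>(L i) e i s"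
    using h.hom_mult[of x "e 0 s"] x es0 B.io(2)[OF i s] by simp
   ultimately show ?thesis by simp
  qed
  finally have "e i (B.ac 0 x s) = io i x |>\<^sub>(L i) e i s" .
  from m.act_unique[OF s tN this] show ?thesis by blast
 qed
 show "s : B.NS i ==> s : B.dm i (io i x)" "s : B.NS i ==> B.ac i (io i x) s = B.ac 0 x s" using both by auto
qed

text \<open>The lift of \<open>L 0\<close> is fixed before the others. Restricted to
  \<open>R i\<close> it gives a lift of the edge group, which a lift of \<open>L i\<close> can be
  made to extend. Since the tree of groups is a star, the leaves impose no conditions on each
  other.\<close>

lemma lifts_exist:
 "EX h. (ALL i<=n. lifted_model S F p (R i) (L i) (e i) LL pr dl (h i)) &
  (ALL i x. 1 <= i --> i <= n --> x : edge i -->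
   cmp (R i) U U (h 0 x) (inc (R i) U) = cmp (R i) (R i) U (inc (R i) U) (h i (io i x)))"
proof -
 interpret z: model_linking S F p "R 0" "L 0" "e 0" LL pr dl by (rule model_linking) simp
 obtain h0 where h0: "h0 : hom (L 0) (aut_link (R 0))" "ALL s:B.NS 0. h0 (e 0 s) = dl (R 0) (R 0) s"
  "ALL x:car (L 0). ALL r:R 0. pr (R 0) (R 0) (h0 x) r = B.ac 0 x r" using z.model_lift by blast
 have lift0: "lifted_model S F p (R 0) (L 0) (e 0) LL pr dl h0"
  using h0 z.model_linking_axioms by (simp add: lifted_model_def lifted_model_axioms_def)
 have h0m: "h0 x : mor U U" if "x : car (L 0)" for x
 proof -
  have "h0 x : mor (R 0) (R 0)" using h0(1) that by (auto simp: hom_def aut_simps)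
  thus ?thesis unfolding B.R_zero .
 qed
 have h0_mult: "h0 (x \<cdot>\<^sub>(L 0) y) = cmp U U U (h0 x) (h0 y)" if "x : car (L 0)" "y : car (L 0)" for x y
 proof -
  have "h0 (x \<cdot>\<^sub>(L 0) y) = cmp (R 0) (R 0) (R 0) (h0 x) (h0 y)" using h0(1) that by (auto simp: hom_def aut_simps)
  thus ?thesis unfolding B.R_zero .
 qed
 have h0_e: "h0 (e 0 s) = dl U U s" if "s : U" for s using h0(2) that unfolding B.NS_zero unfolding B.R_zero by blast
 have pr_h0: "pr U U (h0 x) r = B.ac 0 x r" if "x : car (L 0)" "r : U" for x r
 proof -
  have "r : R 0" unfolding B.R_zero by (rule that(2))
  hence "pr (R 0) (R 0) (h0 x) r = B.ac 0 x r" using h0(3) that(1) by blast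
  moreover have "pr (R 0) (R 0) = pr U U" unfolding B.R_zero ..
  ultimately show ?thesis by simp
 qed
 have "EX h. lifted_model S F p (R i) (L i) (e i) LL pr dl h &
   (ALL x:edge i. cmp (R i) U U (h0 x) (inc (R i) U) = cmp (R i) (R i) U (inc (R i) U) (h (io i x)))"
  if i: "1 <= i" "i <= n" for i
 proof -
  interpret m: model_linking S F p "R i" "L i" "e i" LL pr dl by (rule model_linking[OF i(2)])
   note c = m.R_cen and RU = cen_U[OF m.R_cen]
  note inc = inc_closed[OF c cenU RU]
  note es = B.am.edge_subgroup[OF i]
  define k where "k = (%x. cmp (R i) U U (h0 x) (inc (R i) U))"
  \<comment> \<open>For \<open>x\<close> in the edge group the automorphism \<open>h0 x\<close> of
    \<open>S\<close> preserves \<open>R i\<close>, and \<open>q x\<close> is the automorphism of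
    \<open>R i\<close> that it induces in the linking system.\<close>
  define q where "q = (%x. res (R i) (R i) U (k x))"
  have k: "k x : mor (R i) U" "r : R i ==> pr (R i) U (k x) r = B.ac 0 x r" if x: "x : edge i" for x r
  proof -
   note xc = edge_zero(1)[OF i x]
   show "k x : mor (R i) U" unfolding k_def by (rule cmp_closed[OF c cenU cenU inc h0m[OF xc]])
   assume r: "r : R i"
   have "r : U" using RU r by blast
   thus "pr (R i) U (k x) r = B.ac 0 x r"
    using pr_cmp_apply[OF c cenU cenU inc h0m[OF xc] r] pr_inc[OF c cenU RU r] pr_h0[OF xc] by (simp add: k_def)
  qed
  have q: "q x : mor (R i) (R i)" "cmp (R i) (R i) U (inc (R i) U) (q x) = k x"
   "r : R i ==> pr (R i) (R i) (q x) r = B.ac 0 x r" if x: "x : edge i" for x r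
  proof -
   have im: "pr (R i) U (k x) ` R i <= R i" using k(2)[OF x] edge_zero(3)[OF i x] by auto
   show "q x : mor (R i) (R i)" "cmp (R i) (R i) U (inc (R i) U) (q x) = k x"
    unfolding q_def using res[OF c c cenU k(1)[OF x] im RU] by auto
   show "r : R i ==> pr (R i) (R i) (q x) r = B.ac 0 x r"
    unfolding q_def using pr_res[OF c c cenU k(1)[OF x] im RU] k(2)[OF x] by simp
  qed
  have q_mult: "q (x \<cdot>\<^sub>(L 0) y) = cmp (R i) (R i) (R i) (q x) (q y)" if x: "x : edge i" and y: "y : edge i" for x y
  proof -
   note xc = edge_zero(1)[OF i x] edge_zero(1)[OF i y]
   have xy: "x \<cdot>\<^sub>(L 0) y : edge i" using sub_mult[OF es x y] .
   have "k (x \<cdot>\<^sub>(L 0) y) = cmp (R i) U U (h0 x) (k y)"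
    unfolding k_def h0_mult[OF xc] by (rule cmp_assoc[OF c cenU cenU cenU inc h0m[OF xc(2)] h0m[OF xc(1)], symmetric])
   also have "... = cmp (R i) U U (h0 x) (cmp (R i) (R i) U (inc (R i) U) (q y))" by (simp only: q(2)[OF y])
   also have "... = cmp (R i) (R i) U (k x) (q y)"
    unfolding k_def by (rule cmp_assoc[OF c c cenU cenU q(1)[OF y] inc h0m[OF xc(1)]])
   also have "... = cmp (R i) (R i) U (inc (R i) U) (cmp (R i) (R i) (R i) (q x) (q y))"
    unfolding q(2)[OF x, symmetric] by (rule cmp_assoc[OF c c c cenU q(1)[OF y] q(1)[OF x] inc, symmetric])
   finally have "cmp (R i) (R i) U (inc (R i) U) (q (x \<cdot>\<^sub>(L 0) y)) =
     cmp (R i) (R i) U (inc (R i) U) (cmp (R i) (R i) (R i) (q x) (q y))" using q(2)[OF xy] by simp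
   thus ?thesis by (rule mono[OF c c cenU q(1)[OF xy] cmp_closed[OF c c c q(1)[OF y] q(1)[OF x]] inc])
  qed
  have e0_edge: "e 0 s : edge i" if "s : B.NS i" for s using B.edge_e0[OF i(2) B.NS_US[OF i(2) that]] that by simp
  have q_e: "q (e 0 s) = dl (R i) (R i) s" if s: "s : B.NS i" for s
  proof -
   have sU: "s : U" by (rule B.NS_US[OF i(2) s])
   note tr = m.NR_trans[OF s]
   have "cmp (R i) (R i) U (inc (R i) U) (q (e 0 s)) = cmp (R i) (R i) U (inc (R i) U) (dl (R i) (R i) s)"
    unfolding q(2)[OF e0_edge[OF s]] k_def h0_e[OF sU] by (rule inc_slide[OF c cenU RU sU tr, symmetric])
   thus ?thesis by (rule mono[OF c c cenU q(1)[OF e0_edge[OF s]] dl_closed[OF c c tr] inc])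
  qed
  interpret h: group_hom "(L 0)(|carrier := edge i|)" "L i" "io i"
   using B.io(1)[OF i] B.zero.M.subgroup_imp_group[OF es] m.M.is_group by (simp add: group_hom_def group_hom_axioms_def mon_def)
  have inj: "inj_on (io i) (edge i)" using B.io(1)[OF i] by (simp add: mon_def)
  define et where "et = (%y. q (inv_into (edge i) (io i) y))"
  have et: "et (io i x) = q x" if "x : edge i" for x using inj that by (simp add: et_def)
  have K: "sgp (io i ` edge i) (L i)" using h.img_is_subgroup by simp
  have eK: "e i ` B.NS i <= io i ` edge i"
  proof (rule image_subsetI)
   fix s assume s: "s : B.NS i"
   show "e i s : io i ` edge i" unfolding B.io(2)[OF i s, symmetric] by (rule imageI[OF e0_edge[OF s]])
  qed
  have "EX h:hom (L i) (aut_link (R i)). (ALL s:B.NS i. h (e i s) = dl (R i) (R i) s) &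
    (ALL x:car (L i). ALL r:R i. pr (R i) (R i) (h x) r = B.ac i x r) & (ALL x:io i ` edge i. h x = et x)"
  proof (rule m.model_lift_extending[OF K eK])
   show "et : hom ((L i)(|carrier := io i ` edge i|)) (aut_link (R i))"
   proof (rule homI)
    fix a assume "a : car ((L i)(|carrier := io i ` edge i|))"
    then obtain x where x: "x : edge i" "a = io i x" by auto
    show "et a : car (aut_link (R i))" unfolding x(2) et[OF x(1)] aut_simps by (rule q(1)[OF x(1)])
    fix b assume "b : car ((L i)(|carrier := io i ` edge i|))"
    then obtain y where y: "y : edge i" "b = io i y" by auto
    have "io i x \<cdot>\<^sub>(L i) io i y = io i (x \<cdot>\<^sub>(L 0) y)" using h.hom_mult[of x y] x(1) y(1) by simp
    hence "et (a \<cdot>\<^sub>(L i) b) = q (x \<cdot>\<^sub>(L 0) y)" using et[OF sub_mult[OF es x(1) y(1)]] x(2) y(2) by simp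
    thus "et (a \<cdot>\<^bsub>(L i)(|carrier := io i ` edge i|)\<^esub> b) = et a \<cdot>\<^bsub>aut_link (R i)\<^esub> et b"
     using q_mult[OF x(1) y(1)] et[OF x(1)] et[OF y(1)] x(2) y(2) by (simp add: aut_simps)
   qed
   show "et (e i s) = dl (R i) (R i) s" if "s : B.NS i" for s
    unfolding B.io(2)[OF i that, symmetric] et[OF e0_edge[OF that]] by (rule q_e[OF that])
   fix a r assume a: "a : io i ` edge i" and r: "r : R i"
   obtain x where x: "x : edge i" "a = io i x" using a by blast
   have "r : B.NS i" using m.R_NR r by blast
   thus "pr (R i) (R i) (et a) r = B.ac i a r"
    unfolding x(2) et[OF x(1)] using q(3)[OF x(1) r] edge_zero(5)[OF i x(1)] by simp
  qed
  then obtain h where h: "h : hom (L i) (aut_link (R i))" "ALL s:B.NS i. h (e i s) = dl (R i) (R i) s"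
   "ALL x:car (L i). ALL r:R i. pr (R i) (R i) (h x) r = B.ac i x r" "ALL x:io i ` edge i. h x = et x" by blast
  have "lifted_model S F p (R i) (L i) (e i) LL pr dl h"
   using h(1-3) m.model_linking_axioms by (simp add: lifted_model_def lifted_model_axioms_def)
  moreover have "cmp (R i) U U (h0 x) (inc (R i) U) = cmp (R i) (R i) U (inc (R i) U) (h (io i x))" if x: "x : edge i" for x
   using q(2)[OF x] h(4) et[OF x] x by (simp add: k_def)
  ultimately show ?thesis by blast
 qed
 hence "ALL i. EX h. 1 <= i & i <= n --> lifted_model S F p (R i) (L i) (e i) LL pr dl h &
   (ALL x:edge i. cmp (R i) U U (h0 x) (inc (R i) U) = cmp (R i) (R i) U (inc (R i) U) (h (io i x)))" by blast
 from choice[OF this] obtain h where h: "!!i. 1 <= i ==> i <= n ==> lifted_model S F p (R i) (L i) (e i) LL pr dl (h i)"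
  "!!i x. 1 <= i ==> i <= n ==> x : edge i ==>
   cmp (R i) U U (h0 x) (inc (R i) U) = cmp (R i) (R i) U (inc (R i) U) (h i (io i x))" by blast
 show ?thesis
 proof (intro exI[of _ "h(0 := h0)"] conjI allI impI)
  fix i assume "i <= n"
  thus "lifted_model S F p (R i) (L i) (e i) LL pr dl ((h(0 := h0)) i)" using lift0 h(1)[of i] by (cases "i = 0") auto
 next
  fix i x assume "1 <= i" "i <= n" "x : edge i"
  thus "cmp (R i) U U ((h(0 := h0)) 0 x) (inc (R i) U) = cmp (R i) (R i) U (inc (R i) U) ((h(0 := h0)) i (io i x))"
   using h(2) by simp
 qed
qed

end

section \<open>Gluing the lifts of the vertex groups\<close>

locale robinson_lifts = robinson_linking S F p Rs n R L e io LL pr dl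
 for S :: "'a monoid" (structure) and F and p and Rs and n and R and L :: "nat => 'b monoid" and e and io
  and LL :: "('a set, 'm) cat" and pr and dl +
 fixes h :: "nat => 'b => 'm"
 assumes lifted: "!!i. i <= n ==> lifted_model S F p (R i) (L i) (e i) LL pr dl (h i)"
  and compatible: "!!i x. 1 <= i ==> i <= n ==> x : edge_group R L e i ==>
   composite LL (R i) (car S) (car S) (h 0 x) (dl (R i) (car S) \<one>) =
   composite LL (R i) (R i) (car S) (dl (R i) (car S) \<one>) (h i (io i x))"
begin

abbreviation "ex i x == lifted_model.ext S (R i) (L i) (e i) LL pr dl (h i) x"

lemma dm_cen: "i <= n ==> x : car (L i) ==> cen (B.dm i x)" using model.dom_cen[OF B.model] .

lemma ex_over:
 assumes i: "i <= n" "x : car (L i)"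
 shows "ex i x : over (B.dm i x) (v i x)" "ex i x : mor (B.dm i x) U"
proof -
 interpret m: lifted_model S F p "R i" "L i" "e i" LL pr dl "h i" by (rule lifted[OF i(1)])
 note E = m.ext[OF i(2)]
 show "ex i x : mor (B.dm i x) U" by (rule E(1))
 have "pr (B.dm i x) U (ex i x) = restrict (B.ac i x) (B.dm i x)"
 proof (rule extensionalityI[of _ "B.dm i x"])
  show "pr (B.dm i x) U (ex i x) : extensional (B.dm i x)"
   by (rule F_mon(2)[OF B.dom_sub[OF i] sub_self pr_closed[OF dm_cen[OF i] cenU E(1)]])
 qed (use E(2) in auto)
 thus "ex i x : over (B.dm i x) (v i x)" using E(1) B.ind_vert[OF i] by (simp add: over_def)
qed

lemma move_composite:
 assumes P: "cen P" and i: "i <= n" "x : car (L i)" "y : car (L i)"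
  and g: "g : N P (B.dm i y)" "v i y \<cdot>\<^sub>pG g : N P (B.dm i x)" and f: "f : over P g"
 shows "move P (B.dm i x) (ex i x) (move P (B.dm i y) (ex i y) f) =
  move P (B.dm i (x \<cdot>\<^sub>(L i) y)) (ex i (x \<cdot>\<^sub>(L i) y)) f"
proof -
 interpret m: lifted_model S F p "R i" "L i" "e i" LL pr dl "h i" by (rule lifted[OF i(1)])
 note s = cen_sub[OF P]
 have fm: "f : mor P U" "pr P U f = ind P g" using f by (auto simp: over_def)
 have 1: "pr P U f u : B.dm i y" if "u : P" for u
  unfolding fm(2) by (rule ind_apply(1)[OF s B.dom_sub[OF i(1,3)] g(1) that])
 have 2: "B.ac i y (pr P U f u) : B.dm i x" if u: "u : P" for u
 proof -
  have "ind P (v i y \<cdot>\<^sub>pG g) = compose P (ind (B.dm i y) (v i y)) (ind P g)"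
   by (rule ind_mult[OF s B.dom_sub[OF i(1,3)] sub_self g(1) B.vert_transporter(2)[OF i(1,3)]])
  hence "ind P (v i y \<cdot>\<^sub>pG g) u = B.ac i y (pr P U f u)"
   using u 1[OF u] B.ind_vert[OF i(1,3)] fm(2) by (simp add: compose_def)
  thus ?thesis using ind_apply(1)[OF s B.dom_sub[OF i(1,2)] g(2) u] by simp
 qed
 show ?thesis unfolding move_def by (rule m.ext_mult[OF i(2,3) P fm(1) 1 2])
qed

lemma ext_zero: "x : car (L 0) ==> ex 0 x = h 0 x"
proof -
 assume x: "x : car (L 0)"
 interpret m: lifted_model S F p "R 0" "L 0" "e 0" LL pr dl "h 0" by (rule lifted) simp
 have eq: "cmp U U U (ex 0 x) (inc U U) = cmp U U U (inc U U) (h 0 x)"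
  using m.ext(3)[OF x] B.dom_zero[OF x] B.R_zero by metis
 have "ex 0 x : mor U U" using m.ext(1)[OF x] B.dom_zero[OF x] by metis
 moreover have "h 0 x : mor U U" using m.h_closed[OF x] B.R_zero by metis
 ultimately show "ex 0 x = h 0 x" using eq cmp_ident[OF cenU cenU] by (simp add: inc_UU)
qed

lemma move_zero:
 assumes P: "cen P" and x: "x : car (L 0)" and f: "f : mor P U" 
 shows "move P U (ex 0 x) f = cmp P U U (ex 0 x) f"
proof -
 have "res P U U f = f" using res_unique[OF P cenU cenU f order_refl] cmp_ident(2)[OF P cenU f] by (simp add: inc_UU)
 thus ?thesis by (simp add: move_def)
qed

text \<open>The lifts used at the two ends have the same restriction to \<open>R i\<close> by
  compatibility, and a morphism on \<open>NS i\<close> is determined by that restriction.\<close>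

lemma edge_move:
 assumes P: "cen P" and i: "1 <= i" "i <= n" and x: "x : edge i" and g: "g : N P (B.NS i)" and f: "f : over P g"
 shows "B.dm i (io i x) = B.NS i"
  and "move P (B.dm i (io i x)) (ex i (io i x)) f = move P U (ex 0 x) f"
proof -
 interpret m: lifted_model S F p "R i" "L i" "e i" LL pr dl "h i" by (rule lifted[OF i(2)])
 note xc = edge_zero(1,2)[OF i x]
 show D: "B.dm i (io i x) = B.NS i" using edge_zero(4)[OF i x] m.dom_NR by blast
 note N = m.NR_cen and R = m.R_cen
 have NU: "B.NS i <= U" using B.NS_US[OF i(2)] by blast
 have RU: "R i <= U" using NU m.R_NR by blast
 note iN = inc_closed[OF N cenU NU] and iR = inc_closed[OF R N m.R_NR]
 have x0: "ex 0 x : mor U U" using ex_over(2)[OF zero_le xc(1)] unfolding B.dom_zero[OF xc(1)] .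
 note E = m.ext[OF xc(2), unfolded D]
 have "ex i (io i x) = cmp (B.NS i) U U (ex 0 x) (inc (B.NS i) U)"
 proof (rule m.determined[OF N m.R_NR order_refl cenU E(1) cmp_closed[OF N cenU cenU iN x0]])
  have "cmp (R i) (B.NS i) U (ex i (io i x)) (inc (R i) (B.NS i)) = cmp (R i) U U (h 0 x) (inc (R i) U)"
   using E(3) compatible[OF i x] by simp
  also have "... = cmp (R i) U U (ex 0 x) (cmp (R i) (B.NS i) U (inc (B.NS i) U) (inc (R i) (B.NS i)))"
   unfolding inc_inc[OF R N cenU m.R_NR NU] ext_zero[OF xc(1)] ..
  also have "... = cmp (R i) (B.NS i) U (cmp (B.NS i) U U (ex 0 x) (inc (B.NS i) U)) (inc (R i) (B.NS i))"
   by (rule cmp_assoc[OF R N cenU cenU iR iN x0])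
  finally show "cmp (R i) (B.NS i) U (ex i (io i x)) (inc (R i) (B.NS i)) =
    cmp (R i) (B.NS i) U (cmp (B.NS i) U U (ex 0 x) (inc (B.NS i) U)) (inc (R i) (B.NS i))" .
 qed
 note r = over_res[OF P N g f]
 have "move P (B.NS i) (ex i (io i x)) f = cmp P U U (ex 0 x) f"
  unfolding move_def \<open>ex i (io i x) = _\<close> using cmp_assoc[OF P N cenU cenU r(3) iN x0] r(4) by simp
 thus "move P (B.dm i (io i x)) (ex i (io i x)) f = move P U (ex 0 x) f" unfolding D move_zero[OF P xc(1) r(1)] .
qed

text \<open>The lifts \<open>ex i x\<close> compose like elements of \<open>L i\<close>, so one
  value in a coset determines the others. Only part of a coset of \<open>L i\<close> carries
  \<open>P\<close> into \<open>NS i\<close>, hence the recourse to a partial action.\<close>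

lemma vertex_section:
 assumes P: "cen P" and i: "i <= n"
 shows "EX f. ALL g:N P (B.NS i). f g : over P g & (ALL x:car (L i). v i x \<cdot>\<^sub>pG g : N P (B.NS i) -->
  f (v i x \<cdot>\<^sub>pG g) = move P (B.dm i x) (ex i x) (f g))"
proof -
 note s = cen_sub[OF P]
 interpret Li: group "L i" by (rule B.am.L_group[OF i])
 have vH: "sgp (v i ` car (L i)) pG" using group_hom.img_is_subgroup[OF B.am.vert_group_hom[OF i]] .
 define w where "w = inv_into (car (L i)) (v i)"
 have w: "w (v i x) = x" if "x : car (L i)" for x using B.am.vert_inj[OF i] that by (simp add: w_def)
 have "EX f. ALL g:N P (B.NS i). f g : over P g & (ALL u:v i ` car (L i). u \<cdot>\<^sub>pG g : N P (B.NS i) -->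
   f (u \<cdot>\<^sub>pG g) = move P (B.dm i (w u)) (ex i (w u)) (f g))"
 proof (rule G.equivariant_choice[OF vH])
  show "N P (B.NS i) <= car pG" using N_carrier by blast
  show "over P g ~= {}" if "g : N P (B.NS i)" for g using over_nonempty[OF P B.NS_transporter[OF i that]] .
  show "move P (B.dm i (w u)) (ex i (w u)) y : over P (u \<cdot>\<^sub>pG g)"
   if u: "u : v i ` car (L i)" and g: "g : N P (B.NS i)" "u \<cdot>\<^sub>pG g : N P (B.NS i)" and y: "y : over P g" for u g y
  proof -
   obtain x where x: "x : car (L i)" "u = v i x" using u by blast
   have "g : N P (B.dm i x)" using B.vert_move[OF s i x(1)] g unfolding x(2) by blast
   thus ?thesis unfolding x(2) w[OF x(1)]
    by (rule move_over[OF P dm_cen[OF i x(1)] _ y ex_over(1)[OF i x(1)] B.vert_transporter(2)[OF i x(1)]])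
  qed
  show "move P (B.dm i (w u')) (ex i (w u')) (move P (B.dm i (w u)) (ex i (w u)) y) =
    move P (B.dm i (w (u' \<cdot>\<^sub>pG u))) (ex i (w (u' \<cdot>\<^sub>pG u))) y"
   if u: "u : v i ` car (L i)" "u' : v i ` car (L i)" and g: "g : N P (B.NS i)" "u \<cdot>\<^sub>pG g : N P (B.NS i)"
    "u' \<cdot>\<^sub>pG (u \<cdot>\<^sub>pG g) : N P (B.NS i)" and y: "y : over P g" for u u' g y
  proof -
   obtain x x' where x: "x : car (L i)" "u = v i x" "x' : car (L i)" "u' = v i x'" using u by blast
   have g1: "g : N P (B.dm i x)" using B.vert_move[OF s i x(1)] g(1,2) unfolding x(2) by blast
   have g2: "v i x \<cdot>\<^sub>pG g : N P (B.dm i x')" using B.vert_move[OF s i x(3)] g(2,3) unfolding x(2,4) by blast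
   have eq: "u' \<cdot>\<^sub>pG u = v i (x' \<cdot>\<^sub>(L i) x)" unfolding x(2,4) by (rule B.am.vert_mult[OF i x(3,1), symmetric])
   have xx: "x' \<cdot>\<^sub>(L i) x : car (L i)" using x(1,3) by simp
   show ?thesis unfolding eq w[OF xx] unfolding x(2,4) w[OF x(1)] w[OF x(3)] by (rule move_composite[OF P i x(3,1) g1 g2 y])
  qed
 qed
 then obtain f where f: "!!g. g : N P (B.NS i) ==> f g : over P g"
  "!!g u. g : N P (B.NS i) ==> u : v i ` car (L i) ==> u \<cdot>\<^sub>pG g : N P (B.NS i) ==>
   f (u \<cdot>\<^sub>pG g) = move P (B.dm i (w u)) (ex i (w u)) (f g)" by blast
 have "f (v i x \<cdot>\<^sub>pG g) = move P (B.dm i x) (ex i x) (f g)"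
  if "g : N P (B.NS i)" "x : car (L i)" "v i x \<cdot>\<^sub>pG g : N P (B.NS i)" for g x
  using f(2)[OF that(1) imageI[OF that(2)] that(3)] unfolding w[OF that(2)] .
 thus ?thesis using f(1) by (intro exI[of _ f]) blast
qed

end

context robinson_lifts
begin

text \<open>Each vertex group has its own equivariant family of lifts \<open>f i\<close>, and over a
  fixed edge \<open>f i\<close> and \<open>f 0\<close> differ by elements of the centre of
  \<open>P\<close>. The cocycle theorem provides corrections \<open>c\<close> and
  \<open>ce i\<close> under which both ends describe the same lift.\<close>

lemma section_exists:
 assumes P: "cen P"
 shows "EX r. r \<one>\<^sub>pG = inc P U & (ALL g:N P U. r g : over P g) &
  (ALL i<=n. ALL x:car (L i). ALL g:N P (B.dm i x). r (v i x \<cdot>\<^sub>pG g) = move P (B.dm i x) (ex i x) (r g))"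
proof -
 note s = cen_sub[OF P]
 have jP: "sgp (j ` P) pG" by (rule jh.subgroup_img_is_subgroup[OF s])
 have jP0: "j ` P <= v 0 ` car (L 0)" using B.e0_mem cen_U[OF P] unfolding B.j_vert by blast
 have "ALL i. EX f. i <= n --> (ALL g:N P (B.NS i). f g : over P g & (ALL x:car (L i). v i x \<cdot>\<^sub>pG g : N P (B.NS i) -->
   f (v i x \<cdot>\<^sub>pG g) = move P (B.dm i x) (ex i x) (f g)))" using vertex_section[OF P] by blast
 from choice[OF this] obtain f where f: "!!i g. i <= n ==> g : N P (B.NS i) ==> f i g : over P g"
  "!!i g x. i <= n ==> g : N P (B.NS i) ==> x : car (L i) ==> v i x \<cdot>\<^sub>pG g : N P (B.NS i) ==>
   f i (v i x \<cdot>\<^sub>pG g) = move P (B.dm i x) (ex i x) (f i g)" by blast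
 have f_mor: "f i g : mor P U" if "i <= n" "g : N P (B.NS i)" for i g using f(1)[OF that] by (simp add: over_def)
 have f0: "f 0 g : over P g" if "g : N P U" for g using f(1)[OF zero_le] that unfolding B.NS_zero by blast
 have v0_N: "v 0 x \<cdot>\<^sub>pG g : N P U" if x: "x : car (L 0)" and g: "g : N P U" for x g
  using N_mult[OF s sub_self g] B.vert_transporter(2)[OF zero_le x] unfolding B.dom_zero[OF x] by blast
 have f0_move: "f 0 (v 0 x \<cdot>\<^sub>pG g) = move P U (ex 0 x) (f 0 g)" if x: "x : car (L 0)" and g: "g : N P U" for x g
  using f(2)[OF zero_le, of g x] v0_N[OF x g] g x unfolding B.NS_zero B.dom_zero[OF x] by blast
 have x0: "ex 0 x : mor U U" if "x : car (L 0)" for x using ex_over(2)[OF zero_le that] unfolding B.dom_zero[OF that] .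
 \<comment> \<open>The label \<open>z\<close> at the base stands for
   \<open>scale P (f 0 g) z\<close>. Here the edge moves nothing; \<open>ze\<close> only rewrites
   this lift relative to \<open>f i\<close>.\<close>
 define ze where "ze = (%i g z. if z : centre S P then ratio P (f i g) (scale P (f 0 g) z) else z)"
 have ze: "ze i g z : centre S P" "scale P (f i g) (ze i g z) = scale P (f 0 g) z"
  if i: "i <= n" and g: "g : N P (B.NS i)" and z: "z : centre S P" for i g z
  using z ratio[OF P f(1)[OF i g] scale_over[OF P f0[OF B.NS_transporter[OF i g]] z]] by (auto simp: ze_def)
 have ze_bij: "bij_betw (ze i g) (centre S P) (centre S P)"
  if i: "i : {1..n}" and g: "g : trp pG (j ` P) (v 0 ` edge i)" for i g
 proof -
  have i': "i <= n" using i by simp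
  have g': "g : N P (B.NS i)" using g B.edge_transporter[OF s i'] by simp
  have f0m: "f 0 g : mor P U" using f0[OF B.NS_transporter[OF i' g']] by (simp add: over_def)
  have "inj_on (ze i g) (centre S P)"
  proof (rule inj_onI)
   fix z z' assume z: "z : centre S P" "z' : centre S P" "ze i g z = ze i g z'"
   hence "scale P (f 0 g) z = scale P (f 0 g) z'" using ze(2)[OF i' g' z(1)] ze(2)[OF i' g' z(2)] by simp
   thus "z = z'" using scale_inj[OF P f0m z(1,2)] by blast
  qed
  moreover have "ze i g ` centre S P <= centre S P" using ze(1)[OF i' g'] by blast
  moreover have "finite (centre S P)" by (rule B.sub_finite[OF centre_subgroup[OF s]])
  ultimately show ?thesis by (simp add: bij_betw_def endo_inj_surj)
 qed
 \<comment> \<open>By \<open>edge_move\<close> an element of the edge group moves a lift in the same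
   way from both ends, so the passage between the two descriptions does not change.\<close>
 have ze_left: "ze i (u \<cdot>\<^sub>pG g) = ze i g"
  if i: "i : {1..n}" and g: "g : trp pG (j ` P) (v 0 ` edge i)" and u: "u : v 0 ` edge i" for i g u
 proof
  fix z
  have i': "1 <= i" "i <= n" using i by auto
  have gN: "g : N P (B.NS i)" using g B.edge_transporter[OF s i'(2)] by simp
  have gU: "g : N P U" by (rule B.NS_transporter[OF i'(2) gN])
  obtain x where x: "x : edge i" "u = v 0 x" using u by blast
  note xc = edge_zero(1,2)[OF i' x(1)]
  have D: "B.dm i (io i x) = B.NS i" using edge_zero(4)[OF i' x(1)] model.dom_NR[OF B.model[OF i'(2)]] by blast
  have vx: "v i (io i x) = u" unfolding x(2) by (rule B.am.vert_edge[OF i' x(1)])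
  have ugN: "u \<cdot>\<^sub>pG g : N P (B.NS i)" using B.vert_move[OF s i'(2) xc(2), of g] gN unfolding D vx by blast
  show "ze i (u \<cdot>\<^sub>pG g) z = ze i g z"
  proof (cases "z : centre S P")
   case True
   note w = ze[OF i'(2) gN True]
   have fi: "f i (u \<cdot>\<^sub>pG g) = move P (B.dm i (io i x)) (ex i (io i x)) (f i g)"
    using f(2)[OF i'(2) gN xc(2)] ugN unfolding vx by blast
   have gD: "g : N P (B.dm i (io i x))" unfolding D by (rule gN)
   have "scale P (f i (u \<cdot>\<^sub>pG g)) (ze i g z) = move P (B.dm i (io i x)) (ex i (io i x)) (scale P (f i g) (ze i g z))"
    unfolding fi
    by (rule move_scale[OF P dm_cen[OF i'(2) xc(2)] gD f(1)[OF i'(2) gN] ex_over(2)[OF i'(2) xc(2)] w(1), symmetric])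
   also have "... = move P U (ex 0 x) (scale P (f 0 g) z)"
    unfolding w(2) by (rule edge_move(2)[OF P i' x(1) gN scale_over[OF P f0[OF gU] True]])
   also have "... = scale P (f 0 (u \<cdot>\<^sub>pG g)) z"
    unfolding x(2) f0_move[OF xc(1) gU] by (rule move_scale[OF P cenU gU f0[OF gU] x0[OF xc(1)] True])
   finally have "ratio P (f i (u \<cdot>\<^sub>pG g)) (scale P (f 0 (u \<cdot>\<^sub>pG g)) z) = ze i g z"
    by (rule ratio_unique[OF P f(1)[OF i'(2) ugN] w(1)])
   thus ?thesis using True by (simp add: ze_def)
  qed (simp add: ze_def)
 qed
 have one: "\<one>\<^sub>pG : N P U" using j_transporter[OF s one_trp[OF s cen_U[OF P]]] by simp
 define lz where "lz = ratio P (f 0 \<one>\<^sub>pG) (inc P U)"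
 have lz: "lz : centre S P" "scale P (f 0 \<one>\<^sub>pG) lz = inc P U"
  unfolding lz_def using ratio[OF P f0[OF one] inc_over[OF P]] by auto
 have "EX c ce. c \<one>\<^sub>pG = lz &
   (ALL g:trp pG (j ` P) (v 0 ` car (L 0)). c g : centre S P & (ALL x:v 0 ` car (L 0). c (x \<cdot>\<^sub>pG g) = c g)) &
   (ALL i:{1..n}. (ALL g:trp pG (j ` P) (v i ` car (L i)). ce i g : centre S P &
     (ALL x:v i ` car (L i). ce i (x \<cdot>\<^sub>pG g) = ce i g)) &
    (ALL g:trp pG (j ` P) (v 0 ` edge i). ce i (\<one>\<^sub>pG \<cdot>\<^sub>pG g) = ze i g (c g)) &
    (i : {} --> (ALL g:trp pG (j ` P) (v 0 ` car (L 0)). ce i g = c g)))"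
  by (rule B.am.tree.fixed_tree_cocycle[OF B.am.universal_actions jP jP0])
   (rule ze_bij ze_left lz(1); assumption)+
 then obtain c ce where c: "c \<one>\<^sub>pG = lz"
   "ALL g:trp pG (j ` P) (v 0 ` car (L 0)). c g : centre S P & (ALL x:v 0 ` car (L 0). c (x \<cdot>\<^sub>pG g) = c g)"
   "ALL i:{1..n}. (ALL g:trp pG (j ` P) (v i ` car (L i)). ce i g : centre S P &
     (ALL x:v i ` car (L i). ce i (x \<cdot>\<^sub>pG g) = ce i g)) &
    (ALL g:trp pG (j ` P) (v 0 ` edge i). ce i (\<one>\<^sub>pG \<cdot>\<^sub>pG g) = ze i g (c g)) &
    (i : {} --> (ALL g:trp pG (j ` P) (v 0 ` car (L 0)). ce i g = c g))" by (elim exE conjE) (rule that)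
 have cZ: "c g : centre S P" and c_left: "x : car (L 0) ==> c (v 0 x \<cdot>\<^sub>pG g) = c g" if "g : N P U" for g x
  using c(2) that unfolding B.base_transporter[OF s] by blast+
 have ce_ze: "ce i g = ze i g (c g)" if i: "1 <= i" "i <= n" and g: "g : N P (B.NS i)" for i g
 proof -
  have "g : trp pG (j ` P) (v 0 ` edge i)" using g B.edge_transporter[OF s i(2)] by simp
  hence "ce i (\<one>\<^sub>pG \<cdot>\<^sub>pG g) = ze i g (c g)" using bspec[OF c(3), of i] i by simp
  thus ?thesis using N_carrier[OF g] by simp
 qed
 have ce_left: "ce i (v i x \<cdot>\<^sub>pG g) = ce i g" if i: "1 <= i" "i <= n" and g: "g : N P (B.NS i)" and x: "x : car (L i)" for i g x
 proof -
  interpret m: model S F p "R i" "L i" "e i" by (rule B.model[OF i(2)])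
  have "j ` B.NS i <= v i ` car (L i)"
  proof (rule image_subsetI)
   fix t assume t: "t : B.NS i"
   show "j t : v i ` car (L i)" unfolding B.vert_e[OF i(2) t, symmetric] by (rule imageI[OF m.e_closed[OF t]])
  qed
  hence "g : trp pG (j ` P) (v i ` car (L i))" using g unfolding trp_def by blast
  thus ?thesis using bspec[OF c(3), of i] i x by simp
 qed
 define r where "r = (%g. scale P (f 0 g) (c g))"
 \<comment> \<open>Over an edge the glued lift can be read from the far end as well; equivariance
   under \<open>L i\<close> is checked in that description.\<close>
 have r_i: "r g = scale P (f i g) (ce i g)" if "1 <= i" "i <= n" "g : N P (B.NS i)" for i g
  unfolding r_def ce_ze[OF that] by (rule ze(2)[OF that(2,3) cZ[OF B.NS_transporter[OF that(2,3)]], symmetric])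
 have "r (v i x \<cdot>\<^sub>pG g) = move P (B.dm i x) (ex i x) (r g)"
  if i: "i <= n" and x: "x : car (L i)" and g: "g : N P (B.dm i x)" for i x g
 proof (cases "i = 0")
  case True
  have x': "x : car (L 0)" and gU: "g : N P U" using x g True B.dom_zero by auto
  have "r (v 0 x \<cdot>\<^sub>pG g) = move P U (ex 0 x) (r g)" unfolding r_def f0_move[OF x' gU] c_left[OF gU x']
   by (rule move_scale[OF P cenU gU f0[OF gU] x0[OF x'] cZ[OF gU], symmetric])
  thus ?thesis unfolding True B.dom_zero[OF x'] .
 next
  case False
  hence i1: "1 <= i" by simp
  have gN: "g : N P (B.NS i)" "v i x \<cdot>\<^sub>pG g : N P (B.NS i)" using B.vert_move[OF s i x] g by blast+
  have ceZ: "ce i g : centre S P"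
   unfolding ce_ze[OF i1 i gN(1)] by (rule ze(1)[OF i gN(1) cZ[OF B.NS_transporter[OF i gN(1)]]])
  show ?thesis unfolding r_i[OF i1 i gN(1)] r_i[OF i1 i gN(2)] ce_left[OF i1 i gN(1) x] f(2)[OF i gN(1) x gN(2)]
   by (rule move_scale[OF P dm_cen[OF i x] g f(1)[OF i gN(1)] ex_over(2)[OF i x] ceZ, symmetric])
 qed
 moreover have "r \<one>\<^sub>pG = inc P U" unfolding r_def c(1) by (rule lz(2))
 moreover have "r g : over P g" if "g : N P U" for g unfolding r_def by (rule scale_over[OF P f0[OF that] cZ[OF that]])
 ultimately show ?thesis by blast
qed

theorem signaliser_exists: "EX Th. signaliser_functor S F pG j Th & induces S F pG j Th LL pr"
proof -
 have "ALL P. EX r. cen P --> r \<one>\<^sub>pG = inc P U & (ALL g:N P U. r g : over P g) &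
   (ALL i<=n. ALL x:car (L i). ALL g:N P (B.dm i x). r (v i x \<cdot>\<^sub>pG g) = move P (B.dm i x) (ex i x) (r g))"
  using section_exists by blast
 from choice[OF this] obtain r where r: "!!P. cen P ==> r P \<one>\<^sub>pG = inc P U"
  "!!P g. cen P ==> g : N P U ==> r P g : over P g"
  "!!P i x g. cen P ==> i <= n ==> x : car (L i) ==> g : N P (B.dm i x) ==>
   r P (v i x \<cdot>\<^sub>pG g) = move P (B.dm i x) (ex i x) (r P g)" by blast
 have "transporter_functor S F pG j LL pr dl r"
 proof (rule functor_of_moves[OF B.connected, where l = "%(i, x). ex i x"])
  fix k assume "k : B.moves"
  then obtain i x where k: "k = (i, x)" "i <= n" "x : car (L i)" by auto
  show "cen (B.move_dom k)" "B.move_elt k : N (B.move_dom k) U" "(case k of (i, x) => ex i x) : over (B.move_dom k) (B.move_elt k)"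
   using dm_cen[OF k(2,3)] B.vert_transporter(2)[OF k(2,3)] ex_over(1)[OF k(2,3)] by (simp_all add: k(1))
  fix P g assume "cen P" "g : N P (B.move_dom k)"
  thus "r P (B.move_elt k \<cdot>\<^sub>pG g) = move P (B.move_dom k) (case k of (i, x) => ex i x) (r P g)"
   using r(3)[OF _ k(2,3)] by (simp add: k(1))
 next
  fix P g s assume P: "cen P" and g: "g : N P U" and s: "s : U"
  interpret m: lifted_model S F p "R 0" "L 0" "e 0" LL pr dl "h 0" by (rule lifted) simp
  have x: "e 0 s : car (L 0)" by (rule B.e0_mem[OF s])
  have E: "ex 0 (e 0 s) = dl U U s" using m.ext_e[of s] s unfolding B.NS_zero by blast
  have "r P (v 0 (e 0 s) \<cdot>\<^sub>pG g) = move P U (ex 0 (e 0 s)) (r P g)"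
   using r(3)[OF P zero_le x, of g] g unfolding B.dom_zero[OF x] by blast
  thus "r P (j s \<cdot>\<^sub>pG g) = cmp P U U (dl U U s) (r P g)"
   unfolding E B.j_vert[symmetric] move_dl[OF P cenU g r(2)[OF P g] s] .
 qed (use r in auto)
 from transporter_functor.signaliser_signal[OF this] transporter_functor.signal_induces[OF this]
 show ?thesis by blast
qed

end

theorem robinson_signaliser:
 fixes S :: "'a monoid" and LL :: "('a set, 'm) cat" and L :: "nat => 'b monoid"
 assumes p: "Factorial_Ring.prime p" "group S" "finite (car S)" "EX k. order S = p ^ k" "fusion_system S F"
  and sat: "saturated p S F" and data: "robinson_data p S F Rs n R L e io"
 defines "pG == robinson_group n R L e io" and "j == robinson_incl n R L e io"
 shows "realises p S F pG j"
  and "(EX dl. centric_linking_system S F LL pr dl) <->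
   (EX Th. signaliser_functor S F pG j Th & induces S F pG j Th LL pr)"
proof -
 have "fusion S F" using p(2,5) by (simp add: fusion_def fusion_axioms_def)
 hence "saturated_fusion S F p" using p(1,3,4) sat by (intro saturated_fusion.intro saturated_fusion_axioms.intro)
 then interpret B: robinson S F p Rs n R L e io using data by (intro robinson.intro robinson_axioms.intro)
 show real: "realises p S F pG j" unfolding pG_def j_def by (rule B.robinson_realises)
 interpret R: realised S F pG j
  using real p(2,5) by (simp add: realised_def fusion_def fusion_axioms_def realised_axioms_def realises_def)
 show "(EX dl. centric_linking_system S F LL pr dl) <->
   (EX Th. signaliser_functor S F pG j Th & induces S F pG j Th LL pr)"
 proof
  assume "EX dl. centric_linking_system S F LL pr dl"
  then obtain dl where dl: "centric_linking_system S F LL pr dl" ..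
  interpret linking S F LL pr dl by unfold_locales (rule dl)
  have "realised S F (robinson_group n R L e io) (robinson_incl n R L e io)"
   using R.realised_axioms by (simp add: pG_def j_def)
  hence link: "robinson_linking S F p Rs n R L e io LL pr dl"
   by (intro robinson_linking.intro realised_linking.intro linking_axioms B.robinson_axioms)
  from robinson_linking.lifts_exist[OF this] obtain h where
   h: "!!i. i <= n ==> lifted_model S F p (R i) (L i) (e i) LL pr dl (h i)"
    "!!i x. 1 <= i ==> i <= n ==> x : edge_group R L e i ==>
     composite LL (R i) (car S) (car S) (h 0 x) (dl (R i) (car S) \<one>\<^sub>S) =
     composite LL (R i) (R i) (car S) (dl (R i) (car S) \<one>\<^sub>S) (h i (io i x))" by blast
  have "robinson_lifts S F p Rs n R L e io LL pr dl h"
   using link h by (intro robinson_lifts.intro robinson_lifts_axioms.intro)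
  from robinson_lifts.signaliser_exists[OF this]
  show "EX Th. signaliser_functor S F pG j Th & induces S F pG j Th LL pr" by (simp add: pG_def j_def)
 next
  assume "EX Th. signaliser_functor S F pG j Th & induces S F pG j Th LL pr"
  then obtain Th where *: "signaliser_functor S F pG j Th" "induces S F pG j Th LL pr" by blast
  interpret signaliser S F pG j Th by unfold_locales (rule *(1))
  show "EX dl. centric_linking_system S F LL pr dl" by (rule linking_of_signaliser[OF *(2)])
 qed
qed

theorem corollary1p2:
  fixes p :: nat and S :: "'a monoid" and F :: "'a fusion"
    and \<R> :: "'a set set" and n :: nat and R :: "nat \<Rightarrow> 'a set"
    and L :: "nat \<Rightarrow> 'b monoid" and e :: "nat \<Rightarrow> 'a \<Rightarrow> 'b" and \<iota> :: "nat \<Rightarrow> 'b \<Rightarrow> 'b"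
    and \<Phi> :: "('a set \<times> ('a \<Rightarrow> 'a)) set"
  assumes "Factorial_Ring.prime p"
    and "group S" and "finite (carrier S)" and "\<exists>k. order S = p ^ k"
    and "fusion_system S F" and "saturated p S F"
  shows
    "(robinson_data p S F \<R> n R L e \<iota> \<longrightarrow>
        (let \<pi> = robinson_group n R L e \<iota>; j = robinson_incl n R L e \<iota> in
           realises p S F \<pi> j \<and>
           (\<forall>(\<L> :: ('a set, 'm) cat) pr.
              (\<exists>\<delta>. centric_linking_system S F \<L> pr \<delta>) \<longleftrightarrow>
              (\<exists>\<Theta>. signaliser_functor S F \<pi> j \<Theta> \<and> induces S F \<pi> j \<Theta> \<L> pr)))) \<and>
     (leary_stancu_data S F \<Phi> \<longrightarrow>
        (let \<pi> = leary_stancu_group S \<Phi>; j = leary_stancu_incl S \<Phi> in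
           realises p S F \<pi> j \<and>
           (\<forall>(\<L> :: ('a set, 'm) cat) pr.
              (\<exists>\<delta>. centric_linking_system S F \<L> pr \<delta>) \<longleftrightarrow>
              (\<exists>\<Theta>. signaliser_functor S F \<pi> j \<Theta> \<and> induces S F \<pi> j \<Theta> \<L> pr))))"
 unfolding Let_def
 by (intro conjI impI allI robinson_signaliser[OF assms] leary_stancu_signaliser[OF assms(1-5)]) assumption+

end
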